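(* Let $K\in\{0,\pm1\}$ and let $M^n=\partial\Omega$ be a smooth, closed, connected hypersurface in the simply connected space form $S_K^{n+1}$. Assume that the normalised mean curvature satisfies $E_1>\sqrt{-K}$ if $K\le0$. Let $\lambda_1\ge\lambda_2\ge\dots\ge\lambda_n$ denote the principal curvatures of $M$ and let $b_1$ be the first focal map. Then $$\int_Mh_K\bigl(\operatorname{arccot}_K(E_1)\bigr)\,d\mu-|\Omega|\ge-V[b_1]\ge0.$$ When $n=1$, the left-hand inequality is an equality. When $n\ge2$, equality in the left-hand inequality holds if and only if $M$ is a hypersphere.
   Context: $S_K^{n+1}$ is $\mathbb S^{n+1},\mathbb R^{n+1},\mathbb H^{n+1}$ for $K=1,0,-1$. Set $s_K(t)=\sin t,\ t,\ \sinh t$ and $c_K(t)=\cos t,\ 1,\ \cosh t$ respectively, and $\cot_K=c_K/s_K$. $\operatorname{arccot}_K$ is the inverse of $\cot_K$ on positive arguments: for $K=1$ it is $\operatorname{arccot}:\mathbb R\to(0,\pi)$, for $K=0$ it is $x\mapsto1/x$ on $(0,\infty)$, and for $K=-1$ it is $\operatorname{arccoth}$ on $(1,\infty)$. The volume-to-area ratio of a geodesic ball of radius $r$ is $$h_K(r)=\frac{\int_0^rs_K(t)^n\,dt}{s_K(r)^n}.$$ $\Omega$ is the bounded domain enclosed by $M$, $\nu$ its outward unit normal, and $f$ the inclusion of $M$. The second fundamental form is $A(X,Y)=\langle\overline\nabla_X\nu,Y\rangle$, with eigenvalues $\lambda_i$, and $E_1=\frac1n\sum_i\lambda_i$. The first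 focal map is $b_1(x)=\exp_{f(x)}\bigl(-\operatorname{arccot}_K(\lambda_1(x))\,\nu(x)\bigr)$. For continuous $u:M\to\mathbb R$, the oriented volume of the normal graph $\mathrm f(x)=\exp_{f(x)}(u(x)\nu(x))$ is $$V[\mathrm f]:=|\Omega|+\int_M\int_0^{u(x)}J(x,t)\,dt\,d\mu(x),\qquad J(x,t)=\prod_{j=1}^n\bigl(c_K(t)+\lambda_j(x)s_K(t)\bigr),$$ where $J$ is the signed Jacobian of $(x,t)\mapsto\exp_{f(x)}(t\nu(x))$ with respect to $dt\,d\mu$. $V[b_1]$ corresponds to $u=-\operatorname{arccot}_K\lambda_1$. A hypersphere is a geodesic sphere. *)

theory Defs
  imports "HOL-Analysis.Analysis"
begin

section \<open>The functions s, c, cot, arccot and h of constant curvature\<close>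

definition sK :: "real \<Rightarrow> real \<Rightarrow> real" where
  "sK K t = (if K = 1 then sin t else if K = 0 then t else sinh t)"

definition cK :: "real \<Rightarrow> real \<Rightarrow> real" where
  "cK K t = (if K = 1 then cos t else if K = 0 then 1 else cosh t)"

definition cotK :: "real \<Rightarrow> real \<Rightarrow> real" where
  "cotK K t = cK K t / sK K t"

text \<open>Meaningful for all x if K = 1, for x > 0 if K = 0, and for x > 1 if K = -1.\<close>

definition arccotK :: "real \<Rightarrow> real \<Rightarrow> real" where
  "arccotK K = the_inv_into (if K = 1 then {0<..<pi} else {0<..}) (cotK K)"

definition hK :: "real \<Rightarrow> nat \<Rightarrow> real \<Rightarrow> real" where
  "hK K n r = (LBINT t=0..r. sK K t ^ n) / sK K r ^ n"


section \<open>Space forms\<close>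

text \<open>
  All three space forms are realised in the product of the real line with a Euclidean space, with
  the bilinear form \<open>K s s' + x \<bullet> x'\<close>: the unit sphere for K = 1, the affine hyperplane s = 1
  for K = 0 (whose tangent vectors have vanishing first component), and the upper sheet of the
  hyperboloid in Minkowski space for K = -1.  On tangent vectors the form is the Riemannian metric
  of curvature K.
\<close>

definition innerK :: "real \<Rightarrow> real \<times> 'e::euclidean_space \<Rightarrow> real \<times> 'e \<Rightarrow> real" where
  "innerK K v w = K * (fst v * fst w) + snd v \<bullet> snd w"

definition space_form :: "real \<Rightarrow> (real \<times> 'e::euclidean_space) set" where
  "space_form K = {p. (fst p)\<^sup>2 + K * (snd p \<bullet> snd p) = 1 \<and> (K \<le> 0 \<longrightarrow> 0 < fst p)}"

definition exp_map :: "real \<Rightarrow> real \<times> 'e::euclidean_space \<Rightarrow> real \<times> 'e \<Rightarrow> real \<times> 'e" where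
  "exp_map K p v =
    (let r = sqrt (innerK K v v)
     in if r = 0 then p else cK K r *\<^sub>R p + (sK K r / r) *\<^sub>R v)"

text \<open>
  The projection onto the tangent space of the space form at p along p, which is the identity for
  K = 0.  For K = 1 and K = -1 it is orthogonal, because \<open>innerK K p p = K\<close> on the space form.
\<close>

definition tangential :: "real \<Rightarrow> real \<times> 'e::euclidean_space \<Rightarrow> real \<times> 'e \<Rightarrow> real \<times> 'e" where
  "tangential K p w = w - (K * innerK K w p) *\<^sub>R p"


section \<open>Smooth submanifolds and Riemannian measure\<close>

fun Ck_on :: "nat \<Rightarrow> 'a::real_normed_vector set \<Rightarrow> ('a \<Rightarrow> 'b::real_normed_vector) \<Rightarrow> bool" where
  "Ck_on 0 U f \<longleftrightarrow> continuous_on U f"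
| "Ck_on (Suc k) U f \<longleftrightarrow> (\<forall>x\<in>U. f differentiable (at x)) \<and>
     (\<forall>v. Ck_on k U (\<lambda>x. frechet_derivative f (at x) v))"

text \<open>Used for finite-dimensional domains and open U only.\<close>

definition smooth_on :: "'a::real_normed_vector set \<Rightarrow> ('a \<Rightarrow> 'b::real_normed_vector) \<Rightarrow> bool" where
  "smooth_on U f \<longleftrightarrow> (\<forall>k. Ck_on k U f)"

definition local_param ::
    "'a::euclidean_space set \<Rightarrow> (real^'k) set \<Rightarrow> (real^'k \<Rightarrow> 'a) \<Rightarrow> bool" where
  "local_param M W X \<longleftrightarrow>
     open W \<and> smooth_on W X \<and> (\<forall>u\<in>W. inj (frechet_derivative X (at u))) \<and>
     openin (top_of_set M) (X ` W) \<and> (\<exists>Y. homeomorphism W (X ` W) X Y)"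

definition smooth_submanifold :: "'k::finite itself \<Rightarrow> 'a::euclidean_space set \<Rightarrow> bool" where
  "smooth_submanifold _ M \<longleftrightarrow>
     (\<forall>p\<in>M. \<exists>(W :: (real^'k) set) X. local_param M W X \<and> p \<in> X ` W)"

definition curve_through ::
    "'a::euclidean_space set \<Rightarrow> 'a \<Rightarrow> 'a \<Rightarrow> (real \<Rightarrow> 'a) \<Rightarrow> bool" where
  "curve_through M p v \<gamma> \<longleftrightarrow>
     (\<exists>e>0. smooth_on {-e<..<e} \<gamma> \<and> \<gamma> ` {-e<..<e} \<subseteq> M) \<and>
     \<gamma> 0 = p \<and> (\<gamma> has_vector_derivative v) (at 0)"

definition tangent_space :: "'a::euclidean_space set \<Rightarrow> 'a \<Rightarrow> 'a set" where
  "tangent_space M p = {v. \<exists>\<gamma>. curve_through M p v \<gamma>}"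

definition gram_matrix ::
    "real \<Rightarrow> (real^'k \<Rightarrow> real \<times> 'e::euclidean_space) \<Rightarrow> real^'k \<Rightarrow> real^'k^'k" where
  "gram_matrix K X u =
     (\<chi> i j. innerK K (frechet_derivative X (at u) (axis i 1))
                      (frechet_derivative X (at u) (axis j 1)))"

text \<open>
  The measure of a submanifold of dimension \<open>CARD('k)\<close> of the space form.  It is determined
  uniquely by its values inside the coordinate patches, since countably many patches cover.
\<close>

definition riemannian_measure ::
    "'k::finite itself \<Rightarrow> real \<Rightarrow> (real \<times> 'e::euclidean_space) set \<Rightarrow> (real \<times> 'e) measure" where
  "riemannian_measure _ K M =
     (THE \<mu>. sets \<mu> = sets (restrict_space borel M) \<and>
        (\<forall>(W :: (real^'k) set) X B. local_param M W X \<and> B \<in> sets borel \<and> B \<subseteq> W \<longrightarrow>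
           emeasure \<mu> (X ` B) = (\<integral>\<^sup>+u\<in>B. ennreal (sqrt (det (gram_matrix K X u))) \<partial>lborel)))"


section \<open>Hypersurfaces bounding a domain\<close>

text \<open>
  The index type \<open>'n option\<close> has \<open>CARD('n) + 1\<close> elements, so with \<open>n = CARD('n)\<close> the space form
  in \<open>'n ambient\<close> has dimension n + 1.
\<close>

type_synonym 'n ambient = "real \<times> (real^('n option))"

definition area_measure :: "real \<Rightarrow> 'n::finite ambient set \<Rightarrow> 'n ambient measure" where
  "area_measure K M = riemannian_measure TYPE('n) K M"

definition enclosed_volume :: "real \<Rightarrow> 'n::finite ambient set \<Rightarrow> real" where
  "enclosed_volume K \<Omega> = measure (riemannian_measure TYPE('n option) K (space_form K)) \<Omega>"

definition closed_hypersurface :: "real \<Rightarrow> 'n::finite ambient set \<Rightarrow> bool" where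
  "closed_hypersurface K M \<longleftrightarrow>
     M \<subseteq> space_form K \<and> M \<noteq> {} \<and> compact M \<and> smooth_submanifold TYPE('n) M"

text \<open>A subset of hyperbolic space is bounded for the hyperbolic metric iff it is bounded in the
  ambient vector space.\<close>

definition bounded_domain :: "real \<Rightarrow> 'n::finite ambient set \<Rightarrow> bool" where
  "bounded_domain K \<Omega> \<longleftrightarrow>
     openin (top_of_set (space_form K)) \<Omega> \<and> connected \<Omega> \<and> bounded \<Omega>"

definition outward_unit_normal ::
    "real \<Rightarrow> 'n::finite ambient set \<Rightarrow> 'n ambient set \<Rightarrow> ('n ambient \<Rightarrow> 'n ambient) \<Rightarrow> bool" where
  "outward_unit_normal K \<Omega> M \<nu> \<longleftrightarrow>
     (\<forall>p\<in>M. \<nu> p \<in> tangent_space (space_form K) p \<and> innerK K (\<nu> p) (\<nu> p) = 1 \<and>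
        (\<forall>v\<in>tangent_space M p. innerK K (\<nu> p) v = 0) \<and>
        (\<forall>\<^sub>F t in at_right 0. exp_map K p (t *\<^sub>R \<nu> p) \<notin> \<Omega> \<and>
                              exp_map K p (- t *\<^sub>R \<nu> p) \<in> \<Omega>))"

text \<open>The Levi-Civita derivative of the space form, for a vector field V along M and a tangent
  vector v of M at p.\<close>

definition cov_deriv ::
    "real \<Rightarrow> 'n::finite ambient set \<Rightarrow> ('n ambient \<Rightarrow> 'n ambient) \<Rightarrow> 'n ambient \<Rightarrow> 'n ambient
      \<Rightarrow> 'n ambient" where
  "cov_deriv K M V p v =
     tangential K p
       (THE w. \<forall>\<gamma>. curve_through M p v \<gamma> \<longrightarrow> ((\<lambda>t. V (\<gamma> t)) has_vector_derivative w) (at 0))"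

definition second_fundamental_form ::
    "real \<Rightarrow> 'n::finite ambient set \<Rightarrow> ('n ambient \<Rightarrow> 'n ambient) \<Rightarrow> 'n ambient
      \<Rightarrow> 'n ambient \<Rightarrow> 'n ambient \<Rightarrow> real" where
  "second_fundamental_form K M \<nu> p v w = innerK K (cov_deriv K M \<nu> p v) w"

text \<open>
  \<open>l 1 \<ge> \<dots> \<ge> l n\<close> are the eigenvalues, with multiplicity, of the second fundamental form at p
  relative to the metric; e is an orthonormal basis of eigenvectors.
\<close>

definition principal_curvatures ::
    "real \<Rightarrow> 'n::finite ambient set \<Rightarrow> ('n ambient \<Rightarrow> 'n ambient) \<Rightarrow> 'n ambient
      \<Rightarrow> (nat \<Rightarrow> real) \<Rightarrow> bool" where
  "principal_curvatures K M \<nu> p l \<longleftrightarrow>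
     (\<forall>i\<in>{1..CARD('n)}. \<forall>j\<in>{1..CARD('n)}. i \<le> j \<longrightarrow> l j \<le> l i) \<and>
     (\<exists>e. (\<forall>i\<in>{1..CARD('n)}. e i \<in> tangent_space M p) \<and>
          (\<forall>i\<in>{1..CARD('n)}. \<forall>j\<in>{1..CARD('n)}. innerK K (e i) (e j) = (if i = j then 1 else 0)) \<and>
          (\<forall>i\<in>{1..CARD('n)}. \<forall>w\<in>tangent_space M p.
             second_fundamental_form K M \<nu> p (e i) w = l i * innerK K (e i) w))"

definition mean_curvature :: "nat \<Rightarrow> (nat \<Rightarrow> 'a \<Rightarrow> real) \<Rightarrow> 'a \<Rightarrow> real" where
  "mean_curvature n lam x = (\<Sum>i=1..n. lam i x) / real n"

definition geodesic_sphere :: "real \<Rightarrow> 'n::finite ambient set \<Rightarrow> bool" where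
  "geodesic_sphere K M \<longleftrightarrow>
     (\<exists>c\<in>space_form K. \<exists>r>0. (K = 1 \<longrightarrow> r < pi) \<and>
        M = {exp_map K c (r *\<^sub>R v) | v. v \<in> tangent_space (space_form K) c \<and> innerK K v v = 1})"


section \<open>Normal graphs and the first focal map\<close>

definition normal_graph ::
    "real \<Rightarrow> ('n::finite ambient \<Rightarrow> 'n ambient) \<Rightarrow> ('n ambient \<Rightarrow> real) \<Rightarrow> 'n ambient \<Rightarrow> 'n ambient"
  where "normal_graph K \<nu> u x = exp_map K x (u x *\<^sub>R \<nu> x)"

definition normal_jacobian ::
    "real \<Rightarrow> nat \<Rightarrow> (nat \<Rightarrow> 'a \<Rightarrow> real) \<Rightarrow> 'a \<Rightarrow> real \<Rightarrow> real" where
  "normal_jacobian K n lam x t = (\<Prod>j=1..n. cK K t + lam j x * sK K t)"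

text \<open>The oriented volume of \<open>normal_graph K \<nu> u\<close>, which depends on the height function u.  The
  inner integral is oriented, so it is minus the integral from u x to 0 where u x is negative.\<close>

definition oriented_volume ::
    "real \<Rightarrow> 'n::finite ambient set \<Rightarrow> 'n ambient set \<Rightarrow> (nat \<Rightarrow> 'n ambient \<Rightarrow> real)
      \<Rightarrow> ('n ambient \<Rightarrow> real) \<Rightarrow> real" where
  "oriented_volume K \<Omega> M lam u =
     enclosed_volume K \<Omega> +
     (\<integral>x. (LBINT t=0..u x. normal_jacobian K CARD('n) lam x t) \<partial>area_measure K M)"

definition focal_height :: "real \<Rightarrow> (nat \<Rightarrow> 'a \<Rightarrow> real) \<Rightarrow> 'a \<Rightarrow> real" where
  "focal_height K lam x = - arccotK K (lam 1 x)"

definition first_focal_map ::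
    "real \<Rightarrow> ('n::finite ambient \<Rightarrow> 'n ambient) \<Rightarrow> (nat \<Rightarrow> 'n ambient \<Rightarrow> real)
      \<Rightarrow> 'n ambient \<Rightarrow> 'n ambient" where
  "first_focal_map K \<nu> lam = normal_graph K \<nu> (focal_height K lam)"

text \<open>The oriented volume of \<open>first_focal_map K \<nu> lam\<close>.\<close>

definition focal_volume ::
    "real \<Rightarrow> 'n::finite ambient set \<Rightarrow> 'n ambient set \<Rightarrow> (nat \<Rightarrow> 'n ambient \<Rightarrow> real) \<Rightarrow> real" where
  "focal_volume K \<Omega> M lam = oriented_volume K \<Omega> M lam (focal_height K lam)"

end

theory Submission
  imports Defs
begin

text \<open>
  After the substitution of t by -t, -V[b_1] + |\<Omega>| is the integral over M of
  \<open>\<integral> \<Prod>j (c(t) - \<lambda>\<^sub>j s(t)) dt\<close> over \<open>0 \<le> t \<le> arccot \<lambda>\<^sub>1\<close>.  By the arithmetic-geometric mean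
  inequality the product is at most \<open>(c(t) - E\<^sub>1 s(t))^n\<close>, whose integral up to
  \<open>arccot E\<^sub>1 \<ge> arccot \<lambda>\<^sub>1\<close> is \<open>h(arccot E\<^sub>1)\<close>; equality forces \<open>\<lambda>\<^sub>1 = E\<^sub>1\<close>.
  Conversely every point of the domain lies on the inner normal geodesic of a nearest point x of M, at
  a distance of at most \<open>arccot \<lambda>\<^sub>1(x)\<close>, since beyond the first focal point x no longer minimises the
  distance.  Hence the normal flow covers the domain, and the area formula gives V[b_1] \<le> 0.
  In the equality case M is umbilic, hence the curvature and the focal point are locally constant, so M
  lies on a geodesic sphere, and it is all of it because it separates the inside from the outside.
\<close>

section \<open>Calculus of smooth maps\<close>

text \<open>\<open>\<nu>\<close> and \<open>lam\<close> are given by pointwise conditions only, so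
  their regularity has to be earned: \<open>\<nu>\<close> is locally a smooth normal field up to a
  sign, and the sign cannot jump because it tells on which side \<open>\<Omega>\<close> lies; the
  principal curvatures are continuous by a min-max comparison of eigenvalues at neighbouring points.
  The Riemannian measure is a definite description, so its existence and its independence of charts
  have to be proved as well. One tool serves both this and the volume estimate: the measure of the
  image of a differentiable map is at most the integral of its Jacobian, overlaps included. Nearest
  points are found by minimising the ambient quadratic form of \<open>z - y\<close> instead of a
  geodesic distance. Along a geodesic this form increases with the distance, and its first and
  second variation are plain derivatives along coordinate lines. The hypothesis
  \<open>E_1 > sqrt (- K)\<close> acts through \<open>\<lambda>_1 \<ge> E_1\<close>: it puts both
  numbers into the domain of \<open>arccotK\<close>.\<close>

lemma frechet_derivative_eq:
  "(f has_derivative f') (at x) \<Longrightarrow> frechet_derivative f (at x) = f'"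
  by (metis frechet_derivative_at)

lemma frechet_derivative_cong_open:
  assumes "open U" "x \<in> U" "\<And>y. y \<in> U \<Longrightarrow> f y = g y" "f differentiable (at x)"
  shows "frechet_derivative g (at x) = frechet_derivative f (at x)"
  by (metis assms frechet_derivative_transform_within_open)

lemma differentiable_cong_open:
  assumes "open U" "x \<in> U" "\<And>y. y \<in> U \<Longrightarrow> f y = g y" "f differentiable (at x)"
  shows "g differentiable (at x)"
  using assms by (metis differentiable_def has_derivative_transform_within_open)

section \<open>Closure properties of maps of class C^k\<close>

lemma Ck_on_cong:
  assumes "open U" "Ck_on k U f" "\<And>x. x \<in> U \<Longrightarrow> f x = g x"
  shows "Ck_on k U g"
  using assms(2,3)
proof (induction k arbitrary: f g)
  case 0
  then show ?case by (simp cong: continuous_on_cong)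
next
  case (Suc k)
  have 1: "g differentiable (at x)" if "x \<in> U" for x
    by (rule differentiable_cong_open[OF assms(1) that, of f]) (use Suc.prems that in auto)
  have "frechet_derivative g (at x) = frechet_derivative f (at x)" if "x \<in> U" for x
    by (rule frechet_derivative_cong_open[OF assms(1) that]) (use Suc.prems that in auto)
  then have "Ck_on k U (\<lambda>x. frechet_derivative g (at x) v)" for v
    using Suc.IH[of "\<lambda>x. frechet_derivative f (at x) v"] Suc.prems by auto
  with 1 show ?case by auto
qed

lemma Ck_on_SucD:
  "Ck_on (Suc k) U f \<Longrightarrow> x \<in> U \<Longrightarrow> (f has_derivative frechet_derivative f (at x)) (at x)"
  by (simp add: frechet_derivative_works)

lemma Ck_on_Suc_continuous: "Ck_on (Suc k) U f \<Longrightarrow> continuous_on U f"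
  by (auto intro!: continuous_at_imp_continuous_on dest: differentiable_imp_continuous_within)

lemma Ck_on_lower: "Ck_on (Suc k) U f \<Longrightarrow> Ck_on k U f"
proof (induction k arbitrary: f)
  case 0
  then show ?case using Ck_on_Suc_continuous[of 0 U f] by simp
next
  case (Suc k)
  have "Ck_on k U (\<lambda>x. frechet_derivative f (at x) v)" for v
    using Suc.prems Suc.IH[of "\<lambda>x. frechet_derivative f (at x) v"] by (metis Ck_on.simps(2))
  then show ?case using Suc.prems by (metis Ck_on.simps(2))
qed

lemma Ck_on_le: "Ck_on k U f \<Longrightarrow> j \<le> k \<Longrightarrow> Ck_on j U f"
proof (induction k)
  case (Suc k)
  then show ?case using Ck_on_lower[of k U f] by (cases "j = Suc k") auto
qed simp

lemma Ck_on_continuous: "Ck_on k U f \<Longrightarrow> continuous_on U f"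
  using Ck_on_le[of k U f 0] by simp

text \<open>\<open>frechet_derivative\<close> is a description, so the closure proofs below need a
  rule that accepts any explicitly computed derivative. The two agree on the open set
  \<open>U\<close>, and \<open>Ck_on_cong\<close> carries the order over.\<close>

lemma Ck_on_SucI:
  assumes "open U" "\<And>x. x \<in> U \<Longrightarrow> (f has_derivative f' x) (at x)" "\<And>v. Ck_on k U (\<lambda>x. f' x v)"
  shows "Ck_on (Suc k) U f"
proof -
  have "frechet_derivative f (at x) v = f' x v" if "x \<in> U" for x v
    using frechet_derivative_eq[OF assms(2)[OF that]] by simp
  then have "Ck_on k U (\<lambda>x. frechet_derivative f (at x) v)" for v
    using Ck_on_cong[OF assms(1) assms(3)[of v]] by simp
  then show ?thesis using assms(2) by (auto simp: differentiable_def)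
qed

lemma Ck_on_subset: "Ck_on k U f \<Longrightarrow> V \<subseteq> U \<Longrightarrow> Ck_on k V f"
  by (induction k arbitrary: f) (auto intro: continuous_on_subset)

text \<open>Serves the unit normal, which agrees with a smooth field only locally, up to a sign that
  depends on the neighbourhood.\<close>

lemma Ck_on_local:
  assumes "\<And>x. x \<in> U \<Longrightarrow> \<exists>V. open V \<and> x \<in> V \<and> Ck_on k V f"
  shows "Ck_on k U f"
  using assms
proof (induction k arbitrary: f)
  case 0
  have "isCont f x" if "x \<in> U" for x
    using 0[OF that] by (metis Ck_on.simps(1) continuous_on_eq_continuous_at)
  then show ?case by (simp add: continuous_at_imp_continuous_on)
next
  case (Suc k)
  have "Ck_on k U (\<lambda>x. frechet_derivative f (at x) v)" for v
  proof (rule Suc.IH)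
    fix x assume "x \<in> U"
    then obtain V where "open V" "x \<in> V" "Ck_on (Suc k) V f" using Suc.prems by blast
    then show "\<exists>V. open V \<and> x \<in> V \<and> Ck_on k V (\<lambda>x. frechet_derivative f (at x) v)"
      by (intro exI[of _ V]) simp
  qed
  moreover have "f differentiable (at x)" if "x \<in> U" for x
    using Suc.prems[OF that] by auto
  ultimately show ?case by auto
qed

lemma Ck_on_const [simp]: "Ck_on k U (\<lambda>x. c)"
  by (induction k arbitrary: c) auto

lemma Ck_on_bounded_linear:
  assumes "open U" "bounded_linear h" "Ck_on k U f"
  shows "Ck_on k U (\<lambda>x. h (f x))"
  using assms(3)
proof (induction k arbitrary: f)
  case 0
  then show ?case using bounded_linear.continuous_on[OF assms(2)] by auto
next
  case (Suc k)
  show ?case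
  proof (rule Ck_on_SucI[OF assms(1)])
    show "((\<lambda>x. h (f x)) has_derivative (\<lambda>v. h (frechet_derivative f (at x) v))) (at x)" if "x \<in> U" for x
      using bounded_linear.has_derivative[OF assms(2) Ck_on_SucD[OF Suc.prems that]] by simp
    show "Ck_on k U (\<lambda>x. h (frechet_derivative f (at x) v))" for v
      using Suc by simp
  qed
qed

lemma Ck_on_add:
  assumes "open U" "Ck_on k U f" "Ck_on k U g"
  shows "Ck_on k U (\<lambda>x. f x + g x)"
  using assms(2,3)
proof (induction k arbitrary: f g)
  case 0
  then show ?case by (auto intro: continuous_intros)
next
  case (Suc k)
  show ?case
    by (rule Ck_on_SucI[OF assms(1) has_derivative_add[OF Ck_on_SucD[OF Suc.prems(1)] Ck_on_SucD[OF Suc.prems(2)]]])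
      (use Suc in auto)
qed

lemma Ck_on_ident:
  assumes "open U" shows "Ck_on k U (\<lambda>x. x)"
  by (cases k) (auto intro!: Ck_on_SucI[OF assms, where f' = "\<lambda>x v. v"])

lemma Ck_on_linear:
  assumes "open U" "bounded_linear h" shows "Ck_on k U h"
  using Ck_on_bounded_linear[OF assms Ck_on_ident[OF assms(1)]] .

lemma Ck_on_sum:
  assumes "open U" "\<And>i. i \<in> I \<Longrightarrow> Ck_on k U (f i)"
  shows "Ck_on k U (\<lambda>x. \<Sum>i\<in>I. f i x)"
  using assms(2)
  by (induction I rule: infinite_finite_induct) (auto intro: Ck_on_add[OF assms(1)])

text \<open>The product rule produces terms of the same shape in which one factor has lost an order,
  so the induction closes. One statement covers scaling, the inner product and the forms
  \<open>innerK\<close> and \<open>polarK\<close>.\<close>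

lemma Ck_on_bilinear:
  assumes "open U" "bounded_bilinear B" "Ck_on k U f" "Ck_on k U g"
  shows "Ck_on k U (\<lambda>x. B (f x) (g x))"
  using assms(3,4)
proof (induction k arbitrary: f g)
  case 0
  then show ?case using bounded_bilinear.continuous_on[OF assms(2)] by auto
next
  case (Suc k)
  show ?case
  proof (rule Ck_on_SucI[OF assms(1)])
    show "((\<lambda>x. B (f x) (g x)) has_derivative
       (\<lambda>v. B (f x) (frechet_derivative g (at x) v) + B (frechet_derivative f (at x) v) (g x))) (at x)" if "x \<in> U" for x
      using bounded_bilinear.FDERIV[OF assms(2) Ck_on_SucD[OF Suc.prems(1) that] Ck_on_SucD[OF Suc.prems(2) that]] .
    show "Ck_on k U (\<lambda>x. B (f x) (frechet_derivative g (at x) v) + B (frechet_derivative f (at x) v) (g x))" for v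
      using Suc Ck_on_lower[OF Suc.prems(1)] Ck_on_lower[OF Suc.prems(2)]
      by (intro Ck_on_add[OF assms(1)] Suc.IH) auto
  qed
qed

lemmas Ck_on_scaleR = Ck_on_bilinear[OF _ bounded_bilinear_scaleR]
lemmas Ck_on_inner = Ck_on_bilinear[OF _ bounded_bilinear_inner]

lemma Ck_on_mult:
  fixes f g :: "'a::real_normed_vector \<Rightarrow> real"
  assumes "open U" "Ck_on k U f" "Ck_on k U g"
  shows "Ck_on k U (\<lambda>x. f x * g x)"
  by (rule Ck_on_bilinear[OF assms(1) bounded_bilinear_mult assms(2,3)])

lemma Ck_on_minus:
  assumes "open U" "Ck_on k U f" shows "Ck_on k U (\<lambda>x. - f x)"
  by (rule Ck_on_bounded_linear[OF assms(1) bounded_linear_minus[OF bounded_linear_ident] assms(2)])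

lemma Ck_on_diff:
  assumes "open U" "Ck_on k U f" "Ck_on k U g"
  shows "Ck_on k U (\<lambda>x. f x - g x)"
  using Ck_on_add[OF assms(1,2) Ck_on_minus[OF assms(1,3)]] by simp

lemma Ck_on_prod:
  fixes f :: "'i \<Rightarrow> 'a::real_normed_vector \<Rightarrow> real"
  assumes "open U" "\<And>i. i \<in> I \<Longrightarrow> Ck_on k U (f i)"
  shows "Ck_on k U (\<lambda>x. \<Prod>i\<in>I. f i x)"
  using assms(2)
  by (induction I rule: infinite_finite_induct) (auto intro: Ck_on_mult[OF assms(1)])

lemma Ck_on_det:
  fixes A :: "'a::real_normed_vector \<Rightarrow> real^'m^'m"
  assumes "open U" "\<And>i j. Ck_on k U (\<lambda>x. A x $ i $ j)"
  shows "Ck_on k U (\<lambda>x. det (A x))"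
  unfolding det_def by (intro Ck_on_sum Ck_on_mult Ck_on_prod assms Ck_on_const)

text \<open>The derivative is a polynomial in the derivative of \<open>f\<close> and in
  \<open>inverse f\<close> itself, which has one order less by induction.\<close>

lemma Ck_on_inverse:
  fixes f :: "'a::real_normed_vector \<Rightarrow> real"
  assumes "open U" "Ck_on k U f" "\<And>x. x \<in> U \<Longrightarrow> f x \<noteq> 0"
  shows "Ck_on k U (\<lambda>x. inverse (f x))"
  using assms(2)
proof (induction k)
  case 0
  then show ?case using assms(3) by (auto intro: continuous_intros)
next
  case (Suc k)
  show ?case
  proof (rule Ck_on_SucI[OF assms(1)])
    show "((\<lambda>x. inverse (f x)) has_derivative
        (\<lambda>v. - (inverse (f x) * frechet_derivative f (at x) v * inverse (f x)))) (at x)" if "x \<in> U" for x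
      using Deriv.has_derivative_inverse[OF assms(3)[OF that] Ck_on_SucD[OF Suc.prems that]] .
    show "Ck_on k U (\<lambda>x. - (inverse (f x) * frechet_derivative f (at x) v * inverse (f x)))" for v
      using Suc Ck_on_lower[OF Suc.prems(1)]
      by (intro Ck_on_minus[OF assms(1)] Ck_on_mult[OF assms(1)]) auto
  qed
qed

lemma Ck_on_sqrt:
  fixes f :: "'a::real_normed_vector \<Rightarrow> real"
  assumes "open U" "Ck_on k U f" "\<And>x. x \<in> U \<Longrightarrow> f x > 0"
  shows "Ck_on k U (\<lambda>x. sqrt (f x))"
  using assms(2)
proof (induction k)
  case 0
  then show ?case by (simp add: continuous_on_real_sqrt)
next
  case (Suc k)
  have s: "Ck_on k U (\<lambda>x. sqrt (f x))" by (rule Suc.IH[OF Ck_on_lower[OF Suc.prems]])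
  have nz: "sqrt (f x) \<noteq> 0" if "x \<in> U" for x using assms(3)[OF that] by simp
  show ?case
  proof (rule Ck_on_SucI[OF assms(1)])
    show "((\<lambda>x. sqrt (f x)) has_derivative
        (\<lambda>v. frechet_derivative f (at x) v * (inverse (sqrt (f x)) * (1 / 2)))) (at x)" if "x \<in> U" for x
      using DERIV_compose_FDERIV[OF DERIV_real_sqrt[OF assms(3)[OF that]] Ck_on_SucD[OF Suc.prems that]]
      by simp
    have "Ck_on k U (\<lambda>x. frechet_derivative f (at x) v)" for v using Suc.prems by simp
    then show "Ck_on k U (\<lambda>x. frechet_derivative f (at x) v * (inverse (sqrt (f x)) * (1 / 2)))" for v
      by (intro Ck_on_mult[OF assms(1)] Ck_on_inverse[OF assms(1)] s nz Ck_on_const)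
  qed
qed

text \<open>The derivative of an affine inner map is constant, so differentiating gives again a
  composition with the same inner map and the induction closes. It is used for lines in a chart and
  for coordinate projections.\<close>

lemma Ck_on_compose_affine:
  assumes "open U" "bounded_linear h" "Ck_on k U f"
  shows "Ck_on k ((\<lambda>x. c + h x) -` U) (\<lambda>x. f (c + h x))"
proof -
  have op: "open ((\<lambda>x. c + h x) -` U)"
    by (intro open_vimage assms(1) continuous_on_add continuous_on_const linear_continuous_on assms(2))
  show ?thesis using assms(3)
  proof (induction k arbitrary: f)
    case 0
    then show ?case
      using assms(2) continuous_on_compose2[of U f "(\<lambda>x. c + h x) -` U" "\<lambda>x. c + h x"]
      by (simp add: continuous_on_add linear_continuous_on)
  next
    case (Suc k)
    show ?case
    proof (rule Ck_on_SucI[OF op])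
      show "((\<lambda>x. f (c + h x)) has_derivative (\<lambda>v. frechet_derivative f (at (c + h x)) (h v))) (at x)"
        if "x \<in> (\<lambda>x. c + h x) -` U" for x
      proof -
        have "((\<lambda>x. c + h x) has_derivative h) (at x)"
          using bounded_linear_imp_has_derivative[OF assms(2)] by (auto intro!: derivative_eq_intros)
        from diff_chain_at[OF this] Ck_on_SucD[OF Suc.prems, of "c + h x"] that show ?thesis
          by (simp add: o_def)
      qed
      show "Ck_on k ((\<lambda>x. c + h x) -` U) (\<lambda>x. frechet_derivative f (at (c + h x)) (h v))" for v
        using Suc.IH[of "\<lambda>x. frechet_derivative f (at x) (h v)"] Suc.prems by simp
    qed
  qed
qed

lemma Ck_on_compose_linear:
  assumes "open U" "bounded_linear h" "Ck_on k U f"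
  shows "Ck_on k (h -` U) (\<lambda>x. f (h x))"
  using Ck_on_compose_affine[OF assms, of 0] by simp

lemma sK_has_derivative: "K \<in> {-1,0,1} \<Longrightarrow> (sK K has_real_derivative cK K t) (at t)"
  unfolding sK_def cK_def by (auto intro!: derivative_eq_intros)

lemma cK_has_derivative: "K \<in> {-1,0,1} \<Longrightarrow> (cK K has_real_derivative - K * sK K t) (at t)"
  unfolding sK_def cK_def by (auto intro!: derivative_eq_intros)

text \<open>The two functions are treated together because each is, up to a constant factor, the
  derivative of the other.\<close>

lemma Ck_on_sK_cK:
  assumes "K \<in> {-1,0,1}"
  shows "Ck_on k UNIV (sK K) \<and> Ck_on k UNIV (cK K)"
proof (induction k)
  case 0
  show ?case using sK_has_derivative[OF assms] cK_has_derivative[OF assms]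
    by (auto intro!: continuous_at_imp_continuous_on DERIV_isCont)
next
  case (Suc k)
  have "Ck_on (Suc k) UNIV (sK K)"
    using sK_has_derivative[OF assms] Suc
    by (intro Ck_on_SucI[where f' = "\<lambda>x. (*) (cK K x)"] Ck_on_mult)
      (auto simp: has_field_derivative_def)
  moreover have "Ck_on (Suc k) UNIV (cK K)"
    using cK_has_derivative[OF assms] Suc
    by (intro Ck_on_SucI[where f' = "\<lambda>x. (*) (- K * sK K x)"] Ck_on_mult)
      (auto simp: has_field_derivative_def)
  ultimately show ?case ..
qed

lemma Ck_on_real_compose:
  assumes "open U" "Ck_on k U (f :: 'a::real_normed_vector \<Rightarrow> real)" "\<And>j. Ck_on j UNIV (g :: real \<Rightarrow> real)"
  shows "Ck_on k U (\<lambda>x. g (f x))"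
  using assms(2,3)
proof (induction k arbitrary: g)
  case 0
  have "continuous_on UNIV g" using 0(2)[of 0] by (simp only: Ck_on.simps)
  then show ?case using continuous_on_compose2[of UNIV g U f] 0(1) by simp
next
  case (Suc k)
  have g': "(g has_derivative (\<lambda>v. v * frechet_derivative g (at y) 1)) (at y)" for y
  proof -
    have D: "(g has_derivative frechet_derivative g (at y)) (at y)"
      by (rule Ck_on_SucD[OF Suc.prems(2)[of "Suc 0"]]) simp
    show ?thesis
    proof (rule has_derivative_eq_rhs[OF D], rule ext)
      show "frechet_derivative g (at y) v = v * frechet_derivative g (at y) 1" for v
        using linear_scale[OF has_derivative_linear[OF D], of v 1] by simp
    qed
  qed
  show ?case
  proof (rule Ck_on_SucI[OF assms(1)])
    show "((\<lambda>x. g (f x)) has_derivative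
        (\<lambda>v. frechet_derivative f (at x) v * frechet_derivative g (at (f x)) 1)) (at x)" if "x \<in> U" for x
      by (rule diff_chain_at[OF Ck_on_SucD[OF Suc.prems(1) that] g', unfolded o_def])
    have "Ck_on j UNIV (\<lambda>x. frechet_derivative g (at x) 1)" for j
      using Suc.prems(2)[of "Suc j"] by (simp only: Ck_on.simps)
    moreover have "Ck_on k U (\<lambda>x. frechet_derivative f (at x) v)" for v
      using Suc.prems(1) by (simp only: Ck_on.simps)
    ultimately show "Ck_on k U (\<lambda>x. frechet_derivative f (at x) v * frechet_derivative g (at (f x)) 1)" for v
      by (intro Ck_on_mult[OF assms(1)] Suc.IH[of "\<lambda>y. frechet_derivative g (at y) 1"] Ck_on_lower[OF Suc.prems(1)])
  qed
qed

lemma smooth_on_SucD: "smooth_on U f \<Longrightarrow> smooth_on U (\<lambda>x. frechet_derivative f (at x) v)"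
  unfolding smooth_on_def by (metis Ck_on.simps(2))

lemma smooth_on_has_derivative:
  "smooth_on U f \<Longrightarrow> x \<in> U \<Longrightarrow> (f has_derivative frechet_derivative f (at x)) (at x)"
  unfolding smooth_on_def using Ck_on_SucD by blast

lemma smooth_on_continuous: "smooth_on U f \<Longrightarrow> continuous_on U f"
  unfolding smooth_on_def using Ck_on_continuous by blast

text \<open>The mean value theorem applied to the increment in the second variable.\<close>

lemma second_difference_mvt:
  fixes f :: "'a::real_normed_vector \<Rightarrow> real"
  assumes "\<And>s t. s \<in> {0..1} \<Longrightarrow> t \<in> {0..1} \<Longrightarrow>
      f differentiable (at (x + s *\<^sub>R a + t *\<^sub>R b)) \<and>
      (\<lambda>y. frechet_derivative f (at y) a) differentiable (at (x + s *\<^sub>R a + t *\<^sub>R b))"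
  shows "\<exists>s\<in>{0..1}. \<exists>t\<in>{0..1}. f (x + a + b) - f (x + a) - f (x + b) + f x =
     frechet_derivative (\<lambda>y. frechet_derivative f (at y) a) (at (x + s *\<^sub>R a + t *\<^sub>R b)) b"
proof -
  let ?D = "\<lambda>y. frechet_derivative f (at y) a"
  let ?g = "\<lambda>s. f (x + s *\<^sub>R a + b) - f (x + s *\<^sub>R a)"
  have line: "((\<lambda>s. h (y + s *\<^sub>R c)) has_real_derivative frechet_derivative h (at (y + s *\<^sub>R c)) c) (at s)"
    if "h differentiable (at (y + s *\<^sub>R c))" for h :: "'a \<Rightarrow> real" and y c s
  proof -
    have "((\<lambda>s. y + s *\<^sub>R c) has_vector_derivative c) (at s)"
      by (auto intro!: derivative_eq_intros)
    from vector_derivative_diff_chain_within[OF this, of h "frechet_derivative h (at (y + s *\<^sub>R c))"] that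
    show ?thesis
      by (simp add: o_def has_real_derivative_iff_has_vector_derivative has_derivative_at_withinI
          flip: frechet_derivative_works)
  qed
  have "\<exists>s. 0 < s \<and> s < 1 \<and> ?g 1 - ?g 0 = (1 - 0) * (?D (x + b + s *\<^sub>R a) - ?D (x + s *\<^sub>R a))"
  proof (rule MVT2)
    fix s :: real assume "0 \<le> s" "s \<le> 1"
    then have "f differentiable (at (x + b + s *\<^sub>R a))" "f differentiable (at (x + s *\<^sub>R a))"
      using assms[of s 1] assms[of s 0] by (auto simp: algebra_simps)
    from DERIV_diff[OF line[OF this(1)] line[OF this(2)]]
    show "(?g has_real_derivative ?D (x + b + s *\<^sub>R a) - ?D (x + s *\<^sub>R a)) (at s)"
      by (simp add: algebra_simps)
  qed auto
  then obtain s where s: "0 < s" "s < 1" "?g 1 - ?g 0 = ?D (x + s *\<^sub>R a + b) - ?D (x + s *\<^sub>R a)"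
    by (auto simp: algebra_simps)
  have "\<exists>t. 0 < t \<and> t < 1 \<and> ?D (x + s *\<^sub>R a + 1 *\<^sub>R b) - ?D (x + s *\<^sub>R a + 0 *\<^sub>R b) =
      (1 - 0) * frechet_derivative ?D (at (x + s *\<^sub>R a + t *\<^sub>R b)) b"
    by (rule MVT2) (use s assms in \<open>auto intro!: line\<close>)
  then obtain t where "0 < t" "t < 1" "?D (x + s *\<^sub>R a + b) - ?D (x + s *\<^sub>R a) =
      frechet_derivative ?D (at (x + s *\<^sub>R a + t *\<^sub>R b)) b"
    by auto
  with s show ?thesis by (intro bexI[of _ s] bexI[of _ t]) (auto simp: algebra_simps)
qed

text \<open>The second difference is symmetric in \<open>a\<close> and \<open>b\<close>. The mean
  value theorem writes it as \<open>r^2\<close> times a mixed derivative at a point near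
  \<open>x\<close>, in either order, and continuity of the second derivatives moves both points to
  \<open>x\<close>.\<close>

lemma second_derivative_symmetric_real:
  fixes f :: "'a::real_normed_vector \<Rightarrow> real"
  assumes "open U" "Ck_on 2 U f" "x \<in> U"
  shows "frechet_derivative (\<lambda>y. frechet_derivative f (at y) a) (at x) b =
         frechet_derivative (\<lambda>y. frechet_derivative f (at y) b) (at x) a"
proof -
  define H where "H = (\<lambda>a b y. frechet_derivative (\<lambda>y. frechet_derivative f (at y) a) (at y) b)"
  have C2: "Ck_on (Suc (Suc 0)) U f" using assms(2) by (simp add: numeral_2_eq_2)
  have "continuous_on U (H a b)" for a b using C2 unfolding H_def by simp
  then have Hcont: "\<forall>\<^sub>F y in nhds x. \<bar>H a b y - H a b x\<bar> < e" if "e > 0" for a b e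
    using assms(1,3) tendstoD[OF _ that, of "H a b" "H a b x" "nhds x"]
    by (simp add: continuous_on_eq_continuous_at isCont_def tendsto_nhds_iff dist_real_def)
  have d1: "f differentiable (at y) \<and> (\<lambda>y. frechet_derivative f (at y) a) differentiable (at y)" if "y \<in> U" for y a
    using C2 that by simp
  have lin1: "linear (frechet_derivative f (at y))" if "y \<in> U" for y
    using C2 that by (intro linear_frechet_derivative) auto
  have lin2: "H a (r *\<^sub>R b) y = r * H a b y" if "y \<in> U" for a b y r
    using C2 that linear_scale[OF linear_frechet_derivative, of "\<lambda>y. frechet_derivative f (at y) a" "at y" r b]
    unfolding H_def by simp
  have lin3: "H (r *\<^sub>R a) b y = r * H a b y" if y: "y \<in> U" for a b y r
  proof -
    have "((\<lambda>y. frechet_derivative f (at y) (r *\<^sub>R a)) has_derivative (\<lambda>b. r * H a b y)) (at y)"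
    proof (rule has_derivative_transform_within_open[OF _ assms(1) y])
      show "((\<lambda>y. r * frechet_derivative f (at y) a) has_derivative (\<lambda>b. r * H a b y)) (at y)"
        using C2 y unfolding H_def by (intro has_derivative_mult_right) (simp add: frechet_derivative_works)
      show "r * frechet_derivative f (at z) a = frechet_derivative f (at z) (r *\<^sub>R a)" if "z \<in> U" for z
        using linear_scale[OF lin1[OF that], of r a] by simp
    qed
    from frechet_derivative_eq[OF this] show ?thesis unfolding H_def by simp
  qed
  have "H a b x - H b a x = 0"
  proof (rule ccontr)
    assume ne: "H a b x - H b a x \<noteq> 0"
    \<comment> \<open>Half the gap: if each mixed derivative moves by less than \<open>e\<close>,
      the two cannot take a common value.\<close>
    define e where "e = \<bar>H a b x - H b a x\<bar> / 2"
    have e: "e > 0" using ne by (simp add: e_def)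
    have "\<forall>\<^sub>F y in nhds x. y \<in> U \<and> \<bar>H a b y - H a b x\<bar> < e \<and> \<bar>H b a y - H b a x\<bar> < e"
      by (intro eventually_conj eventually_nhds_in_open assms(1,3) Hcont e)
    then obtain d where d: "d > 0" "\<And>y. dist y x < d \<Longrightarrow> y \<in> U \<and> \<bar>H a b y - H a b x\<bar> < e \<and> \<bar>H b a y - H b a x\<bar> < e"
      unfolding eventually_nhds_metric by blast
    \<comment> \<open>A bound strictly above \<open>norm a + norm b\<close>, so that the
      parallelogram with sides \<open>r a\<close> and \<open>r b\<close>, where
      \<open>r = d / C\<close>, stays within distance \<open>d\<close> of \<open>x\<close>.\<close>
    define C where "C = norm a + norm b + 1"
    have C: "C > 0" "norm a + norm b < C" by (auto simp: C_def add_nonneg_pos)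
    define r where "r = d / C"
    have r: "r > 0" "r * C = d" using d C by (auto simp: r_def)
    have near: "dist (x + s *\<^sub>R (r *\<^sub>R a) + t *\<^sub>R (r *\<^sub>R b)) x < d" if "s \<in> {0..1}" "t \<in> {0..1}" for s t
    proof -
      have "dist (x + s *\<^sub>R (r *\<^sub>R a) + t *\<^sub>R (r *\<^sub>R b)) x \<le> s * (r * norm a) + t * (r * norm b)"
        using norm_triangle_ineq[of "s *\<^sub>R (r *\<^sub>R a)" "t *\<^sub>R (r *\<^sub>R b)"] that r
        by (simp add: dist_norm add.assoc)
      also have "\<dots> \<le> r * norm a + r * norm b"
        using that r by (intro add_mono mult_left_le_one_le) auto
      also have "\<dots> < r * C"
        using mult_strict_left_mono[OF C(2) r(1)] by (simp add: distrib_left)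
      also have "\<dots> = d" by fact
      finally show ?thesis .
    qed
    have mvt: "\<exists>y. dist y x < d \<and>
        f (x + r *\<^sub>R a + r *\<^sub>R b) - f (x + r *\<^sub>R a) - f (x + r *\<^sub>R b) + f x = r * (r * H a b y)"
      if nr: "\<And>s t. s \<in> {0..1} \<Longrightarrow> t \<in> {0..1} \<Longrightarrow> dist (x + s *\<^sub>R (r *\<^sub>R a) + t *\<^sub>R (r *\<^sub>R b)) x < d" for a b
    proof -
      have U: "x + s *\<^sub>R (r *\<^sub>R a) + t *\<^sub>R (r *\<^sub>R b) \<in> U" if "s \<in> {0..1}" "t \<in> {0..1}" for s t
        using nr[OF that] d by blast
      obtain s t where st: "s \<in> {0..1}" "t \<in> {0..1}"
        "f (x + r *\<^sub>R a + r *\<^sub>R b) - f (x + r *\<^sub>R a) - f (x + r *\<^sub>R b) + f x =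
          H (r *\<^sub>R a) (r *\<^sub>R b) (x + s *\<^sub>R (r *\<^sub>R a) + t *\<^sub>R (r *\<^sub>R b))"
        using second_difference_mvt[of f x "r *\<^sub>R a" "r *\<^sub>R b"] d1[OF U] unfolding H_def by blast
      define y where "y = x + s *\<^sub>R (r *\<^sub>R a) + t *\<^sub>R (r *\<^sub>R b)"
      have "y \<in> U" "dist y x < d" using U[OF st(1,2)] nr[OF st(1,2)] by (simp_all only: y_def)
      with st(3) show ?thesis
        by (intro exI[of _ y]) (simp only: lin2 lin3 y_def[symmetric] simp_thms)
    qed
    obtain y where y: "dist y x < d"
      "f (x + r *\<^sub>R a + r *\<^sub>R b) - f (x + r *\<^sub>R a) - f (x + r *\<^sub>R b) + f x = r * (r * H a b y)"
      using mvt[OF near] by blast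
    have near': "dist (x + s *\<^sub>R (r *\<^sub>R b) + t *\<^sub>R (r *\<^sub>R a)) x < d" if "s \<in> {0..1}" "t \<in> {0..1}" for s t
      using near[OF that(2,1)] by (simp only: add.assoc add.commute[of "s *\<^sub>R r *\<^sub>R b"])
    obtain z where z: "dist z x < d"
      "f (x + r *\<^sub>R b + r *\<^sub>R a) - f (x + r *\<^sub>R b) - f (x + r *\<^sub>R a) + f x = r * (r * H b a z)"
      using mvt[OF near'] by blast
    have "x + r *\<^sub>R b + r *\<^sub>R a = x + r *\<^sub>R a + r *\<^sub>R b" by simp
    with z(2) have "f (x + r *\<^sub>R a + r *\<^sub>R b) - f (x + r *\<^sub>R b) - f (x + r *\<^sub>R a) + f x = r * (r * H b a z)"
      by (simp only:)
    with y(2) have "r * (r * H a b y) = r * (r * H b a z)" by linarith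
    then have "H a b y = H b a z" using r by simp
    moreover have "\<bar>H a b y - H a b x\<bar> < e" "\<bar>H b a z - H b a x\<bar> < e" using d y z by blast+
    ultimately show False unfolding e_def by (simp add: abs_if split: if_splits)
  qed
  then show ?thesis by (simp add: H_def)
qed

lemma second_derivative_symmetric:
  fixes f :: "'a::real_normed_vector \<Rightarrow> 'b::euclidean_space"
  assumes "open U" "Ck_on 2 U f" "x \<in> U"
  shows "frechet_derivative (\<lambda>y. frechet_derivative f (at y) a) (at x) b =
         frechet_derivative (\<lambda>y. frechet_derivative f (at y) b) (at x) a"
proof (rule euclidean_eqI)
  fix e :: 'b assume "e \<in> Basis"
  have C2: "Ck_on (Suc (Suc 0)) U f" using assms(2) by (simp add: numeral_2_eq_2)
  have D1: "frechet_derivative (\<lambda>y. f y \<bullet> e) (at y) c = frechet_derivative f (at y) c \<bullet> e" if "y \<in> U" for y c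
    by (subst frechet_derivative_eq[OF has_derivative_inner_left[OF Ck_on_SucD[OF C2 that]]]) simp
  have D2: "frechet_derivative (\<lambda>y. frechet_derivative (\<lambda>y. f y \<bullet> e) (at y) c) (at x) c' =
      frechet_derivative (\<lambda>y. frechet_derivative f (at y) c) (at x) c' \<bullet> e" for c c'
  proof -
    have "((\<lambda>y. frechet_derivative f (at y) c) has_derivative
        frechet_derivative (\<lambda>y. frechet_derivative f (at y) c) (at x)) (at x)"
      using C2 assms(3) by (simp add: frechet_derivative_works)
    from has_derivative_transform_within_open[OF has_derivative_inner_left[OF this, of e] assms(1,3)] D1
    show ?thesis by (subst frechet_derivative_eq) auto
  qed
  have "Ck_on 2 U (\<lambda>y. f y \<bullet> e)"
    by (rule Ck_on_bounded_linear[OF assms(1) bounded_linear_inner_left assms(2)])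
  from second_derivative_symmetric_real[OF assms(1) this assms(3), of a b]
  show "frechet_derivative (\<lambda>y. frechet_derivative f (at y) a) (at x) b \<bullet> e =
     frechet_derivative (\<lambda>y. frechet_derivative f (at y) b) (at x) a \<bullet> e"
    by (simp add: D2)
qed

text \<open>The norm of a linear map is at most the sum of the norms of its values on a basis. This
  turns continuity of each directional derivative, as in \<open>Ck_on\<close>, into continuity in
  operator norm, as the local injectivity theorem demands.\<close>

lemma C1_continuous_onorm:
  fixes f :: "'a::euclidean_space \<Rightarrow> 'b::real_normed_vector"
  assumes "open U" "Ck_on 1 U f" "a \<in> U" "e > 0"
  shows "\<exists>d>0. \<forall>x. dist a x < d \<longrightarrow> x \<in> U \<and> onorm (\<lambda>v. frechet_derivative f (at x) v - frechet_derivative f (at a) v) < e"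
proof -
  let ?D = "\<lambda>x. frechet_derivative f (at x)"
  let ?S = "\<lambda>x. \<Sum>b\<in>Basis. norm (?D x b - ?D a b)"
  have "continuous_on U ?S"
    using assms(2) by (auto intro!: continuous_intros)
  then have "isCont ?S a" using assms(1,3) by (simp add: continuous_on_eq_continuous_at)
  then have "\<forall>\<^sub>F x in nhds a. ?S x < e"
    using assms(4) by (intro order_tendstoD(2)[of _ "?S a"]) (auto simp: isCont_def tendsto_nhds_iff)
  moreover have "\<forall>\<^sub>F x in nhds a. x \<in> U" using assms(1,3) by (simp add: eventually_nhds_in_open)
  ultimately have "\<forall>\<^sub>F x in nhds a. ?S x < e \<and> x \<in> U" by eventually_elim simp
  then obtain d where d: "d > 0" "\<And>x. dist x a < d \<Longrightarrow> ?S x < e \<and> x \<in> U"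
    unfolding eventually_nhds_metric by blast
  have "onorm (\<lambda>v. ?D x v - ?D a v) < e" if "dist a x < d" for x
  proof -
    have xU: "x \<in> U" "?S x < e" using d that by (auto simp: dist_commute)
    have "linear (\<lambda>v. ?D x v - ?D a v)"
      using xU assms(2,3) by (intro linear_compose_sub linear_frechet_derivative) auto
    then have lin: "bounded_linear (\<lambda>v. ?D x v - ?D a v)" by (simp add: linear_conv_bounded_linear)
    have "onorm (\<lambda>v. ?D x v - ?D a v) \<le> ?S x"
      by (rule onorm_componentwise[OF lin, unfolded])
    with xU show ?thesis by simp
  qed
  with d show ?thesis by (metis dist_commute)
qed

text \<open>The target may have a larger dimension than the source, as for maps from coordinates
  into the ambient vector space, so the argument rests on a linear left inverse of the
  derivative.\<close>

lemma C1_locally_injective: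
  fixes f :: "'a::euclidean_space \<Rightarrow> 'b::euclidean_space"
  assumes "open U" "Ck_on 1 U f" "a \<in> U" "inj (frechet_derivative f (at a))"
  shows "\<exists>r>0. ball a r \<subseteq> U \<and> inj_on f (ball a r)"
proof -
  have "linear (frechet_derivative f (at a))"
    using assms(2,3) by (intro linear_frechet_derivative) auto
  then obtain g' where g': "linear g'" "g' \<circ> frechet_derivative f (at a) = id"
    using linear_injective_left_inverse[OF _ assms(4)] by blast
  show ?thesis
  proof (rule has_derivative_locally_injective[OF assms(3,1), of g' "\<lambda>x. frechet_derivative f (at x)" f])
    show "bounded_linear g'" using g' by (simp add: linear_conv_bounded_linear)
    show "g' \<circ> frechet_derivative f (at a) = id" by fact
    show "(f has_derivative frechet_derivative f (at x)) (at x)" if "x \<in> U" for x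
      using Ck_on_SucD[of 0 U f x] assms(2) that by simp
    show "\<exists>d>0. \<forall>x. dist a x < d \<longrightarrow> onorm (\<lambda>v. frechet_derivative f (at x) v - frechet_derivative f (at a) v) < e" if "e > 0" for e
      using C1_continuous_onorm[OF assms(1-3) that] by blast
  qed auto
qed

section \<open>Determinants and the area inequality\<close>

lemma permutes_UNIV_bij: "p permutes UNIV \<longleftrightarrow> bij p"
  by (simp add: permutes_def bij_iff)

text \<open>Conjugation by \<open>f\<close> is a bijection between the permutations of the two index
  types, and it preserves signs.\<close>

lemma det_reindex:
  fixes A :: "real^'b^'b" and f :: "'a::finite \<Rightarrow> 'b::finite"
  assumes "bij f"
  shows "det (\<chi> i j. A $ f i $ f j) = det A"
proof -
  have inv: "f (inv f y) = y" "inv f (f x) = x" for x y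
    using assms by (simp_all add: bij_is_surj surj_f_inv_f bij_is_inj)
  have "(\<Sum>p | p permutes UNIV. of_int (sign p) * (\<Prod>i\<in>UNIV. A $ f i $ f (p i))) =
        (\<Sum>q | q permutes UNIV. of_int (sign q) * (\<Prod>i\<in>UNIV. A $ i $ q i))"
  proof (rule sum.reindex_bij_witness[where i = "\<lambda>q. inv f \<circ> q \<circ> f" and j = "\<lambda>p. f \<circ> p \<circ> inv f"])
    fix p :: "'a \<Rightarrow> 'a" assume p: "p \<in> {p. p permutes UNIV}"
    then have bp: "bij p" by (simp add: permutes_bij)
    show "inv f \<circ> (f \<circ> p \<circ> inv f) \<circ> f = p" by (simp add: fun_eq_iff inv)
    have "bij (f \<circ> p \<circ> inv f)" by (intro bij_comp bp assms bij_imp_bij_inv)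
    then show "f \<circ> p \<circ> inv f \<in> {q. q permutes UNIV}" by (simp add: permutes_UNIV_bij)
    have "map_permutation UNIV f p = f \<circ> p \<circ> inv f"
      using assms by (simp add: map_permutation_def restrict_id_def fun_eq_iff bij_is_surj)
    then have sg: "sign (f \<circ> p \<circ> inv f) = sign p"
      using sign_map_permutation[of f UNIV p] p assms bij_is_inj by auto
    have "(\<Prod>i\<in>UNIV. A $ i $ (f \<circ> p \<circ> inv f) i) = (\<Prod>i\<in>UNIV. A $ f i $ f (p i))"
      by (rule prod.reindex_bij_witness[where i = f and j = "inv f"]) (auto simp: inv)
    then show "of_int (sign (f \<circ> p \<circ> inv f)) * (\<Prod>i\<in>UNIV. A $ i $ (f \<circ> p \<circ> inv f) i) =
        of_int (sign p) * (\<Prod>i\<in>UNIV. A $ f i $ f (p i))" by (simp only: sg)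
  next
    fix q :: "'b \<Rightarrow> 'b" assume q: "q \<in> {q. q permutes UNIV}"
    then have "bij q" by (simp add: permutes_bij)
    then have "bij (inv f \<circ> q \<circ> f)" by (intro bij_comp assms bij_imp_bij_inv)
    then show "inv f \<circ> q \<circ> f \<in> {p. p permutes UNIV}" by (simp add: permutes_UNIV_bij)
    show "f \<circ> (inv f \<circ> q \<circ> f) \<circ> inv f = q" by (simp add: fun_eq_iff inv)
  qed
  then show ?thesis by (simp add: det_def)
qed

text \<open>In the Leibniz sum a permutation that moves \<open>None\<close> picks up a zero from the
  row \<open>None\<close>; those that fix it are exactly the maps \<open>map_option q\<close>, with
  the sign of \<open>q\<close>.\<close>

lemma det_option:
  fixes A :: "real^'n::finite option^'n option"
  assumes "\<And>j. A $ None $ Some j = 0"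
  shows "det A = A $ None $ None * det (\<chi> i j. A $ Some i $ Some j)"
proof -
  let ?t = "\<lambda>p. of_int (sign p) * (\<Prod>i\<in>UNIV. A $ i $ p i) :: real"
  have U: "(UNIV :: 'n option set) = insert None (range Some)" by (rule UNIV_option_conv)
  have pr: "(\<Prod>i\<in>UNIV. g i) = g None * (\<Prod>i\<in>UNIV. g (Some i))" for g :: "'n option \<Rightarrow> real"
    by (simp add: U prod.reindex)
  have "det A = (\<Sum>p | p permutes UNIV. ?t p)" by (simp add: det_def)
  also have "\<dots> = (\<Sum>p | p permutes UNIV \<and> p None = None. ?t p)"
  proof (rule sum.mono_neutral_right)
    show "\<forall>p\<in>{p. p permutes UNIV} - {p. p permutes UNIV \<and> p None = None}. ?t p = 0"
    proof
      fix p :: "'n option \<Rightarrow> 'n option"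
      assume "p \<in> {p. p permutes UNIV} - {p. p permutes UNIV \<and> p None = None}"
      then obtain j where "p None = Some j" by (cases "p None") auto
      then show "?t p = 0" by (simp add: pr assms)
    qed
  qed (auto simp: finite_permutations)
  also have "\<dots> = (\<Sum>q | q permutes UNIV. A $ None $ None * (of_int (sign q) * (\<Prod>i\<in>UNIV. A $ Some i $ Some (q i))))"
  proof (rule sym, rule sum.reindex_bij_witness[where j = map_option and i = "\<lambda>p i. the (p (Some i))"])
    fix q :: "'n \<Rightarrow> 'n" assume q: "q \<in> {q. q permutes UNIV}"
    show "(\<lambda>i. the (map_option q (Some i))) = q" by simp
    have "map_permutation UNIV Some q = map_option q"
    proof
      fix x show "map_permutation UNIV Some q x = map_option q x"
        by (cases x) (auto simp: map_permutation_def restrict_id_def)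
    qed
    then have sg: "sign (map_option q) = sign q"
      using sign_map_permutation[of Some UNIV q] q by auto
    have "bij q" using q by (simp add: permutes_bij)
    have "bij (map_option q)"
    proof (rule bijI)
      show "inj (map_option q)" using \<open>bij q\<close> by (simp add: bij_is_inj option.inj_map)
      then show "surj (map_option q)" by (rule finite_UNIV_inj_surj[OF finite])
    qed
    then show "map_option q \<in> {p. p permutes UNIV \<and> p None = None}" by (simp add: permutes_UNIV_bij)
    show "?t (map_option q) = A $ None $ None * (of_int (sign q) * (\<Prod>i\<in>UNIV. A $ Some i $ Some (q i)))"
      by (simp add: pr sg)
  next
    fix p :: "'n option \<Rightarrow> 'n option" assume p: "p \<in> {p. p permutes UNIV \<and> p None = None}"
    then have inj: "inj p" by (auto dest: permutes_inj)
    have S: "\<exists>j. p (Some i) = Some j" for i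
      using inj_eq[OF inj, of "Some i" None] p by (cases "p (Some i)") auto
    then have S': "Some (the (p (Some i))) = p (Some i)" for i by (metis option.sel)
    show "map_option (\<lambda>i. the (p (Some i))) = p"
    proof
      fix x show "map_option (\<lambda>i. the (p (Some i))) x = p x" using p S' by (cases x) auto
    qed
    have "inj (\<lambda>i. the (p (Some i)))"
      by (rule injI) (metis S' inj inj_eq option.inject)
    then have "bij (\<lambda>i. the (p (Some i)))" by (simp add: bij_def finite_UNIV_inj_surj)
    then show "(\<lambda>i. the (p (Some i))) \<in> {q. q permutes UNIV}" by (simp add: permutes_UNIV_bij)
  qed
  also have "\<dots> = A $ None $ None * det (\<chi> i j. A $ Some i $ Some j)"
    by (simp add: det_def sum_distrib_left)
  finally show ?thesis .
qed

text \<open>The preimage of a box is a box with the same side lengths in another order, and Lebesgue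
  measure is determined by its values on boxes.\<close>

lemma distr_lborel_basis_permuting:
  fixes T :: "'a::euclidean_space \<Rightarrow> 'b::euclidean_space"
  assumes "linear T" "bij_betw T Basis Basis"
  shows "distr lborel borel T = lborel"
proof (rule sym, rule lborel_eqI)
  have Tm: "T \<in> borel_measurable lborel"
    using linear_continuous_on[of T UNIV] assms(1)
    by (auto simp: linear_conv_bounded_linear intro: borel_measurable_continuous_onI)
  have TB: "T b \<in> Basis" if "b \<in> Basis" for b using assms(2) that by (auto simp: bij_betw_def)
  have inner: "T x \<bullet> T b = x \<bullet> b" if b: "b \<in> Basis" for x b
  proof -
    have "T x = (\<Sum>c\<in>Basis. (x \<bullet> c) *\<^sub>R T c)"
      by (subst euclidean_representation[of x, symmetric]) (simp add: linear_sum[OF assms(1)] linear_scale[OF assms(1)])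
    then have "T x \<bullet> T b = (\<Sum>c\<in>Basis. (x \<bullet> c) * (T c \<bullet> T b))" by (simp add: inner_sum_left)
    also have "\<dots> = (\<Sum>c\<in>Basis. (x \<bullet> c) * (if c = b then 1 else 0))"
      by (intro sum.cong refl) (use b TB inj_on_eq_iff[OF bij_betw_imp_inj_on[OF assms(2)]] in \<open>simp add: inner_Basis\<close>)
    also have "\<dots> = x \<bullet> b" using b by (simp add: if_distrib[of "\<lambda>z. _ * z"] sum.delta cong: if_cong)
    finally show ?thesis .
  qed
  fix l u :: 'b assume le: "\<And>b. b \<in> Basis \<Longrightarrow> l \<bullet> b \<le> u \<bullet> b"
  define l' u' where "l' = (\<Sum>b\<in>Basis. (l \<bullet> T b) *\<^sub>R b)" and "u' = (\<Sum>b\<in>Basis. (u \<bullet> T b) *\<^sub>R b)"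
  have lu: "l' \<bullet> b = l \<bullet> T b" "u' \<bullet> b = u \<bullet> T b" if "b \<in> Basis" for b
    using that by (simp_all add: l'_def u'_def)
  have "T -` box l u = box l' u'"
  proof (rule set_eqI)
    fix x
    have "T x \<in> box l u \<longleftrightarrow> (\<forall>c\<in>T ` Basis. l \<bullet> c < T x \<bullet> c \<and> T x \<bullet> c < u \<bullet> c)"
      using assms(2) by (simp add: mem_box bij_betw_def)
    then show "x \<in> T -` box l u \<longleftrightarrow> x \<in> box l' u'" by (simp add: mem_box inner lu)
  qed
  moreover have "emeasure lborel (box l' u') = (\<Prod>b\<in>Basis. (u' - l') \<bullet> b)"
    using le TB lu by (intro emeasure_lborel_box) auto
  moreover have "(\<Prod>b\<in>Basis. (u' - l') \<bullet> b) = (\<Prod>b\<in>Basis. (u - l) \<bullet> b)"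
    using prod.reindex_bij_betw[OF assms(2), of "\<lambda>c. (u - l) \<bullet> c"] by (simp add: inner_diff_left lu)
  ultimately show "emeasure (distr lborel borel T) (box l u) = (\<Prod>b\<in>Basis. (u - l) \<bullet> b)"
    using Tm by (subst emeasure_distr) auto
qed simp

text \<open>The change of variables theory of the library is restricted to well-ordered index types, so an
  arbitrary finite index type is replaced by a well-ordered copy of itself.\<close>

typedef 'a wo = "UNIV :: 'a set" by simp

lemma bij_Rep_wo: "bij Rep_wo"
  by (metis Abs_wo_inverse Rep_wo_inverse UNIV_I bijI')

instance wo :: (finite) finite
  by standard (metis bij_Rep_wo bij_betw_finite finite)

instantiation wo :: (finite) wellorder
begin

definition "a \<le> b \<longleftrightarrow> to_nat (Rep_wo a) \<le> to_nat (Rep_wo b)"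
definition "a < b \<longleftrightarrow> to_nat (Rep_wo a) < to_nat (Rep_wo b)"

instance
proof
  fix a b c :: "'a wo"
  show "a < b \<longleftrightarrow> a \<le> b \<and> \<not> b \<le> a" by (auto simp: less_eq_wo_def less_wo_def)
  show "a \<le> a" by (simp add: less_eq_wo_def)
  show "a \<le> b \<Longrightarrow> b \<le> c \<Longrightarrow> a \<le> c" by (simp add: less_eq_wo_def)
  show "a \<le> b \<Longrightarrow> b \<le> a \<Longrightarrow> a = b" by (simp add: less_eq_wo_def Rep_wo_inject)
  show "a \<le> b \<or> b \<le> a" by (auto simp: less_eq_wo_def)
next
  fix P :: "'a wo \<Rightarrow> bool" and a :: "'a wo"
  assume "\<And>x. (\<And>y. y < x \<Longrightarrow> P y) \<Longrightarrow> P x"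
  then show "P a"
    by (induction "to_nat (Rep_wo a)" arbitrary: a rule: less_induct) (metis less_wo_def)
qed

end

text \<open>The image counts each point once, while the right-hand integral counts preimages with
  multiplicity, so overlaps only help. A Borel set \<open>Z\<close> around the image is returned
  because the image itself is only known to be Lebesgue measurable.\<close>

lemma area_inequality_wellorder:
  fixes \<phi> :: "real^'m::{finite,wellorder} \<Rightarrow> real^'m::_" and g :: "real^'m::_ \<Rightarrow> real"
  assumes A: "A \<in> sets borel"
    and der: "\<And>x. x \<in> A \<Longrightarrow> (\<phi> has_derivative \<phi>' x) (at x within A)"
    and g: "g \<in> borel_measurable borel" "\<And>y. 0 \<le> g y"
  shows "\<exists>Z\<in>sets borel. \<phi> ` A \<subseteq> Z \<and>
    (\<integral>\<^sup>+y\<in>Z. ennreal (g y) \<partial>lborel) \<le> (\<integral>\<^sup>+x\<in>A. ennreal (\<bar>det (matrix (\<phi>' x))\<bar> * g (\<phi> x)) \<partial>lborel)"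
proof -
  define h where "h = (\<lambda>x. if x \<in> A then \<bar>det (matrix (\<phi>' x))\<bar> * g (\<phi> x) else 0)"
  have h0: "0 \<le> h x" for x using g by (simp add: h_def)
  have AL: "A \<in> sets lebesgue" using A by simp
  have cont: "continuous_on A \<phi>" using der by (rule has_derivative_continuous_on)
  have "\<phi> \<in> borel_measurable (lebesgue_on A)" by (rule continuous_imp_measurable_on_sets_lebesgue[OF cont AL])
  then have "(\<lambda>x. g (\<phi> x)) \<in> borel_measurable (lebesgue_on A)"
    using g(1) by (rule measurable_compose)
  moreover have "(\<lambda>x. det (matrix (\<phi>' x))) \<in> borel_measurable (lebesgue_on A)"
    by (rule borel_measurable_det_Jacobian[OF AL der])
  ultimately have "(\<lambda>x. \<bar>det (matrix (\<phi>' x))\<bar> * g (\<phi> x)) \<in> borel_measurable (lebesgue_on A)"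
    by measurable
  then have hm: "h \<in> borel_measurable lebesgue"
    unfolding h_def by (simp add: borel_measurable_if AL)
  have heq: "(\<integral>\<^sup>+x\<in>A. ennreal (\<bar>det (matrix (\<phi>' x))\<bar> * g (\<phi> x)) \<partial>lborel) = (\<integral>\<^sup>+x. ennreal (h x) \<partial>lebesgue)"
    by (auto simp: nn_integral_completion h_def intro!: nn_integral_cong split: split_indicator)
  show ?thesis
  proof (cases "(\<integral>\<^sup>+x. ennreal (h x) \<partial>lebesgue) = \<infinity>")
    case True
    \<comment> \<open>An infinite right-hand side imposes no bound, so the whole space
      serves.\<close>
    then show ?thesis unfolding heq by (intro bexI[of _ UNIV]) auto
  next
    case False
    then obtain r where r: "r \<ge> 0" "(\<integral>\<^sup>+x. ennreal (h x) \<partial>lebesgue) = ennreal r"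
      by (cases "\<integral>\<^sup>+x. ennreal (h x) \<partial>lebesgue") (auto simp: top_unique)
    then have "(h has_integral r) UNIV" using has_integral_iff_nn_integral_lebesgue[of h r] h0 hm by blast
    then have hi: "((\<lambda>x. \<bar>det (matrix (\<phi>' x))\<bar> * g (\<phi> x)) has_integral r) A"
      unfolding h_def by (simp add: has_integral_restrict_UNIV)
    have gi: "g integrable_on \<phi> ` A" "integral (\<phi> ` A) g \<le> r"
      using integral_on_image_ubound_nonneg[of A g \<phi> \<phi>'] der g(2) hi by (auto simp: integral_unique has_integral_integrable)
    have "(\<integral>\<^sup>+y\<in>\<phi> ` A. ennreal (g y) \<partial>lborel) = ennreal (integral (\<phi> ` A) g)"
      using nn_integral_has_integral_lebesgue'[OF _ integrable_integral[OF gi(1)]] g(2) by simp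
    then have le: "(\<integral>\<^sup>+y\<in>\<phi> ` A. ennreal (g y) \<partial>lborel) \<le> ennreal r" using gi(2) by (simp add: ennreal_leI)
    have "\<phi> ` A \<in> sets lebesgue"
      by (rule differentiable_image_in_sets_lebesgue[OF AL])
         (use der in \<open>auto simp: differentiable_on_def differentiable_def\<close>)
    \<comment> \<open>The image is a Borel set together with a part of a Borel null set. Adding all
      of that null set gives a Borel set with the same integral.\<close>
    then obtain S N N' where Z: "\<phi> ` A = S \<union> N" "N \<subseteq> N'" "N' \<in> null_sets lborel" "S \<in> sets lborel"
      by (rule sets_completionE)
    have "(\<integral>\<^sup>+y\<in>S \<union> N'. ennreal (g y) \<partial>lborel) = (\<integral>\<^sup>+y\<in>\<phi> ` A. ennreal (g y) \<partial>lborel)"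
      by (rule nn_integral_cong_AE, rule AE_mp[OF AE_not_in[OF Z(3)]])
         (use Z in \<open>auto split: split_indicator\<close>)
    with Z le show ?thesis unfolding heq r(2)
      by (intro bexI[of _ "S \<union> N'"]) (auto simp: null_sets_def)
  qed
qed

text \<open>The integrand is arbitrary, because the Jacobian of a given family of derivatives is not
  known to be Borel. The transformation formula is therefore applied to the simple functions below
  it; a second use with the inverse map gives equality.\<close>

lemma nn_integral_iso_le:
  fixes S :: "'a::euclidean_space \<Rightarrow> 'b::euclidean_space"
  assumes "S \<in> borel_measurable borel" "T \<in> borel_measurable borel"
    "\<And>v. S (T v) = v" "\<And>w. T (S w) = w" "distr lborel borel S = lborel"
  shows "(\<integral>\<^sup>+x. F (S x) \<partial>lborel) \<le> (\<integral>\<^sup>+x. F x \<partial>lborel)"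
  unfolding nn_integral_def[of lborel "\<lambda>x. F (S x)"]
proof (rule SUP_least)
  fix G assume "G \<in> {G. simple_function lborel G \<and> G \<le> (\<lambda>x. F (S x))}"
  then have G: "simple_function lborel G" "\<And>x. G x \<le> F (S x)" by (auto simp: le_fun_def)
  have Gm: "G \<in> borel_measurable borel" using borel_measurable_simple_function[OF G(1)] by simp
  have GT: "(\<lambda>y. G (T y)) \<in> borel_measurable borel" by (rule measurable_compose[OF assms(2) Gm])
  have "integral\<^sup>S lborel G = (\<integral>\<^sup>+x. G (T (S x)) \<partial>lborel)"
    by (simp add: nn_integral_eq_simple_integral[OF G(1)] assms(4))
  also have "\<dots> = (\<integral>\<^sup>+y. G (T y) \<partial>distr lborel borel S)"
    using assms(1) GT by (subst nn_integral_distr) auto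
  also have "\<dots> \<le> (\<integral>\<^sup>+x. F x \<partial>lborel)"
    unfolding assms(5) by (intro nn_integral_mono) (metis G(2) assms(3))
  finally show "integral\<^sup>S lborel G \<le> (\<integral>\<^sup>+x. F x \<partial>lborel)" .
qed

text \<open>\<open>S\<close> and \<open>T\<close> relabel coordinates. They preserve Lebesgue
  measure, and conjugation by them preserves the Jacobian determinant by
  \<open>det_reindex\<close>.\<close>

lemma area_inequality_euclidean:
  fixes \<phi> :: "real^'m \<Rightarrow> real^'m" and g :: "real^'m \<Rightarrow> real"
  assumes A: "A \<in> sets borel"
    and der: "\<And>x. x \<in> A \<Longrightarrow> (\<phi> has_derivative \<phi>' x) (at x within A)"
    and g: "g \<in> borel_measurable borel" "\<And>y. 0 \<le> g y"
  shows "\<exists>Z\<in>sets borel. \<phi> ` A \<subseteq> Z \<and>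
    (\<integral>\<^sup>+y\<in>Z. ennreal (g y) \<partial>lborel) \<le> (\<integral>\<^sup>+x\<in>A. ennreal (\<bar>det (matrix (\<phi>' x))\<bar> * g (\<phi> x)) \<partial>lborel)"
proof -
  define S :: "real^'m wo \<Rightarrow> real^'m" where "S = (\<lambda>w. \<chi> i. w $ Abs_wo i)"
  define T :: "real^'m \<Rightarrow> real^'m wo" where "T = (\<lambda>v. \<chi> i. v $ Rep_wo i)"
  have ST [simp]: "S (T v) = v" "T (S w) = w" for v w
    by (simp_all add: S_def T_def vec_eq_iff Abs_wo_inverse Rep_wo_inverse)
  have linS: "linear S" and linT: "linear T"
    by (auto intro!: linearI simp: S_def T_def vec_eq_iff)
  have blS: "bounded_linear S" and blT: "bounded_linear T"
    using linS linT by (simp_all add: linear_conv_bounded_linear)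
  have mS: "S \<in> borel_measurable borel" and mT: "T \<in> borel_measurable borel"
    using linear_continuous_on[OF blS, of UNIV] linear_continuous_on[OF blT, of UNIV]
    by (auto intro: borel_measurable_continuous_onI)
  have S_axis: "S (axis i 1) = axis (Rep_wo i) 1" for i
    by (auto simp: S_def vec_eq_iff axis_def Abs_wo_inverse Rep_wo_inverse)
  have "bij_betw S Basis Basis"
  proof (rule bij_betw_byWitness[where f' = T])
    show "S ` Basis \<subseteq> Basis" by (auto simp: Basis_vec_def S_axis)
    have "T (axis i 1) = axis (Abs_wo i) 1" for i
      using S_axis[of "Abs_wo i"] by (metis Abs_wo_inverse ST(2) UNIV_I)
    then show "T ` Basis \<subseteq> Basis" by (auto simp: Basis_vec_def)
  qed auto
  then have dS: "distr lborel borel S = lborel" by (rule distr_lborel_basis_permuting[OF linS])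
  have inv_meas: "S -` B \<in> sets borel" if "B \<in> sets borel" for B
    using measurable_sets[OF mS that] by simp
  have inv_meas': "T -` B \<in> sets borel" if "B \<in> sets borel" for B
    using measurable_sets[OF mT that] by simp
  have "\<exists>Z\<in>sets borel. (\<lambda>w. T (\<phi> (S w))) ` (S -` A) \<subseteq> Z \<and>
    (\<integral>\<^sup>+y\<in>Z. ennreal (g (S y)) \<partial>lborel) \<le>
    (\<integral>\<^sup>+x\<in>S -` A. ennreal (\<bar>det (matrix (\<lambda>v. T (\<phi>' (S x) (S v))))\<bar> * g (S (T (\<phi> (S x))))) \<partial>lborel)"
  proof (rule area_inequality_wellorder)
    show "S -` A \<in> sets borel" by (rule inv_meas[OF A])
    show "((\<lambda>w. T (\<phi> (S w))) has_derivative (\<lambda>v. T (\<phi>' (S x) (S v)))) (at x within S -` A)"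
      if "x \<in> S -` A" for x
    proof -
      have 1: "(S has_derivative S) (at x within S -` A)" by (rule bounded_linear_imp_has_derivative[OF blS])
      have 2: "(\<phi> has_derivative \<phi>' (S x)) (at (S x) within S ` (S -` A))"
        by (rule has_derivative_subset[OF der]) (use that in auto)
      show ?thesis
        using bounded_linear.has_derivative[OF blT diff_chain_within[OF 1 2]] by (simp add: o_def)
    qed
    show "(\<lambda>y. g (S y)) \<in> borel_measurable borel" using measurable_compose[OF mS g(1)] .
  qed (use g in auto)
  then obtain Z where Z: "Z \<in> sets borel" "(\<lambda>w. T (\<phi> (S w))) ` (S -` A) \<subseteq> Z"
    "(\<integral>\<^sup>+y\<in>Z. ennreal (g (S y)) \<partial>lborel) \<le>
     (\<integral>\<^sup>+x\<in>S -` A. ennreal (\<bar>det (matrix (\<lambda>v. T (\<phi>' (S x) (S v))))\<bar> * g (\<phi> (S x))) \<partial>lborel)"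
    by auto
  have det_eq: "det (matrix (\<lambda>v. T (f (S v)))) = det (matrix f)" for f :: "real^'m \<Rightarrow> real^'m"
  proof -
    have "matrix (\<lambda>v. T (f (S v))) = (\<chi> i j. matrix f $ Rep_wo i $ Rep_wo j)"
      by (simp add: matrix_def vec_eq_iff S_axis T_def)
    then show ?thesis by (simp add: det_reindex[OF bij_Rep_wo])
  qed
  let ?F = "\<lambda>x. ennreal (\<bar>det (matrix (\<phi>' x))\<bar> * g (\<phi> x)) * indicator A x"
  have dT: "distr lborel borel T = lborel"
    using distr_distr[of T borel borel S lborel] mS mT by (simp add: dS comp_def distr_id2)
  have tr: "(\<integral>\<^sup>+x. F (S x) \<partial>lborel) = (\<integral>\<^sup>+x. F x \<partial>lborel)" for F :: "real^'m \<Rightarrow> ennreal"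
  proof -
    have "(\<integral>\<^sup>+x. F (S x) \<partial>lborel) \<le> (\<integral>\<^sup>+x. F x \<partial>lborel)"
      by (rule nn_integral_iso_le[OF mS mT]) (simp_all add: dS)
    moreover have "(\<integral>\<^sup>+x. F (S (T x)) \<partial>lborel) \<le> (\<integral>\<^sup>+x. F (S x) \<partial>lborel)"
      by (rule nn_integral_iso_le[OF mT mS, of "\<lambda>x. F (S x)"]) (simp_all add: dT)
    ultimately show ?thesis by simp
  qed
  show ?thesis
  proof (rule bexI[of _ "T -` Z"], rule conjI)
    show "T -` Z \<in> sets borel" by (rule inv_meas'[OF Z(1)])
    show "\<phi> ` A \<subseteq> T -` Z"
    proof safe
      fix x assume "x \<in> A"
      then have "T x \<in> S -` A" by simp
      then have "T (\<phi> (S (T x))) \<in> Z" using Z(2) by blast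
      then show "\<phi> x \<in> T -` Z" by simp
    qed
    have "(\<integral>\<^sup>+y\<in>T -` Z. ennreal (g y) \<partial>lborel) = (\<integral>\<^sup>+y\<in>Z. ennreal (g (S y)) \<partial>lborel)"
      by (subst tr[symmetric]) (simp add: indicator_def)
    also note Z(3)
    also have "(\<integral>\<^sup>+x\<in>S -` A. ennreal (\<bar>det (matrix (\<lambda>v. T (\<phi>' (S x) (S v))))\<bar> * g (\<phi> (S x))) \<partial>lborel) = (\<integral>\<^sup>+x. ?F x \<partial>lborel)"
      by (subst tr[symmetric]) (simp add: det_eq indicator_def)
    finally show "(\<integral>\<^sup>+y\<in>T -` Z. ennreal (g y) \<partial>lborel) \<le> (\<integral>\<^sup>+x. ?F x \<partial>lborel)" .
  qed
qed

section \<open>Local parametrisations\<close>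

lemma local_paramD:
  assumes "local_param M W X"
  shows "open W" "smooth_on W X" "u \<in> W \<Longrightarrow> inj (frechet_derivative X (at u))"
    "openin (top_of_set M) (X ` W)" "inj_on X W" "continuous_on W X" "X ` W \<subseteq> M"
    "u \<in> W \<Longrightarrow> (X has_derivative frechet_derivative X (at u)) (at u)"
    "u \<in> W \<Longrightarrow> linear (frechet_derivative X (at u))"
proof -
  show *: "open W" "smooth_on W X" "u \<in> W \<Longrightarrow> inj (frechet_derivative X (at u))"
    "openin (top_of_set M) (X ` W)" using assms by (auto simp: local_param_def)
  obtain Y where "homeomorphism W (X ` W) X Y" using assms by (auto simp: local_param_def)
  then show "inj_on X W" "continuous_on W X" by (auto simp: homeomorphism_def inj_on_def) metis
  show "X ` W \<subseteq> M" using openin_subset[OF *(4)] by simp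
  show "u \<in> W \<Longrightarrow> (X has_derivative frechet_derivative X (at u)) (at u)"
    using smooth_on_has_derivative[OF *(2)] .
  then show "u \<in> W \<Longrightarrow> linear (frechet_derivative X (at u))" using has_derivative_linear by blast
qed

lemma local_param_inv:
  assumes "local_param M W X"
  shows "continuous_on (X ` W) (inv_into W X)" "u \<in> W \<Longrightarrow> inv_into W X (X u) = u"
    "p \<in> X ` W \<Longrightarrow> inv_into W X p \<in> W" "p \<in> X ` W \<Longrightarrow> X (inv_into W X p) = p"
proof -
  note inj = local_paramD(5)[OF assms]
  obtain Y where Y: "homeomorphism W (X ` W) X Y" using assms by (auto simp: local_param_def)
  have "Y p = inv_into W X p" if "p \<in> X ` W" for p
    using that Y inj by (auto simp: homeomorphism_def)
  moreover have "continuous_on (X ` W) Y" using Y by (simp add: homeomorphism_def)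
  ultimately show "continuous_on (X ` W) (inv_into W X)" by (simp cong: continuous_on_cong)
qed (use local_paramD(5)[OF assms] in \<open>auto simp: inv_into_f_f intro: inv_into_into f_inv_into_f\<close>)

lemma local_param_empty: "local_param M {} X"
  by (simp add: local_param_def smooth_on_def homeomorphism_def)
     (metis Ck_on.simps Ck_on_local empty_iff)

lemma local_param_openin:
  assumes "local_param M W X" "open U"
  shows "\<exists>O'. open O' \<and> X ` (W \<inter> U) = M \<inter> O'"
proof -
  have "openin (top_of_set (X ` W)) (X ` W \<inter> inv_into W X -` U)"
    using local_param_inv(1)[OF assms(1)] assms(2) by (simp add: continuous_openin_preimage_gen)
  then have "openin (top_of_set M) (X ` W \<inter> inv_into W X -` U)"
    using local_paramD(4)[OF assms(1)] by (rule openin_trans)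
  moreover have "X ` W \<inter> inv_into W X -` U = X ` (W \<inter> U)"
    using local_param_inv[OF assms(1)] by auto
  ultimately show ?thesis by (metis openin_open)
qed

text \<open>The displacement of the lift \<open>\<psi>\<close> satisfies
  \<open>D (\<psi> z - u) = f' (z - x)\<close> up to two remainders, and a left inverse
  \<open>P\<close> of \<open>D\<close> solves for it. The remainder of \<open>X\<close> is measured
  by the displacement itself; as \<open>\<psi>\<close> is continuous, it can be absorbed into the
  left-hand side. That \<open>f'\<close> takes its values in the range of \<open>D\<close> comes
  afterwards, by uniqueness of derivatives.\<close>

lemma local_param_lift_has_derivative:
  fixes X :: "real^'k \<Rightarrow> 'a::euclidean_space" and f :: "'b::real_normed_vector \<Rightarrow> 'a"
  assumes lp: "local_param M W X" and S: "open S" "x \<in> S" "f ` S \<subseteq> X ` W"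
    and f: "(f has_derivative f') (at x)" and fc: "continuous_on S f"
  shows "\<exists>\<psi>'. ((\<lambda>z. inv_into W X (f z)) has_derivative \<psi>') (at x) \<and>
    (\<forall>v. f' v = frechet_derivative X (at (inv_into W X (f x))) (\<psi>' v))"
proof -
  define \<psi> where "\<psi> = (\<lambda>z. inv_into W X (f z))"
  have X\<psi>: "X (\<psi> z) = f z" "\<psi> z \<in> W" if "z \<in> S" for z
    using local_param_inv[OF lp] S(3) that by (auto simp: \<psi>_def)
  have \<psi>c: "continuous_on S \<psi>" unfolding \<psi>_def
    using continuous_on_compose2[OF local_param_inv(1)[OF lp] fc] S(3) by auto
  define u where "u = \<psi> x"
  have uW: "u \<in> W" using X\<psi> S by (simp add: u_def)
  define D where "D = frechet_derivative X (at u)"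
  have D: "(X has_derivative D) (at u)" "linear D" "inj D"
    using local_paramD[OF lp] uW by (simp_all add: D_def)
  obtain P where P: "linear P" "P \<circ> D = id" using linear_injective_left_inverse[OF D(2,3)] by blast
  then have PD: "P (D v) = v" for v by (metis comp_apply id_apply)
  have blP: "bounded_linear P" using P(1) by (simp add: linear_conv_bounded_linear)
  obtain C where C: "C > 0" "\<And>v. norm (P v) \<le> norm v * C" using bounded_linear.pos_bounded[OF blP] by blast
  have blf: "bounded_linear f'" using f by (rule has_derivative_bounded_linear)
  obtain F where F: "F > 0" "\<And>v. norm (f' v) \<le> norm v * F" using bounded_linear.pos_bounded[OF blf] by blast
  have Xerr: "\<forall>\<^sub>F z in nhds x. norm (f z - f x - D (\<psi> z - u)) \<le> e * norm (\<psi> z - u)" if "e > 0" for e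
  proof -
    obtain d where d: "d > 0" "\<And>y. norm (y - u) < d \<Longrightarrow> norm (X y - X u - D (y - u)) \<le> e * norm (y - u)"
      using D(1) \<open>e > 0\<close> unfolding has_derivative_at_alt by blast
    have "isCont \<psi> x" using \<psi>c S by (simp add: continuous_on_eq_continuous_at)
    then have "\<forall>\<^sub>F z in nhds x. dist (\<psi> z) u < d"
      using tendstoD[of \<psi> "\<psi> x" "nhds x" d] d(1) by (simp add: u_def isCont_def tendsto_nhds_iff)
    moreover have "\<forall>\<^sub>F z in nhds x. z \<in> S" using S by (simp add: eventually_nhds_in_open)
    ultimately show ?thesis
    proof eventually_elim
      case (elim z)
      then have "norm (X (\<psi> z) - X u - D (\<psi> z - u)) \<le> e * norm (\<psi> z - u)"
        by (intro d(2)) (simp only: dist_norm)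
      moreover have "X (\<psi> z) = f z" "X u = f x" using X\<psi>(1) elim(2) S(2) by (simp_all only: u_def)
      ultimately show ?case by (simp only:)
    qed
  qed
  have ferr: "\<forall>\<^sub>F z in nhds x. norm (f z - f x - f' (z - x)) \<le> e * norm (z - x)" if "e > 0" for e
  proof -
    have "\<exists>d>0. \<forall>y. norm (y - x) < d \<longrightarrow> norm (f y - f x - f' (y - x)) \<le> e * norm (y - x)"
      using f[unfolded has_derivative_at_alt, THEN conjunct2] \<open>e > 0\<close> by simp
    then show ?thesis by (simp only: eventually_nhds_metric dist_norm)
  qed
  have main: "(\<psi> has_derivative (\<lambda>v. P (f' v))) (at x)"
    unfolding has_derivative_at_alt
  proof (intro conjI allI impI)
    show "bounded_linear (\<lambda>v. P (f' v))" using bounded_linear_compose[OF blP blf] .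
    fix e :: real assume e: "e > 0"
    \<comment> \<open>A Lipschitz constant of \<open>\<psi>\<close> at \<open>x\<close>: the factor
      2 pays for absorbing the remainder of \<open>X\<close>, and \<open>F + 1\<close> bounds
      \<open>F + \<epsilon>2\<close>.\<close>
    define k where "k = 2 * C * (F + 1)"
    have k: "k > 0" using C F by (simp add: k_def)
    \<comment> \<open>The first entry makes the remainder of \<open>X\<close>, after applying
      \<open>P\<close>, at most half the displacement, so that it can be absorbed. The second keeps
      its share below \<open>e / 2\<close> once the displacement is replaced by
      \<open>k * norm (z - x)\<close>.\<close>
    define \<epsilon>1 where "\<epsilon>1 = min (1 / (2 * C)) (e / (2 * C * k))"
    define \<epsilon>2 where "\<epsilon>2 = min 1 (e / (2 * C))"
    have eps: "\<epsilon>1 > 0" "\<epsilon>2 > 0" using e C k by (simp_all add: \<epsilon>1_def \<epsilon>2_def)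
    have b1: "C * \<epsilon>1 \<le> 1 / 2" "C * \<epsilon>1 * k \<le> e / 2"
    proof -
      have "C * \<epsilon>1 \<le> C * (1 / (2 * C))" using C by (intro mult_left_mono) (auto simp: \<epsilon>1_def)
      then show "C * \<epsilon>1 \<le> 1 / 2" using C by simp
      have "C * \<epsilon>1 * k \<le> C * (e / (2 * C * k)) * k" using C k by (intro mult_left_mono mult_right_mono) (auto simp: \<epsilon>1_def)
      then show "C * \<epsilon>1 * k \<le> e / 2" using C k by simp
    qed
    have b2: "\<epsilon>2 \<le> 1" "C * \<epsilon>2 \<le> e / 2"
    proof -
      have "C * \<epsilon>2 \<le> C * (e / (2 * C))" using C by (intro mult_left_mono) (auto simp: \<epsilon>2_def)
      then show "C * \<epsilon>2 \<le> e / 2" using C by simp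
    qed (simp add: \<epsilon>2_def)
    have "\<forall>\<^sub>F z in nhds x. norm (\<psi> z - \<psi> x - P (f' (z - x))) \<le> e * norm (z - x)"
      using Xerr[OF eps(1)] ferr[OF eps(2)]
    proof eventually_elim
      case (elim z)
      define R1 where "R1 = f z - f x - D (\<psi> z - u)"
      define R2 where "R2 = f z - f x - f' (z - x)"
      have R1: "norm R1 \<le> \<epsilon>1 * norm (\<psi> z - u)" and R2: "norm R2 \<le> \<epsilon>2 * norm (z - x)"
        using elim by (simp_all add: R1_def R2_def)
      have "D (\<psi> z - u) = f' (z - x) + R2 - R1" by (simp add: R1_def R2_def)
      then have eq: "\<psi> z - u = P (f' (z - x)) + P R2 - P R1"
        by (metis PD P(1) linear_add linear_diff)
      have PR1: "norm (P R1) \<le> C * \<epsilon>1 * norm (\<psi> z - u)"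
        by (rule order_trans[OF C(2)], use mult_right_mono[OF R1 less_imp_le[OF C(1)]] in \<open>simp only: mult_ac\<close>)
      have PR2: "norm (P R2) \<le> C * \<epsilon>2 * norm (z - x)"
        by (rule order_trans[OF C(2)], use mult_right_mono[OF R2 less_imp_le[OF C(1)]] in \<open>simp only: mult_ac\<close>)
      have Pf: "norm (P (f' (z - x))) \<le> C * F * norm (z - x)"
        by (rule order_trans[OF C(2)], use mult_right_mono[OF F(2)[of "z - x"] less_imp_le[OF C(1)]] in \<open>simp only: mult_ac\<close>)
      have "norm (\<psi> z - u) \<le> norm (P (f' (z - x))) + norm (P R2) + norm (P R1)"
        unfolding eq by norm
      also have "\<dots> \<le> C * F * norm (z - x) + C * \<epsilon>2 * norm (z - x) + 1 / 2 * norm (\<psi> z - u)"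
        using Pf PR2 PR1 mult_right_mono[OF b1(1), of "norm (\<psi> z - u)"] by simp
      finally have "norm (\<psi> z - u) \<le> 2 * (C * F * norm (z - x) + C * \<epsilon>2 * norm (z - x))" by simp
      also have "\<dots> = 2 * C * (F + \<epsilon>2) * norm (z - x)" by (simp add: algebra_simps)
      also have "\<dots> \<le> k * norm (z - x)" unfolding k_def
        using b2 C by (intro mult_right_mono mult_left_mono) auto
      finally have nk: "norm (\<psi> z - u) \<le> k * norm (z - x)" .
      have "norm (\<psi> z - \<psi> x - P (f' (z - x))) = norm (P R2 - P R1)"
        using eq by (simp add: u_def)
      also have "\<dots> \<le> C * \<epsilon>2 * norm (z - x) + C * \<epsilon>1 * norm (\<psi> z - u)"
        using PR1 PR2 norm_triangle_ineq4[of "P R2" "P R1"] by simp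
      also have "\<dots> \<le> e / 2 * norm (z - x) + C * \<epsilon>1 * (k * norm (z - x))"
        using b2 nk C eps by (intro add_mono mult_right_mono mult_left_mono) auto
      also have "\<dots> \<le> e / 2 * norm (z - x) + e / 2 * norm (z - x)"
        using mult_right_mono[OF b1(2), of "norm (z - x)"] by (simp add: mult.assoc)
      finally show ?case by simp
    qed
    then show "\<exists>d>0. \<forall>y. norm (y - x) < d \<longrightarrow> norm (\<psi> y - \<psi> x - P (f' (y - x))) \<le> e * norm (y - x)"
      by (simp only: eventually_nhds_metric dist_norm)
  qed
  have "((\<lambda>z. X (\<psi> z)) has_derivative (\<lambda>v. D (P (f' v)))) (at x)"
    using diff_chain_at[OF main, of X D] D(1) by (simp add: u_def o_def)
  then have "(f has_derivative (\<lambda>v. D (P (f' v)))) (at x)"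
    by (rule has_derivative_transform_within_open[OF _ S(1,2)]) (simp add: X\<psi>)
  then have "f' = (\<lambda>v. D (P (f' v)))" using f by (rule has_derivative_unique[rotated])
  then have "f' v = D (P (f' v))" for v by metis
  with main show ?thesis unfolding \<psi>_def D_def u_def by blast
qed

section \<open>Curves and tangent spaces in a chart\<close>

lemma smooth_on_line:
  fixes X :: "'a::real_normed_vector \<Rightarrow> 'b::real_normed_vector"
  assumes "open W" "smooth_on W X" "u \<in> W"
  shows "\<exists>e>0. (\<forall>t\<in>{-e<..<e}. u + t *\<^sub>R a \<in> W) \<and> smooth_on {-e<..<e} (\<lambda>t. X (u + t *\<^sub>R a))"
proof -
  have bl: "bounded_linear (\<lambda>t::real. t *\<^sub>R a)" by (rule bounded_linear_scaleR_left)
  have "open ((\<lambda>t::real. u + t *\<^sub>R a) -` W)"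
    by (intro open_vimage assms(1) continuous_intros)
  moreover have "0 \<in> (\<lambda>t::real. u + t *\<^sub>R a) -` W" using assms(3) by simp
  ultimately obtain e where e: "e > 0" "ball 0 e \<subseteq> (\<lambda>t::real. u + t *\<^sub>R a) -` W"
    using open_contains_ball by blast
  then have sub: "{-e<..<e} \<subseteq> (\<lambda>t::real. u + t *\<^sub>R a) -` W" by (auto simp: dist_real_def subset_iff)
  have "smooth_on {-e<..<e} (\<lambda>t. X (u + t *\<^sub>R a))" unfolding smooth_on_def
  proof
    fix k
    have "Ck_on k ((\<lambda>t::real. u + t *\<^sub>R a) -` W) (\<lambda>t. X (u + t *\<^sub>R a))"
      using assms(2) by (intro Ck_on_compose_affine[OF assms(1) bl]) (simp add: smooth_on_def)
    then show "Ck_on k {-e<..<e} (\<lambda>t. X (u + t *\<^sub>R a))" by (rule Ck_on_subset[OF _ sub])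
  qed
  with e sub show ?thesis by (intro exI[of _ e]) auto
qed

text \<open>The patch is relatively open, so the curve stays in it for a short time, and there the
  chart inverse lifts it to a differentiable curve of parameters.\<close>

lemma curve_through_local_param:
  assumes "local_param M W X" "u \<in> W" "curve_through M (X u) v \<gamma>"
  shows "\<exists>\<delta> c a. \<delta> > 0 \<and> (\<forall>t. \<bar>t\<bar> < \<delta> \<longrightarrow> c t \<in> W \<and> X (c t) = \<gamma> t) \<and> c 0 = u \<and>
    (c has_vector_derivative a) (at 0) \<and> v = frechet_derivative X (at u) a"
proof -
  obtain e where e: "e > 0" "smooth_on {-e<..<e} \<gamma>" "\<gamma> ` {-e<..<e} \<subseteq> M" "\<gamma> 0 = X u"
    "(\<gamma> has_vector_derivative v) (at 0)"
    using assms(3) by (auto simp: curve_through_def)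
  obtain O' where O': "open O'" "X ` W = M \<inter> O'"
    using local_param_openin[OF assms(1), of UNIV] by auto
  define S where "S = {-e<..<e} \<inter> \<gamma> -` O'"
  have gc: "continuous_on {-e<..<e} \<gamma>" by (rule smooth_on_continuous[OF e(2)])
  have S: "open S" unfolding S_def
    by (rule continuous_open_preimage[OF gc _ O'(1)]) simp
  have S0: "0 \<in> S" using e(1,4) O'(2) assms(2) by (auto simp: S_def)
  have SX: "\<gamma> ` S \<subseteq> X ` W" using e(3) O' by (auto simp: S_def)
  have fd: "(\<gamma> has_derivative (\<lambda>h. h *\<^sub>R v)) (at 0)" using e(5) by (simp only: has_vector_derivative_def)
  have cS: "continuous_on S \<gamma>" by (rule continuous_on_subset[OF gc]) (simp add: S_def)
  obtain \<psi>' where p: "((\<lambda>z. inv_into W X (\<gamma> z)) has_derivative \<psi>') (at 0)"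
    "\<And>h. h *\<^sub>R v = frechet_derivative X (at (inv_into W X (\<gamma> 0))) (\<psi>' h)"
    using local_param_lift_has_derivative[OF assms(1) S S0 SX fd cS] by blast
  have lin: "linear \<psi>'" using p(1) by (rule has_derivative_linear)
  have \<psi>'_eq: "\<psi>' = (\<lambda>h. h *\<^sub>R \<psi>' 1)"
  proof
    fix h :: real
    show "\<psi>' h = h *\<^sub>R \<psi>' 1"
      using linear_scale[OF lin, of h 1] by (simp only: real_scaleR_def mult_1_right)
  qed
  have vd: "((\<lambda>z. inv_into W X (\<gamma> z)) has_vector_derivative \<psi>' 1) (at 0)"
    unfolding has_vector_derivative_def by (rule has_derivative_eq_rhs[OF p(1) \<psi>'_eq])
  obtain \<delta> where d: "\<delta> > 0" "ball 0 \<delta> \<subseteq> S" using S S0 open_contains_ball by blast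
  show ?thesis
  proof (intro exI[of _ \<delta>] exI[of _ "\<lambda>z. inv_into W X (\<gamma> z)"] exI[of _ "\<psi>' 1"] conjI allI impI)
    show "inv_into W X (\<gamma> t) \<in> W" "X (inv_into W X (\<gamma> t)) = \<gamma> t" if "\<bar>t\<bar> < \<delta>" for t
    proof -
      have "t \<in> S" using d that by (auto simp: dist_real_def subset_iff)
      then show "inv_into W X (\<gamma> t) \<in> W" "X (inv_into W X (\<gamma> t)) = \<gamma> t"
        using SX local_param_inv(3,4)[OF assms(1), of "\<gamma> t"] by auto
    qed
    show "inv_into W X (\<gamma> 0) = u" using e(4) local_param_inv(2)[OF assms(1,2)] by simp
    then show "v = frechet_derivative X (at u) (\<psi>' 1)" using p(2)[of 1] by simp
  qed (use vd d in auto)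
qed

lemma curve_through_line:
  assumes "local_param M W X" "u \<in> W"
  shows "curve_through M (X u) (frechet_derivative X (at u) a) (\<lambda>t. X (u + t *\<^sub>R a))"
proof -
  obtain e where e: "e > 0" "\<forall>t\<in>{-e<..<e}. u + t *\<^sub>R a \<in> W" "smooth_on {-e<..<e} (\<lambda>t. X (u + t *\<^sub>R a))"
    using smooth_on_line[OF local_paramD(1,2)[OF assms(1)] assms(2)] by blast
  have "((\<lambda>t::real. u + t *\<^sub>R a) has_derivative (\<lambda>t. t *\<^sub>R a)) (at 0)"
    by (auto intro!: derivative_eq_intros)
  from diff_chain_at[OF this, of X "frechet_derivative X (at u)"] local_paramD(8)[OF assms]
  have "((\<lambda>t. X (u + t *\<^sub>R a)) has_derivative (\<lambda>t. frechet_derivative X (at u) (t *\<^sub>R a))) (at 0)"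
    by (simp add: o_def)
  then have "((\<lambda>t. X (u + t *\<^sub>R a)) has_vector_derivative frechet_derivative X (at u) a) (at 0)"
    unfolding has_vector_derivative_def by (simp add: linear_scale[OF local_paramD(9)[OF assms]])
  then show ?thesis using e local_paramD(7)[OF assms(1)] unfolding curve_through_def by auto
qed

lemma tangent_space_local_param:
  assumes "local_param M W X" "u \<in> W"
  shows "tangent_space M (X u) = range (frechet_derivative X (at u))"
proof (intro set_eqI iffI)
  fix v assume "v \<in> tangent_space M (X u)"
  then obtain \<gamma> where "curve_through M (X u) v \<gamma>" by (auto simp: tangent_space_def)
  then show "v \<in> range (frechet_derivative X (at u))"
    using curve_through_local_param[OF assms] by blast
qed (use curve_through_line[OF assms] in \<open>auto simp: tangent_space_def\<close>)

section \<open>The Riemannian measure\<close>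

lemma innerK_bounded_bilinear: "bounded_bilinear (innerK K :: real \<times> 'e::euclidean_space \<Rightarrow> _)"
proof -
  have "bounded_linear (\<lambda>v :: real \<times> 'e. (K * fst v, snd v))"
    by (intro bounded_linear_Pair bounded_linear_const_mult bounded_linear_fst bounded_linear_snd)
  from bounded_bilinear.comp[OF bounded_bilinear_inner this bounded_linear_ident] show ?thesis
    by (simp add: innerK_def[abs_def] inner_prod_def mult.assoc)
qed

lemmas innerK_simps =
  bounded_bilinear.add_left[OF innerK_bounded_bilinear] bounded_bilinear.add_right[OF innerK_bounded_bilinear]
  bounded_bilinear.diff_left[OF innerK_bounded_bilinear] bounded_bilinear.diff_right[OF innerK_bounded_bilinear]
  bounded_bilinear.scaleR_left[OF innerK_bounded_bilinear] bounded_bilinear.scaleR_right[OF innerK_bounded_bilinear]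
  bounded_bilinear.minus_left[OF innerK_bounded_bilinear] bounded_bilinear.minus_right[OF innerK_bounded_bilinear]
  bounded_bilinear.zero_left[OF innerK_bounded_bilinear] bounded_bilinear.zero_right[OF innerK_bounded_bilinear]

lemmas innerK_sum = bounded_bilinear.sum_left[OF innerK_bounded_bilinear] bounded_bilinear.sum_right[OF innerK_bounded_bilinear]

lemma innerK_commute: "innerK K v w = innerK K w v"
  by (simp add: innerK_def inner_commute mult.commute)

definition vol_density :: "real \<Rightarrow> (real^'k \<Rightarrow> real \<times> 'e::euclidean_space) \<Rightarrow> real^'k \<Rightarrow> real" where
  "vol_density K X u = sqrt (det (gram_matrix K X u))"

text \<open>The Gram matrix changes by the congruence \<open>transpose P ** G ** P\<close>, where
  \<open>P\<close> is the matrix of \<open>\<psi>'\<close>.\<close>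

lemma vol_density_compose:
  fixes X :: "real^'k \<Rightarrow> real \<times> 'e::euclidean_space" and \<psi>' :: "real^'k \<Rightarrow> real^'k"
  assumes "linear (frechet_derivative X (at y))" "linear \<psi>'"
    "\<And>v. frechet_derivative f (at u) v = frechet_derivative X (at y) (\<psi>' v)"
  shows "vol_density K f u = \<bar>det (matrix \<psi>')\<bar> * vol_density K X y"
proof -
  let ?D = "frechet_derivative X (at y)" and ?P = "matrix \<psi>'"
  have D: "frechet_derivative f (at u) (axis i 1) = (\<Sum>k\<in>UNIV. (?P $ k $ i) *\<^sub>R ?D (axis k 1))" for i
  proof -
    have "\<psi>' (axis i 1) = (\<Sum>k\<in>UNIV. (?P $ k $ i) *\<^sub>R axis k 1)"
      by (subst basis_expansion[symmetric]) (simp add: matrix_def scalar_mult_eq_scaleR)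
    then show ?thesis by (simp add: assms(3) linear_sum[OF assms(1)] linear_scale[OF assms(1)])
  qed
  have "gram_matrix K f u = transpose ?P ** gram_matrix K X y ** ?P"
    by (simp add: vec_eq_iff gram_matrix_def matrix_matrix_mult_def transpose_def D innerK_simps innerK_sum
        sum_distrib_left sum_distrib_right mult_ac)
  then have "det (gram_matrix K f u) = (det ?P)\<^sup>2 * det (gram_matrix K X y)"
    by (simp add: det_mul det_transpose power2_eq_square)
  then show ?thesis by (simp add: vol_density_def real_sqrt_mult)
qed

lemma vol_density_continuous:
  fixes X :: "real^'k \<Rightarrow> real \<times> 'e::euclidean_space"
  assumes "open W" "smooth_on W X"
  shows "continuous_on W (vol_density K X)"
proof -
  have "Ck_on 0 W (\<lambda>u. det (gram_matrix K X u))"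
    using smooth_on_SucD[OF assms(2)] unfolding smooth_on_def
    by (intro Ck_on_det assms(1)) (simp add: gram_matrix_def Ck_on_bilinear[OF assms(1) innerK_bounded_bilinear] del: Ck_on.simps)
  then have "continuous_on W (\<lambda>u. det (gram_matrix K X u))" by simp
  then show ?thesis unfolding vol_density_def[abs_def] by (rule continuous_on_real_sqrt)
qed

text \<open>The indicator makes the density a Borel function on the whole coordinate space, although
  \<open>X\<close> is controlled on \<open>W\<close> only.\<close>

definition patch_measure ::
    "real \<Rightarrow> (real^'k) set \<Rightarrow> (real^'k \<Rightarrow> real \<times> 'e::euclidean_space) \<Rightarrow> (real^'k) measure" where
  "patch_measure K W X = density lborel (\<lambda>u. ennreal (vol_density K X u) * indicator W u)"

lemma sets_patch_measure [simp]: "sets (patch_measure K W X) = sets borel"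
  by (simp add: patch_measure_def)

lemma patch_density_measurable:
  assumes "open W" "smooth_on W X"
  shows "(\<lambda>u. ennreal (vol_density K X u) * indicator W u) \<in> borel_measurable borel"
proof -
  have "(\<lambda>u. indicator W u *\<^sub>R vol_density K X u) \<in> borel_measurable borel"
    by (rule borel_measurable_continuous_on_indicator[OF _ vol_density_continuous[OF assms]])
       (use assms(1) in simp)
  then have "(\<lambda>u. ennreal (indicator W u *\<^sub>R vol_density K X u)) \<in> borel_measurable borel" by simp
  moreover have "ennreal (indicator W u *\<^sub>R vol_density K X u) = ennreal (vol_density K X u) * indicator W u" for u
    by (simp split: split_indicator)
  ultimately show ?thesis by simp
qed

lemma emeasure_patch_measure:
  assumes "open W" "smooth_on W X" "B \<in> sets borel" "B \<subseteq> W"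
  shows "emeasure (patch_measure K W X) B = (\<integral>\<^sup>+u\<in>B. ennreal (vol_density K X u) \<partial>lborel)"
proof -
  have "emeasure (patch_measure K W X) B =
      (\<integral>\<^sup>+u. ennreal (vol_density K X u) * indicator W u * indicator B u \<partial>lborel)"
    unfolding patch_measure_def using patch_density_measurable[OF assms(1,2)] assms(3)
    by (subst emeasure_density) auto
  also have "\<dots> = (\<integral>\<^sup>+u\<in>B. ennreal (vol_density K X u) \<partial>lborel)"
    using assms(4) by (intro nn_integral_cong) (auto split: split_indicator)
  finally show ?thesis .
qed

lemma local_param_vimage_borel:
  assumes "local_param M W X" "B \<in> sets (restrict_space borel M)"
  shows "W \<inter> X -` B \<in> sets borel"
proof -
  obtain B0 where B0: "B = M \<inter> B0" "B0 \<in> sets borel" using assms(2) by (auto simp: sets_restrict_space)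
  have "X \<in> borel_measurable (restrict_space borel W)"
    by (rule borel_measurable_continuous_on_restrict[OF local_paramD(6)[OF assms(1)]])
  from measurable_sets[OF this B0(2)]
  have "X -` B0 \<inter> W \<in> sets (restrict_space borel W)" by (simp add: space_restrict_space)
  then have "X -` B0 \<inter> W \<in> sets borel"
    using local_paramD(1)[OF assms(1)] by (simp add: sets_restrict_space_iff)
  moreover have "W \<inter> X -` B = X -` B0 \<inter> W" using local_paramD(7)[OF assms(1)] B0(1) by auto
  ultimately show ?thesis by simp
qed

lemma local_param_image_borel:
  assumes "local_param M W X" "B \<in> sets borel" "B \<subseteq> W"
  shows "X ` B \<in> sets (restrict_space borel M)"
proof -
  obtain O' where O': "open O'" "X ` W = M \<inter> O'" using local_param_openin[OF assms(1), of UNIV] by auto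
  have "inv_into W X \<in> borel_measurable (restrict_space borel (X ` W))"
    by (rule borel_measurable_continuous_on_restrict[OF local_param_inv(1)[OF assms(1)]])
  from measurable_sets[OF this assms(2)]
  have "inv_into W X -` B \<inter> X ` W \<in> sets (restrict_space borel (X ` W))" by (simp add: space_restrict_space)
  moreover have "inv_into W X -` B \<inter> X ` W = X ` B"
    using local_param_inv[OF assms(1)] assms(3) by force
  ultimately obtain C where "X ` B = X ` W \<inter> C" "C \<in> sets borel" by (auto simp: sets_restrict_space)
  then have "X ` B = M \<inter> (O' \<inter> C)" "O' \<inter> C \<in> sets borel" using O' by auto
  then show ?thesis by (auto simp: sets_restrict_space)
qed

text \<open>In the coordinates of the patch, \<open>f\<close> becomes its lift
  \<open>\<psi>\<close>. The Euclidean inequality is applied to \<open>\<psi>\<close> with the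
  density of \<open>X\<close> as weight, and by the chain rule the Jacobian of \<open>\<psi>\<close>
  times this weight is the density of \<open>f\<close>.\<close>

lemma patch_area_inequality:
  fixes X f :: "real^'k \<Rightarrow> real \<times> 'e::euclidean_space"
  assumes lp: "local_param M W X" and V: "open V" "f ` V \<subseteq> X ` W"
    and f: "\<And>x. x \<in> V \<Longrightarrow> f differentiable (at x)" and A: "A \<in> sets borel" "A \<subseteq> V"
  shows "\<exists>Z\<in>sets borel. Z \<subseteq> W \<and> f ` A \<subseteq> X ` Z \<and>
    emeasure (patch_measure K W X) Z \<le> (\<integral>\<^sup>+x\<in>A. ennreal (vol_density K f x) \<partial>lborel)"
proof -
  define \<psi> where "\<psi> = (\<lambda>z. inv_into W X (f z))"
  have X\<psi>: "X (\<psi> z) = f z" "\<psi> z \<in> W" if "z \<in> V" for z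
    using local_param_inv[OF lp] V(2) that by (auto simp: \<psi>_def)
  have fc: "continuous_on V f"
    using f by (intro continuous_at_imp_continuous_on ballI differentiable_imp_continuous_within) auto
  have "\<exists>\<psi>'. (\<psi> has_derivative \<psi>') (at x) \<and>
      (\<forall>v. frechet_derivative f (at x) v = frechet_derivative X (at (\<psi> x)) (\<psi>' v))" if "x \<in> V" for x
    using local_param_lift_has_derivative[OF lp V(1) that V(2) _ fc] f[OF that]
    unfolding frechet_derivative_works \<psi>_def by metis
  then obtain \<psi>' where \<psi>': "\<And>x. x \<in> V \<Longrightarrow> (\<psi> has_derivative \<psi>' x) (at x)"
    "\<And>x v. x \<in> V \<Longrightarrow> frechet_derivative f (at x) v = frechet_derivative X (at (\<psi> x)) (\<psi>' x v)"
    by metis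
  \<comment> \<open>The form may be indefinite here, and \<open>sqrt\<close> of a negative number is
    negative, so the weight is cut off at 0. \<open>ennreal\<close> does not see the
    difference.\<close>
  define g where "g = (\<lambda>u. indicator W u *\<^sub>R max 0 (vol_density K X u))"
  have gm: "g \<in> borel_measurable borel" unfolding g_def
    by (rule borel_measurable_continuous_on_indicator)
       (use vol_density_continuous[OF local_paramD(1,2)[OF lp]] local_paramD(1)[OF lp] in \<open>auto intro!: continuous_intros\<close>)
  obtain Z where Z: "Z \<in> sets borel" "\<psi> ` A \<subseteq> Z"
    "(\<integral>\<^sup>+y\<in>Z. ennreal (g y) \<partial>lborel) \<le> (\<integral>\<^sup>+x\<in>A. ennreal (\<bar>det (matrix (\<psi>' x))\<bar> * g (\<psi> x)) \<partial>lborel)"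
    using area_inequality_euclidean[OF A(1), of \<psi> \<psi>' g] has_derivative_at_withinI[OF \<psi>'(1)] A(2) gm
    by (auto simp: g_def subset_iff)
  have "(\<integral>\<^sup>+x\<in>A. ennreal (\<bar>det (matrix (\<psi>' x))\<bar> * g (\<psi> x)) \<partial>lborel) =
      (\<integral>\<^sup>+x\<in>A. ennreal (vol_density K f x) \<partial>lborel)"
  proof (rule nn_integral_cong)
    fix x
    have "ennreal (\<bar>det (matrix (\<psi>' x))\<bar> * g (\<psi> x)) = ennreal (vol_density K f x)" if "x \<in> A"
    proof -
      have xV: "x \<in> V" using that A by auto
      have "vol_density K f x = \<bar>det (matrix (\<psi>' x))\<bar> * vol_density K X (\<psi> x)"
        by (rule vol_density_compose[OF local_paramD(9)[OF lp X\<psi>(2)[OF xV]] has_derivative_linear[OF \<psi>'(1)[OF xV]] \<psi>'(2)[OF xV]])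
      moreover have "ennreal (c * max 0 t) = ennreal (c * t)" if "c \<ge> 0" for c t :: real
        using that by (auto simp: max_def mult_nonneg_nonpos ennreal_neg)
      ultimately show ?thesis using X\<psi>(2)[OF xV] by (simp add: g_def)
    qed
    then show "ennreal (\<bar>det (matrix (\<psi>' x))\<bar> * g (\<psi> x)) * indicator A x = ennreal (vol_density K f x) * indicator A x"
      by (simp split: split_indicator)
  qed
  moreover have "emeasure (patch_measure K W X) (Z \<inter> W) = (\<integral>\<^sup>+y\<in>Z \<inter> W. ennreal (vol_density K X y) \<partial>lborel)"
    using Z(1) local_paramD(1,2)[OF lp] by (intro emeasure_patch_measure) auto
  moreover have "(\<integral>\<^sup>+y\<in>Z \<inter> W. ennreal (vol_density K X y) \<partial>lborel) \<le> (\<integral>\<^sup>+y\<in>Z. ennreal (g y) \<partial>lborel)"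
    by (intro nn_integral_mono) (auto simp: g_def ennreal_leI split: split_indicator)
  moreover have "f ` A \<subseteq> X ` (Z \<inter> W)"
  proof
    fix p assume "p \<in> f ` A"
    then obtain x where "x \<in> A" "p = f x" by blast
    then show "p \<in> X ` (Z \<inter> W)" using X\<psi>[of x] A(2) Z(2) by (intro image_eqI[of _ _ "\<psi> x"]) auto
  qed
  ultimately show ?thesis using Z local_paramD(1)[OF lp] by (intro bexI[of _ "Z \<inter> W"]) auto
qed

text \<open>The parametrisation \<open>X'\<close> is itself a map into the patch of
  \<open>X\<close>, so the area inequality compares the two measures. Exchanging the roles gives
  equality, that is, independence of the chart.\<close>

lemma patch_measure_agree_le:
  fixes X X' :: "real^'k \<Rightarrow> real \<times> 'e::euclidean_space"
  assumes "local_param M W X" "local_param M W' X'" "C \<in> sets (restrict_space borel M)"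
    "C \<subseteq> X ` W" "C \<subseteq> X' ` W'"
  shows "emeasure (patch_measure K W X) (W \<inter> X -` C) \<le> emeasure (patch_measure K W' X') (W' \<inter> X' -` C)"
proof -
  obtain O' where O': "open O'" "X ` W = M \<inter> O'" using local_param_openin[OF assms(1), of UNIV] by auto
  define V where "V = W' \<inter> X' -` O'"
  have V: "open V" unfolding V_def
    by (rule continuous_open_preimage[OF local_paramD(6,1)[OF assms(2)] O'(1)])
  have VX: "X' ` V \<subseteq> X ` W" using local_paramD(7)[OF assms(2)] O'(2) by (auto simp: V_def)
  have A: "W' \<inter> X' -` C \<in> sets borel" by (rule local_param_vimage_borel[OF assms(2,3)])
  have AV: "W' \<inter> X' -` C \<subseteq> V" using assms(4) O'(2) by (auto simp: V_def)
  have diff: "X' differentiable (at x)" if "x \<in> V" for x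
    using local_paramD(8)[OF assms(2), of x] that unfolding V_def differentiable_def by auto
  obtain Z where Z: "Z \<in> sets borel" "Z \<subseteq> W" "X' ` (W' \<inter> X' -` C) \<subseteq> X ` Z"
    "emeasure (patch_measure K W X) Z \<le> (\<integral>\<^sup>+x\<in>W' \<inter> X' -` C. ennreal (vol_density K X' x) \<partial>lborel)"
    using patch_area_inequality[OF assms(1) V VX diff A AV, where K = K] by auto
  \<comment> \<open>Injectivity of \<open>X\<close> turns the covering of points of \<open>M\<close>
    into a covering of parameters.\<close>
  have "W \<inter> X -` C \<subseteq> Z"
  proof
    fix u assume u: "u \<in> W \<inter> X -` C"
    then have "X u \<in> X' ` (W' \<inter> X' -` C)" using assms(5) by auto
    then obtain z where "z \<in> Z" "X u = X z" using Z(3) by auto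
    then show "u \<in> Z" using local_paramD(5)[OF assms(1)] u Z(2) by (auto dest: inj_onD)
  qed
  then have "emeasure (patch_measure K W X) (W \<inter> X -` C) \<le> emeasure (patch_measure K W X) Z"
    using Z(1) by (intro emeasure_mono) auto
  also note Z(4)
  also have "(\<integral>\<^sup>+x\<in>W' \<inter> X' -` C. ennreal (vol_density K X' x) \<partial>lborel) = emeasure (patch_measure K W' X') (W' \<inter> X' -` C)"
    using emeasure_patch_measure[OF local_paramD(1,2)[OF assms(2)] A] by simp
  finally show ?thesis .
qed

text \<open>Patches are relatively open, so Lindelof applies. The empty patch is added to make the
  countable family nonempty, so that the naturals enumerate it.\<close>

lemma smooth_submanifold_countable_atlas:
  fixes M :: "'a::euclidean_space set"
  assumes "smooth_submanifold TYPE('k::finite) M"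
  shows "\<exists>(W :: nat \<Rightarrow> (real^'k) set) X. (\<forall>i. local_param M (W i) (X i)) \<and> M = (\<Union>i. X i ` W i)"
proof -
  let ?F = "{X ` W | (W :: (real^'k) set) X. local_param M W X}"
  obtain F' where F': "F' \<subseteq> ?F" "countable F'" "\<Union>F' = \<Union>?F"
    by (rule Lindelof_openin[of ?F M]) (auto dest: local_paramD(4))
  have "\<Union>?F = M"
  proof
    show "\<Union>?F \<subseteq> M" using local_paramD(7) by blast
    show "M \<subseteq> \<Union>?F"
    proof
      fix p assume "p \<in> M"
      then obtain W :: "(real^'k) set" and X where WX: "local_param M W X" and p: "p \<in> X ` W"
        using assms unfolding smooth_submanifold_def by metis
      have "X ` W \<in> ?F" using WX by (intro CollectI exI[of _ W] exI[of _ X] conjI refl)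
      then show "p \<in> \<Union>?F" using p by (rule UnionI)
    qed
  qed
  then have un: "\<Union>(insert {} F') = M" by (simp only: Union_insert F'(3) Un_empty_left)
  have "\<exists>W X. A = X ` W \<and> local_param M (W :: (real^'k) set) X" if "A \<in> insert {} F'" for A
  proof (cases "A = {}")
    case True
    then show ?thesis using local_param_empty[of M "undefined :: real^'k \<Rightarrow> 'a"]
      by (intro exI[of _ "{}"] exI[of _ undefined] conjI) simp_all
  next
    case False
    then have "A \<in> ?F" using that F'(1) by blast
    then show ?thesis by blast
  qed
  then obtain W X where WX: "\<And>A. A \<in> insert {} F' \<Longrightarrow> A = X A ` W A \<and> local_param M (W A :: (real^'k) set) (X A)"
    by metis
  define e where "e = from_nat_into (insert {} F')"
  have r: "range e = insert {} F'" unfolding e_def using F'(2) by (intro range_from_nat_into) auto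
  show ?thesis
  proof (intro exI[of _ "\<lambda>i. W (e i)"] exI[of _ "\<lambda>i. X (e i)"] conjI allI)
    have eF: "e i \<in> insert {} F'" for i using r by blast
    show "local_param M (W (e i)) (X (e i))" for i using WX[OF eF] by (rule conjunct2)
    have "X (e i) ` W (e i) = e i" for i using WX[OF eF, THEN conjunct1] by (rule sym)
    then have "(\<Union>i. X (e i) ` W (e i)) = \<Union>(range e)" by (simp only:)
    then show "M = (\<Union>i. X (e i) ` W (e i))" using un by (simp only: r)
  qed
qed

text \<open>The patches of a countable atlas are made disjoint and each piece is measured in its own
  chart; \<open>patch_measure_agree_le\<close> in both directions shows that any other chart gives
  the same value.\<close>

lemma riemannian_measure_exists:
  fixes M :: "(real \<times> 'e::euclidean_space) set"
  assumes "smooth_submanifold TYPE('k::finite) M"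
  shows "\<exists>\<mu>. sets \<mu> = sets (restrict_space borel M) \<and>
        (\<forall>(W :: (real^'k) set) X B. local_param M W X \<and> B \<in> sets borel \<and> B \<subseteq> W \<longrightarrow>
           emeasure \<mu> (X ` B) = emeasure (patch_measure K W X) B)"
proof -
  obtain W :: "nat \<Rightarrow> (real^'k) set" and X where
    at: "\<And>i. local_param M (W i) (X i)" "M = (\<Union>i. X i ` W i)"
    using smooth_submanifold_countable_atlas[OF assms] by auto
  let ?S = "sets (restrict_space borel M)"
  define P where "P = disjointed (\<lambda>i. X i ` W i)"
  have XW: "range (\<lambda>i. X i ` W i) \<subseteq> ?S"
    using local_param_image_borel[OF at(1)] local_paramD(1)[OF at(1)] by auto
  have PS: "P i \<in> ?S" for i
    unfolding P_def using sets.range_disjointed_sets[OF XW] by auto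
  have Psub: "P i \<subseteq> X i ` W i" for i unfolding P_def by (rule disjointed_subset)
  have Pdisj: "disjoint_family P" unfolding P_def by (rule disjoint_family_disjointed)
  have PM: "(\<Union>i. P i) = M" unfolding P_def at(2) by (rule UN_disjointed_eq)
  define m where "m = (\<lambda>B. \<Sum>i. emeasure (patch_measure K (W i) (X i)) (W i \<inter> X i -` (B \<inter> P i)))"
  define \<mu> where "\<mu> = measure_of M ?S m"
  have pre: "W i \<inter> X i -` (B \<inter> P i) \<in> sets borel" if "B \<in> ?S" for i B
    using that PS by (intro local_param_vimage_borel[OF at(1)]) auto
  have S_sub: "?S \<subseteq> Pow M" using sets.sets_into_space[of _ "restrict_space borel M"] by (auto simp: space_restrict_space)
  have sa: "sigma_algebra M ?S" using sets.sigma_algebra_axioms[of "restrict_space borel M"] by (simp add: space_restrict_space)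
  have sets: "sets \<mu> = ?S" unfolding \<mu>_def using S_sub sigma_algebra.sigma_sets_eq[OF sa] by (simp add: sets_measure_of)
  have em: "emeasure \<mu> B = m B" if "B \<in> ?S" for B
  proof (rule emeasure_measure_of[OF \<mu>_def S_sub])
    show "B \<in> sets \<mu>" using sets that by simp
    show "positive (sets \<mu>) m" by (simp add: positive_def m_def)
    show "countably_additive (sets \<mu>) m" unfolding countably_additive_def sets
    proof (intro allI impI)
      fix A :: "nat \<Rightarrow> _" assume A: "range A \<subseteq> ?S" "disjoint_family A" "(\<Union>i. A i) \<in> ?S"
      have AS: "A n \<in> ?S" for n using A(1) by auto
      \<comment> \<open>Writing one of the two sums as an integral over the counting measure allows
        them to be exchanged.\<close>
      have "(\<Sum>n. m (A n)) = (\<integral>\<^sup>+n. (\<Sum>i. emeasure (patch_measure K (W i) (X i)) (W i \<inter> X i -` (A n \<inter> P i))) \<partial>count_space UNIV)"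
        by (simp add: nn_integral_count_space_nat m_def)
      also have "\<dots> = (\<Sum>i. \<integral>\<^sup>+n. emeasure (patch_measure K (W i) (X i)) (W i \<inter> X i -` (A n \<inter> P i)) \<partial>count_space UNIV)"
        by (intro nn_integral_suminf) simp
      also have "\<dots> = m (\<Union>i. A i)" unfolding m_def
      proof (intro suminf_cong)
        fix i
        have "(\<integral>\<^sup>+n. emeasure (patch_measure K (W i) (X i)) (W i \<inter> X i -` (A n \<inter> P i)) \<partial>count_space UNIV) =
          (\<Sum>n. emeasure (patch_measure K (W i) (X i)) (W i \<inter> X i -` (A n \<inter> P i)))"
          by (simp add: nn_integral_count_space_nat)
        also have "\<dots> = emeasure (patch_measure K (W i) (X i)) (\<Union>n. W i \<inter> X i -` (A n \<inter> P i))"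
        proof (intro suminf_emeasure)
          show "disjoint_family (\<lambda>n. W i \<inter> X i -` (A n \<inter> P i))"
            using A(2) unfolding disjoint_family_on_def by blast
        qed (use pre[OF AS] in auto)
        also have "(\<Union>n. W i \<inter> X i -` (A n \<inter> P i)) = W i \<inter> X i -` ((\<Union>n. A n) \<inter> P i)" by auto
        finally show "(\<integral>\<^sup>+n. emeasure (patch_measure K (W i) (X i)) (W i \<inter> X i -` (A n \<inter> P i)) \<partial>count_space UNIV) =
          emeasure (patch_measure K (W i) (X i)) (W i \<inter> X i -` ((\<Union>n. A n) \<inter> P i))" .
      qed
      finally show "(\<Sum>n. m (A n)) = m (\<Union>i. A i)" .
    qed
  qed
  have "emeasure \<mu> (X' ` B) = emeasure (patch_measure K W' X') B"
    if lp: "local_param M W' X'" and B: "B \<in> sets borel" "B \<subseteq> W'" for W' :: "(real^'k) set" and X' B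
  proof -
    have XB: "X' ` B \<in> ?S" by (rule local_param_image_borel[OF lp B])
    have C: "X' ` B \<inter> P i \<in> ?S" for i using XB PS by auto
    have "emeasure \<mu> (X' ` B) = (\<Sum>i. emeasure (patch_measure K (W i) (X i)) (W i \<inter> X i -` (X' ` B \<inter> P i)))"
      using em[OF XB] by (simp add: m_def)
    also have "\<dots> = (\<Sum>i. emeasure (patch_measure K W' X') (W' \<inter> X' -` (X' ` B \<inter> P i)))"
    proof (intro suminf_cong antisym)
      fix i
      have s: "X' ` B \<inter> P i \<subseteq> X i ` W i" "X' ` B \<inter> P i \<subseteq> X' ` W'" using Psub B(2) by auto
      show "emeasure (patch_measure K (W i) (X i)) (W i \<inter> X i -` (X' ` B \<inter> P i))
          \<le> emeasure (patch_measure K W' X') (W' \<inter> X' -` (X' ` B \<inter> P i))"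
        by (rule patch_measure_agree_le[OF at(1) lp C s])
      show "emeasure (patch_measure K W' X') (W' \<inter> X' -` (X' ` B \<inter> P i))
          \<le> emeasure (patch_measure K (W i) (X i)) (W i \<inter> X i -` (X' ` B \<inter> P i))"
        by (rule patch_measure_agree_le[OF lp at(1) C s(2,1)])
    qed
    also have "\<dots> = emeasure (patch_measure K W' X') (\<Union>i. W' \<inter> X' -` (X' ` B \<inter> P i))"
    proof (intro suminf_emeasure)
      show "disjoint_family (\<lambda>i. W' \<inter> X' -` (X' ` B \<inter> P i))"
        using Pdisj unfolding disjoint_family_on_def by blast
    qed (use local_param_vimage_borel[OF lp C] in auto)
    also have "(\<Union>i. W' \<inter> X' -` (X' ` B \<inter> P i)) = B"
    proof -
      have "(\<Union>i. W' \<inter> X' -` (X' ` B \<inter> P i)) = W' \<inter> X' -` (X' ` B \<inter> M)" unfolding PM[symmetric] by auto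
      also have "\<dots> = B"
        using local_paramD(7)[OF lp] B(2) inj_on_image_mem_iff[OF local_paramD(5)[OF lp] _ B(2)] by blast
      finally show ?thesis .
    qed
    finally show ?thesis .
  qed
  with sets show ?thesis by blast
qed

lemma riemannian_measure_unique:
  fixes M :: "(real \<times> 'e::euclidean_space) set"
  assumes "smooth_submanifold TYPE('k::finite) M"
    and "sets \<mu> = sets (restrict_space borel M)" "sets \<mu>' = sets (restrict_space borel M)"
    and "\<And>(W :: (real^'k) set) X B. local_param M W X \<Longrightarrow> B \<in> sets borel \<Longrightarrow> B \<subseteq> W \<Longrightarrow>
           emeasure \<mu> (X ` B) = emeasure \<mu>' (X ` B)"
  shows "\<mu> = \<mu>'"
proof (rule measure_eqI)
  obtain W :: "nat \<Rightarrow> (real^'k) set" and X where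
    at: "\<And>i. local_param M (W i) (X i)" "M = (\<Union>i. X i ` W i)"
    using smooth_submanifold_countable_atlas[OF assms(1)] by auto
  let ?S = "sets (restrict_space borel M)"
  define P where "P = disjointed (\<lambda>i. X i ` W i)"
  have XW: "range (\<lambda>i. X i ` W i) \<subseteq> ?S"
    using local_param_image_borel[OF at(1)] local_paramD(1)[OF at(1)] by auto
  have PS: "P i \<in> ?S" for i
    unfolding P_def using sets.range_disjointed_sets[OF XW] by auto
  have Psub: "P i \<subseteq> X i ` W i" for i unfolding P_def by (rule disjointed_subset)
  have PM: "(\<Union>i. P i) = M" unfolding P_def at(2) by (rule UN_disjointed_eq)
  fix B assume "B \<in> sets \<mu>"
  then have B: "B \<in> ?S" using assms(2) by simp
  have BM: "B \<subseteq> M" using sets.sets_into_space[OF B] by (simp add: space_restrict_space)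
  have eq: "emeasure \<mu> (B \<inter> P i) = emeasure \<mu>' (B \<inter> P i)" for i
  proof -
    have "X i ` (W i \<inter> X i -` (B \<inter> P i)) = B \<inter> P i" using Psub[of i] by blast
    moreover have "W i \<inter> X i -` (B \<inter> P i) \<in> sets borel"
      using B PS by (intro local_param_vimage_borel[OF at(1)]) auto
    ultimately show ?thesis using assms(4)[OF at(1), of "W i \<inter> X i -` (B \<inter> P i)" i] by simp
  qed
  have sm: "emeasure m B = (\<Sum>i. emeasure m (B \<inter> P i))" if "sets m = ?S" for m :: "(real \<times> 'e) measure"
  proof -
    have "(\<Sum>i. emeasure m (B \<inter> P i)) = emeasure m (\<Union>i. B \<inter> P i)"
    proof (intro suminf_emeasure)
      show "disjoint_family (\<lambda>i. B \<inter> P i)"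
        using disjoint_family_disjointed[of "\<lambda>i. X i ` W i"] unfolding P_def disjoint_family_on_def by blast
    qed (use B PS that in auto)
    also have "(\<Union>i. B \<inter> P i) = B" using PM BM by auto
    finally show ?thesis by simp
  qed
  show "emeasure \<mu> B = emeasure \<mu>' B" by (simp add: sm assms eq)
qed (simp add: assms)

text \<open>Existence and uniqueness make the description in the definition denote. The two facts
  proved here are the only access to the measure from now on.\<close>

lemma riemannian_measure:
  fixes M :: "(real \<times> 'e::euclidean_space) set"
  assumes "smooth_submanifold TYPE('k::finite) M"
  shows sets_riemannian_measure: "sets (riemannian_measure TYPE('k) K M) = sets (restrict_space borel M)"
    and emeasure_riemannian_measure: "\<And>(W :: (real^'k) set) X B. local_param M W X \<Longrightarrow> B \<in> sets borel \<Longrightarrow> B \<subseteq> W \<Longrightarrow>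
      emeasure (riemannian_measure TYPE('k) K M) (X ` B) = emeasure (patch_measure K W X) B"
proof -
  let ?P = "\<lambda>\<mu>. sets \<mu> = sets (restrict_space borel M) \<and>
        (\<forall>(W :: (real^'k) set) X B. local_param M W X \<and> B \<in> sets borel \<and> B \<subseteq> W \<longrightarrow>
           emeasure \<mu> (X ` B) = (\<integral>\<^sup>+u\<in>B. ennreal (sqrt (det (gram_matrix K X u))) \<partial>lborel))"
  have pm: "emeasure (patch_measure K W X) B = (\<integral>\<^sup>+u\<in>B. ennreal (sqrt (det (gram_matrix K X u))) \<partial>lborel)"
    if "local_param M W X" "B \<in> sets borel" "B \<subseteq> W" for W :: "(real^'k) set" and X B
    using emeasure_patch_measure[OF local_paramD(1,2)[OF that(1)] that(2,3)] by (simp add: vol_density_def)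
  obtain \<mu> where "?P \<mu>" using riemannian_measure_exists[OF assms, of K] pm by auto
  then have "?P (riemannian_measure TYPE('k) K M)"
    unfolding riemannian_measure_def
  proof (rule theI)
    fix \<mu>' assume "?P \<mu>'"
    show "\<mu>' = \<mu>"
      by (rule riemannian_measure_unique[OF assms]) (use \<open>?P \<mu>\<close> \<open>?P \<mu>'\<close> in simp_all)
  qed
  then show "sets (riemannian_measure TYPE('k) K M) = sets (restrict_space borel M)"
    "\<And>(W :: (real^'k) set) X B. local_param M W X \<Longrightarrow> B \<in> sets borel \<Longrightarrow> B \<subseteq> W \<Longrightarrow>
      emeasure (riemannian_measure TYPE('k) K M) (X ` B) = emeasure (patch_measure K W X) B"
    using pm by auto
qed

text \<open>The image under \<open>X\<close> of the patch density on \<open>B\<close> is the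
  Riemannian measure restricted to the image of \<open>B\<close>, because both agree on measurable
  sets. Integrating \<open>F\<close> against these two measures gives the two sides.\<close>

lemma nn_integral_riemannian_measure:
  fixes M :: "(real \<times> 'e::euclidean_space) set" and X :: "real^'k \<Rightarrow> real \<times> 'e"
  assumes sm: "smooth_submanifold TYPE('k::finite) M" and lp: "local_param M W X"
    and B: "B \<in> sets borel" "B \<subseteq> W" and F: "F \<in> borel_measurable (restrict_space borel M)"
  shows "(\<integral>\<^sup>+x\<in>X ` B. F x \<partial>riemannian_measure TYPE('k) K M) =
    (\<integral>\<^sup>+u\<in>B. F (X u) * ennreal (vol_density K X u) \<partial>lborel)"
proof -
  let ?\<mu> = "riemannian_measure TYPE('k) K M" and ?R = "restrict_space borel M"
  let ?J = "\<lambda>u. ennreal (vol_density K X u) * indicator W u"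
  have Jm: "?J \<in> borel_measurable borel" by (rule patch_density_measurable[OF local_paramD(1,2)[OF lp]])
  define N where "N = density (restrict_space lborel B) ?J"
  have XB: "X ` B \<in> sets ?R" by (rule local_param_image_borel[OF lp B])
  have s\<mu>: "sets ?\<mu> = sets ?R" by (rule sets_riemannian_measure[OF sm])
  have X_R: "X \<in> restrict_space lborel B \<rightarrow>\<^sub>M ?R"
  proof (rule measurable_restrict_space2)
    show "X \<in> space (restrict_space lborel B) \<rightarrow> M" using local_paramD(7)[OF lp] B by (auto simp: space_restrict_space)
    have "X \<in> borel_measurable (restrict_space borel B)"
      by (rule borel_measurable_continuous_on_restrict[OF continuous_on_subset[OF local_paramD(6)[OF lp] B(2)]])
    then show "X \<in> borel_measurable (restrict_space lborel B)"
      by (simp add: measurable_def space_restrict_space sets_restrict_space)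
  qed
  have X_meas: "X \<in> N \<rightarrow>\<^sub>M ?R" using X_R by (simp add: measurable_def N_def)
  have Jm': "?J \<in> borel_measurable (restrict_space lborel B)"
    using Jm by (intro measurable_restrict_space1) simp
  have "distr N ?R X = density ?\<mu> (indicator (X ` B))"
  proof (rule measure_eqI)
    show "sets (distr N ?R X) = sets (density ?\<mu> (indicator (X ` B)))" by (simp add: s\<mu>)
    fix C assume "C \<in> sets (distr N ?R X)"
    then have C: "C \<in> sets ?R" by simp
    have pre: "W \<inter> X -` C \<in> sets borel" by (rule local_param_vimage_borel[OF lp C])
    then have BC: "B \<inter> X -` C \<in> sets borel"
      using sets.Int[OF B(1) pre] B(2) by (simp add: Int_absorb2 Int_assoc[symmetric])
    have "emeasure (distr N ?R X) C = emeasure N (X -` C \<inter> B)"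
      by (subst emeasure_distr[OF X_meas C]) (simp add: N_def space_restrict_space)
    also have "\<dots> = (\<integral>\<^sup>+u. ?J u * indicator (X -` C \<inter> B) u \<partial>restrict_space lborel B)"
      unfolding N_def using BC B(1)
      by (intro emeasure_density[OF Jm']) (auto simp: sets_restrict_space_iff Int_commute)
    also have "\<dots> = (\<integral>\<^sup>+u. ?J u * indicator (X -` C \<inter> B) u * indicator B u \<partial>lborel)"
      using B by (intro nn_integral_restrict_space) simp
    also have "\<dots> = (\<integral>\<^sup>+u\<in>B \<inter> X -` C. ennreal (vol_density K X u) \<partial>lborel)"
      using B by (intro nn_integral_cong) (auto split: split_indicator)
    also have "\<dots> = emeasure (patch_measure K W X) (B \<inter> X -` C)"
      using B BC by (intro emeasure_patch_measure[OF local_paramD(1,2)[OF lp], symmetric]) auto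
    also have "\<dots> = emeasure ?\<mu> (X ` (B \<inter> X -` C))"
      using B BC by (intro emeasure_riemannian_measure[OF sm lp, symmetric]) auto
    also have "X ` (B \<inter> X -` C) = X ` B \<inter> C" by auto
    also have "emeasure ?\<mu> (X ` B \<inter> C) = emeasure (density ?\<mu> (indicator (X ` B))) C"
      using C XB s\<mu> by (subst emeasure_density) (auto simp: nn_integral_indicator simp flip: indicator_inter_arith)
    finally show "emeasure (distr N ?R X) C = emeasure (density ?\<mu> (indicator (X ` B))) C" .
  qed
  then have "(\<integral>\<^sup>+x. F x \<partial>distr N ?R X) = (\<integral>\<^sup>+x. F x \<partial>density ?\<mu> (indicator (X ` B)))" by simp
  moreover have "F \<in> borel_measurable ?\<mu>" using F measurable_cong_sets[OF s\<mu> refl] by blast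
  then have "(\<integral>\<^sup>+x. F x \<partial>density ?\<mu> (indicator (X ` B))) = (\<integral>\<^sup>+x\<in>X ` B. F x \<partial>?\<mu>)"
    using XB s\<mu> by (subst nn_integral_density) (auto simp: mult.commute)
  moreover have "(\<integral>\<^sup>+x. F x \<partial>distr N ?R X) = (\<integral>\<^sup>+u\<in>B. F (X u) * ennreal (vol_density K X u) \<partial>lborel)"
  proof -
    have "(\<integral>\<^sup>+x. F x \<partial>distr N ?R X) = (\<integral>\<^sup>+u. F (X u) \<partial>N)" by (rule nn_integral_distr[OF X_meas]) (use F in simp)
    also have "\<dots> = (\<integral>\<^sup>+u. ?J u * F (X u) \<partial>restrict_space lborel B)"
      unfolding N_def by (rule nn_integral_density[OF Jm' measurable_compose[OF X_R F]])
    also have "\<dots> = (\<integral>\<^sup>+u. ?J u * F (X u) * indicator B u \<partial>lborel)"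
      using B by (intro nn_integral_restrict_space) simp
    also have "\<dots> = (\<integral>\<^sup>+u\<in>B. F (X u) * ennreal (vol_density K X u) \<partial>lborel)"
      using B by (intro nn_integral_cong) (auto simp: mult_ac split: split_indicator)
    finally show ?thesis .
  qed
  ultimately show ?thesis by simp
qed

text \<open>\<open>A\<close> is cut into disjoint Borel pieces, each mapped into a single patch.
  Disjointness makes the right-hand integrals add up to the integral over \<open>A\<close>, while on
  the left countable subadditivity suffices.\<close>

lemma riemannian_area_inequality:
  fixes S :: "(real \<times> 'e::euclidean_space) set" and f :: "real^'k \<Rightarrow> real \<times> 'e"
  assumes sm: "smooth_submanifold TYPE('k::finite) S" and V: "open V" "f ` V \<subseteq> S"
    and f: "smooth_on V f" and A: "A \<in> sets borel" "A \<subseteq> V"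
  shows "\<exists>Z\<in>sets (restrict_space borel S). f ` A \<subseteq> Z \<and>
    emeasure (riemannian_measure TYPE('k) K S) Z \<le> (\<integral>\<^sup>+x\<in>A. ennreal (vol_density K f x) \<partial>lborel)"
proof -
  obtain W :: "nat \<Rightarrow> (real^'k) set" and X where
    at: "\<And>i. local_param S (W i) (X i)" "S = (\<Union>i. X i ` W i)"
    using smooth_submanifold_countable_atlas[OF sm] by auto
  define O' where "O' = (\<lambda>i. SOME U. open U \<and> X i ` (W i \<inter> UNIV) = S \<inter> U)"
  have O'': "open (O' i) \<and> X i ` (W i \<inter> UNIV) = S \<inter> O' i" for i
    unfolding O'_def by (rule someI_ex[OF local_param_openin[OF at(1) open_UNIV]])
  have O': "open (O' i)" "X i ` W i = S \<inter> O' i" for i using O''[of i] by simp_all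
  have fc: "continuous_on V f" by (rule smooth_on_continuous[OF f])
  define V' where "V' = (\<lambda>i. V \<inter> f -` O' i)"
  have V': "open (V' i)" for i unfolding V'_def by (rule continuous_open_preimage[OF fc V(1) O'(1)])
  have V'X: "f ` V' i \<subseteq> X i ` W i" for i using V(2) O'(2) by (auto simp: V'_def)
  have VV': "V = (\<Union>i. V' i)"
  proof -
    have "x \<in> (\<Union>i. V' i)" if "x \<in> V" for x
    proof -
      have "f x \<in> (\<Union>i. X i ` W i)" using that V(2) at(2) by blast
      then show ?thesis using O'(2) that by (auto simp: V'_def)
    qed
    then show ?thesis by (auto simp: V'_def)
  qed
  define A' where "A' = (\<lambda>i. A \<inter> disjointed V' i)"
  have dV: "disjointed V' i \<in> sets borel" for i
    using sets.range_disjointed_sets[of V' borel] V' by (auto simp: image_subset_iff)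
  have A': "A' i \<in> sets borel" "A' i \<subseteq> V' i" for i
    using A(1) dV disjointed_subset[of V' i] by (auto simp: A'_def)
  define Q where "Q = (\<lambda>i Z. Z \<in> sets borel \<and> Z \<subseteq> W i \<and> f ` A' i \<subseteq> X i ` Z \<and>
    emeasure (patch_measure K (W i) (X i)) Z \<le> (\<integral>\<^sup>+x\<in>A' i. ennreal (vol_density K f x) \<partial>lborel))"
  have fd: "f differentiable (at x)" if "x \<in> V' i" for x i
    using smooth_on_has_derivative[OF f, of x] that unfolding differentiable_def V'_def by blast
  have "\<exists>Z. Q i Z" for i
    using patch_area_inequality[OF at(1) V' V'X fd A'] unfolding Q_def Bex_def .
  then have Q: "Q i (SOME Z. Q i Z)" for i by (rule someI_ex)
  define Z where "Z = (\<lambda>i. SOME Z. Q i Z)"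
  have Z: "Z i \<in> sets borel" "Z i \<subseteq> W i" "f ` A' i \<subseteq> X i ` Z i"
    "emeasure (patch_measure K (W i) (X i)) (Z i) \<le> (\<integral>\<^sup>+x\<in>A' i. ennreal (vol_density K f x) \<partial>lborel)" for i
    using Q[of i] unfolding Q_def Z_def by simp_all
  let ?\<mu> = "riemannian_measure TYPE('k) K S"
  have XZ: "X i ` Z i \<in> sets (restrict_space borel S)" for i by (rule local_param_image_borel[OF at(1) Z(1,2)])
  have AA': "A = (\<Union>i. A' i)" using A(2) VV' UN_disjointed_eq[of V'] by (auto simp: A'_def)
  have "emeasure ?\<mu> (\<Union>i. X i ` Z i) \<le> (\<Sum>i. emeasure ?\<mu> (X i ` Z i))"
    using XZ sets_riemannian_measure[OF sm, of K] by (intro emeasure_subadditive_countably) auto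
  also have "\<dots> \<le> (\<Sum>i. \<integral>\<^sup>+x\<in>A' i. ennreal (vol_density K f x) \<partial>lborel)"
    using Z emeasure_riemannian_measure[OF sm at(1) Z(1,2)] by (intro suminf_le) auto
  also have "\<dots> \<le> (\<integral>\<^sup>+x\<in>A. ennreal (vol_density K f x) \<partial>lborel)"
  proof -
    have "(\<Sum>i. \<integral>\<^sup>+x\<in>A' i. ennreal (vol_density K f x) \<partial>lborel) = (\<Sum>i. emeasure (patch_measure K V f) (A' i))"
      using A' VV' by (intro suminf_cong emeasure_patch_measure[OF V(1) f, symmetric]) auto
    also have "\<dots> = emeasure (patch_measure K V f) (\<Union>i. A' i)"
    proof (intro suminf_emeasure)
      show "disjoint_family A'"
        using disjoint_family_disjointed[of V'] unfolding A'_def disjoint_family_on_def by blast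
    qed (use A'(1) in auto)
    also have "\<dots> = (\<integral>\<^sup>+x\<in>A. ennreal (vol_density K f x) \<partial>lborel)"
      using A by (simp add: AA'[symmetric] emeasure_patch_measure[OF V(1) f])
    finally show ?thesis by simp
  qed
  finally have "emeasure ?\<mu> (\<Union>i. X i ` Z i) \<le> (\<integral>\<^sup>+x\<in>A. ennreal (vol_density K f x) \<partial>lborel)" .
  moreover have "f ` A \<subseteq> (\<Union>i. X i ` Z i)" unfolding AA' image_UN using Z(3) by blast
  moreover have "(\<Union>i. X i ` Z i) \<in> sets (restrict_space borel S)" using XZ by blast
  ultimately show ?thesis by blast
qed

section \<open>Geometry of the space forms\<close>

lemma cK_sK_simps [simp]:
  "cK K 0 = 1" "sK K 0 = 0" "cK K (- t) = cK K t" "sK K (- t) = - sK K t"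
  by (simp_all add: cK_def sK_def)

lemma cK_sK_squared: "K \<in> {-1,0,1} \<Longrightarrow> (cK K t)\<^sup>2 + K * (sK K t)\<^sup>2 = 1"
  by (auto simp: cK_def sK_def cosh_square_eq)

lemma sK_diff: "K \<in> {-1,0,1} \<Longrightarrow> sK K (s - t) = sK K s * cK K t - cK K s * sK K t"
  by (auto simp: cK_def sK_def sin_diff sinh_diff)

lemma cK_diff: "K \<in> {-1,0,1} \<Longrightarrow> cK K (s - t) = cK K s * cK K t + K * (sK K s * sK K t)"
  by (auto simp: cK_def sK_def cos_diff cosh_diff)

lemma sK_pos: "K \<in> {-1,0,1} \<Longrightarrow> 0 < t \<Longrightarrow> (K = 1 \<longrightarrow> t < pi) \<Longrightarrow> 0 < sK K t"
  by (auto simp: sK_def sin_gt_zero)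

text \<open>The form polar to the defining equation of the space form; its kernel at p is the tangent space.\<close>

definition polarK :: "real \<Rightarrow> real \<times> 'e::euclidean_space \<Rightarrow> real \<times> 'e \<Rightarrow> real" where
  "polarK K v w = fst v * fst w + K * (snd v \<bullet> snd w)"

lemma polarK_inner: "polarK K v w = (fst v, K *\<^sub>R snd v) \<bullet> w"
  by (simp add: polarK_def inner_prod_def)

lemma polarK_bounded_bilinear: "bounded_bilinear (polarK K :: real \<times> 'e::euclidean_space \<Rightarrow> _)"
proof -
  have "bounded_linear (\<lambda>v :: real \<times> 'e. (fst v, K *\<^sub>R snd v))"
    by (intro bounded_linear_Pair bounded_linear_compose[OF bounded_linear_scaleR_right] bounded_linear_fst bounded_linear_snd)
  from bounded_bilinear.comp[OF bounded_bilinear_inner this bounded_linear_ident] show ?thesis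
    by (simp add: polarK_inner[abs_def])
qed

lemmas polarK_simps =
  bounded_bilinear.add_left[OF polarK_bounded_bilinear] bounded_bilinear.add_right[OF polarK_bounded_bilinear]
  bounded_bilinear.diff_left[OF polarK_bounded_bilinear] bounded_bilinear.diff_right[OF polarK_bounded_bilinear]
  bounded_bilinear.scaleR_left[OF polarK_bounded_bilinear] bounded_bilinear.scaleR_right[OF polarK_bounded_bilinear]
  bounded_bilinear.minus_left[OF polarK_bounded_bilinear] bounded_bilinear.minus_right[OF polarK_bounded_bilinear]
  bounded_bilinear.zero_left[OF polarK_bounded_bilinear] bounded_bilinear.zero_right[OF polarK_bounded_bilinear]

lemma polarK_commute: "polarK K v w = polarK K w v"
  by (simp add: polarK_def inner_commute mult.commute)

lemma innerK_polarK: "K \<in> {-1,1} \<Longrightarrow> innerK K v w = K * polarK K v w"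
  by (auto simp: innerK_def polarK_def)

lemma polarK_eq: "K \<in> {-1,1} \<Longrightarrow> polarK K v w = K * innerK K v w"
  by (auto simp: innerK_def polarK_def)

lemma space_form_iff: "p \<in> space_form K \<longleftrightarrow> polarK K p p = 1 \<and> (K \<le> 0 \<longrightarrow> 0 < fst p)"
  by (simp add: space_form_def polarK_def power2_eq_square)

lemma space_form_polar: "p \<in> space_form K \<Longrightarrow> polarK K p p = 1"
  by (simp add: space_form_iff)

lemma space_form_0_fst: "p \<in> space_form 0 \<Longrightarrow> fst p = 1"
  by (auto simp: space_form_def power2_eq_1_iff)

text \<open>For K = 0 the first component of a tangent vector vanishes.\<close>

lemma polarK_tangent:
  assumes "K \<in> {-1,0,1}" "p \<in> space_form K" "polarK K p v = 0"
  shows "polarK K v w = K * innerK K v w" "polarK K w v = K * innerK K w v"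
proof -
  show *: "polarK K v w = K * innerK K v w"
  proof (cases "K = 0")
    case True
    then show ?thesis using assms space_form_0_fst[of p] by (simp add: polarK_def)
  next
    case False
    then have "K \<in> {-1,1}" using assms(1) by blast
    then show ?thesis by (rule polarK_eq)
  qed
  then show "polarK K w v = K * innerK K w v" by (simp add: polarK_commute innerK_commute)
qed

text \<open>For \<open>K = 0\<close> the position vector is not orthogonal to tangent vectors; the
  factor \<open>K\<close> makes the statements uniform. Position vectors enter the velocities of
  geodesics with just such a factor.\<close>

lemma innerK_position:
  assumes "K \<in> {-1,0,1}" "p \<in> space_form K" "polarK K p v = 0"
  shows "K * innerK K p v = 0" "K * innerK K v p = 0" "K * innerK K p p = K * K"
  using assms by (auto simp: innerK_polarK polarK_commute space_form_polar)

text \<open>For \<open>K = -1\<close>, tangency makes \<open>fst p * fst v\<close> equal to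
  \<open>snd p \<bullet> snd v\<close>. Cauchy-Schwarz, together with the equation of the
  hyperboloid, then bounds the Euclidean norm by the Lorentz form. The constant covers all three
  curvatures.\<close>

lemma innerK_tangent_norm:
  assumes K: "K \<in> {-1,0,1}" and p: "p \<in> space_form K" and v: "polarK K p v = 0"
  shows "(norm v)\<^sup>2 \<le> 2 * (1 + (fst p)\<^sup>2) * innerK K v v"
proof -
  have nv: "(norm v)\<^sup>2 = (fst v)\<^sup>2 + snd v \<bullet> snd v"
    by (simp add: norm_prod_def power2_norm_eq_inner real_sqrt_pow2 flip: power2_norm_eq_inner)
  have sv: "snd v \<bullet> snd v \<ge> 0" by simp
  consider "K = 0" | "K = 1" | "K = -1" using K by auto
  then show ?thesis
  proof cases
    case 1
    have "fst p = 1" using space_form_0_fst p 1 by blast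
    then have "fst v = 0" using v 1 by (simp add: polarK_def)
    then show ?thesis using 1 sv mult_right_mono[of 1 "2 * (1 + (fst p)\<^sup>2)" "snd v \<bullet> snd v"]
      by (simp add: nv innerK_def)
  next
    case 2
    then have i: "innerK K v v = (norm v)\<^sup>2" unfolding nv by (simp add: innerK_def power2_eq_square)
    show ?thesis unfolding i using mult_right_mono[of 1 "2 * (1 + (fst p)\<^sup>2)" "(norm v)\<^sup>2"] by simp
  next
    case 3
    have pp: "(fst p)\<^sup>2 = 1 + snd p \<bullet> snd p" using p 3 by (simp add: space_form_def)
    have "fst p * fst v = snd p \<bullet> snd v" using v 3 by (simp add: polarK_def)
    then have "(fst p)\<^sup>2 * (fst v)\<^sup>2 \<le> (snd p \<bullet> snd p) * (snd v \<bullet> snd v)"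
      using Cauchy_Schwarz_ineq[of "snd p" "snd v"] by (metis power_mult_distrib)
    then have "(1 + snd p \<bullet> snd p) * (fst v)\<^sup>2 \<le> (snd p \<bullet> snd p) * (snd v \<bullet> snd v)" by (simp add: pp)
    moreover have "(snd p \<bullet> snd p) * (snd v \<bullet> snd v) - (1 + snd p \<bullet> snd p) * (fst v)\<^sup>2 =
        (1 + snd p \<bullet> snd p) * (snd v \<bullet> snd v - (fst v)\<^sup>2) - snd v \<bullet> snd v" by (simp add: algebra_simps)
    moreover have ii: "innerK K v v = snd v \<bullet> snd v - (fst v)\<^sup>2" using 3 by (simp add: innerK_def power2_eq_square)
    ultimately have *: "snd v \<bullet> snd v \<le> (fst p)\<^sup>2 * innerK K v v" unfolding pp ii by linarith
    then have i0: "innerK K v v \<ge> 0"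
      using sv pp by (smt (verit) inner_ge_zero mult_nonneg_nonpos mult_pos_neg)
    have "(norm v)\<^sup>2 \<le> 2 * (snd v \<bullet> snd v)" unfolding nv using i0 3 by (simp add: innerK_def power2_eq_square)
    also have "\<dots> \<le> 2 * ((fst p)\<^sup>2 * innerK K v v)" using * by simp
    also have "\<dots> \<le> 2 * (1 + (fst p)\<^sup>2) * innerK K v v" using i0 by (simp add: algebra_simps)
    finally show ?thesis .
  qed
qed

lemma innerK_tangent_nonneg:
  assumes "K \<in> {-1,0,1}" "p \<in> space_form K" "polarK K p v = 0"
  shows "0 \<le> innerK K v v"
proof -
  have "0 \<le> 2 * (1 + (fst p)\<^sup>2) * innerK K v v"
    using innerK_tangent_norm[OF assms] by (meson order_trans zero_le_power2)
  moreover have "0 < 2 * (1 + (fst p)\<^sup>2)" by (simp add: add_pos_nonneg)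
  ultimately show ?thesis by (metis linorder_not_le mult_pos_neg)
qed

lemma innerK_tangent_zero:
  assumes "K \<in> {-1,0,1}" "p \<in> space_form K" "polarK K p v = 0" "innerK K v v = 0"
  shows "v = 0"
  using innerK_tangent_norm[OF assms(1-3)] assms(4) by simp

text \<open>Inverse stereographic projection from \<open>(- \<sigma>, 0)\<close>, scaled so that one
  formula serves all curvatures: with \<open>\<sigma> = 1\<close> it is the affine inclusion for
  \<open>K = 0\<close> and the ball model of radius 2 for \<open>K = -1\<close>. On the sphere the
  two signs of \<open>\<sigma>\<close> together cover everything.\<close>

definition stereo :: "real \<Rightarrow> real \<Rightarrow> 'e::euclidean_space \<Rightarrow> real \<times> 'e" where
  "stereo K \<sigma> x = (\<sigma> * (1 - K * (x \<bullet> x) / 4) * inverse (1 + K * (x \<bullet> x) / 4),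
     inverse (1 + K * (x \<bullet> x) / 4) *\<^sub>R x)"

definition stereo_inv :: "real \<Rightarrow> real \<times> 'e::euclidean_space \<Rightarrow> 'e" where
  "stereo_inv \<sigma> p = (2 * inverse (1 + \<sigma> * fst p)) *\<^sub>R snd p"

definition stereo_domain :: "real \<Rightarrow> 'e::euclidean_space set" where
  "stereo_domain K = {x. 0 < 1 + K * (x \<bullet> x) / 4}"

lemma stereo_props:
  assumes K: "K \<in> {-1,0,1}" and \<sigma>: "\<sigma> \<in> {-1,1}" "K \<le> 0 \<longrightarrow> \<sigma> = 1"
  shows "x \<in> stereo_domain K \<Longrightarrow> stereo K \<sigma> x \<in> space_form K \<and> -1 < \<sigma> * fst (stereo K \<sigma> x) \<and> stereo_inv \<sigma> (stereo K \<sigma> x) = x"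
    and "p \<in> space_form K \<Longrightarrow> -1 < \<sigma> * fst p \<Longrightarrow> stereo_inv \<sigma> p \<in> stereo_domain K \<and> stereo K \<sigma> (stereo_inv \<sigma> p) = p"
proof -
  have \<sigma>2: "\<sigma> * \<sigma> = 1" using \<sigma> by auto
  {
    assume "x \<in> stereo_domain K"
    define a where "a = K * (x \<bullet> x) / 4"
    have a: "1 + a > 0" using \<open>x \<in> stereo_domain K\<close> by (simp add: stereo_domain_def a_def)
    have st: "stereo K \<sigma> x = (\<sigma> * (1 - a) * inverse (1 + a), inverse (1 + a) *\<^sub>R x)" by (simp add: stereo_def a_def)
    have "(\<sigma> * (1 - a) * inverse (1 + a))\<^sup>2 + K * ((inverse (1 + a) *\<^sub>R x) \<bullet> (inverse (1 + a) *\<^sub>R x)) =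
        (\<sigma> * \<sigma>) * ((1 - a)\<^sup>2 * (inverse (1 + a))\<^sup>2) + 4 * a * (inverse (1 + a))\<^sup>2"
      by (simp add: a_def power2_eq_square)
    \<comment> \<open>This is \<open>(1 - a)^2 + 4 a = (1 + a)^2\<close>, after the sign has gone by
      \<open>\<sigma> * \<sigma> = 1\<close>.\<close>
    also have "\<dots> = ((1 + a) * inverse (1 + a))\<^sup>2" by (simp add: \<sigma>2 power_mult_distrib power2_eq_square algebra_simps)
    also have "\<dots> = 1" using a by simp
    finally have e: "(\<sigma> * (1 - a) * inverse (1 + a))\<^sup>2 + K * ((inverse (1 + a) *\<^sub>R x) \<bullet> (inverse (1 + a) *\<^sub>R x)) = 1" .
    have pos: "K \<le> 0 \<longrightarrow> 0 < \<sigma> * (1 - a) * inverse (1 + a)"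
    proof
      assume "K \<le> 0"
      then have "a \<le> 0" unfolding a_def using mult_nonpos_nonneg[of K "x \<bullet> x"] by simp
      then show "0 < \<sigma> * (1 - a) * inverse (1 + a)" using a \<sigma>(2) \<open>K \<le> 0\<close> by simp
    qed
    have *: "1 + \<sigma> * (\<sigma> * (1 - a) * inverse (1 + a)) = 2 * inverse (1 + a)"
    proof -
      have "\<sigma> * (\<sigma> * (1 - a) * inverse (1 + a)) = (\<sigma> * \<sigma>) * (1 - a) * inverse (1 + a)" by (simp only: mult.assoc)
      moreover have "((1 + a) + (1 - a)) * inverse (1 + a) = 1 + (1 - a) * inverse (1 + a)"
        using right_inverse[of "1 + a"] a by (simp only: distrib_right)
      ultimately show ?thesis by (simp add: \<sigma>2)
    qed
    have "stereo_inv \<sigma> (stereo K \<sigma> x) = (2 * inverse (2 * inverse (1 + a)) * inverse (1 + a)) *\<^sub>R x"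
      by (simp only: st stereo_inv_def fst_conv snd_conv * scaleR_scaleR)
    also have "2 * inverse (2 * inverse (1 + a)) * inverse (1 + a) = 1"
    proof -
      have "2 * inverse (2 * inverse c) * inverse c = 1" if "0 < c" for c :: real using that by simp
      then show ?thesis using a .
    qed
    finally have "stereo_inv \<sigma> (stereo K \<sigma> x) = x" by simp
    moreover have "0 < 2 * inverse (1 + a)" using a by simp
    then have "-1 < \<sigma> * (\<sigma> * (1 - a) * inverse (1 + a))" using * by linarith
    ultimately show "stereo K \<sigma> x \<in> space_form K \<and> -1 < \<sigma> * fst (stereo K \<sigma> x) \<and> stereo_inv \<sigma> (stereo K \<sigma> x) = x"
      using e pos by (simp add: st space_form_def)
  }
  {
    assume p: "p \<in> space_form K" "-1 < \<sigma> * fst p"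
    define b where "b = 1 + \<sigma> * fst p"
    have b: "b > 0" using p by (simp add: b_def)
    have x: "stereo_inv \<sigma> p = (2 * inverse b) *\<^sub>R snd p" by (simp add: stereo_inv_def b_def)
    have "K * (snd p \<bullet> snd p) = 1 - (fst p)\<^sup>2" using p by (simp add: space_form_def algebra_simps)
    also have "\<dots> = (1 + \<sigma> * fst p) * (1 - \<sigma> * fst p)"
      using \<sigma>2 by (simp add: algebra_simps power2_eq_square)
    also have "\<dots> = b * (2 - b)" by (simp add: b_def)
    finally have Ks: "K * (snd p \<bullet> snd p) = b * (2 - b)" .
    have "K * (stereo_inv \<sigma> p \<bullet> stereo_inv \<sigma> p) / 4 = (K * (snd p \<bullet> snd p)) * (inverse b * inverse b)"
      by (simp add: x)
    also have "\<dots> = (2 - b) * inverse b" using b by (simp add: Ks field_simps)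
    finally have a: "K * (stereo_inv \<sigma> p \<bullet> stereo_inv \<sigma> p) / 4 = (2 - b) * inverse b" .
    have a1: "1 + (2 - b) * inverse b = 2 * inverse b" "1 - (2 - b) * inverse b = (2 * b - 2) * inverse b"
      using b by (simp_all add: field_simps)
    have ib: "inverse (2 * inverse b) = b / 2" using b by simp
    have "stereo K \<sigma> (stereo_inv \<sigma> p) = (\<sigma> * ((2 * b - 2) * inverse b) * (b / 2), (b / 2) *\<^sub>R stereo_inv \<sigma> p)"
      by (simp only: stereo_def a a1 ib)
    also have "\<sigma> * ((2 * b - 2) * inverse b) * (b / 2) = \<sigma> * (b - 1)" using b by (simp add: field_simps)
    also have "\<dots> = fst p" by (simp add: b_def \<sigma>2 mult.assoc[symmetric])
    also have "(b / 2) *\<^sub>R stereo_inv \<sigma> p = snd p" unfolding x using b by simp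
    finally have "stereo K \<sigma> (stereo_inv \<sigma> p) = p" by simp
    moreover have "stereo_inv \<sigma> p \<in> stereo_domain K" using b by (simp only: stereo_domain_def mem_Collect_eq a a1) simp
    ultimately show "stereo_inv \<sigma> p \<in> stereo_domain K \<and> stereo K \<sigma> (stereo_inv \<sigma> p) = p" by blast
  }
qed

lemma local_param_stereo:
  fixes K \<sigma> :: real
  assumes K: "K \<in> {-1,0,1}" and \<sigma>: "\<sigma> \<in> {-1,1}" "K \<le> 0 \<longrightarrow> \<sigma> = 1"
  shows "local_param (space_form K) (stereo_domain K) (stereo K \<sigma> :: real^'k \<Rightarrow> _)"
    and "(stereo K \<sigma> :: real^'k \<Rightarrow> _) ` stereo_domain K = space_form K \<inter> {p. -1 < \<sigma> * fst p}"
proof -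
  let ?W = "stereo_domain K :: (real^'k) set" and ?X = "stereo K \<sigma> :: real^'k \<Rightarrow> _"
  note pr = stereo_props[OF K \<sigma>]
  show im: "?X ` ?W = space_form K \<inter> {p. -1 < \<sigma> * fst p}"
  proof (intro set_eqI iffI)
    fix p :: "real \<times> (real^'k)" assume "p \<in> space_form K \<inter> {p. -1 < \<sigma> * fst p}"
    then show "p \<in> ?X ` ?W" using pr(2)[of p] by (intro image_eqI[of _ _ "stereo_inv \<sigma> p"]) auto
  qed (use pr(1) in blast)
  have op: "open ?W" unfolding stereo_domain_def by (intro open_Collect_less continuous_intros) simp_all
  have opP: "open {p :: real \<times> (real^'k). -1 < \<sigma> * fst p}" by (intro open_Collect_less continuous_intros)
  have sm: "smooth_on ?W ?X" unfolding smooth_on_def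
  proof
    fix k
    have q: "Ck_on k ?W (\<lambda>x. K * (x \<bullet> x) / 4)"
      using Ck_on_mult[OF op Ck_on_const[of _ _ "K / 4"] Ck_on_inner[OF op Ck_on_ident[OF op] Ck_on_ident[OF op]]] by simp
    have i: "Ck_on k ?W (\<lambda>x. inverse (1 + K * (x \<bullet> x) / 4))"
      by (rule Ck_on_inverse[OF op Ck_on_add[OF op Ck_on_const q]]) (simp add: stereo_domain_def)
    have 1: "Ck_on k ?W (\<lambda>x. \<sigma> * (1 - K * (x \<bullet> x) / 4) * inverse (1 + K * (x \<bullet> x) / 4))"
      by (intro Ck_on_mult[OF op] Ck_on_diff[OF op] Ck_on_const q i)
    have 2: "Ck_on k ?W (\<lambda>x. inverse (1 + K * (x \<bullet> x) / 4) *\<^sub>R x)"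
      by (intro Ck_on_scaleR[OF op] Ck_on_ident[OF op] i)
    have bl1: "bounded_linear (\<lambda>s :: real. (s, 0 :: real^'k))" and bl2: "bounded_linear (\<lambda>y :: real^'k. (0 :: real, y))"
      by (intro bounded_linear_Pair bounded_linear_ident bounded_linear_zero)+
    have "Ck_on k ?W (\<lambda>x. (\<sigma> * (1 - K * (x \<bullet> x) / 4) * inverse (1 + K * (x \<bullet> x) / 4), 0) +
        (0, inverse (1 + K * (x \<bullet> x) / 4) *\<^sub>R x))"
      by (rule Ck_on_add[OF op Ck_on_bounded_linear[OF op bl1 1] Ck_on_bounded_linear[OF op bl2 2]])
    then show "Ck_on k ?W ?X" by (simp add: stereo_def[abs_def])
  qed
  have inj: "inj (frechet_derivative ?X (at x))" if x: "x \<in> ?W" for x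
  proof -
    have D: "(?X has_derivative frechet_derivative ?X (at x)) (at x)" by (rule smooth_on_has_derivative[OF sm x])
    have nz: "1 + \<sigma> * fst (?X x) \<noteq> 0" using pr(1)[OF x] by simp
    have "(\<lambda>p :: real \<times> (real^'k). 1 + \<sigma> * fst p) differentiable (at (?X x))"
      by (intro derivative_intros bounded_linear_imp_differentiable bounded_linear_fst)
    then have "(\<lambda>p :: real \<times> (real^'k). inverse (1 + \<sigma> * fst p)) differentiable (at (?X x))"
      by (rule differentiable_inverse) (rule nz)
    then have "stereo_inv \<sigma> differentiable (at (?X x))"
      unfolding stereo_inv_def[abs_def]
      by (rule differentiable_scaleR[OF differentiable_mult[OF differentiable_const]
            bounded_linear_imp_differentiable[OF bounded_linear_snd]])
    then obtain R where R: "(stereo_inv \<sigma> has_derivative R) (at (?X x))" unfolding differentiable_def by blast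
    \<comment> \<open>Differentiating the left inverse identity gives a left inverse
      \<open>R\<close> of the derivative of \<open>?X\<close>, which is therefore injective.\<close>
    have "((\<lambda>y. stereo_inv \<sigma> (?X y)) has_derivative (\<lambda>v. R (frechet_derivative ?X (at x) v))) (at x)"
      using diff_chain_at[OF D R] by (simp add: o_def)
    then have "((\<lambda>y. y) has_derivative (\<lambda>v. R (frechet_derivative ?X (at x) v))) (at x)"
      by (rule has_derivative_transform_within_open[OF _ op x]) (use pr(1) in blast)
    then have "(\<lambda>v. R (frechet_derivative ?X (at x) v)) = (\<lambda>v. v)"
      using has_derivative_ident by (rule has_derivative_unique)
    then show ?thesis by (intro injI) metis
  qed
  have "homeomorphism ?W (?X ` ?W) ?X (stereo_inv \<sigma>)"
  proof (rule homeomorphismI)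
    show "continuous_on ?W ?X" by (rule smooth_on_continuous[OF sm])
    show "continuous_on (?X ` ?W) (stereo_inv \<sigma>)"
      unfolding stereo_inv_def[abs_def] im
      by (intro continuous_intros) auto
    show "?X ` ?W \<subseteq> ?X ` ?W" ..
    show "stereo_inv \<sigma> ` ?X ` ?W \<subseteq> ?W" using pr(1) by fastforce
    show "stereo_inv \<sigma> (?X x) = x" if "x \<in> ?W" for x using pr(1)[OF that] by blast
    show "?X (stereo_inv \<sigma> p) = p" if "p \<in> ?X ` ?W" for p using pr(1) that by fastforce
  qed
  then show "local_param (space_form K) ?W ?X"
    unfolding local_param_def using op sm inj openin_open_Int[OF opP, of "space_form K"] im by auto
qed

lemma space_form_local_param:
  fixes p :: "real \<times> (real^'k)"
  assumes "K \<in> {-1,0,1}" "p \<in> space_form K"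
  shows "\<exists>(W :: (real^'k) set) X. local_param (space_form K) W X \<and> p \<in> X ` W"
proof (cases "-1 < fst p")
  case True
  then show ?thesis using local_param_stereo[OF assms(1), where \<sigma> = 1] assms(2) by fastforce
next
  case False
  have "K = 1" using False assms by (auto simp: space_form_def)
  then show ?thesis using local_param_stereo[OF assms(1), where \<sigma> = "-1"] assms(2) False by fastforce
qed

lemma smooth_submanifold_space_form:
  "K \<in> {-1,0,1} \<Longrightarrow> smooth_submanifold TYPE('k::finite) (space_form K :: (real \<times> (real^'k)) set)"
  unfolding smooth_submanifold_def using space_form_local_param by blast

section \<open>Tangent spaces and geodesics of the space forms\<close>

lemma curve_polar_derivative:
  fixes \<gamma> :: "real \<Rightarrow> real \<times> 'e::euclidean_space"
  assumes "e > 0" "\<And>t. \<bar>t\<bar> < e \<Longrightarrow> \<gamma> t \<in> space_form K" "(\<gamma> has_vector_derivative v) (at 0)"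
  shows "polarK K (\<gamma> 0) v = 0"
proof -
  have "((\<lambda>t. polarK K (\<gamma> t) (\<gamma> t)) has_vector_derivative polarK K (\<gamma> 0) v + polarK K v (\<gamma> 0)) (at 0)"
    by (rule bounded_bilinear.has_vector_derivative[OF polarK_bounded_bilinear assms(3,3)])
  moreover have "((\<lambda>t. polarK K (\<gamma> t) (\<gamma> t)) has_vector_derivative 0) (at 0)"
  proof (rule has_vector_derivative_transform_within_open[where S = "{-e<..<e}" and f = "\<lambda>t. 1"])
    show "1 = polarK K (\<gamma> t) (\<gamma> t)" if "t \<in> {-e<..<e}" for t
      using space_form_polar[OF assms(2)[of t]] that by (simp add: abs_less_iff)
  qed (use assms(1) in auto)
  ultimately have "polarK K (\<gamma> 0) v + polarK K v (\<gamma> 0) = 0" by (rule vector_derivative_unique_at)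
  then show ?thesis by (simp add: polarK_commute)
qed

lemma tangent_space_subset_polar:
  assumes "M \<subseteq> space_form K" "v \<in> tangent_space M p"
  shows "polarK K p v = 0"
proof -
  obtain \<gamma> e where "e > 0" "\<gamma> ` {-e<..<e} \<subseteq> M" "\<gamma> 0 = p" "(\<gamma> has_vector_derivative v) (at 0)"
    using assms(2) by (auto simp: tangent_space_def curve_through_def)
  moreover from this have "\<gamma> t \<in> space_form K" if "\<bar>t\<bar> < e" for t
    using assms(1) that by (auto simp: abs_less_iff image_subset_iff)
  ultimately show ?thesis using curve_polar_derivative[of e \<gamma> K v] by blast
qed

text \<open>Differentiating \<open>polarK K p p = 1\<close> along curves gives one inclusion. Both
  sides are subspaces of dimension \<open>CARD('k)\<close>, the right-hand one as a
  hyperplane.\<close>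

lemma tangent_space_space_form:
  fixes p :: "real \<times> (real^'k)"
  assumes K: "K \<in> {-1,0,1}" and p: "p \<in> space_form K"
  shows "tangent_space (space_form K) p = {v. polarK K p v = 0}"
proof -
  obtain W :: "(real^'k) set" and X u where X: "local_param (space_form K) W X" "u \<in> W" "p = X u"
    using space_form_local_param[OF assms] by blast
  have T: "tangent_space (space_form K) p = range (frechet_derivative X (at u))"
    using tangent_space_local_param[OF X(1,2)] X(3) by simp
  have lin: "linear (frechet_derivative X (at u))" and inj: "inj (frechet_derivative X (at u))"
    using local_paramD[OF X(1)] X(2) by auto
  have "dim (range (frechet_derivative X (at u))) = CARD('k)"
    using dim_image_eq[OF lin, of UNIV] inj by (simp add: dim_UNIV)
  moreover have "dim {v. polarK K p v = 0} = CARD('k)"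
  proof -
    have "(fst p, K *\<^sub>R snd p) \<noteq> 0"
      using space_form_polar[OF p] by (auto simp: polarK_def zero_prod_def)
    from dim_hyperplane[OF this] show ?thesis by (simp add: polarK_inner)
  qed
  moreover have "subspace {v. polarK K p v = 0}"
    unfolding polarK_inner by (rule subspace_hyperplane)
  moreover have "subspace (range (frechet_derivative X (at u)))"
    by (rule linear_subspace_image[OF lin subspace_UNIV])
  moreover have "range (frechet_derivative X (at u)) \<subseteq> {v. polarK K p v = 0}"
    unfolding T[symmetric] using tangent_space_subset_polar[OF order_refl, of _ K p] by auto
  ultimately have "range (frechet_derivative X (at u)) = {v. polarK K p v = 0}"
    by (intro subspace_dim_equal) simp_all
  then show ?thesis by (simp only: T)
qed

text \<open>For a unit vector \<open>v\<close> this is the exponential map on the line through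
  \<open>v\<close>, free of the case distinction at the zero vector and with a signed time.\<close>

definition geodesic :: "real \<Rightarrow> real \<times> 'e::euclidean_space \<Rightarrow> real \<times> 'e \<Rightarrow> real \<Rightarrow> real \<times> 'e" where
  "geodesic K p v t = cK K t *\<^sub>R p + sK K t *\<^sub>R v"

lemma exp_map_geodesic:
  assumes "innerK K v v = 1"
  shows "exp_map K p (t *\<^sub>R v) = geodesic K p v t"
proof -
  have r: "sqrt (innerK K (t *\<^sub>R v) (t *\<^sub>R v)) = \<bar>t\<bar>"
    using assms by (simp add: innerK_simps flip: power2_eq_square)
  have "cK K \<bar>t\<bar> = cK K t" by (simp add: abs_if)
  moreover have "sK K \<bar>t\<bar> / \<bar>t\<bar> * t = sK K t" if "t \<noteq> 0" using that by (auto simp: abs_if)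
  ultimately show ?thesis
    by (simp add: exp_map_def r geodesic_def Let_def)
qed

lemma geodesic_minus: "geodesic K p v (- t) = cK K t *\<^sub>R p - sK K t *\<^sub>R v"
  by (simp add: geodesic_def)

lemma polarK_unit:
  assumes "K \<in> {-1,0,1}" "p \<in> space_form K" "polarK K p v = 0" "innerK K v v = 1"
  shows "polarK K v v = K"
  using polarK_tangent(1)[OF assms(1-3), of v] assms(4) by simp

lemma geodesic_in_space_form:
  assumes K: "K \<in> {-1,0,1}" and p: "p \<in> space_form K" and v: "polarK K p v = 0" "innerK K v v = 1"
  shows "geodesic K p v t \<in> space_form K"
proof -
  have "polarK K (geodesic K p v t) (geodesic K p v t) = (cK K t)\<^sup>2 + K * (sK K t)\<^sup>2"
    using space_form_polar[OF p] v polarK_unit[OF K p v]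
    by (simp add: geodesic_def polarK_simps polarK_commute[of K v p] power2_eq_square)
  then have 1: "polarK K (geodesic K p v t) (geodesic K p v t) = 1" using cK_sK_squared[OF K] by simp
  have "0 < fst (geodesic K p v t)" if K0: "K \<le> 0"
  proof -
    have fp: "0 < fst p" using p K0 by (simp add: space_form_def)
    consider "K = 0" | "K = -1" using K K0 by fastforce
    then show ?thesis
    proof cases
      case 1
      then show ?thesis using fp v space_form_0_fst p by (simp add: geodesic_def cK_def sK_def polarK_def)
    next
      case 2
      \<comment> \<open>The geodesic stays on the upper sheet because \<open>fst v\<close> is
        smaller than \<open>fst p\<close> in absolute value, by Cauchy-Schwarz, and
        \<open>sinh t\<close> is smaller than \<open>cosh t\<close>.\<close>
      have pp: "(fst p)\<^sup>2 = 1 + snd p \<bullet> snd p" using p 2 by (simp add: space_form_def)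
      have vv: "snd v \<bullet> snd v = 1 + (fst v)\<^sup>2" using v(2) 2 by (simp add: innerK_def power2_eq_square)
      have "fst p * fst v = snd p \<bullet> snd v" using v 2 by (simp add: polarK_def)
      then have "(fst p)\<^sup>2 * (fst v)\<^sup>2 \<le> (snd p \<bullet> snd p) * (snd v \<bullet> snd v)"
        using Cauchy_Schwarz_ineq[of "snd p" "snd v"] by (metis power_mult_distrib)
      then have "(fst p)\<^sup>2 * (fst v)\<^sup>2 \<le> ((fst p)\<^sup>2 - 1) * (1 + (fst v)\<^sup>2)" by (simp add: pp vv)
      then have "(fst v)\<^sup>2 < (fst p)\<^sup>2" by (simp add: algebra_simps)
      then have fv: "\<bar>fst v\<bar> < fst p" using fp by (metis abs_le_square_iff abs_of_pos linorder_not_le)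
      have sc: "\<bar>sinh t\<bar> < cosh t" using sinh_less_cosh_real[of t] sinh_less_cosh_real[of "-t"] by (simp add: abs_if)
      have "\<bar>sinh t * fst v\<bar> \<le> cosh t * \<bar>fst v\<bar>" using sc by (simp add: abs_mult mult_right_mono)
      also have "\<dots> < cosh t * fst p" using fv by simp
      finally show ?thesis using 2 by (simp add: geodesic_def cK_def sK_def abs_less_iff)
    qed
  qed
  with 1 show ?thesis by (simp add: space_form_iff)
qed

lemma continuous_on_cK_sK:
  assumes "K \<in> {-1,0,1}"
  shows "continuous_on A (cK K)" "continuous_on A (sK K)"
  by (rule continuous_on_subset[OF _ subset_UNIV], use Ck_on_sK_cK[OF assms, of 0] in simp)+

lemma geodesic_continuous: "K \<in> {-1,0,1} \<Longrightarrow> continuous_on A (geodesic K p v)"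
  unfolding geodesic_def[abs_def]
  by (intro continuous_on_add continuous_on_scaleR continuous_on_cK_sK continuous_on_const)

text \<open>The squared ambient distance of two points at distance t.\<close>

definition chordK :: "real \<Rightarrow> real \<Rightarrow> real" where
  "chordK K t = (if K = 0 then t\<^sup>2 else 2 * K * (1 - cK K t))"

lemma geodesic_chord:
  assumes K: "K \<in> {-1,0,1}" and p: "p \<in> space_form K" and v: "polarK K p v = 0" "innerK K v v = 1"
  shows "innerK K (geodesic K p v s - geodesic K p v t) (geodesic K p v s - geodesic K p v t) = chordK K (s - t)"
proof (cases "K = 0")
  case True
  then have "geodesic K p v s - geodesic K p v t = (s - t) *\<^sub>R v"
    by (simp add: geodesic_def cK_def sK_def scaleR_diff_left)
  then show ?thesis using v True by (simp add: innerK_simps chordK_def power2_eq_square)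
next
  case False
  then have K': "K \<in> {-1,1}" using K by auto
  then have KK: "K * K = 1" by auto
  have sq: "polarK K (geodesic K p v r) (geodesic K p v r) = 1" for r
    using space_form_polar[OF geodesic_in_space_form[OF assms]] .
  have mx: "polarK K (geodesic K p v s) (geodesic K p v t) = cK K (s - t)"
    using space_form_polar[OF p] v polarK_unit[OF K p v] cK_diff[OF K]
    by (simp add: geodesic_def polarK_simps polarK_commute[of K v p])
  have "polarK K (geodesic K p v s - geodesic K p v t) (geodesic K p v s - geodesic K p v t) = 2 - 2 * cK K (s - t)"
    by (simp add: polarK_simps sq mx polarK_commute[of K "geodesic K p v t" "geodesic K p v s"])
  then show ?thesis using False by (simp add: innerK_polarK[OF K'] chordK_def)
qed

text \<open>Comparing ambient chords thus amounts to comparing distances along a geodesic, so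
  minimising the ambient form finds nearest points.\<close>

lemma chordK_strict_mono:
  assumes "K \<in> {-1,0,1}" "0 \<le> s" "s < t" "K = 1 \<longrightarrow> t \<le> pi"
  shows "chordK K s < chordK K t"
proof -
  consider "K = 0" | "K = 1" | "K = -1" using assms by auto
  then show ?thesis
  proof cases
    case 1
    then show ?thesis using assms by (simp add: chordK_def power2_eq_square mult_strict_mono)
  next
    case 2
    then show ?thesis using cos_monotone_0_pi[of s t] assms by (simp add: chordK_def cK_def)
  next
    case 3
    then show ?thesis using cosh_real_strict_mono[of s t] assms by (simp add: chordK_def cK_def)
  qed
qed

text \<open>The coefficients satisfy \<open>\<alpha>^2 + K * \<beta>^2 = 1\<close>, and
  \<open>cK\<close> and \<open>sK\<close> parametrise this conic. For \<open>K = -1\<close> it has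
  two branches; \<open>\<alpha> > 0\<close> follows from Cauchy-Schwarz for two points of the upper
  sheet.\<close>

lemma geodesic_representation:
  assumes K: "K \<in> {-1,0,1}" and p: "p \<in> space_form K" and v: "polarK K p v = 0" "innerK K v v = 1"
    and y: "y \<in> space_form K" "y = \<alpha> *\<^sub>R p + \<beta> *\<^sub>R v"
  shows "\<exists>t. (K = 1 \<longrightarrow> \<bar>t\<bar> \<le> pi) \<and> y = geodesic K p v t"
proof -
  have "polarK K y y = \<alpha>\<^sup>2 + K * \<beta>\<^sup>2"
    using space_form_polar[OF p] v polarK_unit[OF K p v]
    by (simp add: y(2) polarK_simps polarK_commute[of K v p] power2_eq_square)
  then have ab: "\<alpha>\<^sup>2 + K * \<beta>\<^sup>2 = 1" using space_form_polar[OF y(1)] by simp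
  have "polarK K p y = \<alpha>" using space_form_polar[OF p] v by (simp add: y(2) polarK_simps)
  then have \<alpha>: "\<alpha> = fst p * fst y + K * (snd p \<bullet> snd y)" by (simp add: polarK_def)
  consider "K = 0" | "K = 1" | "K = -1" using K by auto
  then show ?thesis
  proof cases
    case 1
    have "fst p = 1" "fst y = 1" using space_form_0_fst p y(1) 1 by blast+
    then have "\<alpha> = 1" using \<alpha> 1 by simp
    then show ?thesis using 1 y(2) by (intro exI[of _ \<beta>]) (simp add: geodesic_def cK_def sK_def)
  next
    case 2
    then have "\<alpha>\<^sup>2 + \<beta>\<^sup>2 = 1" using ab by simp
    then obtain t where t: "-pi < t" "t \<le> pi" "\<alpha> = cos t" "\<beta> = sin t"
      using sincos_total_2pi_le[of \<alpha> \<beta>] sincos_principal_value by metis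
    then show ?thesis using 2 y(2) by (intro exI[of _ t]) (auto simp: geodesic_def cK_def sK_def)
  next
    case 3
    have "norm (snd p) < fst p" "norm (snd y) < fst y"
      using p y(1) 3 by (auto simp: space_form_def power2_norm_eq_inner[symmetric] intro: power2_less_imp_less)
    then have "norm (snd p) * norm (snd y) < fst p * fst y" 
      by (intro mult_strict_mono) (auto intro: le_less_trans[OF norm_ge_zero])
    then have "\<alpha> > 0" using \<alpha> 3 norm_cauchy_schwarz[of "snd p" "snd y"] by simp
    moreover have "\<alpha>\<^sup>2 = (cosh (arsinh \<beta>))\<^sup>2" using ab 3 by (simp add: cosh_square_eq)
    ultimately have "\<alpha> = cosh (arsinh \<beta>)" by (simp add: power2_eq_iff_nonneg)
    then show ?thesis using 3 y(2) by (intro exI[of _ "arsinh \<beta>"]) (simp add: geodesic_def cK_def sK_def)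
  qed
qed

section \<open>The unit normal of a hypersurface\<close>

locale hypersurface =
  fixes K :: real and \<Omega> M :: "'n::finite ambient set" and \<nu> :: "'n ambient \<Rightarrow> 'n ambient"
    and lam :: "nat \<Rightarrow> 'n ambient \<Rightarrow> real"
  assumes K: "K \<in> {-1, 0, 1}"
    and domain: "bounded_domain K \<Omega>"
    and frontier: "M = top_of_set (space_form K) frontier_of \<Omega>"
    and closed: "closed_hypersurface K M"
    and conn: "connected M"
    and normal: "outward_unit_normal K \<Omega> M \<nu>"
    and curvatures: "\<forall>x\<in>M. principal_curvatures K M \<nu> x (\<lambda>i. lam i x)"
    and mean_convex: "K \<le> 0 \<longrightarrow> (\<forall>x\<in>M. sqrt (- K) < mean_curvature CARD('n) lam x)"
begin

lemma M_space_form: "M \<subseteq> space_form K" "M \<noteq> {}" "compact M" "smooth_submanifold TYPE('n) M"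
  using closed by (simp_all add: closed_hypersurface_def)

lemma M_chart:
  assumes "x \<in> M"
  obtains W :: "(real^'n) set" and X u where "local_param M W X" "u \<in> W" "x = X u"
proof -
  obtain W :: "(real^'n) set" and X where "local_param M W X" "x \<in> X ` W"
    using M_space_form(4) assms unfolding smooth_submanifold_def by metis
  then show ?thesis using that by blast
qed

lemma \<nu>_props:
  assumes "x \<in> M"
  shows "polarK K x (\<nu> x) = 0" "innerK K (\<nu> x) (\<nu> x) = 1"
    "v \<in> tangent_space M x \<Longrightarrow> innerK K (\<nu> x) v = 0"
    "\<exists>d>0. \<forall>t. 0 < t \<longrightarrow> t < d \<longrightarrow> exp_map K x (t *\<^sub>R \<nu> x) \<notin> \<Omega> \<and> exp_map K x (- t *\<^sub>R \<nu> x) \<in> \<Omega>"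
proof -
  have o: "\<nu> x \<in> tangent_space (space_form K) x \<and> innerK K (\<nu> x) (\<nu> x) = 1 \<and>
        (\<forall>v\<in>tangent_space M x. innerK K (\<nu> x) v = 0) \<and>
        (\<forall>\<^sub>F t in at_right 0. exp_map K x (t *\<^sub>R \<nu> x) \<notin> \<Omega> \<and> exp_map K x (- t *\<^sub>R \<nu> x) \<in> \<Omega>)"
    using normal assms unfolding outward_unit_normal_def by blast
  show "polarK K x (\<nu> x) = 0" using tangent_space_subset_polar[OF order_refl] o by blast
  show "innerK K (\<nu> x) (\<nu> x) = 1" "v \<in> tangent_space M x \<Longrightarrow> innerK K (\<nu> x) v = 0" using o by auto
  show "\<exists>d>0. \<forall>t. 0 < t \<longrightarrow> t < d \<longrightarrow> exp_map K x (t *\<^sub>R \<nu> x) \<notin> \<Omega> \<and> exp_map K x (- t *\<^sub>R \<nu> x) \<in> \<Omega>"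
    using o unfolding eventually_at_right_field by blast
qed

text \<open>Tangency and normality give one inclusion. Conversely the right-hand side meets the
  plane spanned by \<open>\<nu> x\<close> and \<open>x\<close> in 0 only, so in an ambient space of
  dimension \<open>CARD('n) + 2\<close> its dimension is at most \<open>CARD('n)\<close>, which the
  tangent space attains.\<close>

lemma tangent_space_M:
  assumes x: "x \<in> M"
  shows "tangent_space M x = {v. polarK K x v = 0 \<and> innerK K v (\<nu> x) = 0}"
proof -
  obtain W :: "(real^'n) set" and X u where X: "local_param M W X" "u \<in> W" "x = X u" by (rule M_chart[OF x])
  let ?D = "frechet_derivative X (at u)" and ?n = "\<nu> x"
  have T: "tangent_space M x = range ?D" using tangent_space_local_param[OF X(1,2)] X(3) by simp
  have lin: "linear ?D" and inj: "inj ?D" using local_paramD[OF X(1)] X(2) by auto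
  define V where "V = {v. polarK K x v = 0 \<and> innerK K v ?n = 0}"
  have xx: "polarK K x x = 1" using x M_space_form(1) space_form_polar by blast
  have dT: "dim (range ?D) = CARD('n)" using dim_image_eq[OF lin, of UNIV] inj by simp
  have sV: "subspace V" by (auto simp: V_def subspace_def polarK_simps innerK_simps)
  have TV: "range ?D \<subseteq> V"
  proof
    fix v assume "v \<in> range ?D"
    then have v: "v \<in> tangent_space M x" by (simp only: T)
    show "v \<in> V" unfolding V_def
      using tangent_space_subset_polar[OF M_space_form(1) v] \<nu>_props(3)[OF x v] by (simp add: innerK_commute)
  qed
  have n0: "?n \<noteq> 0" using \<nu>_props(2)[OF x] by (auto simp: innerK_simps)
  have x0: "x \<noteq> 0" using xx by (auto simp: polarK_simps)
  have ind: "?n \<notin> span {x}"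
  proof
    assume "?n \<in> span {x}"
    then obtain c where c: "?n = c *\<^sub>R x" by (auto simp: span_singleton)
    then have "c = 0" using \<nu>_props(1)[OF x] xx by (simp add: polarK_simps)
    then show False using n0 c by simp
  qed
  have "independent {?n, x}"
    using ind x0 by (simp add: independent_insert)
  moreover have "?n \<noteq> x" using ind span_base[of x "{x}"] by force
  then have "card {?n, x} = 2" by simp
  ultimately have dS: "dim (span {?n, x}) = 2" using dim_eq_card_independent[of "{?n, x}"] by simp
  have "V \<inter> span {?n, x} \<subseteq> {0}"
  proof
    fix v assume v: "v \<in> V \<inter> span {?n, x}"
    then obtain k where "v - k *\<^sub>R ?n \<in> span {x}" by (auto simp: span_insert)
    then obtain c where c: "v - k *\<^sub>R ?n = c *\<^sub>R x" by (auto simp: span_singleton)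
    then have ve: "v = k *\<^sub>R ?n + c *\<^sub>R x" by (simp add: algebra_simps)
    have "polarK K x v = c" using \<nu>_props(1)[OF x] xx by (simp add: ve polarK_simps)
    then have c0: "c = 0" using v by (simp add: V_def)
    have "innerK K v ?n = k" using \<nu>_props(2)[OF x] by (simp add: ve innerK_simps c0)
    then show "v \<in> {0}" using v ve c0 by (simp add: V_def)
  qed
  then have d0: "dim (V \<inter> span {?n, x}) = 0" by (simp add: dim_eq_0)
  have "dim {a + b |a b. a \<in> V \<and> b \<in> span {?n, x}} + dim (V \<inter> span {?n, x}) = dim V + dim (span {?n, x})"
    by (rule dim_sums_Int[OF sV subspace_span])
  moreover have "dim {a + b |a b. a \<in> V \<and> b \<in> span {?n, x}} \<le> DIM('n ambient)" by (rule dim_subset_UNIV)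
  moreover have "DIM('n ambient) = CARD('n) + 2" by (simp add: card_option)
  ultimately have "dim V \<le> CARD('n)" using d0 dS by linarith
  then have "range ?D = V"
    using subspace_dim_equal[OF linear_subspace_image[OF lin subspace_UNIV] sV TV] dT by simp
  then show ?thesis by (simp add: T V_def)
qed

text \<open>Subtracting the component along \<open>\<nu> x\<close> leaves a vector that is tangent
  to \<open>M\<close> and orthogonal to itself, hence zero, because the form is definite on tangent
  vectors.\<close>

lemma normal_component:
  assumes x: "x \<in> M" and w: "polarK K x w = 0" "\<And>v. v \<in> tangent_space M x \<Longrightarrow> innerK K w v = 0"
  shows "w = innerK K w (\<nu> x) *\<^sub>R \<nu> x"
proof -
  define z where "z = w - innerK K w (\<nu> x) *\<^sub>R \<nu> x"
  have p: "polarK K x z = 0" using w(1) \<nu>_props(1)[OF x] by (simp add: z_def polarK_simps)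
  have i: "innerK K z (\<nu> x) = 0" using \<nu>_props(2)[OF x] by (simp add: z_def innerK_simps)
  have "z \<in> tangent_space M x" using p i by (simp add: tangent_space_M[OF x])
  then have "innerK K w z = 0" by (rule w(2))
  then have "innerK K z z = 0" using i unfolding z_def[of] by (simp add: innerK_simps innerK_commute)
  then have "z = 0" using innerK_tangent_zero[OF K _ p] x M_space_form(1) by blast
  then show ?thesis by (simp add: z_def)
qed

end

section \<open>A cross product in the ambient vector space\<close>

definition flat :: "real \<times> (real^'m::finite) \<Rightarrow> real^'m option" where
  "flat v = (\<chi> i. case i of None \<Rightarrow> fst v | Some j \<Rightarrow> snd v $ j)"

lemma UNIV_option_sum: "(\<Sum>i\<in>UNIV. g i) = g None + (\<Sum>j\<in>UNIV. g (Some j))"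
  for g :: "'m::finite option \<Rightarrow> 'b::comm_monoid_add"
  by (simp add: UNIV_option_conv sum.reindex)

lemma inner_flat: "flat v \<bullet> flat w = v \<bullet> w"
  by (simp add: inner_vec_def flat_def UNIV_option_sum inner_prod_def)

lemma surj_flat: "\<exists>v. flat v = y"
  by (rule exI[of _ "(y $ None, \<chi> j. y $ Some j)"]) (auto simp: flat_def vec_eq_iff split: option.split)

lemma flat_simps: "flat (v + w) = flat v + flat w" "flat (c *\<^sub>R v) = c *s flat v"
  by (auto simp: flat_def vec_eq_iff split: option.split)

lemma flat_nth: "flat v $ None = fst v" "flat v $ Some j = snd v $ j"
  by (simp_all add: flat_def)

text \<open>The cross product of m + 1 vectors in dimension m + 2: its Euclidean inner product with v is
  the determinant with v as an additional row.\<close>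

definition cross_matrix :: "('m::finite option \<Rightarrow> real \<times> (real^'m option)) \<Rightarrow> real \<times> (real^'m option) \<Rightarrow> real^'m option option^'m option option" where
  "cross_matrix r v = (\<chi> i. case i of None \<Rightarrow> flat v | Some j \<Rightarrow> flat (r j))"

definition cross :: "('m::finite option \<Rightarrow> real \<times> (real^'m option)) \<Rightarrow> real \<times> (real^'m option)" where
  "cross r = (\<Sum>b\<in>Basis. det (cross_matrix r b) *\<^sub>R b)"

lemma linear_det_cross_matrix: "linear (\<lambda>v. det (cross_matrix r v))"
proof (rule linearI)
  have eq: "cross_matrix r v = (\<chi> i. if i = None then flat v else (case i of None \<Rightarrow> 0 | Some j \<Rightarrow> flat (r j)))" for v
    by (auto simp: cross_matrix_def vec_eq_iff split: option.split)
  show "det (cross_matrix r (v + w)) = det (cross_matrix r v) + det (cross_matrix r w)" for v w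
    unfolding eq flat_simps by (rule det_row_add)
  show "det (cross_matrix r (c *\<^sub>R v)) = c *\<^sub>R det (cross_matrix r v)" for c v
    unfolding eq flat_simps real_scaleR_def by (rule det_row_mul)
qed

lemma cross_inner: "cross r \<bullet> v = det (cross_matrix r v)"
proof -
  have "det (cross_matrix r v) = det (cross_matrix r (\<Sum>b\<in>Basis. (v \<bullet> b) *\<^sub>R b))" by (simp add: euclidean_representation)
  also have "\<dots> = (\<Sum>b\<in>Basis. (v \<bullet> b) * det (cross_matrix r b))"
    by (simp add: linear_sum[OF linear_det_cross_matrix] linear_scale[OF linear_det_cross_matrix])
  also have "\<dots> = v \<bullet> cross r" by (simp add: cross_def inner_sum_right mult.commute)
  also have "\<dots> = cross r \<bullet> v" by (rule inner_commute)
  finally show ?thesis by simp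
qed

lemma cross_orthogonal: "cross r \<bullet> r j = 0"
  unfolding cross_inner
  by (rule det_identical_rows[of None "Some j"]) (auto simp: cross_matrix_def row_def vec_eq_iff)

text \<open>A vector annihilated by the matrix is orthogonal to \<open>v\<close> and to all rows, so
  the hypothesis makes the matrix invertible.\<close>

lemma cross_nonzero:
  assumes "\<And>z. v \<bullet> z = 0 \<Longrightarrow> (\<And>j. r j \<bullet> z = 0) \<Longrightarrow> z = 0"
  shows "cross r \<bullet> v \<noteq> 0"
proof -
  have "y = 0" if y: "cross_matrix r v *v y = 0" for y
  proof -
    obtain z where z: "flat z = y" using surj_flat by blast
    have row: "(cross_matrix r v *v y) $ i = (case i of None \<Rightarrow> v \<bullet> z | Some j \<Rightarrow> r j \<bullet> z)" for i
      by (cases i) (simp_all add: matrix_vector_mul_component cross_matrix_def inner_flat flip: z)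
    have "v \<bullet> z = 0" using row[of None] y by simp
    moreover have "r j \<bullet> z = 0" for j using row[of "Some j"] y by simp
    ultimately have "z = 0" by (rule assms)
    then show "y = 0" unfolding z[symmetric] by (auto simp: flat_def vec_eq_iff split: option.split)
  qed
  then have "\<exists>B. B ** cross_matrix r v = mat 1" unfolding matrix_left_invertible_ker by blast
  then have "invertible (cross_matrix r v)" using invertible_left_inverse by blast
  then show ?thesis by (simp add: cross_inner invertible_det_nz)
qed

lemma Ck_on_cross:
  fixes r :: "'a::real_normed_vector \<Rightarrow> 'm::finite option \<Rightarrow> real \<times> (real^'m option)"
  assumes "open U" "\<And>j. Ck_on k U (\<lambda>x. r x j)"
  shows "Ck_on k U (\<lambda>x. cross (r x))"
proof -
  have "Ck_on k U (\<lambda>x. cross_matrix (r x) b $ i $ l)" for b i l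
  proof (cases i)
    case None
    then show ?thesis by (simp add: cross_matrix_def del: Ck_on.simps)
  next
    case (Some j)
    show ?thesis
    proof (cases l)
      case None
      then show ?thesis using Some Ck_on_bounded_linear[OF assms(1) bounded_linear_fst assms(2)]
        by (simp add: cross_matrix_def flat_nth del: Ck_on.simps)
    next
      case (Some m)
      have "bounded_linear (\<lambda>v :: real \<times> (real^'m option). snd v $ m)"
        by (rule bounded_linear_compose[OF bounded_linear_vec_nth bounded_linear_snd])
      from Ck_on_bounded_linear[OF assms(1) this assms(2)] show ?thesis
        using Some \<open>i = Some j\<close> by (simp add: cross_matrix_def flat_nth del: Ck_on.simps)
    qed
  qed
  then have "Ck_on k U (\<lambda>x. det (cross_matrix (r x) b))" for b by (intro Ck_on_det assms(1))
  then show ?thesis unfolding cross_def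
    by (intro Ck_on_sum[OF assms(1)] Ck_on_scaleR[OF assms(1)] Ck_on_const)
qed

context hypersurface
begin

text \<open>The cross product of suitably twisted position and coordinate vectors depends smoothly
  on \<open>u\<close>, is tangent to the space form and normal to \<open>M\<close>. It need not
  point outward, hence the undetermined sign.\<close>

lemma local_unit_normal:
  fixes X :: "real^'n \<Rightarrow> 'n ambient"
  assumes lp: "local_param M W X"
  shows "\<exists>N. smooth_on W N \<and> (\<forall>u\<in>W. \<nu> (X u) = N u \<or> \<nu> (X u) = - N u)"
proof -
  have op: "open W" and smX: "smooth_on W X" using local_paramD[OF lp] by auto
  let ?D = "\<lambda>u. frechet_derivative X (at u)"
  \<comment> \<open>The factors \<open>K\<close> turn Euclidean orthogonality to the row
    \<open>None\<close> into tangency to the space form, and orthogonality to the row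
    \<open>Some i\<close> into orthogonality for \<open>innerK\<close> to the coordinate vector of
    index \<open>i\<close>.\<close>
  define r :: "real^'n \<Rightarrow> 'n option \<Rightarrow> 'n ambient" where
    "r = (\<lambda>u j. case j of None \<Rightarrow> (fst (X u), K *\<^sub>R snd (X u))
       | Some i \<Rightarrow> (K * fst (?D u (axis i 1)), snd (?D u (axis i 1))))"
  define N where "N = (\<lambda>u. cross (r u))"
  have bl1: "bounded_linear (\<lambda>v :: 'n ambient. (fst v, K *\<^sub>R snd v))"
    by (intro bounded_linear_Pair bounded_linear_compose[OF bounded_linear_scaleR_right] bounded_linear_fst bounded_linear_snd)
  have bl2: "bounded_linear (\<lambda>v :: 'n ambient. (K * fst v, snd v))"
    by (intro bounded_linear_Pair bounded_linear_const_mult bounded_linear_fst bounded_linear_snd)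
  have r_smooth: "Ck_on k W (\<lambda>u. r u j)" for k j
  proof (cases j)
    case None
    then show ?thesis using Ck_on_bounded_linear[OF op bl1] smX by (simp add: r_def smooth_on_def)
  next
    case (Some i)
    then show ?thesis using Ck_on_bounded_linear[OF op bl2] smooth_on_SucD[OF smX, of "axis i 1"] by (simp add: r_def smooth_on_def)
  qed
  have N_smooth: "Ck_on k W N" for k unfolding N_def by (rule Ck_on_cross[OF op r_smooth])
  have r_polar: "r u None \<bullet> v = polarK K (X u) v" for u v by (simp add: r_def polarK_inner)
  have r_inner: "r u (Some i) \<bullet> v = innerK K (?D u (axis i 1)) v" for u i v
    by (simp add: r_def innerK_def inner_prod_def)
  have XM: "X u \<in> M" if "u \<in> W" for u using local_paramD(7)[OF lp] that by blast
  have tang: "innerK K w v = 0" if u: "u \<in> W" and w: "\<And>i. innerK K (?D u (axis i 1)) w = 0" and v: "v \<in> tangent_space M (X u)" for u v w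
  proof -
    obtain a where a: "v = ?D u a" using v tangent_space_local_param[OF lp u] by blast
    have lin: "linear (?D u)" by (rule local_paramD(9)[OF lp u])
    have "v = (\<Sum>i\<in>UNIV. (a $ i) *\<^sub>R ?D u (axis i 1))"
      using basis_expansion[of a] linear_sum[OF lin, of "\<lambda>i. a $ i *s axis i 1" UNIV]
      by (simp add: a linear_scale[OF lin] scalar_mult_eq_scaleR)
    then show ?thesis using w by (simp add: innerK_sum innerK_simps innerK_commute[of K w])
  qed
  have N_eq: "N u = innerK K (N u) (\<nu> (X u)) *\<^sub>R \<nu> (X u)" if u: "u \<in> W" for u
  proof (rule normal_component[OF XM[OF u]])
    show "polarK K (X u) (N u) = 0" using cross_orthogonal[of "r u" None] r_polar[of u "N u"]
      by (simp add: N_def inner_commute)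
    have "innerK K (?D u (axis i 1)) (N u) = 0" for i using cross_orthogonal[of "r u" "Some i"] r_inner[of u i "N u"]
      by (simp add: N_def inner_commute)
    then show "innerK K (N u) v = 0" if "v \<in> tangent_space M (X u)" for v using tang[OF u _ that] by blast
  qed
  have N_nz: "innerK K (N u) (\<nu> (X u)) \<noteq> 0" if u: "u \<in> W" for u
  proof
    assume "innerK K (N u) (\<nu> (X u)) = 0"
    then have "N u = 0" using N_eq[OF u] by simp
    moreover have "cross (r u) \<bullet> \<nu> (X u) \<noteq> 0"
    proof (rule cross_nonzero)
      fix z assume z: "\<nu> (X u) \<bullet> z = 0" "\<And>j. r u j \<bullet> z = 0"
      have "z = innerK K z (\<nu> (X u)) *\<^sub>R \<nu> (X u)"
      proof (rule normal_component[OF XM[OF u]])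
        show "polarK K (X u) z = 0" using z(2)[of None] by (simp add: r_polar)
        show "innerK K z v = 0" if "v \<in> tangent_space M (X u)" for v
          by (rule tang[OF u _ that]) (use z(2)[of "Some _"] r_inner in auto)
      qed
      then obtain c where c: "z = c *\<^sub>R \<nu> (X u)" by blast
      then have "c * (\<nu> (X u) \<bullet> \<nu> (X u)) = 0" using z(1) by simp
      then show "z = 0" using c by auto
    qed
    ultimately show False by (simp add: N_def)
  qed
  have NN: "innerK K (N u) (N u) = (innerK K (N u) (\<nu> (X u)))\<^sup>2" if u: "u \<in> W" for u
  proof -
    have "innerK K (N u) (N u) = innerK K (N u) (innerK K (N u) (\<nu> (X u)) *\<^sub>R \<nu> (X u))" using N_eq[OF u] by simp
    then show ?thesis by (simp add: innerK_simps power2_eq_square)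
  qed
  have NN_pos: "innerK K (N u) (N u) > 0" if "u \<in> W" for u using NN[OF that] N_nz[OF that] by simp
  define N' where "N' = (\<lambda>u. inverse (sqrt (innerK K (N u) (N u))) *\<^sub>R N u)"
  have "smooth_on W N'" unfolding smooth_on_def N'_def
  proof
    fix k
    have i: "Ck_on k W (\<lambda>u. innerK K (N u) (N u))" by (rule Ck_on_bilinear[OF op innerK_bounded_bilinear N_smooth N_smooth])
    have "Ck_on k W (\<lambda>u. inverse (sqrt (innerK K (N u) (N u))))"
      by (rule Ck_on_inverse[OF op Ck_on_sqrt[OF op i NN_pos]]) (use NN_pos in force)+
    then show "Ck_on k W (\<lambda>u. inverse (sqrt (innerK K (N u) (N u))) *\<^sub>R N u)"
      by (rule Ck_on_scaleR[OF op _ N_smooth])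
  qed
  moreover have "\<nu> (X u) = N' u \<or> \<nu> (X u) = - N' u" if u: "u \<in> W" for u
  proof -
    define c where "c = innerK K (N u) (\<nu> (X u))"
    have c: "c \<noteq> 0" "N u = c *\<^sub>R \<nu> (X u)" using N_nz[OF u] N_eq[OF u] by (simp_all add: c_def)
    have "N' u = (inverse \<bar>c\<bar> * c) *\<^sub>R \<nu> (X u)"
      unfolding N'_def NN[OF u] c_def[symmetric] by (simp add: c(2))
    then show ?thesis using c(1) by (cases "c > 0") (auto simp: abs_if)
  qed
  ultimately show ?thesis by blast
qed

text \<open>The side of \<open>M\<close> on which \<open>\<Omega>\<close> lies decides the sign.
  Moving along \<open>N\<close> from all points near \<open>u0\<close> sweeps out a connected
  one-sided collar that misses \<open>M\<close>; hence it lies inside \<open>\<Omega>\<close>, or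
  outside, for all base points at once.\<close>

lemma normal_locally_smooth:
  fixes X :: "real^'n \<Rightarrow> 'n ambient"
  assumes lp: "local_param M W X" and u0: "u0 \<in> W" and N: "smooth_on W N"
    "\<And>u. u \<in> W \<Longrightarrow> \<nu> (X u) = N u \<or> \<nu> (X u) = - N u"
  shows "\<exists>\<rho>>0. ball u0 \<rho> \<subseteq> W \<and> ((\<forall>u\<in>ball u0 \<rho>. \<nu> (X u) = N u) \<or> (\<forall>u\<in>ball u0 \<rho>. \<nu> (X u) = - N u))"
proof -
  have op: "open W" and smX: "smooth_on W X" using local_paramD[OF lp] by auto
  have XM: "X u \<in> M" if "u \<in> W" for u using local_paramD(7)[OF lp] that by blast
  have N_unit: "polarK K (X u) (N u) = 0" "innerK K (N u) (N u) = 1"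
    "v \<in> tangent_space M (X u) \<Longrightarrow> innerK K v (N u) = 0" if "u \<in> W" for u v
    using N(2)[OF that] \<nu>_props(1,2)[OF XM[OF that]] \<nu>_props(3)[OF XM[OF that], of v]
    by (auto simp: polarK_simps innerK_simps innerK_commute[of K v] simp del: split_paired_All split_paired_Ex)
  define F where "F = (\<lambda>z :: (real^'n) \<times> real. cK K (snd z) *\<^sub>R X (fst z) + sK K (snd z) *\<^sub>R N (fst z))"
  define U where "U = (fst -` W :: ((real^'n) \<times> real) set)"
  have opU: "open U" unfolding U_def by (rule open_vimage_fst[OF op])
  have Cfst: "Ck_on k U (\<lambda>z. g (fst z))" if "smooth_on W g" for k and g :: "real^'n \<Rightarrow> 'n ambient"
    unfolding U_def by (rule Ck_on_compose_linear[OF op bounded_linear_fst]) (use that in \<open>simp add: smooth_on_def\<close>)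
  have Csnd: "Ck_on k U (\<lambda>z. g (snd z))" if "\<And>j. Ck_on j UNIV g" for k and g :: "real \<Rightarrow> real"
    by (rule Ck_on_real_compose[OF opU Ck_on_linear[OF opU bounded_linear_snd] that])
  have CF: "Ck_on k U F" for k
    unfolding F_def using Ck_on_sK_cK[OF K]
    by (intro Ck_on_add[OF opU] Ck_on_scaleR[OF opU] Cfst Csnd smX N(1)) auto
  have z0: "(u0, 0) \<in> U" using u0 by (simp add: U_def)
  have "(F has_derivative (\<lambda>h. frechet_derivative X (at u0) (fst h) + snd h *\<^sub>R N u0)) (at (u0, 0))"
  proof -
    have X1: "((\<lambda>z. X (fst z)) has_derivative (\<lambda>h. frechet_derivative X (at u0) (fst h))) (at (u0, 0))"
      using diff_chain_at[OF bounded_linear_imp_has_derivative[OF bounded_linear_fst], of X _ "(u0, 0)"] local_paramD(8)[OF lp u0]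
      by (simp add: o_def)
    have N1: "((\<lambda>z. N (fst z)) has_derivative (\<lambda>h. frechet_derivative N (at u0) (fst h))) (at (u0, 0))"
      using diff_chain_at[OF bounded_linear_imp_has_derivative[OF bounded_linear_fst], of N _ "(u0, 0)"] smooth_on_has_derivative[OF N(1) u0]
      by (simp add: o_def)
    have snd0: "(snd has_derivative snd) (at (u0, 0))"
      by (rule bounded_linear_imp_has_derivative[OF bounded_linear_snd])
    have c1: "((\<lambda>z. cK K (snd z)) has_derivative (\<lambda>h. 0)) (at (u0, 0))"
    proof -
      have d0: "(cK K has_real_derivative 0) (at (snd (u0, 0)))" using cK_has_derivative[OF K, of 0] by simp
      from DERIV_compose_FDERIV[OF d0 snd0] show ?thesis by simp
    qed
    have s1: "((\<lambda>z. sK K (snd z)) has_derivative snd) (at (u0, 0))"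
    proof -
      have d1: "(sK K has_real_derivative 1) (at (snd (u0, 0)))" using sK_has_derivative[OF K, of 0] by simp
      from DERIV_compose_FDERIV[OF d1 snd0] show ?thesis by simp
    qed
    show ?thesis unfolding F_def
      using has_derivative_add[OF has_derivative_scaleR[OF c1 X1] has_derivative_scaleR[OF s1 N1]] by simp
  qed
  then have DF: "frechet_derivative F (at (u0, 0)) = (\<lambda>h. frechet_derivative X (at u0) (fst h) + snd h *\<^sub>R N u0)"
    by (rule frechet_derivative_eq)
  have "inj (frechet_derivative F (at (u0, 0)))"
  proof -
    have linF: "linear (frechet_derivative F (at (u0, 0)))"
      using CF[of "Suc 0"] z0 by (intro linear_frechet_derivative) auto
    have "h = 0" if h: "frechet_derivative F (at (u0, 0)) h = 0" for h
    proof -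
      have t: "frechet_derivative X (at u0) (fst h) \<in> tangent_space M (X u0)"
        using tangent_space_local_param[OF lp u0] by blast
      have "0 = innerK K (frechet_derivative X (at u0) (fst h) + snd h *\<^sub>R N u0) (N u0)"
        using h by (simp add: DF innerK_simps)
      also have "\<dots> = snd h" using N_unit(2)[OF u0] N_unit(3)[OF u0 t] by (simp add: innerK_simps)
      finally have s: "snd h = 0" by simp
      then have "frechet_derivative X (at u0) (fst h) = 0" using h by (simp add: DF)
      then have "fst h = 0" using local_paramD(3)[OF lp u0] local_paramD(9)[OF lp u0]
        by (metis injD linear_0)
      with s show "h = 0" by (simp add: prod_eq_iff)
    qed
    then show ?thesis using linear_injective_0[OF linF] by blast
  qed
  then obtain r where r: "r > 0" "ball (u0, 0) r \<subseteq> U" "inj_on F (ball (u0, 0) r)"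
    using C1_locally_injective[OF opU CF z0] by blast
  have rW: "ball u0 r \<subseteq> W"
  proof
    fix u assume "u \<in> ball u0 r"
    then have "(u, 0) \<in> ball (u0, 0) r" by (simp add: dist_Pair_Pair)
    then show "u \<in> W" using r(2) by (auto simp: U_def)
  qed
  have F0: "F (u, 0) = X u" for u by (simp add: F_def)
  \<comment> \<open>Relative openness of the patch excludes other sheets: every point of
    \<open>M\<close> in \<open>O'\<close> has a parameter near \<open>u0\<close>.\<close>
  obtain O' where O': "open O'" "X ` (W \<inter> ball u0 (r / 2)) = M \<inter> O'"
    using local_param_openin[OF lp open_ball] by blast
  have "X u0 \<in> M \<inter> O'" using O'(2) u0 r(1) by auto
  then have F0O: "F (u0, 0) \<in> O'" by (simp add: F0)
  have contF: "continuous_on U F" using CF[of 0] by simp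
  have "open (U \<inter> F -` O')" by (rule continuous_open_preimage[OF contF opU O'(1)])
  then obtain \<delta> where \<delta>: "\<delta> > 0" "ball (u0, 0) \<delta> \<subseteq> U \<inter> F -` O'"
    using z0 F0O open_contains_ball by blast
  \<comment> \<open>The outer halving accounts for the two coordinates, whose deviations are added
    in the estimate of the product distance.\<close>
  define \<rho> where "\<rho> = min \<delta> (r / 2) / 2"
  have \<rho>: "\<rho> > 0" "\<rho> < r" using \<delta> r by (auto simp: \<rho>_def)
  have near: "(u, t) \<in> ball (u0, 0) (min \<delta> (r / 2))" if "u \<in> ball u0 \<rho>" "\<bar>t\<bar> < \<rho>" for u t
  proof -
    have "dist (u0, 0) (u, t) \<le> dist u0 u + \<bar>t\<bar>"
      using sqrt_sum_squares_le_sum_abs[of "dist u0 u" t] by (simp add: dist_Pair_Pair dist_real_def)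
    then show ?thesis using that by (simp add: \<rho>_def)
  qed
  \<comment> \<open>Such a point of \<open>M\<close> is also \<open>F (u', 0)\<close> for a
    parameter \<open>u'\<close> near \<open>u0\<close>, and local injectivity of \<open>F\<close>
    forces \<open>t = 0\<close>.\<close>
  have off: "t = 0" if u: "u \<in> ball u0 \<rho>" and t: "\<bar>t\<bar> < \<rho>" and FM: "F (u, t) \<in> M" for u t
  proof -
    have ut: "(u, t) \<in> ball (u0, 0) \<delta>" "(u, t) \<in> ball (u0, 0) r" using near[OF u t] r(1) by auto
    then have "F (u, t) \<in> M \<inter> O'" using \<delta>(2) FM by auto
    then obtain u' where u': "u' \<in> ball u0 (r / 2)" "F (u, t) = X u'" using O'(2) by blast
    have "(u', 0) \<in> ball (u0, 0) r" using u'(1) r(1) by (simp add: dist_Pair_Pair)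
    moreover have "F (u, t) = F (u', 0)" using u'(2) F0 by simp
    ultimately have "(u, t) = (u', 0)" using r(3) ut(2) by (auto dest: inj_onD)
    then show ?thesis by simp
  qed
  define C where "C = F ` (ball u0 \<rho> \<times> {0<..<\<rho>})"
  have \<rho>W: "ball u0 \<rho> \<subseteq> W" using rW \<rho>(2) by (auto simp: subset_iff)
  have F_geo: "F (u, t) = geodesic K (X u) (N u) t" for u t by (simp add: F_def geodesic_def)
  have CSF: "C \<subseteq> space_form K"
  proof
    fix p assume "p \<in> C"
    then obtain u t where "u \<in> ball u0 \<rho>" "p = F (u, t)" unfolding C_def by blast
    then have uW: "u \<in> W" and p: "p = geodesic K (X u) (N u) t" using \<rho>W F_geo by auto
    show "p \<in> space_form K" unfolding p
      using geodesic_in_space_form[OF K _ N_unit(1,2)[OF uW]] XM[OF uW] M_space_form(1) by blast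
  qed
  have connC: "connected C" unfolding C_def
  proof (rule connected_continuous_image)
    show "continuous_on (ball u0 \<rho> \<times> {0<..<\<rho>}) F"
      by (rule continuous_on_subset[OF contF]) (use \<rho>W in \<open>auto simp: U_def\<close>)
    show "connected (ball u0 \<rho> \<times> {0<..<\<rho>})"
      by (intro convex_connected convex_Times convex_ball convex_real_interval)
  qed
  have CM: "C \<inter> M = {}" unfolding C_def using off by force
  have dich: "C \<subseteq> \<Omega> \<or> C \<inter> \<Omega> = {}"
  proof (rule ccontr)
    assume "\<not> (C \<subseteq> \<Omega> \<or> C \<inter> \<Omega> = {})"
    then have "C \<inter> \<Omega> \<noteq> {}" "C - \<Omega> \<noteq> {}" by auto
    moreover have "connectedin (top_of_set (space_form K)) C" using connC CSF by (simp add: connectedin_subtopology connectedin_iff_connected)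
    ultimately have "C \<inter> top_of_set (space_form K) frontier_of \<Omega> \<noteq> {}"
      by (intro connectedin_Int_frontier_of)
    then show False using CM frontier by simp
  qed
  have out: "C \<inter> \<Omega> = {}" if u: "u \<in> ball u0 \<rho>" "\<nu> (X u) = N u" for u
  proof -
    have uW: "u \<in> W" using u(1) \<rho>W by blast
    obtain d where d: "d > 0" "\<And>t. 0 < t \<Longrightarrow> t < d \<Longrightarrow> exp_map K (X u) (t *\<^sub>R \<nu> (X u)) \<notin> \<Omega>"
      using \<nu>_props(4)[OF XM[OF uW]] by blast
    define t where "t = min d \<rho> / 2"
    have t: "0 < t" "t < d" "t < \<rho>" using d(1) \<rho>(1) by (auto simp: t_def)
    have "F (u, t) \<notin> \<Omega>" using d(2)[OF t(1,2)] exp_map_geodesic[of K "N u" "X u" t] N_unit(2)[OF uW] u(2) by (simp add: F_geo)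
    moreover have "F (u, t) \<in> C" unfolding C_def using u(1) t by auto
    ultimately show ?thesis using dich by blast
  qed
  have inn: "C \<subseteq> \<Omega> \<and> C \<noteq> {}" if u: "u \<in> ball u0 \<rho>" "\<nu> (X u) = - N u" for u
  proof -
    have uW: "u \<in> W" using u(1) \<rho>W by blast
    obtain d where d: "d > 0" "\<And>t. 0 < t \<Longrightarrow> t < d \<Longrightarrow> exp_map K (X u) (- t *\<^sub>R \<nu> (X u)) \<in> \<Omega>"
      using \<nu>_props(4)[OF XM[OF uW]] by blast
    define t where "t = min d \<rho> / 2"
    have t: "0 < t" "t < d" "t < \<rho>" using d(1) \<rho>(1) by (auto simp: t_def)
    have "F (u, t) \<in> \<Omega>" using d(2)[OF t(1,2)] exp_map_geodesic[of K "N u" "X u" t] N_unit(2)[OF uW] u(2) by (simp add: F_geo)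
    moreover have "F (u, t) \<in> C" unfolding C_def using u(1) t by auto
    ultimately show ?thesis using dich by blast
  qed
  have "(\<forall>u\<in>ball u0 \<rho>. \<nu> (X u) = N u) \<or> (\<forall>u\<in>ball u0 \<rho>. \<nu> (X u) = - N u)"
  proof (cases "C \<inter> \<Omega> = {}")
    case True
    then have "\<nu> (X u) = N u" if "u \<in> ball u0 \<rho>" for u using inn[OF that] N(2)[of u] that \<rho>W by blast
    then show ?thesis by blast
  next
    case False
    then have "\<nu> (X u) = - N u" if "u \<in> ball u0 \<rho>" for u using out[OF that] N(2)[of u] that \<rho>W by blast
    then show ?thesis by blast
  qed
  then show ?thesis using \<rho>(1) \<rho>W by blast
qed

lemma normal_smooth:
  fixes X :: "real^'n \<Rightarrow> 'n ambient"
  assumes lp: "local_param M W X"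
  shows "smooth_on W (\<lambda>u. \<nu> (X u))"
  unfolding smooth_on_def
proof
  fix k
  obtain N where N: "smooth_on W N" "\<And>u. u \<in> W \<Longrightarrow> \<nu> (X u) = N u \<or> \<nu> (X u) = - N u"
    using local_unit_normal[OF lp] by blast
  show "Ck_on k W (\<lambda>u. \<nu> (X u))"
  proof (rule Ck_on_local)
    fix u0 assume u0: "u0 \<in> W"
    obtain \<rho> where \<rho>: "\<rho> > 0" "ball u0 \<rho> \<subseteq> W"
      "(\<forall>u\<in>ball u0 \<rho>. \<nu> (X u) = N u) \<or> (\<forall>u\<in>ball u0 \<rho>. \<nu> (X u) = - N u)"
      using normal_locally_smooth[OF lp u0 N] by blast
    have C: "Ck_on k (ball u0 \<rho>) N" using N(1) \<rho>(2) Ck_on_subset unfolding smooth_on_def by blast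
    have "Ck_on k (ball u0 \<rho>) (\<lambda>u. \<nu> (X u))"
      using \<rho>(3)
    proof
      assume "\<forall>u\<in>ball u0 \<rho>. \<nu> (X u) = N u"
      then show ?thesis by (intro Ck_on_cong[OF open_ball C]) simp
    next
      assume "\<forall>u\<in>ball u0 \<rho>. \<nu> (X u) = - N u"
      then show ?thesis by (intro Ck_on_cong[OF open_ball Ck_on_minus[OF open_ball C]]) simp
    qed
    then show "\<exists>V. open V \<and> u0 \<in> V \<and> Ck_on k V (\<lambda>u. \<nu> (X u))"
      using \<rho>(1) by (intro exI[of _ "ball u0 \<rho>"]) simp
  qed
qed

end

section \<open>Continuity of the principal curvatures\<close>

text \<open>The images of the two coordinate subspaces have dimensions \<open>card I\<close> and
  \<open>card J\<close>, whose sum exceeds the dimension of the space.\<close>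

lemma coordinate_subspaces_intersect:
  fixes R R' :: "real^'m \<Rightarrow> real^'m"
  assumes R: "linear R" "inj R" and R': "linear R'" "inj R'" and c: "CARD('m) < card I + card J"
  shows "\<exists>y y'. R y \<noteq> 0 \<and> R y = R' y' \<and> (\<forall>i. i \<notin> I \<longrightarrow> y $ i = 0) \<and> (\<forall>i. i \<notin> J \<longrightarrow> y' $ i = 0)"
proof -
  let ?A = "{y :: real^'m. \<forall>i. i \<notin> I \<longrightarrow> y $ i = 0}" and ?B = "{y :: real^'m. \<forall>i. i \<notin> J \<longrightarrow> y $ i = 0}"
  have sA: "subspace ?A" and sB: "subspace ?B" by (auto simp: subspace_def)
  have "dim (R ` ?A) = card I" using dim_image_eq[OF R(1), of ?A] R(2) 
    dim_substandard_cart[where 'a = real and 'n = 'm] by (simp add: dim_vec_eq inj_on_subset)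
  moreover have "dim (R' ` ?B) = card J" using dim_image_eq[OF R'(1), of ?B] R'(2) 
    dim_substandard_cart[where 'a = real and 'n = 'm] by (simp add: dim_vec_eq inj_on_subset)
  moreover have "dim {a + b |a b. a \<in> R ` ?A \<and> b \<in> R' ` ?B} + dim (R ` ?A \<inter> R' ` ?B) = dim (R ` ?A) + dim (R' ` ?B)"
    by (intro dim_sums_Int linear_subspace_image R R' sA sB)
  moreover have "dim {a + b |a b. a \<in> R ` ?A \<and> b \<in> R' ` ?B} \<le> CARD('m)"
    using dim_subset_UNIV[of "{a + b |a b. a \<in> R ` ?A \<and> b \<in> R' ` ?B}"] by simp
  ultimately have "dim (R ` ?A \<inter> R' ` ?B) > 0" using c by linarith
  then have "\<not> R ` ?A \<inter> R' ` ?B \<subseteq> {0}" unfolding dim_eq_0[symmetric] by (rule gr_implies_not0)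
  then obtain z where z: "z \<in> R ` ?A" "z \<in> R' ` ?B" "z \<noteq> 0" by blast
  from z(1) obtain y where y: "z = R y" "y \<in> ?A" by blast
  from z(2) obtain y' where y': "z = R' y'" "y' \<in> ?B" by blast
  show ?thesis by (intro exI[of _ y] exI[of _ y']) (use y y' z(3) in simp)
qed

text \<open>R maps the coordinate axes to a simultaneous orthonormal eigenbasis of the quadratic forms G and
  A, with eigenvalues l.\<close>

definition eigenframe ::
    "(real^'m \<Rightarrow> real) \<Rightarrow> (real^'m \<Rightarrow> real) \<Rightarrow> ('m \<Rightarrow> nat) \<Rightarrow> (nat \<Rightarrow> real) \<Rightarrow> (real^'m \<Rightarrow> real^'m) \<Rightarrow> bool" where
  "eigenframe G A \<beta> l R \<longleftrightarrow> linear R \<and> inj R \<and> bij_betw \<beta> UNIV {1..CARD('m)} \<and>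
     (\<forall>y. G (R y) = (\<Sum>i\<in>UNIV. (y $ i)\<^sup>2)) \<and> (\<forall>y. A (R y) = (\<Sum>i\<in>UNIV. l (\<beta> i) * (y $ i)\<^sup>2)) \<and>
     (\<forall>i\<in>{1..CARD('m)}. \<forall>j\<in>{1..CARD('m)}. i \<le> j \<longrightarrow> l j \<le> l i)"

lemma eigenframe_card:
  fixes \<beta> :: "'m::finite \<Rightarrow> nat"
  assumes "bij_betw \<beta> UNIV {1..CARD('m)}" "k \<in> {1..CARD('m)}"
  shows "card {i. \<beta> i \<le> k} = k" "card {i. k \<le> \<beta> i} = CARD('m) + 1 - k"
proof -
  have inj: "inj \<beta>" and im: "range \<beta> = {1..CARD('m)}" using assms(1) by (auto simp: bij_betw_def)
  have "\<beta> ` {i. \<beta> i \<le> k} = {1..k}"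
  proof
    show "{1..k} \<subseteq> \<beta> ` {i. \<beta> i \<le> k}"
    proof
      fix m assume m: "m \<in> {1..k}"
      then have "m \<in> range \<beta>" using im assms(2) by auto
      then show "m \<in> \<beta> ` {i. \<beta> i \<le> k}" using m by auto
    qed
  qed (use im in auto)
  then show "card {i. \<beta> i \<le> k} = k" using card_image[OF inj_on_subset[OF inj], of "{i. \<beta> i \<le> k}"] by simp
  have "\<beta> ` {i. k \<le> \<beta> i} = {k..CARD('m)}"
  proof
    show "{k..CARD('m)} \<subseteq> \<beta> ` {i. k \<le> \<beta> i}"
    proof
      fix m assume m: "m \<in> {k..CARD('m)}"
      then have "m \<in> range \<beta>" using im assms(2) by auto
      then show "m \<in> \<beta> ` {i. k \<le> \<beta> i}" using m by auto
    qed
  qed (use im in auto)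
  then show "card {i. k \<le> \<beta> i} = CARD('m) + 1 - k"
    using card_image[OF inj_on_subset[OF inj], of "{i. k \<le> \<beta> i}"] by simp
qed

text \<open>The Courant-Fischer argument: a span of the first k eigenvectors of one pair of forms meets the
  span of the last n + 1 - k eigenvectors of the other.\<close>

lemma eigenvalue_perturbation:
  fixes G A G' A' :: "real^'m \<Rightarrow> real"
  assumes F: "eigenframe G A \<beta> l R" and F': "eigenframe G' A' \<beta>' l' R'" and k: "k \<in> {1..CARD('m)}"
    and Gd: "\<And>b. \<bar>G' b - G b\<bar> \<le> \<delta> * (norm b)\<^sup>2" and Ad: "\<And>b. \<bar>A' b - A b\<bar> \<le> \<delta> * (norm b)\<^sup>2"
    and c: "\<And>b. c * (norm b)\<^sup>2 \<le> G b" and d: "\<delta> < c"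
  shows "\<bar>l' k - l k\<bar> \<le> \<delta> * (1 + \<bar>l k\<bar>) / (c - \<delta>)"
proof -
  note F = F[unfolded eigenframe_def] and F' = F'[unfolded eigenframe_def]
  have bk: "\<beta> i \<in> {1..CARD('m)}" "\<beta>' i \<in> {1..CARD('m)}" for i using F F' by (auto simp: bij_betw_def)
  have up: "A (R y) \<le> l k * G (R y)" if "\<forall>i. i \<notin> {i. k \<le> \<beta> i} \<longrightarrow> y $ i = 0" for y
  proof -
    have "A (R y) = (\<Sum>i\<in>UNIV. l (\<beta> i) * (y $ i)\<^sup>2)" using F by blast
    also have "\<dots> \<le> (\<Sum>i\<in>UNIV. l k * (y $ i)\<^sup>2)"
    proof (rule sum_mono)
      fix i show "l (\<beta> i) * (y $ i)\<^sup>2 \<le> l k * (y $ i)\<^sup>2"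
        using that F k bk(1)[of i] by (cases "k \<le> \<beta> i") (auto intro: mult_right_mono)
    qed
    also have "\<dots> = l k * G (R y)" using F by (simp add: sum_distrib_left)
    finally show ?thesis .
  qed
  have lo: "l k * G (R y) \<le> A (R y)" if "\<forall>i. i \<notin> {i. \<beta> i \<le> k} \<longrightarrow> y $ i = 0" for y
  proof -
    have "l k * G (R y) = (\<Sum>i\<in>UNIV. l k * (y $ i)\<^sup>2)" using F by (simp add: sum_distrib_left)
    also have "\<dots> \<le> (\<Sum>i\<in>UNIV. l (\<beta> i) * (y $ i)\<^sup>2)"
    proof (rule sum_mono)
      fix i show "l k * (y $ i)\<^sup>2 \<le> l (\<beta> i) * (y $ i)\<^sup>2"
        using that F k bk(1)[of i] by (cases "\<beta> i \<le> k") (auto intro: mult_right_mono)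
    qed
    also have "\<dots> = A (R y)" using F by simp
    finally show ?thesis .
  qed
  have up': "A' (R' y) \<le> l' k * G' (R' y)" if "\<forall>i. i \<notin> {i. k \<le> \<beta>' i} \<longrightarrow> y $ i = 0" for y
  proof -
    have "A' (R' y) = (\<Sum>i\<in>UNIV. l' (\<beta>' i) * (y $ i)\<^sup>2)" using F' by blast
    also have "\<dots> \<le> (\<Sum>i\<in>UNIV. l' k * (y $ i)\<^sup>2)"
    proof (rule sum_mono)
      fix i show "l' (\<beta>' i) * (y $ i)\<^sup>2 \<le> l' k * (y $ i)\<^sup>2"
        using that F' k bk(2)[of i] by (cases "k \<le> \<beta>' i") (auto intro: mult_right_mono)
    qed
    also have "\<dots> = l' k * G' (R' y)" using F' by (simp add: sum_distrib_left)
    finally show ?thesis .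
  qed
  have lo': "l' k * G' (R' y) \<le> A' (R' y)" if "\<forall>i. i \<notin> {i. \<beta>' i \<le> k} \<longrightarrow> y $ i = 0" for y
  proof -
    have "l' k * G' (R' y) = (\<Sum>i\<in>UNIV. l' k * (y $ i)\<^sup>2)" using F' by (simp add: sum_distrib_left)
    also have "\<dots> \<le> (\<Sum>i\<in>UNIV. l' (\<beta>' i) * (y $ i)\<^sup>2)"
    proof (rule sum_mono)
      fix i show "l' k * (y $ i)\<^sup>2 \<le> l' (\<beta>' i) * (y $ i)\<^sup>2"
        using that F' k bk(2)[of i] by (cases "\<beta>' i \<le> k") (auto intro: mult_right_mono)
    qed
    also have "\<dots> = A' (R' y)" using F' by simp
    finally show ?thesis .
  qed
  \<comment> \<open>On a common vector \<open>b\<close> of the two spans, the change of the forms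
    costs at most \<open>\<delta> * (1 + \<bar>l k\<bar>) * (norm b)^2\<close>, while
    \<open>G' b\<close> is at least \<open>(c - \<delta>) * (norm b)^2\<close>. The quotient is the
    bound.\<close>
  have fin: "s \<le> \<delta> * (1 + \<bar>l k\<bar>) / (c - \<delta>)"
    if b: "b \<noteq> 0" and s: "s * G' b \<le> \<delta> * (1 + \<bar>l k\<bar>) * (norm b)\<^sup>2" for s b
  proof (cases "s \<le> 0")
    case True
    have "0 \<le> \<delta> * (norm b)\<^sup>2" using Gd[of b] by (rule order_trans[OF abs_ge_zero])
    then have "0 \<le> \<delta>" using b by (simp add: zero_le_mult_iff)
    then have "0 \<le> \<delta> * (1 + \<bar>l k\<bar>) / (c - \<delta>)" using d by simp
    with True show ?thesis by linarith
  next
    case False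
    have nb: "(norm b)\<^sup>2 > 0" using b by simp
    have "(c - \<delta>) * (norm b)\<^sup>2 \<le> G' b" using c[of b] Gd[of b] by (simp add: left_diff_distrib)
    then have "s * ((c - \<delta>) * (norm b)\<^sup>2) \<le> s * G' b" using False by simp
    then have "(s * (c - \<delta>)) * (norm b)\<^sup>2 \<le> (\<delta> * (1 + \<bar>l k\<bar>)) * (norm b)\<^sup>2" using s by (simp only: mult.assoc)
    then have "s * (c - \<delta>) \<le> \<delta> * (1 + \<bar>l k\<bar>)" using nb by simp
    then show ?thesis using d by (simp add: pos_le_divide_eq)
  qed
  have lG: "\<bar>l k * G' b - l k * G b\<bar> \<le> \<bar>l k\<bar> * (\<delta> * (norm b)\<^sup>2)" for b
    using mult_left_mono[OF Gd[of b], of "\<bar>l k\<bar>"] by (simp add: abs_mult flip: right_diff_distrib)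
  have ex: "\<delta> * (1 + \<bar>l k\<bar>) * (norm b)\<^sup>2 = \<delta> * (norm b)\<^sup>2 + \<bar>l k\<bar> * (\<delta> * (norm b)\<^sup>2)" for b :: "real^'m"
    by (simp add: algebra_simps)
  have "l' k - l k \<le> \<delta> * (1 + \<bar>l k\<bar>) / (c - \<delta>)"
  proof -
    have cd: "CARD('m) < card {i. k \<le> \<beta> i} + card {i. \<beta>' i \<le> k}"
      using eigenframe_card[of \<beta> k] eigenframe_card[of \<beta>' k] F F' k by auto
    obtain y y' where y: "R y \<noteq> 0" "R y = R' y'" "\<forall>i. i \<notin> {i. k \<le> \<beta> i} \<longrightarrow> y $ i = 0"
      "\<forall>i. i \<notin> {i. \<beta>' i \<le> k} \<longrightarrow> y' $ i = 0"
      using coordinate_subspaces_intersect[OF _ _ _ _ cd, of R R'] F F' by auto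
    have "(l' k - l k) * G' (R y) \<le> \<delta> * (1 + \<bar>l k\<bar>) * (norm (R y))\<^sup>2"
      using up[OF y(3)] lo'[OF y(4)] Ad[of "R y"] lG[of "R y"] unfolding ex y(2)[symmetric] left_diff_distrib by linarith
    then show ?thesis by (rule fin[OF y(1)])
  qed
  moreover have "l k - l' k \<le> \<delta> * (1 + \<bar>l k\<bar>) / (c - \<delta>)"
  proof -
    have cd: "CARD('m) < card {i. \<beta> i \<le> k} + card {i. k \<le> \<beta>' i}"
      using eigenframe_card[of \<beta> k] eigenframe_card[of \<beta>' k] F F' k by auto
    obtain y y' where y: "R y \<noteq> 0" "R y = R' y'" "\<forall>i. i \<notin> {i. \<beta> i \<le> k} \<longrightarrow> y $ i = 0"
      "\<forall>i. i \<notin> {i. k \<le> \<beta>' i} \<longrightarrow> y' $ i = 0"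
      using coordinate_subspaces_intersect[OF _ _ _ _ cd, of R R'] F F' by auto
    have "(l k - l' k) * G' (R y) \<le> \<delta> * (1 + \<bar>l k\<bar>) * (norm (R y))\<^sup>2"
      using lo[OF y(3)] up'[OF y(4)] Ad[of "R y"] lG[of "R y"] unfolding ex y(2)[symmetric] left_diff_distrib by linarith
    then show ?thesis by (rule fin[OF y(1)])
  qed
  ultimately show ?thesis by (simp add: abs_le_iff)
qed

text \<open>Writing \<open>b = R y\<close>, the form \<open>G b\<close> is the square of
  \<open>norm y\<close>, and a bound \<open>C\<close> for the linear map \<open>R\<close> compares
  it with \<open>norm b\<close>.\<close>

lemma eigenframe_lower_bound:
  fixes G :: "real^'m \<Rightarrow> real"
  assumes "eigenframe G A \<beta> l R"
  shows "\<exists>c>0. \<forall>b. c * (norm b)\<^sup>2 \<le> G b"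
proof -
  note F = assms[unfolded eigenframe_def]
  obtain C where C: "C > 0" "\<And>y. norm (R y) \<le> C * norm y"
    using F linear_bounded_pos by blast
  have "inverse (C\<^sup>2) * (norm b)\<^sup>2 \<le> G b" for b
  proof -
    have "surj R" using F linear_injective_imp_surjective by blast
    then obtain y where y: "b = R y" by (metis surjD)
    have G: "G b = (norm y)\<^sup>2" using F by (simp add: y norm_vec_def L2_set_def sum_nonneg)
    have "(norm b)\<^sup>2 \<le> (C * norm y)\<^sup>2" unfolding y by (rule power_mono[OF C(2)]) simp
    then have "(norm b)\<^sup>2 \<le> C\<^sup>2 * G b" by (simp add: G power_mult_distrib)
    then show ?thesis using C(1) by (simp add: field_simps)
  qed
  moreover have "inverse (C\<^sup>2) > 0" using C(1) by simp
  ultimately show ?thesis by blast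
qed

text \<open>A product of two components of \<open>b\<close> is at most \<open>(norm b)^2\<close>, so
  the sum of the entrywise deviations controls the forms uniformly in \<open>b\<close>.\<close>

lemma quadratic_form_close:
  fixes B :: "'x::topological_space \<Rightarrow> real^'m \<Rightarrow> real^'m \<Rightarrow> real"
  assumes bil: "\<And>x. x \<in> S \<Longrightarrow> bilinear (B x)" and x0: "x0 \<in> S"
    and cont: "\<And>i j. continuous_on S (\<lambda>x. B x (axis i 1) (axis j 1))" and \<delta>: "\<delta> > 0"
  shows "\<forall>\<^sub>F x in at x0 within S. \<forall>b. \<bar>B x b b - B x0 b b\<bar> \<le> \<delta> * (norm b)\<^sup>2"
proof -
  let ?E = "\<lambda>x. \<Sum>i\<in>UNIV. \<Sum>j\<in>UNIV. \<bar>B x (axis i 1) (axis j 1) - B x0 (axis i 1) (axis j 1)\<bar>"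
  have "((\<lambda>x. ?E x) \<longlongrightarrow> (\<Sum>i\<in>(UNIV :: 'm set). \<Sum>j\<in>(UNIV :: 'm set). \<bar>B x0 (axis i 1) (axis j 1) - B x0 (axis i 1) (axis j 1)\<bar>)) (at x0 within S)"
    using cont x0 by (intro tendsto_sum tendsto_rabs tendsto_diff tendsto_const) (auto simp: continuous_on_def)
  then have "(?E \<longlongrightarrow> 0) (at x0 within S)" by simp
  then have "\<forall>\<^sub>F x in at x0 within S. ?E x < \<delta>" using \<delta> by (rule order_tendstoD)
  moreover have "\<forall>\<^sub>F x in at x0 within S. x \<in> S" by (simp add: eventually_at_filter)
  ultimately show ?thesis
  proof eventually_elim
    case (elim x)
    show ?case
    proof
      fix b :: "real^'m"
      have ex: "B y b b = (\<Sum>i\<in>UNIV. \<Sum>j\<in>UNIV. (b $ i) * (b $ j) * B y (axis i 1) (axis j 1))" if "y \<in> S" for y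
      proof -
        have b: "b = (\<Sum>i\<in>UNIV. (b $ i) *\<^sub>R axis i 1)" using basis_expansion[of b] by (simp add: scalar_mult_eq_scaleR)
        have "B y (\<Sum>i\<in>UNIV. (b $ i) *\<^sub>R axis i 1) (\<Sum>i\<in>UNIV. (b $ i) *\<^sub>R axis i 1) =
            (\<Sum>i\<in>UNIV. \<Sum>j\<in>UNIV. (b $ i) * (b $ j) * B y (axis i 1) (axis j 1))"
          by (subst bilinear_sum[OF bil[OF that]])
            (simp_all add: sum.cartesian_product bilinear_lmul[OF bil[OF that]] bilinear_rmul[OF bil[OF that]] mult_ac)
        then show ?thesis using b by metis
      qed
      have "\<bar>B x b b - B x0 b b\<bar> = \<bar>\<Sum>i\<in>UNIV. \<Sum>j\<in>UNIV. (b $ i) * (b $ j) * (B x (axis i 1) (axis j 1) - B x0 (axis i 1) (axis j 1))\<bar>"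
        by (simp add: ex[OF elim(2)] ex[OF x0] right_diff_distrib sum_subtractf)
      also have "\<dots> \<le> (\<Sum>i\<in>UNIV. \<Sum>j\<in>UNIV. \<bar>(b $ i) * (b $ j) * (B x (axis i 1) (axis j 1) - B x0 (axis i 1) (axis j 1))\<bar>)"
        by (intro order_trans[OF sum_abs] sum_mono sum_abs)
      also have "\<dots> \<le> (\<Sum>i\<in>UNIV. \<Sum>j\<in>UNIV. (norm b)\<^sup>2 * \<bar>B x (axis i 1) (axis j 1) - B x0 (axis i 1) (axis j 1)\<bar>)"
      proof (intro sum_mono)
        fix i j
        have "\<bar>b $ i\<bar> * \<bar>b $ j\<bar> \<le> norm b * norm b"
          by (intro mult_mono component_le_norm_cart) auto
        then show "\<bar>(b $ i) * (b $ j) * (B x (axis i 1) (axis j 1) - B x0 (axis i 1) (axis j 1))\<bar>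
            \<le> (norm b)\<^sup>2 * \<bar>B x (axis i 1) (axis j 1) - B x0 (axis i 1) (axis j 1)\<bar>"
          by (simp add: abs_mult power2_eq_square mult_right_mono)
      qed
      also have "\<dots> = (norm b)\<^sup>2 * ?E x" by (simp add: sum_distrib_left)
      also have "\<dots> \<le> (norm b)\<^sup>2 * \<delta>" using elim(1) by (intro mult_left_mono) auto
      finally show "\<bar>B x b b - B x0 b b\<bar> \<le> \<delta> * (norm b)\<^sup>2" by (simp add: mult.commute)
    qed
  qed
qed

context hypersurface
begin

section \<open>The shape operator in coordinates\<close>

definition dnormal :: "(real^'n \<Rightarrow> 'n ambient) \<Rightarrow> real^'n \<Rightarrow> real^'n \<Rightarrow> 'n ambient" where
  "dnormal X u = frechet_derivative (\<lambda>u. \<nu> (X u)) (at u)"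

text \<open>The vectors a i are mapped to a principal orthonormal frame, and L b lists the coefficients of
  the image of b with respect to it.\<close>

definition principal_coords ::
    "(real^'n \<Rightarrow> 'n ambient) \<Rightarrow> real^'n \<Rightarrow> ('n \<Rightarrow> nat) \<Rightarrow> (real^'n \<Rightarrow> real^'n) \<Rightarrow> ('n \<Rightarrow> real^'n) \<Rightarrow> bool" where
  "principal_coords X u \<beta> L a \<longleftrightarrow> bij_betw \<beta> (UNIV :: 'n set) {1..CARD('n)} \<and> linear L \<and> inj L \<and>
    (\<forall>i j. innerK K (frechet_derivative X (at u) (a i)) (frechet_derivative X (at u) (a j)) = (if i = j then 1 else 0)) \<and>
    (\<forall>b. b = (\<Sum>i\<in>UNIV. (L b $ i) *\<^sub>R a i)) \<and> (\<forall>y. L (\<Sum>i\<in>UNIV. (y $ i) *\<^sub>R a i) = y) \<and>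
    (\<forall>b. frechet_derivative X (at u) b = (\<Sum>i\<in>UNIV. (L b $ i) *\<^sub>R frechet_derivative X (at u) (a i))) \<and>
    (\<forall>b. dnormal X u b = (\<Sum>i\<in>UNIV. (L b $ i * lam (\<beta> i) (X u)) *\<^sub>R frechet_derivative X (at u) (a i)))"

lemma principal_coordsD:
  assumes "principal_coords X u \<beta> L a"
  shows "bij_betw \<beta> (UNIV :: 'n set) {1..CARD('n)}" "linear L" "inj L"
    "innerK K (frechet_derivative X (at u) (a i)) (frechet_derivative X (at u) (a j)) = (if i = j then 1 else 0)"
    "L (\<Sum>i\<in>UNIV. (y $ i) *\<^sub>R a i) = y"
    "frechet_derivative X (at u) b = (\<Sum>i\<in>UNIV. (L b $ i) *\<^sub>R frechet_derivative X (at u) (a i))"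
    "dnormal X u b = (\<Sum>i\<in>UNIV. (L b $ i * lam (\<beta> i) (X u)) *\<^sub>R frechet_derivative X (at u) (a i))"
  using assms unfolding principal_coords_def by blast+

context
  fixes W :: "(real^'n) set" and X :: "real^'n \<Rightarrow> 'n ambient"
  assumes lp: "local_param M W X"
begin

lemma X_in_M: "u \<in> W \<Longrightarrow> X u \<in> M" "u \<in> W \<Longrightarrow> X u \<in> space_form K"
  using local_paramD(7)[OF lp] M_space_form(1) by auto

lemma dnormal_has_derivative: "u \<in> W \<Longrightarrow> ((\<lambda>u. \<nu> (X u)) has_derivative dnormal X u) (at u)"
  unfolding dnormal_def by (rule smooth_on_has_derivative[OF normal_smooth[OF lp]])

lemma dnormal_linear: "u \<in> W \<Longrightarrow> linear (dnormal X u)"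
  using has_derivative_linear[OF dnormal_has_derivative] .

lemma DX_tangent: "u \<in> W \<Longrightarrow> frechet_derivative X (at u) a \<in> tangent_space M (X u)"
  using tangent_space_local_param[OF lp] by blast

lemma DX_props:
  assumes "u \<in> W"
  shows "polarK K (X u) (frechet_derivative X (at u) a) = 0"
    "innerK K (frechet_derivative X (at u) a) (\<nu> (X u)) = 0"
  using DX_tangent[OF assms, of a] tangent_space_M[OF X_in_M(1)[OF assms]] by auto

text \<open>Differentiate \<open>polarK K (X u) (\<nu> (X u)) = 0\<close> and
  \<open>innerK K (\<nu> (X u)) (\<nu> (X u)) = 1\<close>. The additional term of the first identity
  vanishes because \<open>\<nu>\<close> is normal to \<open>M\<close>.\<close>

lemma dnormal_tangent:
  assumes u: "u \<in> W"
  shows "dnormal X u a \<in> tangent_space M (X u)"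
proof -
  have op: "open W" using local_paramD(1)[OF lp] .
  note dX = local_paramD(8)[OF lp u] and dn = dnormal_has_derivative[OF u]
  have p1: "((\<lambda>u. polarK K (X u) (\<nu> (X u))) has_derivative
      (\<lambda>a. polarK K (X u) (dnormal X u a) + polarK K (frechet_derivative X (at u) a) (\<nu> (X u)))) (at u)"
    by (rule bounded_bilinear.FDERIV[OF polarK_bounded_bilinear dX dn])
  have p0: "((\<lambda>u. polarK K (X u) (\<nu> (X u))) has_derivative (\<lambda>a. 0)) (at u)"
    by (rule has_derivative_transform_within_open[OF has_derivative_const[of 0] op u])
       (simp add: \<nu>_props(1)[OF X_in_M(1)])
  have "polarK K (X u) (dnormal X u a) + polarK K (frechet_derivative X (at u) a) (\<nu> (X u)) = 0"
    by (rule fun_cong[OF has_derivative_unique[OF p1 p0], of a])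
  moreover have "polarK K (frechet_derivative X (at u) a) (\<nu> (X u)) = 0"
    using polarK_tangent(1)[OF K X_in_M(2)[OF u] DX_props(1)[OF u]] DX_props(2)[OF u] by simp
  ultimately have p: "polarK K (X u) (dnormal X u a) = 0" by simp
  have i1: "((\<lambda>u. innerK K (\<nu> (X u)) (\<nu> (X u))) has_derivative
      (\<lambda>a. innerK K (\<nu> (X u)) (dnormal X u a) + innerK K (dnormal X u a) (\<nu> (X u)))) (at u)"
    by (rule bounded_bilinear.FDERIV[OF innerK_bounded_bilinear dn dn])
  have i0: "((\<lambda>u. innerK K (\<nu> (X u)) (\<nu> (X u))) has_derivative (\<lambda>a. 0)) (at u)"
    by (rule has_derivative_transform_within_open[OF has_derivative_const[of 1] op u])
       (simp add: \<nu>_props(2)[OF X_in_M(1)])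
  have "innerK K (\<nu> (X u)) (dnormal X u a) + innerK K (dnormal X u a) (\<nu> (X u)) = 0"
    by (rule fun_cong[OF has_derivative_unique[OF i1 i0], of a])
  then have "innerK K (dnormal X u a) (\<nu> (X u)) = 0" by (simp add: innerK_commute)
  with p show ?thesis by (simp add: tangent_space_M[OF X_in_M(1)[OF u]])
qed

text \<open>Every curve with the given velocity lifts to the chart, so the chain rule yields the
  same derivative for all of them and the description in \<open>cov_deriv\<close> denotes. The
  projection changes nothing because this derivative is already tangent.\<close>

lemma cov_deriv_normal:
  assumes u: "u \<in> W"
  shows "cov_deriv K M \<nu> (X u) (frechet_derivative X (at u) a) = dnormal X u a"
proof -
  let ?v = "frechet_derivative X (at u) a"
  have P: "((\<lambda>t. \<nu> (\<gamma> t)) has_vector_derivative dnormal X u a) (at 0)" if g: "curve_through M (X u) ?v \<gamma>" for \<gamma>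
  proof -
    obtain \<delta> c a' where c: "\<delta> > 0" "\<forall>t. \<bar>t\<bar> < \<delta> \<longrightarrow> c t \<in> W \<and> X (c t) = \<gamma> t" "c 0 = u"
      "(c has_vector_derivative a') (at 0)" "?v = frechet_derivative X (at u) a'"
      using curve_through_local_param[OF lp u g] by blast
    have a': "a' = a" using local_paramD(3)[OF lp u] c(5) by (auto dest: injD)
    have "((\<lambda>t. \<nu> (X (c t))) has_vector_derivative dnormal X u a) (at 0)"
      using vector_derivative_diff_chain_within[OF c(4), of "\<lambda>u. \<nu> (X u)" "dnormal X u"]
        dnormal_has_derivative[OF u] c(3) a' by (simp add: o_def has_derivative_at_withinI)
    then show ?thesis
      by (rule has_vector_derivative_transform_within_open[where S = "{-\<delta><..<\<delta>}"])
         (use c(1,2) in \<open>auto simp: abs_less_iff\<close>)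
  qed
  have "(THE w. \<forall>\<gamma>. curve_through M (X u) ?v \<gamma> \<longrightarrow> ((\<lambda>t. \<nu> (\<gamma> t)) has_vector_derivative w) (at 0)) = dnormal X u a"
  proof (rule the_equality)
    fix w assume "\<forall>\<gamma>. curve_through M (X u) ?v \<gamma> \<longrightarrow> ((\<lambda>t. \<nu> (\<gamma> t)) has_vector_derivative w) (at 0)"
    then show "w = dnormal X u a"
      using curve_through_line[OF lp u, of a] P[OF curve_through_line[OF lp u, of a]]
      by (auto dest: vector_derivative_unique_at)
  qed (use P in simp)
  moreover have "K * innerK K (dnormal X u a) (X u) = 0"
    using innerK_position(2)[OF K X_in_M(2)[OF u]] dnormal_tangent[OF u] tangent_space_M[OF X_in_M(1)[OF u]] by blast
  ultimately show ?thesis unfolding cov_deriv_def tangential_def by simp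
qed

text \<open>The eigenvalue equation is given in weak form, tested against tangent vectors. The
  defect \<open>d\<close> is itself tangent, so testing with \<open>d\<close> gives
  \<open>innerK K d d = 0\<close>.\<close>

lemma principal_frame:
  assumes u: "u \<in> W"
  shows "\<exists>\<beta> a. bij_betw \<beta> (UNIV :: 'n set) {1..CARD('n)} \<and>
    (\<forall>i j. innerK K (frechet_derivative X (at u) (a i)) (frechet_derivative X (at u) (a j)) = (if i = j then 1 else 0)) \<and>
    (\<forall>i. dnormal X u (a i) = lam (\<beta> i) (X u) *\<^sub>R frechet_derivative X (at u) (a i))"
proof -
  let ?D = "frechet_derivative X (at u)"
  obtain e where e: "\<forall>i\<in>{1..CARD('n)}. e i \<in> tangent_space M (X u)"
    "\<forall>i\<in>{1..CARD('n)}. \<forall>j\<in>{1..CARD('n)}. innerK K (e i) (e j) = (if i = j then 1 else 0)"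
    "\<forall>i\<in>{1..CARD('n)}. \<forall>w\<in>tangent_space M (X u). second_fundamental_form K M \<nu> (X u) (e i) w = lam i (X u) * innerK K (e i) w"
    using curvatures X_in_M(1)[OF u] unfolding principal_curvatures_def by blast
  obtain \<beta> :: "'n \<Rightarrow> nat" where \<beta>: "bij_betw \<beta> UNIV {1..CARD('n)}"
    using finite_same_card_bij[of "UNIV :: 'n set" "{1..CARD('n)}"] by auto
  have \<beta>i: "\<beta> i \<in> {1..CARD('n)}" for i using \<beta> by (auto simp: bij_betw_def)
  define a where "a = (\<lambda>i. inv ?D (e (\<beta> i)))"
  have Da: "?D (a i) = e (\<beta> i)" for i
  proof -
    have "e (\<beta> i) \<in> range ?D" using e(1) \<beta>i tangent_space_local_param[OF lp u] by blast
    then show ?thesis unfolding a_def by (rule f_inv_into_f)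
  qed
  have "dnormal X u (a i) = lam (\<beta> i) (X u) *\<^sub>R ?D (a i)" for i
  proof -
    define d where "d = dnormal X u (a i) - lam (\<beta> i) (X u) *\<^sub>R ?D (a i)"
    have dT: "d \<in> tangent_space M (X u)"
      using dnormal_tangent[OF u, of "a i"] DX_tangent[OF u, of "a i"]
      by (simp add: d_def tangent_space_M[OF X_in_M(1)[OF u]] polarK_simps innerK_simps)
    have "second_fundamental_form K M \<nu> (X u) (e (\<beta> i)) d = lam (\<beta> i) (X u) * innerK K (e (\<beta> i)) d"
      using e(3) \<beta>i dT by blast
    then have "innerK K (dnormal X u (a i)) d = lam (\<beta> i) (X u) * innerK K (?D (a i)) d"
      unfolding second_fundamental_form_def Da[symmetric] cov_deriv_normal[OF u] .
    then have "innerK K d d = 0" by (subst d_def) (simp add: innerK_simps)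
    moreover have "polarK K (X u) d = 0" using dT by (simp add: tangent_space_M[OF X_in_M(1)[OF u]])
    ultimately have "d = 0" using innerK_tangent_zero[OF K X_in_M(2)[OF u]] by blast
    then show ?thesis by (simp add: d_def)
  qed
  moreover have "innerK K (?D (a i)) (?D (a j)) = (if i = j then 1 else 0)" for i j
    using e(2) \<beta>i[of i] \<beta>i[of j] \<beta> unfolding Da by (auto simp: bij_betw_def dest: injD)
  ultimately show ?thesis using \<beta> by blast
qed

lemma principal_coordinates:
  assumes u: "u \<in> W"
  shows "\<exists>\<beta> L a. principal_coords X u \<beta> L a"
proof -
  let ?D = "frechet_derivative X (at u)"
  obtain \<beta> :: "'n \<Rightarrow> nat" and a where f: "bij_betw \<beta> (UNIV :: 'n set) {1..CARD('n)}"
    "\<And>i j. innerK K (?D (a i)) (?D (a j)) = (if i = j then 1 else 0)"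
    "\<And>i. dnormal X u (a i) = lam (\<beta> i) (X u) *\<^sub>R ?D (a i)"
    using principal_frame[OF u] by metis
  have lin: "linear ?D" by (rule local_paramD(9)[OF lp u])
  define L where "L = (\<lambda>b. \<chi> i. innerK K (?D b) (?D (a i)))"
  have linL: "linear L"
    by (auto intro!: linearI simp: L_def vec_eq_iff linear_add[OF lin] linear_scale[OF lin] innerK_simps)
  have La: "L (\<Sum>i\<in>UNIV. (y $ i) *\<^sub>R a i) = y" for y
  proof -
    have "innerK K (?D (\<Sum>i\<in>UNIV. (y $ i) *\<^sub>R a i)) (?D (a j)) = y $ j" for j
    proof -
      have "innerK K (?D (\<Sum>i\<in>UNIV. (y $ i) *\<^sub>R a i)) (?D (a j)) = (\<Sum>i\<in>UNIV. y $ i * (if i = j then 1 else 0))"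
        by (simp only: linear_sum[OF lin] linear_scale[OF lin] innerK_sum innerK_simps f(2) real_scaleR_def)
      also have "\<dots> = y $ j" by (simp add: if_distrib[of "\<lambda>z. _ * z"] sum.delta cong: if_cong)
      finally show ?thesis .
    qed
    then show ?thesis by (simp add: L_def vec_eq_iff)
  qed
  then have "surj L" by (rule surjI)
  then have injL: "inj L" using linear_surjective_imp_injective[OF linL] by blast
  have b: "b = (\<Sum>i\<in>UNIV. (L b $ i) *\<^sub>R a i)" for b
    by (rule injD[OF injL]) (rule La[symmetric])
  have Db: "?D b = (\<Sum>i\<in>UNIV. (L b $ i) *\<^sub>R ?D (a i))" for b
    by (rule trans[OF arg_cong[OF b[of b], of ?D]]) (simp only: linear_sum[OF lin] linear_scale[OF lin])
  have dnb: "dnormal X u b = (\<Sum>i\<in>UNIV. (L b $ i * lam (\<beta> i) (X u)) *\<^sub>R ?D (a i))" for b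
    by (rule trans[OF arg_cong[OF b[of b], of "dnormal X u"]])
       (simp only: linear_sum[OF dnormal_linear[OF u]] linear_scale[OF dnormal_linear[OF u]] f(3) scaleR_scaleR)
  have "principal_coords X u \<beta> L a" unfolding principal_coords_def
    by (intro conjI allI f linL injL La b Db dnb)
  then show ?thesis by blast
qed

lemma frame_sum_inner:
  fixes f :: "'i::finite \<Rightarrow> 'n ambient"
  assumes "\<And>i j. innerK K (f i) (f j) = (if i = j then 1 else 0)"
  shows "innerK K (\<Sum>i\<in>UNIV. p i *\<^sub>R f i) (\<Sum>i\<in>UNIV. q i *\<^sub>R f i) = (\<Sum>i\<in>UNIV. p i * q i)"
  by (simp add: innerK_sum innerK_simps assms if_distrib[of "\<lambda>z. _ * z"] sum.delta mult.commute cong: if_cong)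

text \<open>The frame is pulled back to the coordinate space, so that the forms at different points
  of \<open>M\<close> live on the same \<open>real^'n\<close> and
  \<open>eigenvalue_perturbation\<close> can compare them.\<close>

lemma eigenframe_shape:
  assumes u: "u \<in> W"
  shows "\<exists>\<beta> R. eigenframe (\<lambda>b. innerK K (frechet_derivative X (at u) b) (frechet_derivative X (at u) b))
    (\<lambda>b. innerK K (dnormal X u b) (frechet_derivative X (at u) b)) \<beta> (\<lambda>i. lam i (X u)) R"
proof -
  let ?D = "frechet_derivative X (at u)"
  obtain \<beta> L a where pc: "principal_coords X u \<beta> L a" using principal_coordinates[OF u] by blast
  note f = principal_coordsD[OF pc]
  define R where "R = (\<lambda>y :: real^'n. \<Sum>i\<in>UNIV. (y $ i) *\<^sub>R a i)"
  have "linear R" by (auto intro!: linearI simp: R_def scaleR_add_left sum.distrib scaleR_sum_right)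
  moreover have "inj R"
  proof (rule injI)
    fix y z assume "R y = R z"
    then have "L (R y) = L (R z)" by simp
    then show "y = z" unfolding R_def f(5) .
  qed
  moreover have "innerK K (?D (R y)) (?D (R y)) = (\<Sum>i\<in>UNIV. (y $ i)\<^sup>2)" for y
  proof -
    have 1: "?D (R y) = (\<Sum>i\<in>UNIV. (y $ i) *\<^sub>R ?D (a i))" using f(6)[of "R y"] f(5)[of y] by (simp only: R_def)
    show ?thesis unfolding 1 frame_sum_inner[of "\<lambda>i. ?D (a i)", OF f(4)] by (simp add: power2_eq_square)
  qed
  moreover have "innerK K (dnormal X u (R y)) (?D (R y)) = (\<Sum>i\<in>UNIV. lam (\<beta> i) (X u) * (y $ i)\<^sup>2)" for y
  proof -
    have 1: "?D (R y) = (\<Sum>i\<in>UNIV. (y $ i) *\<^sub>R ?D (a i))" using f(6)[of "R y"] f(5)[of y] by (simp only: R_def)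
    have 2: "dnormal X u (R y) = (\<Sum>i\<in>UNIV. (y $ i * lam (\<beta> i) (X u)) *\<^sub>R ?D (a i))"
      using f(7)[of "R y"] f(5)[of y] by (simp only: R_def)
    show ?thesis unfolding 1 2 frame_sum_inner[of "\<lambda>i. ?D (a i)", OF f(4)] by (simp add: power2_eq_square mult_ac)
  qed
  moreover have "\<forall>i\<in>{1..CARD('n)}. \<forall>j\<in>{1..CARD('n)}. i \<le> j \<longrightarrow> lam j (X u) \<le> lam i (X u)"
    using curvatures X_in_M(1)[OF u] unfolding principal_curvatures_def by blast
  ultimately show ?thesis using f(1) unfolding eigenframe_def by blast
qed

lemma lam_continuous_chart:
  assumes k: "k \<in> {1..CARD('n)}"
  shows "continuous_on W (\<lambda>u. lam k (X u))"
  unfolding continuous_on_def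
proof (intro ballI tendstoI)
  fix u0 and e :: real assume u0: "u0 \<in> W" and e: "e > 0"
  have op: "open W" and smX: "smooth_on W X" using local_paramD[OF lp] by auto
  let ?G = "\<lambda>u b c. innerK K (frechet_derivative X (at u) b) (frechet_derivative X (at u) c)"
  let ?A = "\<lambda>u b c. innerK K (dnormal X u b) (frechet_derivative X (at u) c)"
  have cX: "continuous_on W (\<lambda>u. frechet_derivative X (at u) b)" for b
    by (rule smooth_on_continuous[OF smooth_on_SucD[OF smX]])
  have cn: "continuous_on W (\<lambda>u. dnormal X u b)" for b
    unfolding dnormal_def by (rule smooth_on_continuous[OF smooth_on_SucD[OF normal_smooth[OF lp]]])
  have bG: "bilinear (?G u)" and bA: "bilinear (?A u)" if "u \<in> W" for u
    using local_paramD(9)[OF lp that] dnormal_linear[OF that]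
    by (auto intro!: linearI simp: bilinear_def linear_add linear_scale innerK_simps simp del: split_paired_All)
  obtain \<beta> R where F0: "eigenframe (\<lambda>b. ?G u0 b b) (\<lambda>b. ?A u0 b b) \<beta> (\<lambda>i. lam i (X u0)) R"
    using eigenframe_shape[OF u0] by blast
  obtain c where c: "c > 0" "\<And>b. c * (norm b)\<^sup>2 \<le> ?G u0 b b" using eigenframe_lower_bound[OF F0] by blast
  let ?l = "1 + \<bar>lam k (X u0)\<bar>"
  \<comment> \<open>The first entry gives \<open>c - \<delta> \<ge> c / 2\<close>; the second then
    makes the perturbation bound at most \<open>e / 2\<close>.\<close>
  define \<delta> where "\<delta> = min (c / 2) (e * c / (4 * ?l))"
  have l: "?l > 0" by (simp add: add_pos_nonneg)
  have \<delta>: "\<delta> > 0" "\<delta> \<le> c / 2" "\<delta> * ?l \<le> e * c / 4"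
  proof -
    show "\<delta> > 0" using c e l by (simp add: \<delta>_def)
    have "\<delta> * ?l \<le> e * c / (4 * ?l) * ?l" using l by (intro mult_right_mono) (auto simp: \<delta>_def)
    also have "e * c / (4 * m) * m = e * c / 4" if "m > 0" for m :: real using that by simp
    note this[OF l]
    finally show "\<delta> * ?l \<le> e * c / 4" .
    show "\<delta> \<le> c / 2" unfolding \<delta>_def by (rule min.cobounded1)
  qed
  have bound: "\<delta> * ?l / (c - \<delta>) < e"
  proof -
    have "\<delta> * ?l < e * (c - \<delta>)"
    proof -
      have "e * c / 4 < e * (c / 2)" using e c by simp
      also have "\<dots> \<le> e * (c - \<delta>)" using e \<delta>(2) by (intro mult_left_mono) auto
      finally show ?thesis using \<delta>(3) by linarith
    qed
    then show ?thesis using \<delta> c by (simp add: pos_divide_less_eq)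
  qed
  have "\<forall>\<^sub>F u in at u0 within W. \<forall>b. \<bar>?G u b b - ?G u0 b b\<bar> \<le> \<delta> * (norm b)\<^sup>2"
    by (rule quadratic_form_close[OF bG u0 _ \<delta>(1)])
       (auto intro!: bounded_bilinear.continuous_on[OF innerK_bounded_bilinear] cX)
  moreover have "\<forall>\<^sub>F u in at u0 within W. \<forall>b. \<bar>?A u b b - ?A u0 b b\<bar> \<le> \<delta> * (norm b)\<^sup>2"
    by (rule quadratic_form_close[OF bA u0 _ \<delta>(1)])
       (auto intro!: bounded_bilinear.continuous_on[OF innerK_bounded_bilinear] cX cn)
  moreover have "\<forall>\<^sub>F u in at u0 within W. u \<in> W" by (simp add: eventually_at_filter)
  ultimately show "\<forall>\<^sub>F u in at u0 within W. dist (lam k (X u)) (lam k (X u0)) < e"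
  proof eventually_elim
    case (elim u)
    obtain \<beta>' R' where F: "eigenframe (\<lambda>b. ?G u b b) (\<lambda>b. ?A u b b) \<beta>' (\<lambda>i. lam i (X u)) R'"
      using eigenframe_shape[OF elim(3)] by blast
    have "\<bar>lam k (X u) - lam k (X u0)\<bar> \<le> \<delta> * ?l / (c - \<delta>)"
      by (rule eigenvalue_perturbation[OF F0 F k]) (use elim c \<delta> in auto)
    then show ?case using bound by (simp add: dist_real_def)
  qed
qed

end

text \<open>Composition with the continuous chart inverse gives continuity on each patch, and the
  patches form a relatively open cover.\<close>

lemma continuous_on_M_charts:
  fixes f :: "'n ambient \<Rightarrow> 'b::topological_space"
  assumes "\<And>(W :: (real^'n) set) X. local_param M W X \<Longrightarrow> continuous_on W (\<lambda>u. f (X u))"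
  shows "continuous_on M f"
proof -
  have "\<exists>S. openin (top_of_set M) S \<and> x \<in> S \<and> continuous_on S f" if x: "x \<in> M" for x
  proof -
    obtain W :: "(real^'n) set" and X u where X: "local_param M W X" "u \<in> W" "x = X u" by (rule M_chart[OF x])
    have "continuous_on (X ` W) (\<lambda>p. f (X (inv_into W X p)))"
      by (rule continuous_on_compose2[OF assms[OF X(1)] local_param_inv(1)[OF X(1)]])
         (use local_param_inv(3)[OF X(1)] in blast)
    then have "continuous_on (X ` W) f"
      using local_param_inv(4)[OF X(1)] by (simp cong: continuous_on_cong)
    then show ?thesis using local_paramD(4)[OF X(1)] X(2,3) by blast
  qed
  then obtain S where S: "\<And>x. x \<in> M \<Longrightarrow> openin (top_of_set M) (S x) \<and> x \<in> S x \<and> continuous_on (S x) f" by metis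
  show ?thesis unfolding continuous_openin_preimage_eq
  proof (intro allI impI)
    fix B :: "'b set" assume B: "open B"
    have "M \<inter> f -` B = (\<Union>x\<in>M. S x \<inter> f -` B)" using S openin_subset by fastforce
    moreover have "openin (top_of_set M) (S x \<inter> f -` B)" if x: "x \<in> M" for x
    proof (rule openin_trans)
      show "openin (top_of_set (S x)) (S x \<inter> f -` B)" using S[OF x] B continuous_openin_preimage_gen by blast
      show "openin (top_of_set M) (S x)" using S[OF x] by blast
    qed
    then have "openin (top_of_set M) (\<Union>x\<in>M. S x \<inter> f -` B)" by (intro openin_Union) blast
    ultimately show "openin (top_of_set M) (M \<inter> f -` B)" by (simp only:)
  qed
qed

lemma lam_continuous: "k \<in> {1..CARD('n)} \<Longrightarrow> continuous_on M (lam k)"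
  by (rule continuous_on_M_charts) (rule lam_continuous_chart)

end

section \<open>Inequalities between one-dimensional integrals\<close>

definition rangeK :: "real \<Rightarrow> real set" where
  "rangeK K = (if K = 1 then {0<..<pi} else {0<..})"

text \<open>The curvatures for which \<open>arccotK K\<close> inverts \<open>cotK K\<close>: all
  reals for \<open>K = 1\<close>, \<open>x > 0\<close> for \<open>K = 0\<close> and
  \<open>x > 1\<close> for \<open>K = -1\<close>. The mean convexity hypothesis says that the mean
  curvature takes its values here.\<close>

definition cotK_values :: "real \<Rightarrow> real set" where
  "cotK_values K = {x. K \<le> 0 \<longrightarrow> sqrt (- K) < x}"

lemma sK_rangeK: "K \<in> {-1,0,1} \<Longrightarrow> r \<in> rangeK K \<Longrightarrow> 0 < sK K r"
  by (rule sK_pos) (auto simp: rangeK_def split: if_splits)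

text \<open>The difference of the cotangents at \<open>a\<close> and \<open>b\<close> is
  \<open>sK K (b - a)\<close> divided by the positive number \<open>sK K a * sK K b\<close>.\<close>

lemma cotK_less_iff:
  assumes "K \<in> {-1,0,1}" "a \<in> rangeK K" "b \<in> rangeK K"
  shows "cotK K b < cotK K a \<longleftrightarrow> a < b"
proof -
  have *: "cotK K y < cotK K x" if "x \<in> rangeK K" "y \<in> rangeK K" "x < y" for x y
  proof -
    have "0 < sK K (y - x)"
      using that by (intro sK_pos[OF assms(1)]) (auto simp: rangeK_def split: if_splits)
    then have "sK K x * cK K y < sK K y * cK K x" by (simp add: sK_diff[OF assms(1)] mult.commute)
    then show ?thesis using sK_rangeK[OF assms(1) that(1)] sK_rangeK[OF assms(1) that(2)]
      by (simp add: cotK_def field_simps)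
  qed
  show ?thesis using *[OF assms(2,3)] *[OF assms(3,2)] by (metis less_asym linorder_neqE_linordered_idom)
qed

lemma inj_on_cotK: "K \<in> {-1,0,1} \<Longrightarrow> inj_on (cotK K) (rangeK K)"
  by (rule inj_onI) (metis cotK_less_iff less_irrefl linorder_neqE_linordered_idom)

lemma arccotK_eqI:
  assumes "K \<in> {-1,0,1}" "r \<in> rangeK K" "cotK K r = x"
  shows "arccotK K x = r"
  using the_inv_into_f_f[OF inj_on_cotK[OF assms(1)] assms(2)] assms(3)
  by (simp add: arccotK_def rangeK_def)

text \<open>Explicit inverses show that the values are attained and later that
  \<open>arccotK\<close> is continuous; injectivity of \<open>cotK\<close> identifies them with the
  abstract inverse.\<close>

lemma arccotK_cases:
  assumes "x \<in> cotK_values K" "K \<in> {-1,0,1}"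
  shows "arccotK K x = (if K = 1 then pi / 2 - arctan x else if K = 0 then 1 / x else ln ((x + 1) / (x - 1)) / 2)"
    and "arccotK K x \<in> rangeK K" and "cotK K (arccotK K x) = x"
proof -
  let ?r = "if K = 1 then pi / 2 - arctan x else if K = 0 then 1 / x else ln ((x + 1) / (x - 1)) / 2"
  have r: "?r \<in> rangeK K \<and> cotK K ?r = x"
  proof -
    consider "K = 1" | "K = 0" "x > 0" | "K = -1" "x > 1" using assms by (auto simp: cotK_values_def)
    then show ?thesis
    proof cases
      case 1
      have "cos (pi / 2 - arctan x) / sin (pi / 2 - arctan x) = tan (arctan x)"
        by (simp add: cos_diff sin_diff tan_def)
      then show ?thesis using 1 arctan_lbound[of x] arctan_ubound[of x]
        by (auto simp: rangeK_def cotK_def cK_def sK_def tan_arctan)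
    next
      case 2
      then show ?thesis by (simp add: rangeK_def cotK_def cK_def sK_def)
    next
      case 3
      define y where "y = (x + 1) / (x - 1)"
      have y: "y > 1" "(y + 1) / (y - 1) = x" using 3 by (simp_all add: y_def field_simps)
      \<comment> \<open>With \<open>c = exp r\<close> the hyperbolic cotangent of \<open>r\<close>
        is \<open>(c^2 + 1) / (c^2 - 1)\<close>, and here \<open>c^2 = y\<close>.\<close>
      define c where "c = exp (ln y / 2)"
      have c: "c > 0" "exp (- (ln y / 2)) = inverse c" by (simp_all add: c_def exp_minus)
      have cc: "c * c = y" using y(1) by (simp add: c_def flip: exp_add)
      have c1: "c * c - 1 \<noteq> 0" using y(1) cc by simp
      have "cosh (ln y / 2) / sinh (ln y / 2) = (c + inverse c) / (c - inverse c)"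
      proof -
        have half: "(p / 2) / (q / 2) = p / q" for p q :: real by simp
        show ?thesis unfolding cosh_field_def sinh_field_def c(2) c_def[symmetric] by (rule half)
      qed
      also have "\<dots> = (c * (c + inverse c)) / (c * (c - inverse c))" using c by simp
      also have "\<dots> = (c * c + 1) / (c * c - 1)" using c by (simp add: distrib_left right_diff_distrib)
      also have "\<dots> = x" unfolding cc by (rule y(2))
      finally show ?thesis using 3 y(1) by (simp add: rangeK_def cotK_def cK_def sK_def y_def)
    qed
  qed
  then show a: "arccotK K x = ?r" using arccotK_eqI[OF assms(2)] by blast
  show "arccotK K x \<in> rangeK K" "cotK K (arccotK K x) = x" unfolding a using r by blast+
qed

lemma arccotK_continuous:
  assumes "K \<in> {-1,0,1}"
  shows "continuous_on (cotK_values K) (arccotK K)"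
proof -
  consider "K = 1" | "K = 0" | "K = -1" using assms by auto
  then have "continuous_on (cotK_values K) (\<lambda>x. if K = 1 then pi / 2 - arctan x else if K = 0 then 1 / x else ln ((x + 1) / (x - 1)) / 2)"
  proof cases
    case 1
    then show ?thesis by (auto intro!: continuous_intros)
  next
    case 2
    then show ?thesis by (auto intro!: continuous_on_divide continuous_intros simp: cotK_values_def)
  next
    case 3
    have "continuous_on (cotK_values K) (\<lambda>x. ln ((x + 1) / (x - 1)) / 2)" 
      using 3 by (intro continuous_on_divide continuous_on_ln continuous_intros) (auto simp: cotK_values_def)
    then show ?thesis using 3 by simp
  qed
  then show ?thesis
    by (subst continuous_on_cong[OF refl arccotK_cases(1)[OF _ assms]])
qed

lemma arccotK_less_iff:
  assumes "K \<in> {-1,0,1}" "x \<in> cotK_values K" "y \<in> cotK_values K"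
  shows "arccotK K x < arccotK K y \<longleftrightarrow> y < x"
  using cotK_less_iff[OF assms(1) arccotK_cases(2)[OF assms(2,1)] arccotK_cases(2)[OF assms(3,1)]]
    arccotK_cases(3)[OF assms(2,1)] arccotK_cases(3)[OF assms(3,1)] by simp

lemma arccotK_le_iff:
  assumes "K \<in> {-1,0,1}" "x \<in> cotK_values K" "y \<in> cotK_values K"
  shows "arccotK K x \<le> arccotK K y \<longleftrightarrow> y \<le> x"
  using arccotK_less_iff[OF assms(1,3,2)] by (simp add: not_less[symmetric])

text \<open>All claims rest on \<open>cK K t - cotK K r * sK K t = sK K (r - t) / sK K r\<close>:
  the Jacobian factor of the curvature \<open>cotK K r\<close> vanishes first at the focal distance
  \<open>r\<close>.\<close>

lemma cK_ge_cotK: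
  assumes K: "K \<in> {-1,0,1}" and r: "r \<in> rangeK K" and t: "0 \<le> t" "t \<le> r"
  shows "0 \<le> sK K t" "0 \<le> cK K t - cotK K r * sK K t" "t < r \<Longrightarrow> 0 < cK K t - cotK K r * sK K t"
proof -
  show "0 \<le> sK K t"
    using sK_pos[OF K, of t] t r by (cases "t = 0") (auto simp: rangeK_def split: if_splits)
  have e: "cK K t - cotK K r * sK K t = sK K (r - t) / sK K r"
    using sK_rangeK[OF K r] by (simp add: sK_diff[OF K] cotK_def field_simps)
  show "t < r \<Longrightarrow> 0 < cK K t - cotK K r * sK K t"
    unfolding e using sK_pos[OF K, of "r - t"] sK_rangeK[OF K r] t r by (auto simp: rangeK_def split: if_splits)
  then show "0 \<le> cK K t - cotK K r * sK K t"
    using e t by (cases "t = r") auto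
qed

section \<open>Interval integrals of the Jacobian\<close>

lemma LBINT_integral:
  fixes f :: "real \<Rightarrow> real"
  assumes "continuous_on {0..r} f" "0 \<le> r"
  shows "(LBINT t=0..r. f t) = integral {0..r} f"
proof -
  have "set_integrable lborel {0..r} f" by (rule borel_integrable_atLeastAtMost'[OF assms(1)])
  then show ?thesis using interval_integral_eq_integral[of 0 r f] assms(2) by (simp add: zero_ereal_def)
qed

lemma LBINT_integral_minus:
  fixes f :: "real \<Rightarrow> real"
  assumes "continuous_on {-r..0} f" "0 \<le> r"
  shows "(LBINT t=0..-r. f t) = - integral {0..r} (\<lambda>t. f (- t))"
proof -
  have "(LBINT t=0..-r. f t) = (LBINT t=r..0. f (- t))"
    by (subst interval_integral_reflect) (simp add: zero_ereal_def)
  also have "\<dots> = - (LBINT t=0..r. f (- t))" by (rule interval_integral_endpoints_reverse)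
  also have "(LBINT t=0..r. f (- t)) = integral {0..r} (\<lambda>t. f (- t))"
    using assms by (intro LBINT_integral continuous_on_compose2[OF assms(1)] continuous_intros) auto
  finally show ?thesis .
qed

text \<open>Replacing \<open>t\<close> by \<open>r - t\<close> turns the ratio into the inward
  Jacobian integral of a sphere of radius \<open>r\<close>, whose curvatures all equal
  \<open>cotK K r\<close>. In this form it can be compared with
  \<open>focal_integral\<close>.\<close>

lemma hK_integral:
  assumes K: "K \<in> {-1,0,1}" and r: "r \<in> rangeK K"
  shows "hK K n r = integral {0..r} (\<lambda>t. (cK K t - cotK K r * sK K t) ^ n)"
proof -
  have s: "0 < sK K r" and r0: "0 \<le> r" using sK_rangeK[OF K r] r by (auto simp: rangeK_def split: if_splits)
  have c: "continuous_on A (\<lambda>t. sK K t ^ n)" for A by (intro continuous_on_power continuous_on_cK_sK K)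
  have e: "cK K t - cotK K r * sK K t = sK K (- t + r) / sK K r" for t
    using s sK_diff[OF K, of r t] by (simp add: cotK_def field_simps)
  have "integral {0..r} (\<lambda>t. sK K t ^ n) = integral {0 - r..r - r} (\<lambda>t. sK K (t + r) ^ n)"
    by (rule integral_shift_real_ivl[symmetric])
  also have "\<dots> = integral {-r..-0} (\<lambda>t. sK K (- (- t) + r) ^ n)" by simp
  also have "\<dots> = integral {0..r} (\<lambda>t. sK K (- t + r) ^ n)" by (rule Henstock_Kurzweil_Integration.integral_reflect_real)
  finally have "hK K n r = integral {0..r} (\<lambda>t. sK K (- t + r) ^ n) / sK K r ^ n"
    unfolding hK_def by (simp add: LBINT_integral[OF c r0])
  also have "\<dots> = integral {0..r} (\<lambda>t. sK K (- t + r) ^ n / sK K r ^ n)" by simp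
  finally show ?thesis by (simp add: e power_divide)
qed

definition focal_integral :: "real \<Rightarrow> nat \<Rightarrow> (nat \<Rightarrow> real) \<Rightarrow> real" where
  "focal_integral K n l = integral {0..arccotK K (l 1)} (\<lambda>t. \<Prod>j=1..n. cK K t - l j * sK K t)"

lemma normal_jacobian_integral:
  assumes K: "K \<in> {-1,0,1}" and v: "lam 1 x \<in> cotK_values K"
  shows "(LBINT t=0..focal_height K lam x. normal_jacobian K n lam x t) = - focal_integral K n (\<lambda>j. lam j x)"
proof -
  have a: "0 \<le> arccotK K (lam 1 x)" using arccotK_cases(2)[OF v K] by (auto simp: rangeK_def split: if_splits)
  have "continuous_on A (normal_jacobian K n lam x)" for A
    unfolding normal_jacobian_def[abs_def]
    by (intro continuous_on_prod continuous_on_add continuous_on_mult continuous_on_const continuous_on_cK_sK K)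
  from LBINT_integral_minus[OF this a] show ?thesis
    by (simp add: focal_height_def focal_integral_def normal_jacobian_def)
qed

lemma prod_le_mean_power:
  fixes y :: "nat \<Rightarrow> real"
  assumes "n \<ge> 1" "\<And>j. j \<in> {1..n} \<Longrightarrow> 0 \<le> y j"
  shows "(\<Prod>j=1..n. y j) \<le> ((\<Sum>j=1..n. y j) / n) ^ n"
proof -
  let ?p = "\<Prod>j=1..n. y j"
  have p: "0 \<le> ?p" using assms(2) by (intro prod_nonneg) auto
  have "?p powr (1 / n) \<le> (\<Sum>j=1..n. y j / n)"
    using arith_geom_mean[of "{1..n}" y] assms by auto
  then have "(?p powr (1 / n)) ^ n \<le> (\<Sum>j=1..n. y j / n) ^ n" by (rule power_mono) simp
  moreover have "(?p powr (1 / n)) ^ n = ?p"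
  proof (cases "?p = 0")
    case True
    show ?thesis unfolding True using assms(1) by simp
  next
    case False
    then have "?p > 0" using p by (simp only: less_le) simp
    then have "0 < ?p powr (1 / n)" by (simp only: powr_gt_zero not_False_eq_True)
    then have "(?p powr (1 / n)) ^ n = (?p powr (1 / n)) powr (real n)" by (rule powr_realpow[symmetric])
    also have "\<dots> = ?p powr 1" unfolding powr_powr using assms(1) by simp
    also have "\<dots> = ?p" by (rule powr_one[OF p])
    finally show ?thesis .
  qed
  ultimately show ?thesis by (simp add: sum_divide_distrib)
qed

definition sorted_curvatures :: "nat \<Rightarrow> (nat \<Rightarrow> real) \<Rightarrow> bool" where
  "sorted_curvatures n l \<longleftrightarrow> n \<ge> 1 \<and> (\<forall>i\<in>{1..n}. \<forall>j\<in>{1..n}. i \<le> j \<longrightarrow> l j \<le> l i)"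

lemma mean_le_first:
  assumes "sorted_curvatures n l"
  shows "(\<Sum>i=1..n. l i) / n \<le> l 1" "(\<Sum>i=1..n. l i) / n = l 1 \<Longrightarrow> j \<in> {1..n} \<Longrightarrow> l j = l 1"
proof -
  have n: "n \<ge> 1" and le: "l i \<le> l 1" if "i \<in> {1..n}" for i
    using assms that by (auto simp: sorted_curvatures_def)
  have n: "n \<ge> 1" using assms by (simp add: sorted_curvatures_def)
  have s: "(\<Sum>i=1..n. l i) \<le> (\<Sum>i=1..n. l 1)" using le by (intro sum_mono) auto
  then show "(\<Sum>i=1..n. l i) / n \<le> l 1" using n by (simp add: divide_le_eq mult.commute)
  assume e: "(\<Sum>i=1..n. l i) / n = l 1" and j: "j \<in> {1..n}"
  have "(\<Sum>i=1..n. l 1 - l i) = 0" using e n by (simp add: sum_subtractf field_simps)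
  then have "\<forall>i\<in>{1..n}. l 1 - l i = 0" using le by (subst (asm) sum_nonneg_eq_0_iff) auto
  then show "l j = l 1" using j by auto
qed

text \<open>The integrands are compared by the arithmetic-geometric mean inequality; equality is lost
  because the interval of integration shrinks unless the largest curvature equals the mean.\<close>

lemma focal_integral_le:
  assumes K: "K \<in> {-1,0,1}" and srt: "sorted_curvatures n l" and E: "E = (\<Sum>i=1..n. l i) / n" "E \<in> cotK_values K"
  shows "0 \<le> focal_integral K n l" "focal_integral K n l \<le> hK K n (arccotK K E)"
    "focal_integral K n l = hK K n (arccotK K E) \<longleftrightarrow> l 1 = E"
proof -
  have n: "n \<ge> 1" using srt by (simp add: sorted_curvatures_def)
  have lE: "E \<le> l 1" using mean_le_first(1)[OF srt] E by simp
  have v1: "l 1 \<in> cotK_values K" using lE E(2) by (auto simp: cotK_values_def)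
  define a where "a = arccotK K (l 1)"
  define r where "r = arccotK K E"
  have a: "a \<in> rangeK K" "cotK K a = l 1" using arccotK_cases[OF v1 K] by (simp_all add: a_def)
  have r: "r \<in> rangeK K" "cotK K r = E" using arccotK_cases[OF E(2) K] by (simp_all add: r_def)
  have a0: "0 < a" using a by (auto simp: rangeK_def split: if_splits)
  have ar: "a \<le> r" using arccotK_le_iff[OF K v1 E(2)] lE by (simp add: a_def r_def)
  let ?P = "\<lambda>t. \<Prod>j=1..n. cK K t - l j * sK K t" and ?Q = "\<lambda>t. (cK K t - E * sK K t) ^ n"
  have cP: "continuous_on A ?P" and cQ: "continuous_on A ?Q" for A
    by (intro continuous_on_prod continuous_on_power continuous_on_diff continuous_on_mult continuous_on_const continuous_on_cK_sK K)+
  have iP: "?P integrable_on {x..y}" and iQ: "?Q integrable_on {x..y}" for x y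
    using cP cQ integrable_continuous_real by blast+
  have fac: "0 \<le> cK K t - l j * sK K t" if "t \<in> {0..a}" "j \<in> {1..n}" for t j
  proof -
    have "l j \<le> l 1" using srt that(2) by (auto simp: sorted_curvatures_def)
    then have "l j * sK K t \<le> l 1 * sK K t" using cK_ge_cotK(1)[OF K a(1)] that(1) by (intro mult_right_mono) auto
    then show ?thesis using cK_ge_cotK(2)[OF K a(1), of t] that(1) a(2) by auto
  qed
  have PQ: "?P t \<le> ?Q t" if "t \<in> {0..a}" for t
  proof -
    have "?P t \<le> ((\<Sum>j=1..n. cK K t - l j * sK K t) / n) ^ n" using fac[OF that] by (intro prod_le_mean_power n)
    also have "(\<Sum>j=1..n. cK K t - l j * sK K t) / n = cK K t - E * sK K t"
      using n by (simp add: E(1) sum_subtractf flip: sum_distrib_right) (simp add: field_simps)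
    finally show ?thesis .
  qed
  have h: "hK K n r = integral {0..r} ?Q" using hK_integral[OF K r(1)] r(2) by simp
  have f: "focal_integral K n l = integral {0..a} ?P" by (simp add: focal_integral_def a_def)
  show "0 \<le> focal_integral K n l" unfolding f using fac by (intro integral_nonneg iP prod_nonneg) auto
  have le1: "integral {0..a} ?P \<le> integral {0..a} ?Q" using PQ by (intro integral_le iP iQ) auto
  have split: "integral {0..r} ?Q = integral {0..a} ?Q + integral {a..r} ?Q"
    using Henstock_Kurzweil_Integration.integral_combine[OF less_imp_le[OF a0] ar iQ] by simp
  have Qpos: "0 < ?Q t" if "t \<in> {a<..<r}" for t
    using cK_ge_cotK(3)[OF K r(1), of t] that a0 r(2) by (intro zero_less_power) auto
  have Q0: "0 \<le> ?Q t" if "t \<in> {a..r}" for t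
    using cK_ge_cotK(2)[OF K r(1), of t] that a0 r(2) by (intro zero_le_power) auto
  have ge: "0 \<le> integral {a..r} ?Q" using Q0 by (intro integral_nonneg iQ) auto
  show "focal_integral K n l \<le> hK K n (arccotK K E)"
    using le1 split ge h f by (simp add: r_def)
  show "focal_integral K n l = hK K n (arccotK K E) \<longleftrightarrow> l 1 = E"
  proof
    assume eq: "l 1 = E"
    then have "l j = E" if "j \<in> {1..n}" for j using mean_le_first(2)[OF srt _ that] E(1) by simp
    then have "?P t = ?Q t" for t using prod_constant[of "cK K t - E * sK K t" "{1..n}"] by simp
    moreover have "a = r" using eq by (simp add: a_def r_def)
    ultimately show "focal_integral K n l = hK K n (arccotK K E)" using f h by (simp add: r_def)
  next
    assume eq: "focal_integral K n l = hK K n (arccotK K E)"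
    show "l 1 = E"
    proof (rule ccontr)
      assume "l 1 \<noteq> E"
      then have "a < r" using arccotK_less_iff[OF K v1 E(2)] lE by (simp add: a_def r_def)
      then have "integral {a..r} (\<lambda>t. 0) < integral {a..r} ?Q"
        using Qpos by (intro integral_less_real cQ continuous_on_const) auto
      then show False using eq le1 split h f by (simp add: r_def)
    qed
  qed
qed

lemma integral_scale_unit:
  fixes f :: "real \<Rightarrow> real"
  assumes "a > 0"
  shows "integral {0..a} f = a * integral {0..1} (\<lambda>s. f (a * s))"
proof -
  have "(\<lambda>x. x / a) ` {0..a} = {0..1}" using assms by (simp add: image_divide_atLeastAtMost)
  then have "integral {0..1} (\<lambda>s. f (a * s)) = (1 / a) * integral {0..a} f"
    using integral_stretch_real[of a 0 a f] assms by simp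
  then show ?thesis using assms by simp
qed

text \<open>Rescaling to the unit interval moves the parameter from the limit of integration into
  the integrand, where continuity of parameter integrals applies.\<close>

lemma continuous_on_integral_upto:
  fixes a :: "'x::topological_space \<Rightarrow> real" and f :: "'x \<Rightarrow> real \<Rightarrow> real"
  assumes a: "continuous_on S a" "\<And>x. x \<in> S \<Longrightarrow> 0 < a x"
    and f: "continuous_on (S \<times> UNIV) (\<lambda>(x, t). f x t)"
  shows "continuous_on S (\<lambda>x. integral {0..a x} (f x))"
proof -
  have "continuous_on (S \<times> cbox 0 (1::real)) (\<lambda>z. (fst z, a (fst z) * snd z))"
    by (intro continuous_intros continuous_on_compose2[OF a(1)]) auto
  moreover have "(\<lambda>z. (fst z, a (fst z) * snd z)) ` (S \<times> cbox 0 1) \<subseteq> S \<times> UNIV" by auto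
  ultimately have "continuous_on (S \<times> cbox 0 1) (\<lambda>z. case (fst z, a (fst z) * snd z) of (x, t) \<Rightarrow> f x t)"
    by (rule continuous_on_compose2[OF f])
  then
  have "continuous_on (S \<times> cbox 0 1) (\<lambda>(x, s). f x (a x * s))"
    by (auto simp: case_prod_unfold)
  then have "continuous_on S (\<lambda>x. integral (cbox 0 1) (\<lambda>s. f x (a x * s)))"
    by (rule integral_continuous_on_param)
  then have "continuous_on S (\<lambda>x. a x * integral {0..1} (\<lambda>s. f x (a x * s)))"
    by (intro continuous_on_mult a(1)) simp
  then show ?thesis
    by (subst continuous_on_cong[OF refl integral_scale_unit[OF a(2)]])
qed

lemma continuous_on_focal_integral:
  fixes l :: "nat \<Rightarrow> 'x::topological_space \<Rightarrow> real"
  assumes K: "K \<in> {-1,0,1}" and l: "\<And>j. j \<in> {1..n} \<Longrightarrow> continuous_on S (l j)" "n \<ge> 1"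
    and v: "\<And>x. x \<in> S \<Longrightarrow> l 1 x \<in> cotK_values K"
  shows "continuous_on S (\<lambda>x. focal_integral K n (\<lambda>j. l j x))"
  unfolding focal_integral_def
proof (rule continuous_on_integral_upto)
  show "continuous_on S (\<lambda>x. arccotK K (l 1 x))"
    by (rule continuous_on_compose2[OF arccotK_continuous[OF K] l(1)]) (use v l(2) in auto)
  show "0 < arccotK K (l 1 x)" if "x \<in> S" for x
    using arccotK_cases(2)[OF v[OF that] K] by (auto simp: rangeK_def split: if_splits)
  have "continuous_on (S \<times> UNIV) (\<lambda>z. \<Prod>j=1..n. cK K (snd z) - l j (fst z) * sK K (snd z))"
  proof (intro continuous_on_prod continuous_on_diff continuous_on_mult)
    show "continuous_on (S \<times> UNIV) (\<lambda>z. cK K (snd z))" "continuous_on (S \<times> UNIV) (\<lambda>z. sK K (snd z))"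
      by (rule continuous_on_compose2[OF continuous_on_cK_sK(1)[OF K, of UNIV]] continuous_on_compose2[OF continuous_on_cK_sK(2)[OF K, of UNIV]];
          auto intro: continuous_intros)+
    show "continuous_on (S \<times> UNIV) (\<lambda>z. l j (fst z))" if "j \<in> {1..n}" for j
      by (rule continuous_on_compose2[OF l(1)[OF that]]) (auto intro: continuous_intros)
  qed
  then show "continuous_on (S \<times> UNIV) (\<lambda>(x, t). \<Prod>j=1..n. cK K t - l j x * sK K t)"
    by (simp add: case_prod_unfold)
qed

lemma continuous_on_hK:
  fixes E :: "'x::topological_space \<Rightarrow> real"
  assumes K: "K \<in> {-1,0,1}" and E: "continuous_on S E" "\<And>x. x \<in> S \<Longrightarrow> E x \<in> cotK_values K"
  shows "continuous_on S (\<lambda>x. hK K n (arccotK K (E x)))"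
proof -
  have "continuous_on S (\<lambda>x. integral {0..arccotK K (E x)} (\<lambda>t. (cK K t - E x * sK K t) ^ n))"
  proof (rule continuous_on_integral_upto)
    show "continuous_on S (\<lambda>x. arccotK K (E x))"
      by (rule continuous_on_compose2[OF arccotK_continuous[OF K] E(1)]) (use E(2) in auto)
    show "0 < arccotK K (E x)" if "x \<in> S" for x
      using arccotK_cases(2)[OF E(2)[OF that] K] by (auto simp: rangeK_def split: if_splits)
    have "continuous_on (S \<times> UNIV) (\<lambda>z. (cK K (snd z) - E (fst z) * sK K (snd z)) ^ n)"
    proof (intro continuous_on_power continuous_on_diff continuous_on_mult)
      show "continuous_on (S \<times> UNIV) (\<lambda>z. cK K (snd z))" "continuous_on (S \<times> UNIV) (\<lambda>z. sK K (snd z))"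
        by (rule continuous_on_compose2[OF continuous_on_cK_sK(1)[OF K, of UNIV]] continuous_on_compose2[OF continuous_on_cK_sK(2)[OF K, of UNIV]];
            auto intro: continuous_intros)+
      show "continuous_on (S \<times> UNIV) (\<lambda>z. E (fst z))"
        by (rule continuous_on_compose2[OF E(1)]) (auto intro: continuous_intros)
    qed
    then show "continuous_on (S \<times> UNIV) (\<lambda>(x, t). (cK K t - E x * sK K t) ^ n)"
      by (simp add: case_prod_unfold)
  qed
  moreover have "hK K n (arccotK K (E x)) = integral {0..arccotK K (E x)} (\<lambda>t. (cK K t - E x * sK K t) ^ n)" if "x \<in> S" for x
    using hK_integral[OF K arccotK_cases(2)[OF E(2)[OF that] K]] arccotK_cases(3)[OF E(2)[OF that] K] by simp
  ultimately show ?thesis by (simp cong: continuous_on_cong)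
qed

section \<open>Nearest points and the focal distance\<close>

text \<open>If \<open>s\<close> were negative, \<open>q'\<close> would be negative just to the right
  of 0, and the mean value theorem would produce a value below the minimum.\<close>

lemma second_derivative_at_minimum:
  fixes q q' :: "real \<Rightarrow> real"
  assumes e: "e > 0" and q: "\<And>\<tau>. \<bar>\<tau>\<bar> < e \<Longrightarrow> (q has_real_derivative q' \<tau>) (at \<tau>)"
    and q': "(q' has_real_derivative s) (at 0)" and min: "\<And>\<tau>. \<bar>\<tau>\<bar> < e \<Longrightarrow> q 0 \<le> q \<tau>"
  shows "q' 0 = 0" "0 \<le> s"
proof -
  show z: "q' 0 = 0"
    using q[of 0] e min by (intro DERIV_local_min[of q "q' 0" 0 e]) auto
  show "0 \<le> s"
  proof (rule ccontr)
    assume "\<not> 0 \<le> s"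
    then obtain d where d: "d > 0" "\<And>h. 0 < h \<Longrightarrow> h < d \<Longrightarrow> q' h < 0"
      using DERIV_neg_dec_right[OF q'] z by auto
    define h where "h = min d e / 2"
    have h: "0 < h" "h < d" "h < e" using d(1) e by (auto simp: h_def)
    have "\<exists>z. 0 < z \<and> z < h \<and> q h - q 0 = (h - 0) * q' z"
      by (rule MVT2[OF h(1)]) (use q h in auto)
    then obtain z where "0 < z" "z < h" "q h - q 0 = h * q' z" by auto
    moreover have "h * q' z < 0" using h d(2)[of z] calculation by (intro mult_pos_neg) auto
    moreover have "q 0 \<le> q h" using min[of h] h by auto
    ultimately show False by simp
  qed
qed

lemma chordK_minus: "chordK K (- t) = chordK K t"
  by (simp add: chordK_def)

context hypersurface
begin

lemma lam_sorted: "x \<in> M \<Longrightarrow> sorted_curvatures CARD('n) (\<lambda>i. lam i x)"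
  using curvatures unfolding principal_curvatures_def sorted_curvatures_def by (simp add: Suc_le_eq)

lemma mean_curvature_values: "x \<in> M \<Longrightarrow> mean_curvature CARD('n) lam x \<in> cotK_values K"
  using mean_convex by (simp add: cotK_values_def)

text \<open>The largest curvature is at least the mean, so mean convexity puts it into the domain of
  \<open>arccotK\<close> as well and the focal distance is meaningful.\<close>

lemma lam_values: "x \<in> M \<Longrightarrow> lam 1 x \<in> cotK_values K"
  using mean_le_first(1)[OF lam_sorted] mean_curvature_values
  by (fastforce simp: mean_curvature_def cotK_values_def)

lemma \<Omega>_space_form: "\<Omega> \<subseteq> space_form K"
  using domain openin_subset unfolding bounded_domain_def by fastforce

lemma \<Omega>_disjoint_M: "\<Omega> \<inter> M = {}"
  using domain unfolding bounded_domain_def frontier by (auto simp: frontier_of_def interior_of_openin)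

text \<open>\<open>M\<close> is the frontier of \<open>\<Omega>\<close> in the space form. This
  separation argument decides from which side a nearest point is approached and later fills the
  whole sphere.\<close>

lemma connected_meets_M:
  assumes "connected C" "C \<subseteq> space_form K" "C \<inter> \<Omega> \<noteq> {}" "C - \<Omega> \<noteq> {}"
  shows "C \<inter> M \<noteq> {}"
  unfolding frontier using assms
  by (intro connectedin_Int_frontier_of) (simp_all add: connectedin_subtopology connectedin_iff_connected)

text \<open>The test curve is the coordinate line through \<open>u\<close> in direction
  \<open>a\<close>. It lies in \<open>M\<close>, and its acceleration contributes the second
  derivative of \<open>X\<close>.\<close>

lemma second_variation:
  fixes X :: "real^'n \<Rightarrow> 'n ambient"
  assumes lp: "local_param M W X" and u: "u \<in> W"
    and min: "\<And>z. z \<in> M \<Longrightarrow> innerK K (X u - y) (X u - y) \<le> innerK K (z - y) (z - y)"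
  shows "innerK K (frechet_derivative X (at u) a) (X u - y) = 0"
    "0 \<le> innerK K (frechet_derivative (\<lambda>w. frechet_derivative X (at w) a) (at u) a) (X u - y)
        + innerK K (frechet_derivative X (at u) a) (frechet_derivative X (at u) a)"
proof -
  let ?g = "\<lambda>\<tau>. X (u + \<tau> *\<^sub>R a)" and ?D = "\<lambda>w. frechet_derivative X (at w) a"
  let ?g2 = "frechet_derivative ?D (at u) a"
  obtain e where e: "e > 0" "\<And>\<tau>. \<bar>\<tau>\<bar> < e \<Longrightarrow> u + \<tau> *\<^sub>R a \<in> W"
    using smooth_on_line[OF local_paramD(1,2)[OF lp] u, of a] by (force simp: abs_less_iff)
  have line: "((\<lambda>\<tau>. h (u + \<tau> *\<^sub>R a)) has_vector_derivative frechet_derivative h (at (u + \<tau> *\<^sub>R a)) a) (at \<tau>)"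
    if h: "smooth_on W h" and t: "\<bar>\<tau>\<bar> < e" for h :: "real^'n \<Rightarrow> 'n ambient" and \<tau>
  proof -
    have "((\<lambda>\<tau>. u + \<tau> *\<^sub>R a) has_vector_derivative a) (at \<tau>)" by (auto intro!: derivative_eq_intros)
    from vector_derivative_diff_chain_within[OF this, of h "frechet_derivative h (at (u + \<tau> *\<^sub>R a))"]
      smooth_on_has_derivative[OF h e(2)[OF t]]
    show ?thesis by (simp add: o_def has_derivative_at_withinI)
  qed
  have d1: "(?g has_vector_derivative ?D (u + \<tau> *\<^sub>R a)) (at \<tau>)" if "\<bar>\<tau>\<bar> < e" for \<tau>
    by (rule line[OF local_paramD(2)[OF lp] that])
  have d2: "((\<lambda>\<tau>. ?D (u + \<tau> *\<^sub>R a)) has_vector_derivative ?g2) (at 0)"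
    using line[OF smooth_on_SucD[OF local_paramD(2)[OF lp], of a], of 0] e(1) by simp
  define q where "q = (\<lambda>\<tau>. innerK K (?g \<tau> - y) (?g \<tau> - y))"
  define q' where "q' = (\<lambda>\<tau>. 2 * innerK K (?D (u + \<tau> *\<^sub>R a)) (?g \<tau> - y))"
  have d1': "((\<lambda>\<tau>. ?g \<tau> - y) has_vector_derivative ?D (u + \<tau> *\<^sub>R a)) (at \<tau>)" if "\<bar>\<tau>\<bar> < e" for \<tau>
    using has_vector_derivative_diff[OF d1[OF that] has_vector_derivative_const[of y]] by simp
  have q: "(q has_real_derivative q' \<tau>) (at \<tau>)" if "\<bar>\<tau>\<bar> < e" for \<tau>
    using bounded_bilinear.has_vector_derivative[OF innerK_bounded_bilinear d1'[OF that] d1'[OF that], of K]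
    unfolding q_def q'_def has_real_derivative_iff_has_vector_derivative
    by (simp add: innerK_commute[of K "?g \<tau> - y"])
  have d10: "((\<lambda>\<tau>. ?g \<tau> - y) has_vector_derivative ?D u) (at 0)" using d1'[of 0] e(1) by simp
  have q2: "(q' has_real_derivative 2 * (innerK K (?D u) (?D u) + innerK K ?g2 (X u - y))) (at 0)"
    using has_vector_derivative_mult_right[OF bounded_bilinear.has_vector_derivative[OF innerK_bounded_bilinear d2 d10, of K], of 2]
    unfolding q'_def has_real_derivative_iff_has_vector_derivative by simp
  have mq: "q 0 \<le> q \<tau>" if "\<bar>\<tau>\<bar> < e" for \<tau>
  proof -
    have "X (u + \<tau> *\<^sub>R a) \<in> M" using e(2)[OF that] local_paramD(7)[OF lp] by blast
    then show ?thesis using min by (simp add: q_def)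
  qed
  have "q' 0 = 0" "0 \<le> 2 * (innerK K (?D u) (?D u) + innerK K ?g2 (X u - y))"
    using second_derivative_at_minimum[OF e(1) q q2 mq] by auto
  then show "innerK K (?D u) (X u - y) = 0" "0 \<le> innerK K ?g2 (X u - y) + innerK K (?D u) (?D u)"
    by (simp_all add: q'_def)
qed

text \<open>Differentiate in direction \<open>a\<close> the two identities saying that the
  coordinate field is orthogonal to the normal and tangent to the space form.\<close>

lemma second_derivative_components:
  fixes X :: "real^'n \<Rightarrow> 'n ambient"
  assumes lp: "local_param M W X" and u: "u \<in> W"
    and a: "innerK K (frechet_derivative X (at u) a) (frechet_derivative X (at u) a) = 1"
      "dnormal X u a = \<kappa> *\<^sub>R frechet_derivative X (at u) a"
  shows "innerK K (frechet_derivative (\<lambda>w. frechet_derivative X (at w) a) (at u) a) (\<nu> (X u)) = - \<kappa>"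
    "polarK K (X u) (frechet_derivative (\<lambda>w. frechet_derivative X (at w) a) (at u) a) = - K"
proof -
  let ?D = "\<lambda>w. frechet_derivative X (at w) a"
  let ?g2 = "\<lambda>b. frechet_derivative ?D (at u) b"
  have op: "open W" by (rule local_paramD(1)[OF lp])
  have dD: "(?D has_derivative ?g2) (at u)"
    by (rule smooth_on_has_derivative[OF smooth_on_SucD[OF local_paramD(2)[OF lp]] u])
  have i1: "((\<lambda>w. innerK K (?D w) (\<nu> (X w))) has_derivative
      (\<lambda>b. innerK K (?D u) (dnormal X u b) + innerK K (?g2 b) (\<nu> (X u)))) (at u)"
    by (rule bounded_bilinear.FDERIV[OF innerK_bounded_bilinear dD dnormal_has_derivative[OF lp u]])
  have i0: "((\<lambda>w. innerK K (?D w) (\<nu> (X w))) has_derivative (\<lambda>b. 0)) (at u)"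
    by (rule has_derivative_transform_within_open[OF has_derivative_const[of 0] op u])
       (simp add: DX_props(2)[OF lp])
  have "innerK K (?D u) (dnormal X u a) + innerK K (?g2 a) (\<nu> (X u)) = 0"
    by (rule fun_cong[OF has_derivative_unique[OF i1 i0], of a])
  then show "innerK K (?g2 a) (\<nu> (X u)) = - \<kappa>" using a by (simp add: innerK_simps)
  have p1: "((\<lambda>w. polarK K (X w) (?D w)) has_derivative
      (\<lambda>b. polarK K (X u) (?g2 b) + polarK K (frechet_derivative X (at u) b) (?D u))) (at u)"
    by (rule bounded_bilinear.FDERIV[OF polarK_bounded_bilinear local_paramD(8)[OF lp u] dD])
  have p0: "((\<lambda>w. polarK K (X w) (?D w)) has_derivative (\<lambda>b. 0)) (at u)"
    by (rule has_derivative_transform_within_open[OF has_derivative_const[of 0] op u])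
       (simp add: DX_props(1)[OF lp])
  have "polarK K (X u) (?g2 a) + polarK K (?D u) (?D u) = 0"
    by (rule fun_cong[OF has_derivative_unique[OF p1 p0], of a])
  moreover have "polarK K (?D u) (?D u) = K"
    using polarK_tangent(1)[OF K X_in_M(2)[OF lp u] DX_props(1)[OF lp u]] a(1) by simp
  ultimately show "polarK K (X u) (?g2 a) = - K" by simp
qed

text \<open>The first variation puts \<open>y\<close> into the plane of \<open>x\<close> and
  \<open>\<nu> x\<close>, hence on the normal geodesic. The second variation in the direction of the
  largest curvature reads \<open>0 \<le> cK K t - lam 1 x * sK K t\<close>, that is
  \<open>lam 1 x \<le> cotK K t\<close>, which is the bound on \<open>t\<close>.\<close>

lemma nearest_point:
  assumes y: "y \<in> \<Omega>"
  shows "\<exists>x\<in>M. \<exists>t. 0 \<le> t \<and> t \<le> arccotK K (lam 1 x) \<and> y = geodesic K x (\<nu> x) (- t)"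
proof -
  let ?Q = "\<lambda>z. innerK K (z - y) (z - y)"
  have ySF: "y \<in> space_form K" using y \<Omega>_space_form by blast
  have yM: "y \<notin> M" using y \<Omega>_disjoint_M by blast
  have "continuous_on M ?Q"
    by (intro bounded_bilinear.continuous_on[OF innerK_bounded_bilinear] continuous_intros)
  then obtain x where x: "x \<in> M" and min: "\<And>z. z \<in> M \<Longrightarrow> ?Q x \<le> ?Q z"
    using continuous_attains_inf[OF M_space_form(3,2)] by blast
  have xSF: "x \<in> space_form K" using x M_space_form(1) by blast
  obtain W :: "(real^'n) set" and X u where X: "local_param M W X" "u \<in> W" "x = X u" by (rule M_chart[OF x])
  note lp = X(1) and u = X(2)
  let ?n = "\<nu> x" and ?D = "frechet_derivative X (at u)"
  have min': "\<And>z. z \<in> M \<Longrightarrow> ?Q (X u) \<le> ?Q z" using min X(3) by simp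
  have first: "innerK K v (x - y) = 0" if v: "v \<in> tangent_space M x" for v
  proof -
    obtain a where "v = ?D a" using v tangent_space_local_param[OF lp u] X(3) by blast
    then show ?thesis using second_variation(1)[OF lp u min', of a] X(3) by simp
  qed
  \<comment> \<open>Removing this multiple of \<open>x\<close> makes \<open>w\<close> tangent to the
    space form. In the flat case the multiple is 1 and \<open>w = y - x\<close>.\<close>
  define \<alpha> where "\<alpha> = polarK K x y"
  define w where "w = y - \<alpha> *\<^sub>R x"
  have pw: "polarK K x w = 0" using space_form_polar[OF xSF] by (simp add: w_def polarK_simps \<alpha>_def)
  have iw: "innerK K w v = 0" if v: "v \<in> tangent_space M x" for v
  proof -
    have pv: "polarK K x v = 0" using v tangent_space_M[OF x] by blast
    have f: "innerK K x v = innerK K y v" using first[OF v] by (simp add: innerK_simps innerK_commute[of K v])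
    show ?thesis
    proof (cases "K = 0")
      case True
      have "fst x = 1" "fst y = 1" using True xSF ySF space_form_0_fst by blast+
      then have "\<alpha> = 1" using True by (simp add: \<alpha>_def polarK_def)
      then show ?thesis using f by (simp add: w_def innerK_simps)
    next
      case False
      then have "innerK K x v = 0" using innerK_position(1)[OF K xSF pv] by simp
      then show ?thesis using f by (simp add: w_def innerK_simps)
    qed
  qed
  have "w = innerK K w ?n *\<^sub>R ?n" by (rule normal_component[OF x pw iw])
  then have "y = \<alpha> *\<^sub>R x + innerK K w ?n *\<^sub>R ?n" by (metis add_diff_cancel_left' add.commute diff_add_cancel w_def)
  then obtain t0 where t0: "K = 1 \<longrightarrow> \<bar>t0\<bar> \<le> pi" "y = geodesic K x ?n t0"
    using geodesic_representation[OF K xSF \<nu>_props(1,2)[OF x] ySF] by blast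
  have g0: "geodesic K x ?n 0 = x" by (simp add: geodesic_def)
  have chord: "innerK K (geodesic K x ?n r - y) (geodesic K x ?n r - y) = chordK K (r - t0)" for r
    unfolding t0(2) by (rule geodesic_chord[OF K xSF \<nu>_props(1,2)[OF x]])
  have gSF: "geodesic K x ?n r \<in> space_form K" for r by (rule geodesic_in_space_form[OF K xSF \<nu>_props(1,2)[OF x]])
  have t0nz: "t0 \<noteq> 0" using t0(2) g0 x yM by auto
  \<comment> \<open>On the outer side the geodesic from \<open>x\<close> to \<open>y\<close> starts
    outside \<open>\<Omega>\<close> and ends in it, so it would meet \<open>M\<close> at a point
    closer to \<open>y\<close> than \<open>x\<close>.\<close>
  have "\<not> t0 > 0"
  proof
    assume tp: "t0 > 0"
    obtain d where d: "d > 0" "\<And>t. 0 < t \<Longrightarrow> t < d \<Longrightarrow> exp_map K x (t *\<^sub>R ?n) \<notin> \<Omega>"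
      using \<nu>_props(4)[OF x] by blast
    define s where "s = min d t0 / 2"
    have s: "0 < s" "s < d" "s < t0" using d(1) tp by (auto simp: s_def)
    have sO: "geodesic K x ?n s \<notin> \<Omega>" using d(2)[OF s(1,2)] exp_map_geodesic[OF \<nu>_props(2)[OF x]] by simp
    let ?C = "geodesic K x ?n ` {s..t0}"
    have "?C \<inter> M \<noteq> {}"
    proof (rule connected_meets_M)
      show "connected ?C" by (intro connected_continuous_image geodesic_continuous[OF K] connected_Icc)
      show "?C \<subseteq> space_form K" using gSF by blast
      show "?C \<inter> \<Omega> \<noteq> {}" using y t0(2) s by force
      show "?C - \<Omega> \<noteq> {}" using sO s by force
    qed
    then obtain s' where s': "s \<le> s'" "s' \<le> t0" "geodesic K x ?n s' \<in> M" by auto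
    have "chordK K (0 - t0) \<le> chordK K (s' - t0)" using min[OF s'(3)] chord[of s'] chord[of 0] g0 by simp
    then have "chordK K t0 \<le> chordK K (t0 - s')"
      using chordK_minus[of K t0] chordK_minus[of K "t0 - s'"] by simp
    moreover have "chordK K (t0 - s') < chordK K t0"
      using s s' t0(1) by (intro chordK_strict_mono[OF K]) auto
    ultimately show False by simp
  qed
  then have tn: "t0 < 0" using t0nz by simp
  define t where "t = - t0"
  have t: "t > 0" "y = geodesic K x ?n (- t)" "K = 1 \<longrightarrow> t \<le> pi" using tn t0 by (auto simp: t_def)
  obtain \<beta> L a where pc: "principal_coords X u \<beta> L a" using principal_coordinates[OF lp u] by blast
  have "(1::nat) \<in> {1..CARD('n)}" by (simp add: Suc_le_eq)
  then obtain i where i: "\<beta> i = 1" using principal_coordsD(1)[OF pc] by (metis bij_betw_iff_bijections)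
  have vi: "innerK K (?D (a i)) (?D (a i)) = 1" using principal_coordsD(4)[OF pc, of i i] by simp
  have dni: "dnormal X u (a i) = lam 1 x *\<^sub>R ?D (a i)"
  proof -
    have La: "L (a i) = axis i 1"
      using principal_coordsD(5)[OF pc, of "axis i 1"] by (simp add: axis_def if_distrib[of "\<lambda>z. z *\<^sub>R _"] cong: if_cong)
    show ?thesis using principal_coordsD(7)[OF pc, of "a i"]
      by (simp add: La axis_def if_distrib[of "\<lambda>z. z * _"] if_distrib[of "\<lambda>z. z *\<^sub>R _"] i X(3) cong: if_cong)
  qed
  let ?g2 = "frechet_derivative (\<lambda>w. frechet_derivative X (at w) (a i)) (at u) (a i)"
  have comp: "innerK K ?g2 ?n = - lam 1 x" "polarK K x ?g2 = - K"
    using second_derivative_components[OF lp u vi dni] X(3) by simp_all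
  have "x - y = (1 - cK K t) *\<^sub>R x + sK K t *\<^sub>R ?n"
    by (simp add: t(2) geodesic_def scaleR_diff_left)
  then have "innerK K ?g2 (x - y) = (1 - cK K t) * innerK K ?g2 x + sK K t * innerK K ?g2 ?n" by (simp add: innerK_simps)
  \<comment> \<open>For \<open>K = 0\<close> the coefficient vanishes; otherwise
    \<open>innerK K ?g2 x = - 1\<close> by the second component formula. With the summand 1 of the
    second variation, the Jacobian factor remains.\<close>
  moreover have "(1 - cK K t) * innerK K ?g2 x = - (1 - cK K t)"
  proof (cases "K = 0")
    case True
    then show ?thesis by (simp add: cK_def)
  next
    case False
    then have K': "K \<in> {-1,1}" using K by auto
    have "innerK K ?g2 x = K * polarK K x ?g2" by (simp add: innerK_polarK[OF K'] polarK_commute)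
    also have "\<dots> = -1" unfolding comp(2) using K' by auto
    finally show ?thesis by simp
  qed
  ultimately have "0 \<le> cK K t - lam 1 x * sK K t"
    using second_variation(2)[OF lp u min', of "a i"] vi comp(1) X(3) by (simp add: mult.commute)
  note ge = this
  \<comment> \<open>At \<open>t = pi\<close> on the sphere the inequality would read
    \<open>0 \<le> - 1\<close>.\<close>
  have tr: "t \<in> rangeK K"
  proof (cases "K = 1 \<and> t = pi")
    case True
    then show ?thesis using ge by (simp add: cK_def sK_def)
  next
    case False
    then show ?thesis using t by (auto simp: rangeK_def)
  qed
  have cot: "lam 1 x \<le> cotK K t" using ge sK_rangeK[OF K tr] by (simp add: cotK_def field_simps)
  have "t \<le> arccotK K (lam 1 x)"
    using cotK_less_iff[OF K arccotK_cases(2)[OF lam_values[OF x] K] tr] arccotK_cases(3)[OF lam_values[OF x] K] cot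
    by (simp add: not_less[symmetric])
  then show ?thesis using x t by (intro bexI[of _ x] exI[of _ t]) auto
qed

end

section \<open>The volume of the focal region\<close>

text \<open>By orthonormality of the frame the Gram matrix is
  \<open>transpose (matrix M) ** matrix M\<close>.\<close>

lemma vol_density_orthonormal:
  fixes M :: "real^'k \<Rightarrow> real^'k" and Y :: "real^'k \<Rightarrow> real \<times> 'e::euclidean_space" and f :: "'k \<Rightarrow> real \<times> 'e"
  assumes D: "\<And>b. frechet_derivative Y (at u) b = (\<Sum>i\<in>UNIV. (M b $ i) *\<^sub>R f i)"
    and f: "\<And>i j. innerK K (f i) (f j) = (if i = j then 1 else 0)"
  shows "vol_density K Y u = \<bar>det (matrix M)\<bar>"
proof -
  have "gram_matrix K Y u = transpose (matrix M) ** matrix M"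
  proof -
    have "innerK K (\<Sum>k\<in>UNIV. p k *\<^sub>R f k) (\<Sum>k\<in>UNIV. q k *\<^sub>R f k) = (\<Sum>k\<in>UNIV. p k * q k)" for p q :: "'k \<Rightarrow> real"
      by (simp add: innerK_sum innerK_simps f if_distrib[of "\<lambda>z. _ * z"] sum.delta mult.commute cong: if_cong)
    then show ?thesis
      by (simp add: vec_eq_iff gram_matrix_def matrix_matrix_mult_def transpose_def matrix_def D)
  qed
  then have "det (gram_matrix K Y u) = (det (matrix M))\<^sup>2" by (simp add: det_mul det_transpose power2_eq_square)
  then show ?thesis by (simp add: vol_density_def)
qed

text \<open>Coordinates for the normal flow: the index \<open>None\<close> carries the time and
  \<open>Some i\<close> the chart coordinates, so that the flow is a map on
  \<open>real^'n option\<close>, where the area inequality applies.\<close>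

definition opt_tail :: "real^'n option \<Rightarrow> real^'n::finite" where
  "opt_tail z = (\<chi> i. z $ Some i)"

definition opt_join :: "real \<times> (real^'n::finite) \<Rightarrow> real^'n option" where
  "opt_join p = (\<chi> i. case i of None \<Rightarrow> fst p | Some j \<Rightarrow> snd p $ j)"

lemma opt_join_simps [simp]: "opt_join p $ None = fst p" "opt_tail (opt_join p) = snd p"
  by (simp_all add: opt_join_def opt_tail_def vec_eq_iff)

lemma bounded_linear_opt_tail: "bounded_linear opt_tail"
  by (auto simp: opt_tail_def vec_eq_iff linear_conv_bounded_linear[symmetric] intro!: linearI)

lemma opt_tail_borel [measurable]: "opt_tail \<in> borel_measurable borel"
  by (rule borel_measurable_continuous_onI[OF linear_continuous_on[OF bounded_linear_opt_tail]])

lemma linear_opt_join: "linear opt_join"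
  by (rule linearI) (auto simp: opt_join_def vec_eq_iff split: option.split)

lemma opt_join_borel [measurable]: "opt_join \<in> borel_measurable borel"
  by (rule borel_measurable_continuous_onI[OF linear_continuous_on])
     (use linear_opt_join in \<open>simp add: linear_conv_bounded_linear\<close>)

lemma distr_opt_join: "distr lborel borel (opt_join :: real \<times> (real^'n::finite) \<Rightarrow> _) = lborel"
proof (rule distr_lborel_basis_permuting[OF linear_opt_join])
  have j1: "opt_join (1, 0 :: real^'n) = axis None 1"
    by (auto simp: opt_join_def vec_eq_iff axis_def split: option.split)
  have j2: "opt_join (0, axis i 1 :: real^'n) = axis (Some i) 1" for i
    by (auto simp: opt_join_def vec_eq_iff axis_def split: option.split)
  have B: "(Basis :: (real \<times> (real^'n)) set) = insert (1, 0) ((\<lambda>i. (0, axis i 1)) ` UNIV)"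
    by (auto simp: Basis_prod_def Basis_vec_def)
  have B': "(Basis :: (real^'n option) set) = insert (axis None 1) ((\<lambda>i. axis (Some i) 1) ` UNIV)"
    by (auto simp: Basis_vec_def UNIV_option_conv)
  have inj: "inj opt_join"
    by (rule injI) (metis opt_join_simps prod_eq_iff)
  show "bij_betw opt_join (Basis :: (real \<times> (real^'n)) set) Basis"
  proof (rule bij_betw_imageI[OF inj_on_subset[OF inj subset_UNIV]])
    show "opt_join ` (Basis :: (real \<times> (real^'n)) set) = Basis"
      unfolding B B' by (simp only: image_insert image_image j1 j2)
  qed
qed

lemma nn_integral_opt_join:
  fixes F :: "real^'n::finite option \<Rightarrow> ennreal"
  assumes F: "F \<in> borel_measurable borel"
  shows "(\<integral>\<^sup>+z. F z \<partial>lborel) = (\<integral>\<^sup>+u. (\<integral>\<^sup>+t. F (opt_join (t, u)) \<partial>lborel) \<partial>lborel)"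
proof -
  have m: "(\<lambda>p. F (opt_join p)) \<in> borel_measurable (borel :: (real \<times> (real^'n)) measure)"
    by (rule measurable_compose[OF opt_join_borel F])
  have "(\<integral>\<^sup>+z. F z \<partial>lborel) = (\<integral>\<^sup>+z. F z \<partial>distr lborel borel (opt_join :: real \<times> (real^'n) \<Rightarrow> _))"
    by (simp add: distr_opt_join)
  also have "\<dots> = (\<integral>\<^sup>+p. F (opt_join p) \<partial>lborel)"
    by (rule nn_integral_distr) (use F in simp_all)
  also have "\<dots> = (\<integral>\<^sup>+p. F (opt_join p) \<partial>(lborel \<Otimes>\<^sub>M lborel))" by (simp add: lborel_prod)
  also have "\<dots> = (\<integral>\<^sup>+u. (\<integral>\<^sup>+t. F (opt_join (t, u)) \<partial>lborel) \<partial>lborel)"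
    using m by (intro lborel_pair.nn_integral_snd[symmetric]) (simp add: lborel_prod)
  finally show ?thesis .
qed

context hypersurface
begin

abbreviation area :: "'n ambient measure" where "area \<equiv> area_measure K M"

definition focal_area :: "'n ambient \<Rightarrow> real" where
  "focal_area x = focal_integral K CARD('n) (\<lambda>j. lam j x)"

lemma sets_area: "sets area = sets (restrict_space borel M)"
  unfolding area_measure_def by (rule sets_riemannian_measure[OF M_space_form(4)])

lemma space_area: "space area = M"
  using sets_eq_imp_space_eq[OF sets_area] by (simp add: space_restrict_space)

lemma focal_area_continuous: "continuous_on M focal_area"
  unfolding focal_area_def
  by (rule continuous_on_focal_integral[OF K]) (use lam_continuous lam_values in \<open>auto simp: Suc_le_eq\<close>)

lemma focal_area_nonneg: "x \<in> M \<Longrightarrow> 0 \<le> focal_area x"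
  unfolding focal_area_def
  by (rule focal_integral_le(1)[OF K lam_sorted refl]) (use mean_curvature_values in \<open>auto simp: mean_curvature_def\<close>)

lemma area_borel: "continuous_on M f \<Longrightarrow> f \<in> borel_measurable area"
  using borel_measurable_continuous_on_restrict measurable_cong_sets[OF sets_area refl] by blast

context
  fixes W :: "(real^'n) set" and X :: "real^'n \<Rightarrow> 'n ambient"
  assumes lp: "local_param M W X"
begin

definition normal_flow :: "real^'n option \<Rightarrow> 'n ambient" where
  "normal_flow z = cK K (z $ None) *\<^sub>R X (opt_tail z) - sK K (z $ None) *\<^sub>R \<nu> (X (opt_tail z))"

lemma normal_flow_domain_open: "open (opt_tail -` W)"
  by (rule open_vimage[OF local_paramD(1)[OF lp] linear_continuous_on[OF bounded_linear_opt_tail]])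

lemma normal_flow_smooth: "smooth_on (opt_tail -` W) normal_flow"
  unfolding smooth_on_def
proof
  fix k
  note op = normal_flow_domain_open
  have C: "Ck_on k (opt_tail -` W) (\<lambda>z. h (opt_tail z))" if "smooth_on W h" for h :: "real^'n \<Rightarrow> 'n ambient"
    by (rule Ck_on_compose_linear[OF local_paramD(1)[OF lp] bounded_linear_opt_tail])
       (use that in \<open>simp add: smooth_on_def\<close>)
  have R: "Ck_on k (opt_tail -` W) (\<lambda>z. g (z $ None))" if "\<And>j. Ck_on j UNIV g" for g :: "real \<Rightarrow> real"
    by (rule Ck_on_real_compose[OF op Ck_on_linear[OF op bounded_linear_vec_nth] that])
  show "Ck_on k (opt_tail -` W) normal_flow"
    unfolding normal_flow_def[abs_def]
    by (intro Ck_on_diff[OF op] Ck_on_scaleR[OF op] C local_paramD(2)[OF lp] normal_smooth[OF lp])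
       (use Ck_on_sK_cK[OF K] in \<open>intro R; blast\<close>)+
qed

lemma normal_flow_geodesic:
  "normal_flow z = geodesic K (X (opt_tail z)) (\<nu> (X (opt_tail z))) (- (z $ None))"
  by (simp add: normal_flow_def geodesic_minus)

lemma normal_flow_space_form: "normal_flow ` (opt_tail -` W) \<subseteq> space_form K"
proof
  fix p assume "p \<in> normal_flow ` (opt_tail -` W)"
  then obtain z where z: "opt_tail z \<in> W" "p = normal_flow z" by blast
  show "p \<in> space_form K"
    unfolding z(2) normal_flow_geodesic
    by (rule geodesic_in_space_form[OF K X_in_M(2)[OF lp z(1)] \<nu>_props(1,2)[OF X_in_M(1)[OF lp z(1)]]])
qed

text \<open>The velocity of the normal geodesic and the principal directions at its starting point
  are orthonormal at every time. In this frame the derivative splits into 1 for the time and, for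
  each principal direction, its coordinate times the Jacobian factor.\<close>

lemma normal_flow_vol_density:
  assumes z: "opt_tail z \<in> W"
  shows "vol_density K normal_flow z =
    \<bar>\<Prod>j=1..CARD('n). cK K (z $ None) - lam j (X (opt_tail z)) * sK K (z $ None)\<bar> * vol_density K X (opt_tail z)"
proof -
  let ?u = "opt_tail z" and ?t = "z $ None"
  let ?D = "frechet_derivative X (at ?u)"
  have tail: "(opt_tail has_derivative opt_tail) (at z)" by (rule bounded_linear_imp_has_derivative[OF bounded_linear_opt_tail])
  have head: "((\<lambda>z. z $ None) has_derivative (\<lambda>h. h $ None)) (at z)" by (rule bounded_linear_imp_has_derivative[OF bounded_linear_vec_nth])
  have X1: "((\<lambda>z. X (opt_tail z)) has_derivative (\<lambda>h. ?D (opt_tail h))) (at z)"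
    using diff_chain_at[OF tail local_paramD(8)[OF lp z]] by (simp add: o_def)
  have n1: "((\<lambda>z. \<nu> (X (opt_tail z))) has_derivative (\<lambda>h. dnormal X ?u (opt_tail h))) (at z)"
    using diff_chain_at[OF tail dnormal_has_derivative[OF lp z]] by (simp add: o_def)
  have c1: "((\<lambda>z. cK K (z $ None)) has_derivative (\<lambda>h. h $ None * (- K * sK K ?t))) (at z)"
    by (rule DERIV_compose_FDERIV[OF cK_has_derivative[OF K] head])
  have s1: "((\<lambda>z. sK K (z $ None)) has_derivative (\<lambda>h. h $ None * cK K ?t)) (at z)"
    by (rule DERIV_compose_FDERIV[OF sK_has_derivative[OF K] head])
  have dF: "frechet_derivative normal_flow (at z) = (\<lambda>h. (cK K ?t *\<^sub>R ?D (opt_tail h) + (h $ None * (- K * sK K ?t)) *\<^sub>R X ?u) -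
      (sK K ?t *\<^sub>R dnormal X ?u (opt_tail h) + (h $ None * cK K ?t) *\<^sub>R \<nu> (X ?u)))"
    unfolding normal_flow_def[abs_def]
    by (rule frechet_derivative_eq[OF has_derivative_diff[OF has_derivative_scaleR[OF c1 X1] has_derivative_scaleR[OF s1 n1]]])
  obtain \<beta> L a where pc: "principal_coords X ?u \<beta> L a" using principal_coordinates[OF lp z] by blast
  note P = principal_coordsD[OF pc]
  note nu = \<nu>_props(1,2)[OF X_in_M(1)[OF lp z]]
  let ?l = "\<lambda>i. lam (\<beta> i) (X ?u)"
  \<comment> \<open>\<open>f None\<close> is the velocity of the geodesic; the other vectors are the
    principal directions, which the flow only rescales.\<close>
  define f where "f = (\<lambda>i. case i of None \<Rightarrow> - (K * sK K ?t) *\<^sub>R X ?u - cK K ?t *\<^sub>R \<nu> (X ?u) | Some i \<Rightarrow> ?D (a i))"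
  define Mt where "Mt = (\<lambda>h :: real^'n option. \<chi> i. case i of None \<Rightarrow> h $ None | Some i \<Rightarrow> (cK K ?t - ?l i * sK K ?t) * L (opt_tail h) $ i)"
  have "vol_density K normal_flow z = \<bar>det (matrix Mt)\<bar>"
  proof (rule vol_density_orthonormal)
    fix h
    have "frechet_derivative normal_flow (at z) h = h $ None *\<^sub>R f None + (cK K ?t *\<^sub>R ?D (opt_tail h) - sK K ?t *\<^sub>R dnormal X ?u (opt_tail h))"
      by (simp add: dF f_def algebra_simps)
    also have "cK K ?t *\<^sub>R ?D (opt_tail h) - sK K ?t *\<^sub>R dnormal X ?u (opt_tail h) =
        (\<Sum>i\<in>UNIV. ((cK K ?t - ?l i * sK K ?t) * L (opt_tail h) $ i) *\<^sub>R ?D (a i))"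
      by (subst P(6), subst P(7)) (simp add: scaleR_sum_right sum_subtractf[symmetric] algebra_simps)
    finally show "frechet_derivative normal_flow (at z) h = (\<Sum>i\<in>UNIV. (Mt h $ i) *\<^sub>R f i)"
      by (simp add: UNIV_option_sum Mt_def f_def)
  next
    fix i j
    have x0: "innerK K (X ?u) (\<nu> (X ?u)) * K = 0" "innerK K (X ?u) (X ?u) * (K * K) = K * K * K"
      using innerK_position(1)[OF K X_in_M(2)[OF lp z] nu(1)] innerK_position(3)[OF K X_in_M(2)[OF lp z] nu(1)]
      by (simp_all add: mult_ac)
    have KKK: "K * K * K = K" using K by auto
    have NN: "innerK K (f None) (f None) = 1"
    proof -
      have "innerK K (f None) (f None) = (innerK K (X ?u) (X ?u) * (K * K)) * (sK K ?t)\<^sup>2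
          + 2 * (innerK K (X ?u) (\<nu> (X ?u)) * K) * (sK K ?t * cK K ?t) + (cK K ?t)\<^sup>2"
        using nu(2) by (simp add: f_def innerK_simps innerK_commute[of K "\<nu> (X ?u)" "X ?u"] power2_eq_square algebra_simps)
      also have "\<dots> = 1" unfolding x0 KKK using cK_sK_squared[OF K, of ?t] by simp
      finally show ?thesis .
    qed
    have NS: "innerK K (f None) (f (Some i)) = 0" for i
    proof -
      have "K * innerK K (X ?u) (?D (a i)) = 0" by (rule innerK_position(1)[OF K X_in_M(2)[OF lp z] DX_props(1)[OF lp z]])
      then show ?thesis using DX_props(2)[OF lp z, of "a i"] by (auto simp: f_def innerK_simps innerK_commute[of K "\<nu> (X ?u)"])
    qed
    have SS: "innerK K (f (Some i)) (f (Some j)) = (if i = j then 1 else 0)" for i j using P(4) by (simp add: f_def)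
    show "innerK K (f i) (f j) = (if i = j then 1 else 0)"
      using NN NS SS by (cases i; cases j) (simp_all add: innerK_commute[of K "f (Some _)" "f None"])
  qed
  also have "det (matrix Mt) = det (\<chi> i j. matrix Mt $ Some i $ Some j)"
  proof -
    have L0: "L 0 = 0" using P(2) by (rule linear_0)
    have "opt_tail (axis None 1) = (0 :: real^'n)" by (simp add: opt_tail_def axis_def vec_eq_iff)
    then have "matrix Mt $ None $ Some j = 0" "matrix Mt $ None $ None = 1" for j
      by (simp_all add: matrix_def Mt_def axis_def)
    then show ?thesis by (subst det_option) simp_all
  qed
  also have "(\<chi> i j. matrix Mt $ Some i $ Some j) = (\<chi> i. (cK K ?t - ?l i * sK K ?t) *s (matrix L $ i))"
  proof -
    have te: "opt_tail (axis (Some j) 1) = axis j 1" for j :: 'n by (auto simp: opt_tail_def axis_def vec_eq_iff)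
    show ?thesis by (simp add: te vec_eq_iff matrix_def Mt_def left_diff_distrib)
  qed
  also have "det \<dots> = (\<Prod>i\<in>UNIV. cK K ?t - ?l i * sK K ?t) * det (matrix L)"
    unfolding det_rows_mul by (simp only: vec_nth_inverse)
  also have "(\<Prod>i\<in>UNIV. cK K ?t - ?l i * sK K ?t) = (\<Prod>j=1..CARD('n). cK K ?t - lam j (X ?u) * sK K ?t)"
    by (rule prod.reindex_bij_betw[OF P(1)])
  also have "\<bar>\<dots> * det (matrix L)\<bar> = \<bar>\<Prod>j=1..CARD('n). cK K ?t - lam j (X ?u) * sK K ?t\<bar> * \<bar>det (matrix L)\<bar>" by (rule abs_mult)
  also have "\<bar>det (matrix L)\<bar> = vol_density K X ?u"
    by (rule vol_density_orthonormal[OF P(6) P(4), symmetric])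
  finally show ?thesis .
qed

lemma vol_density_positive:
  assumes u: "u \<in> W"
  shows "0 < vol_density K X u"
proof -
  obtain \<beta> L a where pc: "principal_coords X u \<beta> L a" using principal_coordinates[OF lp u] by blast
  note P = principal_coordsD[OF pc]
  have "vol_density K X u = \<bar>det (matrix L)\<bar>" by (rule vol_density_orthonormal[OF P(6) P(4)])
  moreover have "det (matrix L) \<noteq> 0" using det_nz_iff_inj[OF P(2)] P(3) by blast
  ultimately show ?thesis by simp
qed

text \<open>The flow maps the region below the graph of the focal distance onto the swept set, and
  the area inequality bounds its volume. Tonelli integrates the flow density over time first, which
  yields \<open>focal_area\<close> times the density of the chart.\<close>

lemma focal_patch_volume:
  assumes B: "B \<in> sets borel" "B \<subseteq> W"
  shows "\<exists>Z\<in>sets (restrict_space borel (space_form K)).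
    {geodesic K x (\<nu> x) (- t) | x t. x \<in> X ` B \<and> 0 \<le> t \<and> t \<le> arccotK K (lam 1 x)} \<subseteq> Z \<and>
    emeasure (riemannian_measure TYPE('n option) K (space_form K)) Z \<le> (\<integral>\<^sup>+x\<in>X ` B. ennreal (focal_area x) \<partial>area)"
proof -
  let ?V = "opt_tail -` W"
  let ?l1 = "\<lambda>u. arccotK K (lam 1 (X u))"
  \<comment> \<open>The focal distance, extended by 0 outside \<open>W\<close> to be Borel on the
    whole coordinate space.\<close>
  define h where "h = (\<lambda>u. indicator W u *\<^sub>R ?l1 u)"
  have "continuous_on W ?l1"
  proof (rule continuous_on_compose2[OF arccotK_continuous[OF K]])
    show "continuous_on W (\<lambda>u. lam 1 (X u))" by (rule lam_continuous_chart[OF lp]) (simp add: Suc_le_eq)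
    show "(\<lambda>u. lam 1 (X u)) ` W \<subseteq> cotK_values K" using lam_values X_in_M(1)[OF lp] by blast
  qed
  then have hm [measurable]: "h \<in> borel_measurable borel"
    unfolding h_def using local_paramD(1)[OF lp] by (intro borel_measurable_continuous_on_indicator) simp_all
  define A where "A = {z. opt_tail z \<in> B \<and> 0 \<le> z $ None \<and> z $ None \<le> h (opt_tail z)}"
  have nth [measurable]: "(\<lambda>z :: real^'n option. z $ None) \<in> borel_measurable borel"
    by (rule borel_measurable_continuous_onI[OF linear_continuous_on[OF bounded_linear_vec_nth]])
  have Am: "A \<in> sets borel"
  proof -
    have "opt_tail -` B \<in> sets borel" using measurable_sets[OF opt_tail_borel B(1)] by simp
    moreover have "{z :: real^'n option. 0 \<le> z $ None \<and> z $ None \<le> h (opt_tail z)} \<in> sets borel" by measurable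
    moreover have "A = opt_tail -` B \<inter> {z. 0 \<le> z $ None \<and> z $ None \<le> h (opt_tail z)}" by (auto simp: A_def)
    ultimately show ?thesis by simp
  qed
  have AV: "A \<subseteq> ?V" using B(2) by (auto simp: A_def)
  obtain Z where Z: "Z \<in> sets (restrict_space borel (space_form K))" "normal_flow ` A \<subseteq> Z"
    "emeasure (riemannian_measure TYPE('n option) K (space_form K)) Z \<le> (\<integral>\<^sup>+z\<in>A. ennreal (vol_density K normal_flow z) \<partial>lborel)"
    using riemannian_area_inequality[OF smooth_submanifold_space_form[OF K] normal_flow_domain_open
        normal_flow_space_form normal_flow_smooth Am AV, of K] by blast
  let ?F = "\<lambda>z. ennreal (vol_density K normal_flow z) * indicator A z"
  have Fm: "?F \<in> borel_measurable borel"
  proof -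
    have "(\<lambda>z. ennreal (vol_density K normal_flow z) * indicator ?V z * indicator A z) \<in> borel_measurable borel"
      using patch_density_measurable[OF normal_flow_domain_open normal_flow_smooth, of K] Am by measurable
    moreover have "ennreal (vol_density K normal_flow z) * indicator ?V z * indicator A z = ?F z" for z
      using AV by (auto split: split_indicator)
    ultimately show ?thesis by simp
  qed
  have inner: "(\<integral>\<^sup>+t. ?F (opt_join (t, u)) \<partial>lborel) = ennreal (focal_area (X u)) * ennreal (vol_density K X u) * indicator B u" for u
  proof (cases "u \<in> B")
    case False
    then show ?thesis by (simp add: A_def)
  next
    case True
    then have u: "u \<in> W" using B(2) by blast
    let ?P = "\<lambda>t. \<Prod>j=1..CARD('n). cK K t - lam j (X u) * sK K t"
    have v1: "lam 1 (X u) \<in> cotK_values K" by (rule lam_values[OF X_in_M(1)[OF lp u]])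
    note ar = arccotK_cases(2,3)[OF v1 K]
    \<comment> \<open>No curvature exceeds \<open>lam 1\<close>, so each factor is at least the one
      of \<open>lam 1\<close>, which is nonnegative up to the focal distance. This removes the
      absolute value from the flow density.\<close>
    have P0: "0 \<le> ?P t" if "t \<in> {0..?l1 u}" for t
    proof (rule prod_nonneg)
      fix j assume j: "j \<in> {1..CARD('n)}"
      have "lam j (X u) \<le> lam 1 (X u)" using lam_sorted[OF X_in_M(1)[OF lp u]] j by (auto simp: sorted_curvatures_def)
      then have "lam j (X u) * sK K t \<le> lam 1 (X u) * sK K t"
        using cK_ge_cotK(1)[OF K ar(1), of t] that by (intro mult_right_mono) auto
      then show "0 \<le> cK K t - lam j (X u) * sK K t" using cK_ge_cotK(2)[OF K ar(1), of t] that ar(2) by auto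
    qed
    have cP: "continuous_on S ?P" for S
      by (intro continuous_on_prod continuous_on_diff continuous_on_mult continuous_on_const continuous_on_cK_sK K)
    have "(?P has_integral focal_area (X u)) {0..?l1 u}"
      unfolding focal_area_def focal_integral_def using integrable_integral[OF integrable_continuous_real[OF cP]] .
    then have hi: "((\<lambda>t. ?P t * vol_density K X u) has_integral focal_area (X u) * vol_density K X u) {0..?l1 u}"
      by (rule has_integral_mult_left)
    have "(\<integral>\<^sup>+t. ?F (opt_join (t, u)) \<partial>lborel) = (\<integral>\<^sup>+t. ennreal (?P t * vol_density K X u) * indicator {0..?l1 u} t \<partial>lborel)"
    proof (rule nn_integral_cong)
      fix t :: real
      show "?F (opt_join (t, u)) = ennreal (?P t * vol_density K X u) * indicator {0..?l1 u} t"
      proof (cases "t \<in> {0..?l1 u}")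
        case True
        have "vol_density K normal_flow (opt_join (t, u)) = ?P t * vol_density K X u"
          using normal_flow_vol_density[of "opt_join (t, u)"] u P0[OF True] by simp
        then show ?thesis using True \<open>u \<in> B\<close> u by (simp add: A_def h_def)
      next
        case False
        then show ?thesis using \<open>u \<in> B\<close> u by (auto simp: A_def h_def)
      qed
    qed
    also have "\<dots> = ennreal (focal_area (X u) * vol_density K X u)"
      using P0 vol_density_positive[OF u] by (intro nn_integral_has_integral_lebesgue'[OF _ hi]) auto
    also have "\<dots> = ennreal (focal_area (X u)) * ennreal (vol_density K X u)"
      using focal_area_nonneg[OF X_in_M(1)[OF lp u]] vol_density_positive[OF u] by (intro ennreal_mult) auto
    finally show ?thesis using True by simp
  qed
  have "(\<integral>\<^sup>+z\<in>A. ennreal (vol_density K normal_flow z) \<partial>lborel) = (\<integral>\<^sup>+u\<in>B. ennreal (focal_area (X u)) * ennreal (vol_density K X u) \<partial>lborel)"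
    by (subst nn_integral_opt_join[OF Fm]) (simp add: inner)
  also have "\<dots> = (\<integral>\<^sup>+x\<in>X ` B. ennreal (focal_area x) \<partial>area)"
    unfolding area_measure_def
    by (rule nn_integral_riemannian_measure[OF M_space_form(4) lp B, symmetric])
       (use borel_measurable_continuous_on_restrict[OF focal_area_continuous] in simp)
  finally have le: "emeasure (riemannian_measure TYPE('n option) K (space_form K)) Z \<le> (\<integral>\<^sup>+x\<in>X ` B. ennreal (focal_area x) \<partial>area)"
    using Z(3) by simp
  have "{geodesic K x (\<nu> x) (- t) | x t. x \<in> X ` B \<and> 0 \<le> t \<and> t \<le> arccotK K (lam 1 x)} \<subseteq> Z"
  proof
    fix p assume "p \<in> {geodesic K x (\<nu> x) (- t) | x t. x \<in> X ` B \<and> 0 \<le> t \<and> t \<le> arccotK K (lam 1 x)}"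
    then obtain u t where p: "u \<in> B" "p = geodesic K (X u) (\<nu> (X u)) (- t)" "0 \<le> t" "t \<le> ?l1 u" by blast
    have "opt_join (t, u) \<in> A" using p B(2) by (auto simp: A_def h_def)
    moreover have "p = normal_flow (opt_join (t, u))" by (simp add: normal_flow_geodesic p(2))
    ultimately show "p \<in> Z" using Z(2) by blast
  qed
  then show ?thesis using Z(1) le by blast
qed

end

text \<open>Disjoint pieces of an atlas are flowed separately, so their bounds add up to the
  integral over \<open>M\<close>; by \<open>nearest_point\<close> the sets \<open>Z i\<close> cover
  \<open>\<Omega>\<close>.\<close>

lemma enclosed_volume_le:
  "emeasure (riemannian_measure TYPE('n option) K (space_form K)) \<Omega> \<le> (\<integral>\<^sup>+x. ennreal (focal_area x) \<partial>area)"
proof -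
  let ?R = "riemannian_measure TYPE('n option) K (space_form K) :: 'n ambient measure"
  obtain W :: "nat \<Rightarrow> (real^'n) set" and X where
    at: "\<And>i. local_param M (W i) (X i)" "M = (\<Union>i. X i ` W i)"
    using smooth_submanifold_countable_atlas[OF M_space_form(4)] by auto
  let ?S = "sets (restrict_space borel M)"
  define P where "P = disjointed (\<lambda>i. X i ` W i)"
  have XW: "range (\<lambda>i. X i ` W i) \<subseteq> ?S"
    using local_param_image_borel[OF at(1)] local_paramD(1)[OF at(1)] by auto
  have PS: "P i \<in> ?S" for i
    unfolding P_def using sets.range_disjointed_sets[OF XW] by auto
  have Psub: "P i \<subseteq> X i ` W i" for i unfolding P_def by (rule disjointed_subset)
  have PM: "(\<Union>i. P i) = M" unfolding P_def at(2) by (rule UN_disjointed_eq)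
  define B where "B = (\<lambda>i. W i \<inter> X i -` P i)"
  have B: "B i \<in> sets borel" "B i \<subseteq> W i" for i
    unfolding B_def using local_param_vimage_borel[OF at(1) PS] by auto
  have XB: "X i ` B i = P i" for i unfolding B_def using Psub[of i] by blast
  define Q where "Q = (\<lambda>i Z. Z \<in> sets (restrict_space borel (space_form K)) \<and>
    {geodesic K x (\<nu> x) (- t) | x t. x \<in> P i \<and> 0 \<le> t \<and> t \<le> arccotK K (lam 1 x)} \<subseteq> Z \<and>
    emeasure ?R Z \<le> (\<integral>\<^sup>+x\<in>P i. ennreal (focal_area x) \<partial>area))"
  have "\<exists>Z. Q i Z" for i
    using focal_patch_volume[OF at(1) B] unfolding Q_def Bex_def XB .
  then have Q: "Q i (SOME Z. Q i Z)" for i by (rule someI_ex)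
  define Z where "Z = (\<lambda>i. SOME Z. Q i Z)"
  have Z: "Z i \<in> sets ?R" "emeasure ?R (Z i) \<le> (\<integral>\<^sup>+x\<in>P i. ennreal (focal_area x) \<partial>area)"
    "\<And>x t. x \<in> P i \<Longrightarrow> 0 \<le> t \<Longrightarrow> t \<le> arccotK K (lam 1 x) \<Longrightarrow> geodesic K x (\<nu> x) (- t) \<in> Z i" for i
    using Q[of i] unfolding Q_def Z_def sets_riemannian_measure[OF smooth_submanifold_space_form[OF K], of K] by blast+
  have "\<Omega> \<subseteq> (\<Union>i. Z i)"
  proof
    fix y assume "y \<in> \<Omega>"
    then obtain x t where x: "x \<in> M" "0 \<le> t" "t \<le> arccotK K (lam 1 x)" "y = geodesic K x (\<nu> x) (- t)"
      using nearest_point by blast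
    then obtain i where "x \<in> P i" using PM by blast
    then show "y \<in> (\<Union>i. Z i)" using Z(3) x by blast
  qed
  then have "emeasure ?R \<Omega> \<le> emeasure ?R (\<Union>i. Z i)" using Z(1) by (intro emeasure_mono) auto
  also have "\<dots> \<le> (\<Sum>i. emeasure ?R (Z i))" using Z(1) by (intro emeasure_subadditive_countably) auto
  also have "\<dots> \<le> (\<Sum>i. \<integral>\<^sup>+x\<in>P i. ennreal (focal_area x) \<partial>area)" using Z(2) by (intro suminf_le) auto
  also have "\<dots> = (\<integral>\<^sup>+x. ennreal (focal_area x) \<partial>area)"
  proof -
    have fm: "(\<lambda>x. ennreal (focal_area x)) \<in> borel_measurable area" using area_borel[OF focal_area_continuous] by simp
    have Pa: "P i \<in> sets area" for i using PS sets_area by simp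
    have "(\<Sum>i. \<integral>\<^sup>+x\<in>P i. ennreal (focal_area x) \<partial>area) = (\<Sum>i. emeasure (density area (\<lambda>x. ennreal (focal_area x))) (P i))"
      by (intro suminf_cong) (simp add: emeasure_density[OF fm Pa])
    also have "\<dots> = emeasure (density area (\<lambda>x. ennreal (focal_area x))) (\<Union>i. P i)"
      using Pa disjoint_family_disjointed by (intro suminf_emeasure) (auto simp: P_def)
    also have "\<dots> = (\<integral>\<^sup>+x\<in>M. ennreal (focal_area x) \<partial>area)"
      unfolding PM using sets.top[of area] by (subst emeasure_density[OF fm]) (simp_all add: space_area)
    also have "\<dots> = (\<integral>\<^sup>+x. ennreal (focal_area x) \<partial>area)"
      by (intro nn_integral_cong) (simp add: space_area)
    finally show ?thesis .
  qed
  finally show ?thesis .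
qed

text \<open>The density is bounded on a small closed ball of parameters, so every point has a
  neighbourhood of finite area, and compactness leaves finitely many.\<close>

lemma area_finite: "emeasure area M < \<infinity>"
proof -
  have "\<exists>U. open U \<and> x \<in> U \<and> emeasure area (M \<inter> U) < \<infinity>" if x: "x \<in> M" for x
  proof -
    obtain W :: "(real^'n) set" and X u where X: "local_param M W X" "u \<in> W" "x = X u" by (rule M_chart[OF x])
    obtain r where r: "r > 0" "cball u r \<subseteq> W" using local_paramD(1)[OF X(1)] X(2) open_contains_cball by blast
    have bW: "ball u r \<subseteq> W" using r(2) ball_subset_cball by blast
    obtain U where U: "open U" "X ` (W \<inter> ball u r) = M \<inter> U" using local_param_openin[OF X(1) open_ball] by blast
    have WB: "W \<inter> ball u r = ball u r" using bW by blast
    obtain C where C: "\<And>v. v \<in> cball u r \<Longrightarrow> norm (vol_density K X v) \<le> C"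
      using compact_imp_bounded[OF compact_continuous_image[OF continuous_on_subset[OF vol_density_continuous[OF local_paramD(1,2)[OF X(1)]] r(2)] compact_cball], of K]
      unfolding bounded_iff by blast
    have "emeasure area (M \<inter> U) = emeasure (patch_measure K W X) (ball u r)"
      unfolding area_measure_def U(2)[symmetric] WB
      using bW by (intro emeasure_riemannian_measure[OF M_space_form(4) X(1)]) auto
    also have "\<dots> = (\<integral>\<^sup>+v\<in>ball u r. ennreal (vol_density K X v) \<partial>lborel)"
      using bW by (intro emeasure_patch_measure[OF local_paramD(1,2)[OF X(1)]]) auto
    also have "\<dots> \<le> (\<integral>\<^sup>+v. ennreal C * indicator (ball u r) v \<partial>lborel)"
    proof (rule nn_integral_mono)
      fix v show "ennreal (vol_density K X v) * indicator (ball u r) v \<le> ennreal C * indicator (ball u r) v"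
      proof (cases "v \<in> ball u r")
        case True
        then have "vol_density K X v \<le> C" using C[of v] by (simp add: abs_le_iff)
        then show ?thesis using True by (simp add: ennreal_leI)
      qed simp
    qed
    also have "\<dots> = ennreal C * emeasure lborel (ball u r)" by (simp add: nn_integral_cmult_indicator)
    also have "\<dots> < \<infinity>" using emeasure_lborel_ball_finite[of u r] by (simp add: ennreal_mult_less_top)
    finally have "emeasure area (M \<inter> U) < \<infinity>" .
    moreover have "x \<in> U" using U(2) X(2,3) r(1) by auto
    ultimately show ?thesis using U(1) by blast
  qed
  then obtain U where U: "\<And>x. x \<in> M \<Longrightarrow> open (U x) \<and> x \<in> U x \<and> emeasure area (M \<inter> U x) < \<infinity>" by metis
  have "M \<subseteq> (\<Union>x\<in>M. U x)" using U by blast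
  then obtain F where F: "F \<subseteq> M" "finite F" "M \<subseteq> (\<Union>x\<in>F. U x)"
    using compactE_image[OF M_space_form(3), of M U] U by blast
  have ms: "M \<inter> U x \<in> sets area" if "x \<in> M" for x
    using U[OF that] unfolding sets_area sets_restrict_space by auto
  have "M = (\<Union>x\<in>F. M \<inter> U x)" using F by blast
  then have "emeasure area M = emeasure area (\<Union>x\<in>F. M \<inter> U x)" by simp
  also have "\<dots> \<le> (\<Sum>x\<in>F. emeasure area (M \<inter> U x))"
    using ms F by (intro emeasure_subadditive_finite) auto
  also have "\<dots> < \<infinity>"
  proof -
    have fin: "(\<Sum>x\<in>G. g x) < \<infinity>" if "finite G" "\<And>x. x \<in> G \<Longrightarrow> g x < \<infinity>" for G and g :: "'n ambient \<Rightarrow> ennreal"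
      using that by (induction G) auto
    show ?thesis
    proof (rule fin[OF F(2)])
      fix x assume "x \<in> F"
      then have "x \<in> M" using F(1) by (rule rev_subsetD)
      then show "emeasure area (M \<inter> U x) < \<infinity>" using U by simp
    qed
  qed
  finally show ?thesis .
qed

lemma area_integrable:
  fixes f :: "'n ambient \<Rightarrow> real"
  assumes "continuous_on M f"
  shows "integrable area f"
proof -
  interpret finite_measure area by standard (use area_finite space_area in auto)
  obtain C where "\<And>x. x \<in> M \<Longrightarrow> norm (f x) \<le> C"
    using compact_imp_bounded[OF compact_continuous_image[OF assms M_space_form(3)]] unfolding bounded_iff by blast
  then show ?thesis
    by (intro integrable_const_bound[of _ C] area_borel assms AE_I2) (simp add: space_area)
qed

text \<open>A positive value would persist on a ball of parameters, where the chart density is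
  positive too, and the integral over its image could not vanish.\<close>

lemma area_integral_zero:
  fixes f :: "'n ambient \<Rightarrow> real"
  assumes f: "continuous_on M f" "\<And>x. x \<in> M \<Longrightarrow> 0 \<le> f x" and I: "(\<integral>x. f x \<partial>area) = 0" and x: "x \<in> M"
  shows "f x = 0"
proof (rule ccontr)
  assume "f x \<noteq> 0"
  then have fx: "f x > 0" using f(2)[OF x] by simp
  obtain W :: "(real^'n) set" and X u where X: "local_param M W X" "u \<in> W" "x = X u" by (rule M_chart[OF x])
  have c: "continuous_on W (\<lambda>v. f (X v))"
    by (rule continuous_on_compose2[OF f(1) local_paramD(6,7)[OF X(1)]])
  have "open (W \<inter> (\<lambda>v. f (X v)) -` {0<..})"
    by (rule continuous_open_preimage[OF c local_paramD(1)[OF X(1)]]) simp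
  moreover have "u \<in> W \<inter> (\<lambda>v. f (X v)) -` {0<..}" using X fx by simp
  ultimately obtain r where r: "r > 0" "ball u r \<subseteq> W \<inter> (\<lambda>v. f (X v)) -` {0<..}" using open_contains_ball by blast
  have "AE y in area. f y = 0"
  proof -
    have "AE y in area. 0 \<le> f y" by (rule AE_I2) (simp add: space_area f(2))
    then show ?thesis using integral_nonneg_eq_0_iff_AE[OF area_integrable[OF f(1)]] I by simp
  qed
  then have "(\<integral>\<^sup>+y. ennreal (f y) * indicator (X ` ball u r) y \<partial>area) = 0"
    by (subst nn_integral_0_iff_AE)
       (use area_borel[OF f(1)] local_param_image_borel[OF X(1), of "ball u r"] r(2) sets_area in \<open>auto simp del: split_paired_All\<close>)
  moreover have "(\<integral>\<^sup>+y\<in>X ` ball u r. ennreal (f y) \<partial>area) = (\<integral>\<^sup>+v\<in>ball u r. ennreal (f (X v)) * ennreal (vol_density K X v) \<partial>lborel)"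
    unfolding area_measure_def
    by (rule nn_integral_riemannian_measure[OF M_space_form(4) X(1)])
       (use r(2) borel_measurable_continuous_on_restrict[OF f(1)] in auto)
  ultimately have z: "(\<integral>\<^sup>+v. ennreal (f (X v)) * ennreal (vol_density K X v) * indicator (ball u r) v \<partial>lborel) = 0" by simp
  have cb: "continuous_on (ball u r) (\<lambda>v. f (X v) * vol_density K X v)"
    using r(2) by (intro continuous_on_mult continuous_on_subset[OF c] continuous_on_subset[OF vol_density_continuous[OF local_paramD(1,2)[OF X(1)]]]) auto
  have eq: "ennreal (f (X v)) * ennreal (vol_density K X v) * indicator (ball u r) v =
      ennreal (indicator (ball u r) v *\<^sub>R (f (X v) * vol_density K X v))" for v
  proof (cases "v \<in> ball u r")
    case True
    then have "0 \<le> f (X v)" "0 \<le> vol_density K X v" using r(2) vol_density_positive[OF X(1), of v] by auto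
    then show ?thesis using True by (simp add: ennreal_mult)
  qed simp
  have "(\<lambda>v. ennreal (indicator (ball u r) v *\<^sub>R (f (X v) * vol_density K X v))) \<in> borel_measurable lborel"
    using borel_measurable_continuous_on_indicator[OF _ cb] by simp
  then have "AE v in lborel. ennreal (indicator (ball u r) v *\<^sub>R (f (X v) * vol_density K X v)) = 0"
    using z unfolding eq by (simp add: nn_integral_0_iff_AE)
  then have "AE v in lborel. v \<notin> ball u r"
  proof eventually_elim
    case (elim v)
    show ?case
    proof
      assume v: "v \<in> ball u r"
      then have "0 < f (X v)" "0 < vol_density K X v" using r(2) vol_density_positive[OF X(1), of v] by auto
      then have "0 < f (X v) * vol_density K X v" by simp
      then show False using elim v by (simp add: ennreal_eq_0_iff)
    qed
  qed
  then have "emeasure lborel (ball u r) = 0" by (subst (asm) AE_iff_measurable[of "ball u r"]) auto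
  then show False using r(1) content_ball_pos[of r u] by (simp add: measure_def)
qed

end

section \<open>Umbilic hypersurfaces and geodesic spheres\<close>

text \<open>The vector that replaces \<open>v\<close> is the velocity of the geodesic at time
  \<open>r\<close>.\<close>

lemma geodesic_add:
  assumes "K \<in> {-1,0,1}"
  shows "geodesic K p v (r + t) = geodesic K (geodesic K p v r) (cK K r *\<^sub>R v - (K * sK K r) *\<^sub>R p) t"
proof -
  have "cK K (r + t) = cK K r * cK K t - K * (sK K r * sK K t)" "sK K (r + t) = sK K r * cK K t + cK K r * sK K t"
    using cK_diff[OF assms, of r "- t"] sK_diff[OF assms, of r "- t"] by simp_all
  then show ?thesis by (simp add: geodesic_def scaleR_add_left scaleR_diff_left scaleR_add_right scaleR_diff_right mult_ac)
qed

lemma geodesic_velocity: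
  fixes p v :: "real \<times> 'e::euclidean_space" and r :: real
  assumes K: "K \<in> {-1,0,1}" and p: "p \<in> space_form K" and v: "polarK K p v = 0" "innerK K v v = 1"
  defines "w \<equiv> cK K r *\<^sub>R v - (K * sK K r) *\<^sub>R p"
  shows "polarK K (geodesic K p v r) w = 0" "innerK K w w = 1"
proof -
  show "polarK K (geodesic K p v r) w = 0"
    using space_form_polar[OF p] v polarK_unit[OF K p v]
    by (simp add: w_def geodesic_def polarK_simps polarK_commute[of K v p])
  have x0: "innerK K p v * K = 0" "innerK K p p * (K * K) = K * K * K"
    using innerK_position(1)[OF K p v(1)] innerK_position(3)[OF K p v(1)] by (simp_all add: mult_ac)
  have KKK: "K * K * K = K" using K by auto
  have "innerK K w w = (innerK K p p * (K * K)) * (sK K r)\<^sup>2 - 2 * (innerK K p v * K) * (sK K r * cK K r) + (cK K r)\<^sup>2"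
    using v(2) by (simp add: w_def innerK_simps innerK_commute[of K v p] power2_eq_square algebra_simps)
  then show "innerK K w w = 1" unfolding x0 KKK using cK_sK_squared[OF K, of r] by simp
qed

text \<open>Position and velocity at time \<open>r\<close> arise from \<open>p\<close> and
  \<open>v\<close> by a 2 by 2 matrix of determinant \<open>(cK K r)^2 + K * (sK K r)^2 = 1\<close>;
  these are the rows of its inverse.\<close>

lemma geodesic_reverse:
  fixes p v :: "real \<times> 'e::euclidean_space" and r :: real
  assumes K: "K \<in> {-1,0,1}"
  defines "q \<equiv> geodesic K p v r" and "w \<equiv> cK K r *\<^sub>R v - (K * sK K r) *\<^sub>R p"
  shows "cK K r *\<^sub>R q - sK K r *\<^sub>R w = p" "cK K r *\<^sub>R w + (K * sK K r) *\<^sub>R q = v"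
proof -
  have "cK K r *\<^sub>R q - sK K r *\<^sub>R w = ((cK K r)\<^sup>2 + K * (sK K r)\<^sup>2) *\<^sub>R p"
    by (simp add: q_def w_def geodesic_def algebra_simps power2_eq_square)
  then show "cK K r *\<^sub>R q - sK K r *\<^sub>R w = p" using cK_sK_squared[OF K, of r] by simp
  have "cK K r *\<^sub>R w + (K * sK K r) *\<^sub>R q = ((cK K r)\<^sup>2 + K * (sK K r)\<^sup>2) *\<^sub>R v"
    by (simp add: q_def w_def geodesic_def algebra_simps power2_eq_square)
  then show "cK K r *\<^sub>R w + (K * sK K r) *\<^sub>R q = v" using cK_sK_squared[OF K, of r] by simp
qed

definition unit_tangents :: "real \<Rightarrow> real \<times> 'e::euclidean_space \<Rightarrow> (real \<times> 'e) set" where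
  "unit_tangents K p = {v. polarK K p v = 0 \<and> innerK K v v = 1}"

text \<open>Normalising the derivative of a chart maps the punctured coordinate space onto the unit
  tangent vectors, and the punctured space is connected from dimension 2 on.\<close>

lemma connected_unit_tangents:
  fixes p :: "real \<times> (real^'k::finite)"
  assumes K: "K \<in> {-1,0,1}" and p: "p \<in> space_form K" and k: "2 \<le> CARD('k)"
  shows "connected (unit_tangents K p)"
proof -
  obtain W :: "(real^'k) set" and X u where X: "local_param (space_form K) W X" "u \<in> W" "p = X u"
    using space_form_local_param[OF K p] by blast
  let ?D = "frechet_derivative X (at u)"
  have lin: "linear ?D" and inj: "inj ?D" using local_paramD[OF X(1)] X(2) by auto
  have T: "range ?D = {v. polarK K p v = 0}"
    using tangent_space_local_param[OF X(1,2)] tangent_space_space_form[OF K p] X(3) by simp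
  have pD: "polarK K p (?D b) = 0" for b using T by blast
  have pos: "0 < innerK K (?D b) (?D b)" if "b \<noteq> 0" for b
  proof -
    have "?D b \<noteq> 0" using that inj lin by (metis injD linear_0)
    then show ?thesis using innerK_tangent_nonneg[OF K p pD] innerK_tangent_zero[OF K p pD] by (metis less_le)
  qed
  define f where "f = (\<lambda>b. inverse (sqrt (innerK K (?D b) (?D b))) *\<^sub>R ?D b)"
  have cD: "continuous_on A ?D" for A
    using lin by (intro linear_continuous_on) (simp add: linear_conv_bounded_linear)
  have cf: "continuous_on (- {0}) f"
  proof -
    have ci: "continuous_on (- {0}) (\<lambda>b. innerK K (?D b) (?D b))"
      by (intro bounded_bilinear.continuous_on[OF innerK_bounded_bilinear] cD)
    show ?thesis unfolding f_def using pos
      by (intro continuous_on_scaleR continuous_on_inverse continuous_on_real_sqrt ci cD) force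
  qed
  have im: "f ` (- {0}) = unit_tangents K p"
  proof (intro set_eqI iffI)
    fix v assume "v \<in> f ` (- {0})"
    then obtain b where b: "b \<noteq> 0" "v = f b" by blast
    have "innerK K v v = (inverse (sqrt (innerK K (?D b) (?D b))))\<^sup>2 * innerK K (?D b) (?D b)"
      by (simp add: b(2) f_def innerK_simps power2_eq_square)
    also have "\<dots> = 1" using pos[OF b(1)] by (simp add: power_inverse)
    finally show "v \<in> unit_tangents K p" using pD[of b] by (simp add: unit_tangents_def b(2) f_def polarK_simps)
  next
    fix v assume v: "v \<in> unit_tangents K p"
    then have "v \<in> range ?D" unfolding T by (simp add: unit_tangents_def)
    then obtain b where b: "v = ?D b" by blast
    have "innerK K (?D b) (?D b) = 1" using v b by (simp add: unit_tangents_def)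
    then have "f b = v" by (simp add: f_def b)
    moreover have "b \<noteq> 0" using \<open>innerK K (?D b) (?D b) = 1\<close> linear_0[OF lin] by (auto simp: innerK_simps)
    ultimately show "v \<in> f ` (- {0})" by blast
  qed
  have "connected (- {0 :: real^'k})" by (rule connected_punctured_universe) (use k in simp)
  then show ?thesis unfolding im[symmetric] using cf by (rule connected_continuous_image[rotated])
qed

lemma geodesic_sphere_iff:
  fixes M :: "'n::finite ambient set"
  assumes K: "K \<in> {-1,0,1}"
  shows "geodesic_sphere K M \<longleftrightarrow>
    (\<exists>c\<in>space_form K. \<exists>r\<in>rangeK K. M = (\<lambda>v. geodesic K c v r) ` unit_tangents K c)"
proof -
  have "{exp_map K c (r *\<^sub>R v) | v. v \<in> tangent_space (space_form K) c \<and> innerK K v v = 1} =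
      (\<lambda>v. geodesic K c v r) ` unit_tangents K c" if c: "c \<in> space_form K" for c :: "'n ambient" and r
  proof (intro set_eqI iffI)
    fix x assume "x \<in> {exp_map K c (r *\<^sub>R v) | v. v \<in> tangent_space (space_form K) c \<and> innerK K v v = 1}"
    then obtain v where v: "polarK K c v = 0" "innerK K v v = 1" "x = exp_map K c (r *\<^sub>R v)"
      unfolding tangent_space_space_form[OF K c] by blast
    then show "x \<in> (\<lambda>v. geodesic K c v r) ` unit_tangents K c"
      using exp_map_geodesic[OF v(2), of c r] by (intro image_eqI[of _ _ v]) (simp_all add: unit_tangents_def)
  next
    fix x assume "x \<in> (\<lambda>v. geodesic K c v r) ` unit_tangents K c"
    then obtain v where v: "polarK K c v = 0" "innerK K v v = 1" "x = geodesic K c v r"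
      unfolding unit_tangents_def by blast
    have "x = exp_map K c (r *\<^sub>R v)" unfolding exp_map_geodesic[OF v(2)] by (rule v(3))
    then show "x \<in> {exp_map K c (r *\<^sub>R v) | v. v \<in> tangent_space (space_form K) c \<and> innerK K v v = 1}"
      unfolding tangent_space_space_form[OF K c] using v(1,2) by blast
  qed
  moreover have "r \<in> rangeK K \<longleftrightarrow> 0 < r \<and> (K = 1 \<longrightarrow> r < pi)" for r by (auto simp: rangeK_def)
  ultimately show ?thesis unfolding geodesic_sphere_def by (metis (no_types, lifting))
qed

context hypersurface
begin

context
  fixes W :: "(real^'n) set" and X :: "real^'n \<Rightarrow> 'n ambient"
  assumes lp: "local_param M W X"
    and umbilic: "\<And>u b. u \<in> W \<Longrightarrow> dnormal X u b = lam 1 (X u) *\<^sub>R frechet_derivative X (at u) b"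
begin

text \<open>The mixed second derivatives of the normal and of the parametrisation are symmetric, so the
  differential of the principal curvature k satisfies dk(b) dX(a) = dk(a) dX(b).\<close>

lemma umbilic_locally_constant:
  assumes n: "CARD('n) \<ge> 2" and u0: "u0 \<in> W"
  shows "\<exists>r>0. ball u0 r \<subseteq> W \<and> (\<forall>u\<in>ball u0 r. lam 1 (X u) = lam 1 (X u0))"
proof -
  note op = local_paramD(1)[OF lp] and smX = local_paramD(2)[OF lp] and smn = normal_smooth[OF lp]
  let ?D = "\<lambda>u b. frechet_derivative X (at u) b"
  let ?k = "\<lambda>u. lam 1 (X u)"
  have Dnz: "?D u b \<noteq> 0" if "u \<in> W" "b \<noteq> 0" for u b
    using local_paramD(3,9)[OF lp that(1)] that(2) by (metis injD linear_0)
  have pos: "0 < innerK K (?D u b) (?D u b)" if "u \<in> W" "b \<noteq> 0" for u b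
    using innerK_tangent_nonneg[OF K X_in_M(2)[OF lp that(1)] DX_props(1)[OF lp that(1)]]
      innerK_tangent_zero[OF K X_in_M(2)[OF lp that(1)] DX_props(1)[OF lp that(1)]] Dnz[OF that] by (metis less_le)
  define b0 :: "real^'n" where "b0 = axis undefined 1"
  have b0: "b0 \<noteq> 0" by (simp add: b0_def axis_eq_0_iff)
  have SD: "Ck_on j W (\<lambda>u. ?D u b)" for j b using smooth_on_SucD[OF smX] unfolding smooth_on_def by blast
  have Sn: "Ck_on j W (\<lambda>u. dnormal X u b)" for j b
    using smooth_on_SucD[OF smn] unfolding smooth_on_def dnormal_def by blast
  \<comment> \<open>Continuity of \<open>lam\<close> is not enough to differentiate. In the umbilic
    case the curvature is a quotient of two smooth functions, obtained by testing with a fixed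
    nonzero vector.\<close>
  have Ck: "Ck_on 1 W ?k"
  proof (rule Ck_on_cong[OF op])
    have "innerK K (?D u b0) (?D u b0) \<noteq> 0" if "u \<in> W" for u using pos[OF that b0] by simp
    then show "Ck_on 1 W (\<lambda>u. innerK K (dnormal X u b0) (?D u b0) * inverse (innerK K (?D u b0) (?D u b0)))"
      by (intro Ck_on_mult[OF op] Ck_on_inverse[OF op] Ck_on_bilinear[OF op innerK_bounded_bilinear] SD Sn)
    show "innerK K (dnormal X u b0) (?D u b0) * inverse (innerK K (?D u b0) (?D u b0)) = ?k u" if "u \<in> W" for u
      using pos[OF that b0] by (simp add: umbilic[OF that] innerK_simps)
  qed
  have dk: "(?k has_derivative (\<lambda>h. 0)) (at u)" if u: "u \<in> W" for u
  proof -
    let ?k' = "frechet_derivative ?k (at u)"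
    have k': "(?k has_derivative ?k') (at u)" using Ck_on_SucD[of 0 W ?k u] Ck u by simp
    have d2: "frechet_derivative (\<lambda>w. dnormal X w a) (at u) b =
        ?k u *\<^sub>R frechet_derivative (\<lambda>w. ?D w a) (at u) b + ?k' b *\<^sub>R ?D u a" for a b
    proof -
      have Da: "((\<lambda>w. ?D w a) has_derivative frechet_derivative (\<lambda>w. ?D w a) (at u)) (at u)"
        using Ck_on_SucD[OF SD u] .
      have "((\<lambda>w. dnormal X w a) has_derivative
          (\<lambda>b. ?k u *\<^sub>R frechet_derivative (\<lambda>w. ?D w a) (at u) b + ?k' b *\<^sub>R ?D u a)) (at u)"
        by (rule has_derivative_transform_within_open[OF has_derivative_scaleR[OF k' Da] op u]) (simp add: umbilic)
      from frechet_derivative_eq[OF this] show ?thesis by simp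
    qed
    have X2: "Ck_on 2 W X" and n2: "Ck_on 2 W (\<lambda>u. \<nu> (X u))" using smX smn by (simp_all add: smooth_on_def)
    have sym: "?k' b *\<^sub>R ?D u a = ?k' a *\<^sub>R ?D u b" for a b
      using second_derivative_symmetric[OF op n2 u, of a b] second_derivative_symmetric[OF op X2 u, of a b]
        d2[of a b] d2[of b a] unfolding dnormal_def by simp
    have lin: "linear (?D u)" and inj: "inj (?D u)" using local_paramD(9,3)[OF lp u] by auto
    have ax: "?k' (axis i 1) = 0" for i
    proof -
      \<comment> \<open>A second coordinate direction exists because the dimension is at least 2.
        Comparing the components of index \<open>j\<close> in the symmetry relation isolates the
        derivative in direction \<open>i\<close>.\<close>
      obtain j :: 'n where j: "j \<noteq> i"
      proof -
        have "\<not> (UNIV :: 'n set) \<subseteq> {i}" using n card_mono[of "{i}" "UNIV :: 'n set"] by auto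
        then show ?thesis using that by blast
      qed
      have "?D u (?k' (axis i 1) *\<^sub>R axis j 1) = ?D u (?k' (axis j 1) *\<^sub>R axis i 1)"
        using sym[of "axis i 1" "axis j 1"] by (simp add: linear_scale[OF lin])
      then have "?k' (axis i 1) *\<^sub>R axis j 1 = ?k' (axis j 1) *\<^sub>R (axis i 1 :: real^'n)" using inj by (auto dest: injD)
      then have "(?k' (axis i 1) *\<^sub>R axis j 1) $ j = (?k' (axis j 1) *\<^sub>R (axis i 1 :: real^'n)) $ j" by simp
      then show ?thesis using j by (simp add: axis_def)
    qed
    have link: "linear ?k'" using k' by (rule has_derivative_linear)
    have "?k' h = 0" for h
    proof -
      have "?k' h = ?k' (\<Sum>i\<in>UNIV. (h $ i) *\<^sub>R axis i 1)"
        using basis_expansion[of h] by (simp add: scalar_mult_eq_scaleR)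
      also have "\<dots> = (\<Sum>i\<in>UNIV. (h $ i) *\<^sub>R ?k' (axis i 1))"
        unfolding linear_sum[OF link] linear_scale[OF link] ..
      also have "\<dots> = 0" unfolding ax by simp
      finally show ?thesis .
    qed
    then have "?k' = (\<lambda>h. 0)" by blast
    with k' show ?thesis by (simp only:)
  qed
  obtain r where r: "r > 0" "ball u0 r \<subseteq> W" using op u0 open_contains_ball by blast
  have "?k u = ?k u0" if u: "u \<in> ball u0 r" for u
  proof -
    have "\<exists>c. \<forall>x\<in>ball u0 r. ?k x = c"
      by (rule has_derivative_zero_constant[OF convex_ball])
         (rule has_derivative_at_withinI[OF dk[OF subsetD[OF r(2)]]])
    then show ?thesis using u r(1) by (metis centre_in_ball)
  qed
  then show ?thesis using r by blast
qed

text \<open>Locally the curvature is the constant \<open>cotK K a\<close> with \<open>a\<close> the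
  focal distance, so the derivative of the focal point is that of \<open>X\<close> times
  \<open>cK K a - cotK K a * sK K a = 0\<close>.\<close>

lemma umbilic_center_locally_constant:
  assumes n: "CARD('n) \<ge> 2" and u0: "u0 \<in> W"
  defines "c \<equiv> \<lambda>x. cK K (arccotK K (lam 1 x)) *\<^sub>R x - sK K (arccotK K (lam 1 x)) *\<^sub>R \<nu> x"
  shows "\<exists>T. openin (top_of_set M) T \<and> X u0 \<in> T \<and> (\<forall>x\<in>T. (lam 1 x, c x) = (lam 1 (X u0), c (X u0)))"
proof -
  obtain r where r: "r > 0" "ball u0 r \<subseteq> W" "\<And>u. u \<in> ball u0 r \<Longrightarrow> lam 1 (X u) = lam 1 (X u0)"
    using umbilic_locally_constant[OF n u0] by blast
  let ?a = "arccotK K (lam 1 (X u0))"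
  note a = arccotK_cases(2,3)[OF lam_values[OF X_in_M(1)[OF lp u0]] K]
  define g where "g = (\<lambda>u. cK K ?a *\<^sub>R X u - sK K ?a *\<^sub>R \<nu> (X u))"
  have cs: "cK K ?a - sK K ?a * lam 1 (X u0) = 0"
    using a(2) sK_rangeK[OF K a(1)] by (simp add: cotK_def field_simps)
  have "(g has_derivative (\<lambda>h. 0)) (at u)" if u: "u \<in> ball u0 r" for u
  proof -
    have uW: "u \<in> W" using u r(2) by blast
    have "(g has_derivative (\<lambda>h. cK K ?a *\<^sub>R frechet_derivative X (at u) h - sK K ?a *\<^sub>R dnormal X u h)) (at u)"
      unfolding g_def
      by (intro has_derivative_diff has_derivative_scaleR_right local_paramD(8)[OF lp uW] dnormal_has_derivative[OF lp uW])
    moreover have "cK K ?a *\<^sub>R frechet_derivative X (at u) h - sK K ?a *\<^sub>R dnormal X u h = 0" for h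
    proof -
      have "cK K ?a *\<^sub>R frechet_derivative X (at u) h - sK K ?a *\<^sub>R dnormal X u h =
          (cK K ?a - sK K ?a * lam 1 (X u0)) *\<^sub>R frechet_derivative X (at u) h"
        unfolding umbilic[OF uW] r(3)[OF u] by (simp add: scaleR_diff_left)
      then show ?thesis by (simp only: cs scaleR_zero_left)
    qed
    ultimately show ?thesis by simp
  qed
  then have "\<exists>d. \<forall>u\<in>ball u0 r. g u = d"
    by (intro has_derivative_zero_constant[OF convex_ball]) (auto intro: has_derivative_at_withinI)
  then have g: "g u = g u0" if "u \<in> ball u0 r" for u using that r(1) by (metis centre_in_ball)
  have cg: "c (X u) = g u" if "u \<in> ball u0 r" for u unfolding c_def g_def r(3)[OF that] ..
  obtain U where U: "open U" "X ` (W \<inter> ball u0 r) = M \<inter> U" using local_param_openin[OF lp open_ball] by blast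
  have WB: "W \<inter> ball u0 r = ball u0 r" using r(2) by blast
  show ?thesis
  proof (intro exI[of _ "X ` ball u0 r"] conjI ballI)
    show "openin (top_of_set M) (X ` ball u0 r)" using U unfolding WB by (simp add: openin_open_Int)
    show "X u0 \<in> X ` ball u0 r" using r(1) by simp
    fix x assume "x \<in> X ` ball u0 r"
    then obtain u where u: "u \<in> ball u0 r" "x = X u" by blast
    have u0b: "u0 \<in> ball u0 r" using r(1) by simp
    show "(lam 1 x, c x) = (lam 1 (X u0), c (X u0))"
      unfolding u(2) cg[OF u(1)] cg[OF u0b] r(3)[OF u(1)] g[OF u(1)] ..
  qed
qed

end

lemma umbilic_dnormal:
  fixes X :: "real^'n \<Rightarrow> 'n ambient"
  assumes lp: "local_param M W X" and u: "u \<in> W" and l: "lam 1 (X u) = mean_curvature CARD('n) lam (X u)"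
  shows "dnormal X u b = lam 1 (X u) *\<^sub>R frechet_derivative X (at u) b"
proof -
  obtain \<beta> L a where pc: "principal_coords X u \<beta> L a" using principal_coordinates[OF lp u] by blast
  note P = principal_coordsD[OF pc]
  have "lam (\<beta> i) (X u) = lam 1 (X u)" for i
    by (rule mean_le_first(2)[OF lam_sorted[OF X_in_M(1)[OF lp u]]])
       (use l P(1) in \<open>auto simp: mean_curvature_def bij_betw_def\<close>)
  then show ?thesis by (subst P(7), subst P(6)) (simp add: scaleR_sum_right mult.commute)
qed

text \<open>Once \<open>M\<close> is known to lie on the sphere of radius \<open>r\<close> around
  \<open>c\<close>, the open ball and the exterior are connected sets that avoid \<open>M\<close>.
  The normal at one point shows that the ball lies in \<open>\<Omega>\<close> and the exterior
  outside it. Every radius then has to cross \<open>M\<close>, and can do so only at time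
  \<open>r\<close>.\<close>

lemma umbilic_imp_sphere:
  assumes n: "CARD('n) \<ge> 2" and umb: "\<And>x. x \<in> M \<Longrightarrow> lam 1 x = mean_curvature CARD('n) lam x"
  shows "geodesic_sphere K M"
proof -
  define f where "f = (\<lambda>x. (lam 1 x, cK K (arccotK K (lam 1 x)) *\<^sub>R x - sK K (arccotK K (lam 1 x)) *\<^sub>R \<nu> x))"
  have loc: "\<exists>T. openin (top_of_set M) T \<and> x \<in> T \<and> (\<forall>y\<in>T. f y = f x)" if x: "x \<in> M" for x
  proof -
    obtain W :: "(real^'n) set" and X u where X: "local_param M W X" "u \<in> W" "x = X u" by (rule M_chart[OF x])
    have "dnormal X w b = lam 1 (X w) *\<^sub>R frechet_derivative X (at w) b" if "w \<in> W" for w b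
      by (rule umbilic_dnormal[OF X(1) that umb[OF X_in_M(1)[OF X(1) that]]])
    from umbilic_center_locally_constant[OF X(1) this n X(2)] show ?thesis unfolding f_def X(3) .
  qed
  have "f constant_on M"
    by (rule locally_constant_imp_constant[OF conn]) (use loc in blast)
  then obtain \<kappa> c where fc: "\<And>x. x \<in> M \<Longrightarrow> f x = (\<kappa>, c)" unfolding constant_on_def by (metis surj_pair)
  define r where "r = arccotK K \<kappa>"
  have lk: "lam 1 x = \<kappa>" and cx: "cK K r *\<^sub>R x - sK K r *\<^sub>R \<nu> x = c" if "x \<in> M" for x
    using fc[OF that] unfolding f_def r_def by auto
  obtain x0 where x0: "x0 \<in> M" using M_space_form(2) by blast
  have rr: "r \<in> rangeK K" using arccotK_cases(2)[OF lam_values[OF x0] K] lk[OF x0] by (simp add: r_def)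
  have r0: "0 < r" "K = 1 \<longrightarrow> r < pi" using rr by (auto simp: rangeK_def split: if_splits)
  have cg: "c = geodesic K x (\<nu> x) (- r)" if "x \<in> M" for x using cx[OF that] by (simp add: geodesic_minus)
  have cSF: "c \<in> space_form K"
    unfolding cg[OF x0] using x0 M_space_form(1) by (intro geodesic_in_space_form[OF K _ \<nu>_props(1,2)[OF x0]]) blast
  define vel where "vel = (\<lambda>x. cK K r *\<^sub>R \<nu> x + (K * sK K r) *\<^sub>R x)"
  have vel: "vel x \<in> unit_tangents K c" "geodesic K c (vel x) r = x"
    "cK K r *\<^sub>R vel x - (K * sK K r) *\<^sub>R c = \<nu> x" if x: "x \<in> M" for x
  proof -
    have xSF: "x \<in> space_form K" using x M_space_form(1) by blast
    have v: "vel x = cK K (- r) *\<^sub>R \<nu> x - (K * sK K (- r)) *\<^sub>R x" by (simp add: vel_def)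
    show "vel x \<in> unit_tangents K c"
      unfolding v cg[OF x] unit_tangents_def using geodesic_velocity[OF K xSF \<nu>_props(1,2)[OF x], of "- r"] by simp
    show "geodesic K c (vel x) r = x" "cK K r *\<^sub>R vel x - (K * sK K r) *\<^sub>R c = \<nu> x"
      using geodesic_reverse[OF K, where r = "- r" and p = x and v = "\<nu> x"] unfolding v cg[OF x] by (simp_all add: geodesic_def)
  qed
  let ?S = "(\<lambda>v. geodesic K c v r) ` unit_tangents K c"
  have MS: "M \<subseteq> ?S" using vel(1,2) by (metis image_eqI subsetI)
  have chord: "innerK K (geodesic K c v t - c) (geodesic K c v t - c) = chordK K t" if "v \<in> unit_tangents K c" for v t
    using geodesic_chord[OF K cSF, of v t 0] that by (simp add: unit_tangents_def geodesic_def)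
  have off: "geodesic K c v t \<notin> M" if v: "v \<in> unit_tangents K c" and t: "0 \<le> t" "K = 1 \<longrightarrow> t \<le> pi" "t \<noteq> r" for v t
  proof
    assume "geodesic K c v t \<in> M"
    then obtain v' where "v' \<in> unit_tangents K c" "geodesic K c v t = geodesic K c v' r" using MS by blast
    then have "chordK K t = chordK K r" using chord[OF v, of t] chord[of v' r] by simp
    moreover have "chordK K t < chordK K r \<or> chordK K r < chordK K t"
    proof (cases "t < r")
      case True
      then show ?thesis using chordK_strict_mono[OF K t(1) True] r0 by auto
    next
      case False
      then have "r < t" using t(3) by simp
      then show ?thesis using chordK_strict_mono[OF K _ \<open>r < t\<close>] r0 t(2) by auto
    qed
    ultimately show False by simp
  qed
  have k2: "2 \<le> CARD('n option)" using n by (simp add: card_option)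
  have gSF: "geodesic K c v t \<in> space_form K" if "v \<in> unit_tangents K c" for v t
    using that geodesic_in_space_form[OF K cSF] by (simp add: unit_tangents_def)
  have cgeo: "continuous_on A (\<lambda>z. geodesic K c (fst z) (snd z))" for A :: "('n ambient \<times> real) set"
    unfolding geodesic_def
    by (intro continuous_on_add continuous_on_scaleR continuous_on_const continuous_on_fst continuous_on_id
        continuous_on_compose2[OF continuous_on_cK_sK(1)[OF K, of UNIV]] continuous_on_compose2[OF continuous_on_cK_sK(2)[OF K, of UNIV]]
        continuous_on_snd) auto
  have region: "R \<subseteq> \<Omega> \<or> R \<inter> \<Omega> = {}"
    if R: "R = (\<lambda>z. geodesic K c (fst z) (snd z)) ` (unit_tangents K c \<times> I)" and I: "connected I"
      "\<And>t. t \<in> I \<Longrightarrow> 0 \<le> t \<and> (K = 1 \<longrightarrow> t \<le> pi) \<and> t \<noteq> r" for R I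
  proof (rule ccontr)
    assume "\<not> (R \<subseteq> \<Omega> \<or> R \<inter> \<Omega> = {})"
    then have ne: "R \<inter> \<Omega> \<noteq> {}" "R - \<Omega> \<noteq> {}" by auto
    have "connected R" unfolding R
      by (intro connected_continuous_image[OF cgeo] connected_Times connected_unit_tangents[OF K cSF k2] I(1))
    moreover have "R \<subseteq> space_form K" unfolding R using gSF by fastforce
    ultimately have "R \<inter> M \<noteq> {}" using connected_meets_M ne by blast
    moreover have "R \<inter> M = {}" unfolding R using off I(2) by fastforce
    ultimately show False by blast
  qed
  \<comment> \<open>The times of the exterior region; on the sphere it ends at the antipode of
    \<open>c\<close>, at time \<open>pi\<close>.\<close>
  define Ie where "Ie = (if K = 1 then {r<..pi} else {r<..})"
  have Ie: "connected Ie" "\<And>t. t \<in> Ie \<Longrightarrow> 0 \<le> t \<and> (K = 1 \<longrightarrow> t \<le> pi) \<and> t \<noteq> r"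
    using r0 by (auto simp: Ie_def split: if_splits)
  let ?B = "(\<lambda>z. geodesic K c (fst z) (snd z)) ` (unit_tangents K c \<times> {0..<r})"
  let ?E = "(\<lambda>z. geodesic K c (fst z) (snd z)) ` (unit_tangents K c \<times> Ie)"
  obtain d where d: "d > 0" "\<And>t. 0 < t \<Longrightarrow> t < d \<Longrightarrow>
      exp_map K x0 (t *\<^sub>R \<nu> x0) \<notin> \<Omega> \<and> exp_map K x0 (- t *\<^sub>R \<nu> x0) \<in> \<Omega>"
    using \<nu>_props(4)[OF x0] by blast
  \<comment> \<open>Keeps \<open>r - \<epsilon>\<close> and \<open>r + \<epsilon>\<close> among the
    admissible times, below \<open>pi\<close> on the sphere, and within the distance
    \<open>d\<close> on which the normal at \<open>x0\<close> separates inside from outside.\<close>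
  define \<epsilon> where "\<epsilon> = min d (min r (if K = 1 then pi - r else r)) / 2"
  have \<epsilon>: "0 < \<epsilon>" "\<epsilon> < d" "\<epsilon> < r" "K = 1 \<longrightarrow> r + \<epsilon> < pi" using d(1) r0 by (auto simp: \<epsilon>_def min_def field_simps)
  have e: "exp_map K x0 (t *\<^sub>R \<nu> x0) = geodesic K c (vel x0) (r + t)" for t
  proof -
    have "geodesic K c (vel x0) (r + t) = geodesic K x0 (\<nu> x0) t"
      unfolding geodesic_add[OF K] vel(2,3)[OF x0] ..
    then show ?thesis using exp_map_geodesic[OF \<nu>_props(2)[OF x0]] by simp
  qed
  have inO: "geodesic K c (vel x0) (r - \<epsilon>) \<in> \<Omega>" using d(2)[OF \<epsilon>(1,2)] e[of "- \<epsilon>"] by simp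
  have outO: "geodesic K c (vel x0) (r + \<epsilon>) \<notin> \<Omega>" using d(2)[OF \<epsilon>(1,2)] e[of \<epsilon>] by simp
  have BO: "?B \<subseteq> \<Omega>"
  proof -
    have "(vel x0, r - \<epsilon>) \<in> unit_tangents K c \<times> {0..<r}" using vel(1)[OF x0] \<epsilon> by simp
    then have "geodesic K c (vel x0) (r - \<epsilon>) \<in> ?B" by (metis (no_types, lifting) fst_conv image_eqI snd_conv)
    moreover have "?B \<subseteq> \<Omega> \<or> ?B \<inter> \<Omega> = {}" by (rule region[OF refl]) (use r0 in auto)
    ultimately show ?thesis using inO by blast
  qed
  have EO: "?E \<inter> \<Omega> = {}"
  proof -
    have "(vel x0, r + \<epsilon>) \<in> unit_tangents K c \<times> Ie" using vel(1)[OF x0] \<epsilon> by (auto simp: Ie_def)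
    then have "geodesic K c (vel x0) (r + \<epsilon>) \<in> ?E" by (metis (no_types, lifting) fst_conv image_eqI snd_conv)
    moreover have "?E \<subseteq> \<Omega> \<or> ?E \<inter> \<Omega> = {}" by (rule region[OF refl Ie])
    ultimately show ?thesis using outO by blast
  qed
  have "?S \<subseteq> M"
  proof
    fix p assume "p \<in> ?S"
    then obtain v where v: "v \<in> unit_tangents K c" "p = geodesic K c v r" by blast
    let ?C = "geodesic K c v ` {r - \<epsilon>..r + \<epsilon>}"
    have "(v, r - \<epsilon>) \<in> unit_tangents K c \<times> {0..<r}" "(v, r + \<epsilon>) \<in> unit_tangents K c \<times> Ie"
      using v(1) \<epsilon> by (auto simp: Ie_def)
    then have "geodesic K c v (r - \<epsilon>) \<in> ?B" "geodesic K c v (r + \<epsilon>) \<in> ?E"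
      by (metis (no_types, lifting) fst_conv image_eqI snd_conv)+
    then have io: "geodesic K c v (r - \<epsilon>) \<in> \<Omega>" "geodesic K c v (r + \<epsilon>) \<notin> \<Omega>" using BO EO by blast+
    have "?C \<inter> M \<noteq> {}"
    proof (rule connected_meets_M)
      show "connected ?C" by (intro connected_continuous_image geodesic_continuous[OF K] connected_Icc)
      show "?C \<subseteq> space_form K" using gSF[OF v(1)] by blast
      show "?C \<inter> \<Omega> \<noteq> {}" using io(1) \<epsilon>(1) by force
      show "?C - \<Omega> \<noteq> {}" using io(2) \<epsilon>(1) by (auto dest!: subsetD[OF _ imageI[of "r + \<epsilon>" "{r - \<epsilon>..r + \<epsilon>}"]])
    qed
    then obtain t where t: "r - \<epsilon> \<le> t" "t \<le> r + \<epsilon>" "geodesic K c v t \<in> M" by auto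
    then have "t = r" using off[OF v(1), of t] \<epsilon> by (cases "t = r") auto
    then show "p \<in> M" using t(3) v(2) by simp
  qed
  then have "M = ?S" using MS by blast
  then show ?thesis unfolding geodesic_sphere_iff[OF K] using cSF rr by blast
qed

text \<open>The radial field \<open>N\<close> has derivative \<open>cotK K r\<close> times that of
  \<open>X\<close>. It equals \<open>\<nu>\<close> up to a factor \<open>\<sigma>\<close> that has
  square 1 and derivative 0 at \<open>u\<close>, so the derivative of \<open>\<nu>\<close> is a
  multiple of that of \<open>X\<close> and all curvatures agree.\<close>

lemma sphere_imp_umbilic:
  assumes gs: "geodesic_sphere K M" and x: "x \<in> M"
  shows "lam 1 x = mean_curvature CARD('n) lam x"
proof -
  obtain c r where c: "c \<in> space_form K" "r \<in> rangeK K" "M = (\<lambda>v. geodesic K c v r) ` unit_tangents K c"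
    using gs unfolding geodesic_sphere_iff[OF K] by blast
  have s: "0 < sK K r" by (rule sK_rangeK[OF K c(2)])
  obtain W :: "(real^'n) set" and X u where X: "local_param M W X" "u \<in> W" "x = X u" by (rule M_chart[OF x])
  note lp = X(1) and u = X(2) and op = local_paramD(1)[OF X(1)]
  let ?D = "\<lambda>u. frechet_derivative X (at u)"
  \<comment> \<open>The velocity at time \<open>r\<close> of the geodesic from \<open>c\<close>,
    expressed through its end point alone.\<close>
  define N where "N = (\<lambda>x. inverse (sK K r) *\<^sub>R (cK K r *\<^sub>R x - c))"
  have N_props: "polarK K x (N x) = 0" "innerK K (N x) (N x) = 1" "innerK K (x - c) (x - c) = chordK K r" if xM: "x \<in> M" for x
  proof -
    obtain v where v: "v \<in> unit_tangents K c" "x = geodesic K c v r" using xM c(3) by blast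
    then have v': "polarK K c v = 0" "innerK K v v = 1" by (simp_all add: unit_tangents_def)
    have c1: "(cK K r * cK K r - 1) = - (sK K r * (K * sK K r))" using cK_sK_squared[OF K, of r] by (simp add: power2_eq_square algebra_simps)
    have "cK K r *\<^sub>R x - c = (cK K r * cK K r - 1) *\<^sub>R c + (sK K r * cK K r) *\<^sub>R v"
      by (simp add: v(2) geodesic_def algebra_simps)
    also have "\<dots> = sK K r *\<^sub>R (cK K r *\<^sub>R v - (K * sK K r) *\<^sub>R c)"
      unfolding c1 by (simp add: algebra_simps)
    finally have Nx: "N x = cK K r *\<^sub>R v - (K * sK K r) *\<^sub>R c" using s by (simp add: N_def)
    show "polarK K x (N x) = 0" "innerK K (N x) (N x) = 1"
      using geodesic_velocity[OF K c(1) v', of r] unfolding Nx v(2)[symmetric] by simp_all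
    show "innerK K (x - c) (x - c) = chordK K r"
      using geodesic_chord[OF K c(1) v', of r 0] by (simp add: v(2) geodesic_def)
  qed
  have N_perp: "innerK K (N (X w)) (?D w b) = 0" if w: "w \<in> W" for w b
  proof -
    have dXc: "((\<lambda>w. X w - c) has_derivative ?D w) (at w)"
      using has_derivative_diff[OF local_paramD(8)[OF lp w] has_derivative_const[of c]] by simp
    have i1: "((\<lambda>w. innerK K (X w - c) (X w - c)) has_derivative
        (\<lambda>b. innerK K (X w - c) (?D w b) + innerK K (?D w b) (X w - c))) (at w)"
      by (rule bounded_bilinear.FDERIV[OF innerK_bounded_bilinear dXc dXc])
    have i0: "((\<lambda>w. innerK K (X w - c) (X w - c)) has_derivative (\<lambda>b. 0)) (at w)"
      by (rule has_derivative_transform_within_open[OF has_derivative_const[of "chordK K r"] op w])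
         (simp add: N_props(3)[OF X_in_M(1)[OF lp]])
    have "innerK K (X w - c) (?D w b) + innerK K (?D w b) (X w - c) = 0"
      by (rule fun_cong[OF has_derivative_unique[OF i1 i0], of b])
    then have z: "innerK K (X w - c) (?D w b) = 0" by (simp add: innerK_commute[of K "?D w b"])
    have "(cK K r - 1) * innerK K (X w) (?D w b) = 0"
    proof (cases "K = 0")
      case True
      then show ?thesis by (simp add: cK_def)
    next
      case False
      then show ?thesis using innerK_position(1)[OF K X_in_M(2)[OF lp w] DX_props(1)[OF lp w]] by simp
    qed
    moreover have "cK K r *\<^sub>R X w - c = (cK K r - 1) *\<^sub>R X w + (X w - c)" by (simp add: scaleR_diff_left)
    ultimately have "innerK K (cK K r *\<^sub>R X w - c) (?D w b) = 0" using z by (simp only: innerK_simps) simp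
    then show ?thesis by (simp add: N_def innerK_simps)
  qed
  define \<sigma> where "\<sigma> = (\<lambda>w. innerK K (N (X w)) (\<nu> (X w)))"
  have N\<sigma>: "N (X w) = \<sigma> w *\<^sub>R \<nu> (X w)" if w: "w \<in> W" for w
    unfolding \<sigma>_def
  proof (rule normal_component[OF X_in_M(1)[OF lp w]])
    show "polarK K (X w) (N (X w)) = 0" by (rule N_props(1)[OF X_in_M(1)[OF lp w]])
    fix v assume "v \<in> tangent_space M (X w)"
    then obtain b where "v = ?D w b" using tangent_space_local_param[OF lp w] by blast
    then show "innerK K (N (X w)) v = 0" using N_perp[OF w] by simp
  qed
  have \<sigma>2: "\<sigma> u * \<sigma> u = 1"
    using N_props(2)[OF X_in_M(1)[OF lp u]] \<nu>_props(2)[OF X_in_M(1)[OF lp u]] unfolding N\<sigma>[OF u] by (simp add: innerK_simps)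
  have dN: "((\<lambda>w. N (X w)) has_derivative (\<lambda>b. (inverse (sK K r) * cK K r) *\<^sub>R ?D u b)) (at u)"
    unfolding N_def
    using has_derivative_scaleR_right[OF has_derivative_diff[OF has_derivative_scaleR_right[OF local_paramD(8)[OF lp u], of "cK K r"] has_derivative_const[of c]], of "inverse (sK K r)"]
    by simp
  have d\<sigma>: "(\<sigma> has_derivative (\<lambda>b. innerK K (N (X u)) (dnormal X u b) + innerK K ((inverse (sK K r) * cK K r) *\<^sub>R ?D u b) (\<nu> (X u)))) (at u)"
    unfolding \<sigma>_def by (rule bounded_bilinear.FDERIV[OF innerK_bounded_bilinear dN dnormal_has_derivative[OF lp u]])
  have dn0: "innerK K (\<nu> (X u)) (dnormal X u b) = 0" for b
    using dnormal_tangent[OF lp u] \<nu>_props(3)[OF X_in_M(1)[OF lp u]] by blast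
  \<comment> \<open>Both terms pair a normal vector with a tangent one, so \<open>\<sigma>\<close>
    has derivative 0 without a discussion of which sign it takes.\<close>
  have "innerK K (N (X u)) (dnormal X u b) + innerK K ((inverse (sK K r) * cK K r) *\<^sub>R ?D u b) (\<nu> (X u)) = 0" for b
    using dn0[of b] DX_props(2)[OF lp u, of b] unfolding N\<sigma>[OF u] by (simp add: innerK_simps)
  then have d\<sigma>0: "(\<sigma> has_derivative (\<lambda>b. 0)) (at u)" using d\<sigma> by simp
  have "((\<lambda>w. N (X w)) has_derivative (\<lambda>b. \<sigma> u *\<^sub>R dnormal X u b + 0 *\<^sub>R \<nu> (X u))) (at u)"
    by (rule has_derivative_transform_within_open[OF has_derivative_scaleR[OF d\<sigma>0 dnormal_has_derivative[OF lp u]] op u])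
       (simp add: N\<sigma>)
  from has_derivative_unique[OF this dN]
  have "\<sigma> u *\<^sub>R dnormal X u b + 0 *\<^sub>R \<nu> (X u) = (inverse (sK K r) * cK K r) *\<^sub>R ?D u b" for b by (rule fun_cong)
  then have "\<sigma> u *\<^sub>R (\<sigma> u *\<^sub>R dnormal X u b) = \<sigma> u *\<^sub>R ((inverse (sK K r) * cK K r) *\<^sub>R ?D u b)" for b by simp
  then have dn: "dnormal X u b = (\<sigma> u * (inverse (sK K r) * cK K r)) *\<^sub>R ?D u b" for b by (simp add: \<sigma>2)
  obtain \<beta> L a where pc: "principal_coords X u \<beta> L a" using principal_coordinates[OF lp u] by blast
  note P = principal_coordsD[OF pc]
  let ?k = "\<sigma> u * (inverse (sK K r) * cK K r)"
  have lamk: "lam (\<beta> i) (X u) = ?k" for i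
  proof -
    have La: "L (a i) = axis i 1"
      using P(5)[of "axis i 1"] by (simp add: axis_def if_distrib[of "\<lambda>z. z *\<^sub>R _"] cong: if_cong)
    have "dnormal X u (a i) = lam (\<beta> i) (X u) *\<^sub>R ?D u (a i)"
      using P(7)[of "a i"]
      by (simp add: La axis_def if_distrib[of "\<lambda>z. z * _"] if_distrib[of "\<lambda>z. z *\<^sub>R _"] cong: if_cong)
    then have "lam (\<beta> i) (X u) *\<^sub>R ?D u (a i) = ?k *\<^sub>R ?D u (a i)" unfolding dn by (rule sym)
    then have "innerK K (lam (\<beta> i) (X u) *\<^sub>R ?D u (a i)) (?D u (a i)) = innerK K (?k *\<^sub>R ?D u (a i)) (?D u (a i))" by (simp only:)
    then show ?thesis using P(4)[of i i] by (simp add: innerK_simps)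
  qed
  have "lam j (X u) = ?k" if "j \<in> {1..CARD('n)}" for j
    using lamk P(1) that by (metis bij_betw_iff_bijections)
  then show ?thesis by (simp add: X(3) mean_curvature_def Suc_le_eq)
qed

end

theorem theorem22:
  fixes K :: real
    and \<Omega> M :: "'n::finite ambient set"
    and \<nu> :: "'n ambient \<Rightarrow> 'n ambient"
    and lam :: "nat \<Rightarrow> 'n ambient \<Rightarrow> real"
  assumes "K \<in> {-1, 0, 1}"
    and "bounded_domain K \<Omega>"
    and "M = top_of_set (space_form K) frontier_of \<Omega>"
    and "closed_hypersurface K M"
    and "connected M"
    and "outward_unit_normal K \<Omega> M \<nu>"
    and "\<forall>x\<in>M. principal_curvatures K M \<nu> x (\<lambda>i. lam i x)"
    and "K \<le> 0 \<longrightarrow> (\<forall>x\<in>M. sqrt (- K) < mean_curvature CARD('n) lam x)"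
  shows "let n = CARD('n);
             D = (\<integral>x. hK K n (arccotK K (mean_curvature n lam x)) \<partial>area_measure K M)
                 - enclosed_volume K \<Omega>;
             V = focal_volume K \<Omega> M lam
         in D \<ge> - V \<and> - V \<ge> 0 \<and>
            (n = 1 \<longrightarrow> D = - V) \<and>
            (n \<ge> 2 \<longrightarrow> (D = - V \<longleftrightarrow> geodesic_sphere K M))"
proof -
  interpret hypersurface K \<Omega> M \<nu> lam using assms by unfold_locales
  let ?n = "CARD('n)"
  let ?E = "mean_curvature ?n lam"
  let ?h = "\<lambda>x. hK K ?n (arccotK K (?E x))"
  let ?I = "\<integral>x. ?h x \<partial>area" and ?F = "\<integral>x. focal_area x \<partial>area"
  have cE: "continuous_on M ?E"
    unfolding mean_curvature_def[abs_def] divide_inverse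
    by (intro continuous_on_mult continuous_on_sum continuous_on_const lam_continuous)
  have ch: "continuous_on M ?h" by (rule continuous_on_hK[OF K cE mean_curvature_values])
  note ih = area_integrable[OF ch] and iF = area_integrable[OF focal_area_continuous]
  have cmp: "focal_area x \<le> ?h x" "focal_area x = ?h x \<longleftrightarrow> lam 1 x = ?E x" if "x \<in> M" for x
    using focal_integral_le(2,3)[OF K lam_sorted[OF that], of "?E x"] mean_curvature_values[OF that]
    by (simp_all add: focal_area_def mean_curvature_def)
  have V: "focal_volume K \<Omega> M lam = enclosed_volume K \<Omega> - ?F"
  proof -
    have "(\<integral>x. (LBINT t=0..focal_height K lam x. normal_jacobian K ?n lam x t) \<partial>area) = (\<integral>x. - focal_area x \<partial>area)"
    proof (rule Bochner_Integration.integral_cong[OF refl])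
      fix x assume "x \<in> space area"
      then have "x \<in> M" by (simp add: space_area)
      then show "(LBINT t=0..focal_height K lam x. normal_jacobian K ?n lam x t) = - focal_area x"
        unfolding focal_area_def by (intro normal_jacobian_integral[where lam = lam, OF K] lam_values)
    qed
    then show ?thesis by (simp add: focal_volume_def oriented_volume_def)
  qed
  have F0: "0 \<le> ?F" by (intro integral_nonneg_AE AE_I2) (simp add: space_area focal_area_nonneg)
  have vol: "enclosed_volume K \<Omega> \<le> ?F"
  proof -
    have "(\<integral>\<^sup>+x. ennreal (focal_area x) \<partial>area) = ennreal ?F"
      by (intro nn_integral_eq_integral[OF iF] AE_I2) (simp add: space_area focal_area_nonneg)
    then have "emeasure (riemannian_measure TYPE('n option) K (space_form K)) \<Omega> \<le> ennreal ?F"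
      using enclosed_volume_le by simp
    then show ?thesis unfolding enclosed_volume_def measure_def using F0 enn2real_leI by blast
  qed
  have diff: "?I - ?F = (\<integral>x. ?h x - focal_area x \<partial>area)" using ih iF by simp
  have le: "?F \<le> ?I" by (intro integral_mono_AE[OF iF ih] AE_I2) (simp add: space_area cmp(1))
  \<comment> \<open>The difference of the integrands is continuous and nonnegative, so the integrals
    agree only if it vanishes at every point.\<close>
  have eq_iff: "?I = ?F \<longleftrightarrow> (\<forall>x\<in>M. lam 1 x = ?E x)"
  proof
    assume "?I = ?F"
    then have "(\<integral>x. ?h x - focal_area x \<partial>area) = 0" using diff by simp
    then have "?h x - focal_area x = 0" if "x \<in> M" for x
      using cmp(1) that by (intro area_integral_zero[where f = "\<lambda>x. ?h x - focal_area x"] continuous_on_diff ch focal_area_continuous) auto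
    then show "\<forall>x\<in>M. lam 1 x = ?E x" using cmp(2) by fastforce
  next
    assume "\<forall>x\<in>M. lam 1 x = ?E x"
    then show "?I = ?F" by (intro Bochner_Integration.integral_cong refl) (metis space_area cmp(2))
  qed
  \<comment> \<open>In dimension 1 the mean is the single curvature, so the pointwise criterion
    holds everywhere.\<close>
  have n1: "?I = ?F" if "?n = 1" unfolding eq_iff by (simp add: mean_curvature_def that)
  have n2: "?I = ?F \<longleftrightarrow> geodesic_sphere K M" if "?n \<ge> 2"
    unfolding eq_iff using umbilic_imp_sphere[OF that] sphere_imp_umbilic by blast
  show ?thesis unfolding Let_def V using le vol n1 n2 by auto
qed

end
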